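(* Let $k$ be a field of characteristic $0$, let $S\subset M\cong\mathbb Z^2$ be a seminormal affine monoid spanning $M$ such that $\sigma=(\mathbb Q_{\ge0}S)^\vee$ is two-dimensional, let $X=\operatorname{Spec}k[S]$ and $\tilde X=\operatorname{Spec}k[\sigma^\vee\cap M]$ its normalisation. With the notation $\ell_i$, $u_i^j(m)$, $w_i$, $a_i$, $s$ of the context, the dimensions of the homogeneous components $(T^1_X)_u$, $u\in M$, are given by $$\dim(T^1_X)_u=\max\{0,\,d_1(u)+d_2(u)+\tilde d(u)\}\qquad(\ast)$$ with $$d_i(u)=\begin{cases}1&u=-u_i^0(m),\ 1\le m<\ell_i\\ \ell_i-2&u=-u_i^1(m),\ m\le0\\ \ell_i-1&u=-u_i^1(1)\\ \ell_i-m+1&u=-u_i^1(m),\ 2\le m\le\ell_i\\ 1&u=-2u_i^1(m),\ m\le1,\ \ell_i=2\\ 0&\text{otherwise}\end{cases}$$ for $i=1,2$ and $$\tilde d(u)=\begin{cases}1&u=-mw_i,\ 2\le m<a_i,\ 1\le i\le s\\ 1&u=-a_1w_1,\ s=1,\ a_1>1\\ 2-\delta_{i1}-\delta_{is}&u=-w_i,\ 1\le i\le s\\ 0&\text{otherwise}\end{cases}$$ (where $\delta$ is the Kronecker delta), subject to the following exceptions. For $\tilde X\not\cong\mathbb A^2$: (a) If $s=1$, $u=-a_1w_1$ and either $\ell_1=1,\ \ell_2\ne1$ or $\ell_1\ne1,\ \ell_2=1$, then $\dim(T^1_X)_u$ decreases by $1$ compared to $(\ast)$. For $\tilde X\cong\mathbb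 A^2$: (b) If $\ell_1,\ell_2\ge2$ and $u=-u_i^1(\ell_i)$, then $\dim(T^1_X)_u=0$, for $i=1,2$. (c) If $\ell_1=1$ and $u=-u_2^1(m)$ with $1\le m\le\ell_2-1$, or $\ell_2=1$ and $u=-u_1^1(m)$ with $1\le m\le\ell_1-1$, then $\dim(T^1_X)_u$ is decreased by $1$ compared to $(\ast)$. (d) In degree $u=-2u_1^1(1)=-2u_2^1(1)$ we have $$\dim(T^1_X)_u=\begin{cases}1&\ell_1,\ell_2\le2\text{ and }(\ell_1,\ell_2)\ne(1,1)\\0&\text{otherwise.}\end{cases}$$
   Context: $N$ is the dual lattice of $M$, with pairing $\langle\cdot,\cdot\rangle$; $k[S]$ has $k$-basis $\chi^w$, $w\in S$. $\sigma\subset N_{\mathbb Q}$ is spanned by two rays $\rho_1,\rho_2$ with primitive lattice generators $v_1,v_2$. Seminormality: for a face $\tau\prec\sigma$ let $G_\tau$ be the subgroup of $M$ generated by $S\cap\tau^\perp$. $S$ is seminormal if $S=\bigcup_{\tau\prec\sigma}G_\tau\cap\operatorname{relint}(\sigma^\vee\cap\tau^\perp)$ (union over all faces of $\sigma$). $\ell_i$ is the index of $G_{\rho_i}$ in $M\cap\rho_i^\perp$. Generators: let $\bar E=\{w_0,\dots,w_{s+1}\}$ be the minimal generating set of $\bar S=\sigma^\vee\cap M$; if it has only two elements (i.e. $\tilde X\cong\mathbb A^2$), the sum of the two elements is added, so that $\bar E$ has at least three elements. They are ordered such that $w_0\in\rho_1^\perp$, $w_{s+1}\in\rho_2^\perp$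 and $w_{i-1}+w_{i+1}=a_iw_i$ with $a_i\in\mathbb Z$ for $i=1,\dots,s$. Numbering: the lattice points on the line $\{u\mid\langle v_i,u\rangle=j\}$ are numbered consecutively by $m\in\mathbb Z$ so that those with positive number are exactly those pairing positively with the other ray generator of $\sigma$; $u_i^j(m)$ is the $m$-th point. Thus $u_1^0(m)=mw_0$, $u_2^0(m)=mw_{s+1}$, $u_1^1(m)=w_1+(m-1)w_0$, $u_2^1(m)=w_s+(m-1)w_{s+1}$. $T^1$: write $A=k[S]=R/I$ with $R=k[z_1,\dots,z_r]$, $z_i\mapsto\chi^{g_i}$ for a finite generating set $g_1,\dots,g_r$ of $S$. Then $T^1_X=\operatorname{Hom}_A(I/I^2,A)/D$ with $D$ the $A$-submodule generated by $\partial_i:f\mapsto\partial f/\partial z_i$. It is independent of the presentation and $M$-graded ($\deg\chi^w=w$, $\deg z_i=g_i$; a homomorphism of degree $u$ maps degree $d$ to degree $d+u$); $(T^1_X)_u$ is the component of degree $u$. *)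

theory Defs
  imports
    Complex_Main
    "HOL-Library.Poly_Mapping"
    "HOL-Library.Product_Plus"
    "HOL-Library.Function_Algebras"
    "HOL-Computational_Algebra.Group_Closure"
begin

section \<open>Lattices and rational cones in the plane\<close>

text \<open>
  Both \<open>M\<close> and its dual \<open>N\<close> are \<open>\<int>\<^sup>2\<close>, with the standard pairing;
  \<open>M\<^sub>\<rat>\<close> and \<open>N\<^sub>\<rat>\<close> are \<open>\<rat>\<^sup>2\<close>.
\<close>

type_synonym lattice = "int \<times> int"
type_synonym qplane = "rat \<times> rat"

definition zscale :: "int \<Rightarrow> lattice \<Rightarrow> lattice" where
  "zscale m u = (m * fst u, m * snd u)"

definition pairing :: "lattice \<Rightarrow> lattice \<Rightarrow> int" where
  "pairing v u = fst v * fst u + snd v * snd u"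

definition qscale :: "rat \<Rightarrow> qplane \<Rightarrow> qplane" where
  "qscale c x = (c * fst x, c * snd x)"

definition qpairing :: "qplane \<Rightarrow> qplane \<Rightarrow> rat" where
  "qpairing n x = fst n * fst x + snd n * snd x"

definition to_q :: "lattice \<Rightarrow> qplane" where
  "to_q u = (of_int (fst u), of_int (snd u))"

definition qcone :: "qplane set \<Rightarrow> qplane set" where
  "qcone X = {\<Sum>x\<in>F. qscale (c x) x | F c. finite F \<and> F \<subseteq> X \<and> (\<forall>x\<in>F. 0 \<le> c x)}"

definition dual_cone :: "qplane set \<Rightarrow> qplane set" where
  "dual_cone C = {n. \<forall>x\<in>C. 0 \<le> qpairing n x}"

definition perp :: "qplane set \<Rightarrow> qplane set" where
  "perp C = {x. \<forall>n\<in>C. qpairing n x = 0}"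

definition face_of_cone :: "qplane set \<Rightarrow> qplane set \<Rightarrow> bool" where
  "face_of_cone \<tau> \<sigma> \<longleftrightarrow> (\<exists>x\<in>dual_cone \<sigma>. \<tau> = {n\<in>\<sigma>. qpairing n x = 0})"

text \<open>
  The relative interior of a cone: its interior, for the maximum norm, inside its linear span
  (which is also its affine hull, as the cone contains the origin).
\<close>

definition relint :: "qplane set \<Rightarrow> qplane set" where
  "relint C = {x\<in>C. \<exists>\<epsilon>>0. \<forall>y\<in>module.span qscale C.
     max \<bar>fst y - fst x\<bar> \<bar>snd y - snd x\<bar> < \<epsilon> \<longrightarrow> y \<in> C}"

definition primitive :: "lattice \<Rightarrow> bool" where
  "primitive v \<longleftrightarrow> coprime (fst v) (snd v)"

definition ray :: "lattice \<Rightarrow> qplane set" where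
  "ray v = qcone {to_q v}"


section \<open>Affine monoids and seminormality\<close>

definition is_submonoid :: "lattice set \<Rightarrow> bool" where
  "is_submonoid S \<longleftrightarrow> 0 \<in> S \<and> (\<forall>x\<in>S. \<forall>y\<in>S. x + y \<in> S)"

definition affine_monoid :: "lattice set \<Rightarrow> bool" where
  "affine_monoid S \<longleftrightarrow> is_submonoid S \<and> (\<exists>F. finite F \<and> is_submonoid hull F = S)"

definition sigma_cone :: "lattice set \<Rightarrow> qplane set" where
  "sigma_cone S = dual_cone (qcone (to_q ` S))"

definition saturation :: "lattice set \<Rightarrow> lattice set" where
  "saturation S = {u. to_q u \<in> dual_cone (sigma_cone S)}"

definition face_group :: "lattice set \<Rightarrow> qplane set \<Rightarrow> lattice set" where
  "face_group S \<tau> = group_closure {u\<in>S. to_q u \<in> perp \<tau>}"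

definition seminormal :: "lattice set \<Rightarrow> bool" where
  "seminormal S \<longleftrightarrow> S = (\<Union>\<tau>\<in>{\<tau>. face_of_cone \<tau> (sigma_cone S)}.
     {u\<in>face_group S \<tau>. to_q u \<in> relint (dual_cone (sigma_cone S) \<inter> perp \<tau>)})"

definition group_index :: "lattice set \<Rightarrow> lattice set \<Rightarrow> nat" where
  "group_index H G = card {(+) u ` G | u. u \<in> H}"

definition ray_index :: "lattice set \<Rightarrow> lattice \<Rightarrow> nat" where
  "ray_index S v = group_index {u. to_q u \<in> perp (ray v)} (face_group S (ray v))"

definition minimal_generating_set :: "lattice set \<Rightarrow> lattice set \<Rightarrow> bool" where
  "minimal_generating_set H S \<longleftrightarrow>
     is_submonoid hull H = S \<and> (\<forall>H'. H' \<subset> H \<longrightarrow> is_submonoid hull H' \<noteq> S)"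

definition extended_generators :: "lattice set \<Rightarrow> lattice set" where
  "extended_generators H = (if card H = 2 then insert (\<Sum>w\<in>H. w) H else H)"

text \<open>
  \<open>ordered_generators S v\<^sub>1 v\<^sub>2 s w a\<close>: the extended minimal generating set of the saturation
  is \<open>{w\<^sub>0, \<dots>, w\<^sub>s\<^sub>+\<^sub>1}\<close>, without repetitions and ordered from \<open>\<rho>\<^sub>1\<^sup>\<bottom>\<close> to \<open>\<rho>\<^sub>2\<^sup>\<bottom>\<close>.
\<close>

definition ordered_generators ::
  "lattice set \<Rightarrow> lattice \<Rightarrow> lattice \<Rightarrow> nat \<Rightarrow> (nat \<Rightarrow> lattice) \<Rightarrow> (nat \<Rightarrow> int) \<Rightarrow> bool" where
  "ordered_generators S v1 v2 s w a \<longleftrightarrow>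
     (\<exists>H. minimal_generating_set H (saturation S) \<and>
          bij_betw w {0..s + 1} (extended_generators H)) \<and>
     to_q (w 0) \<in> perp (ray v1) \<and> to_q (w (s + 1)) \<in> perp (ray v2) \<and>
     (\<forall>i\<in>{1..s}. w (i - 1) + w (i + 1) = zscale (a i) (w i))"


section \<open>Numbering of lattice points on lines\<close>

text \<open>
  \<open>f\<close> runs through the lattice points on \<open>\<langle>v, u\<rangle> = j\<close> consecutively and without repetition, in
  the direction in which the pairing with the other ray generator \<open>v'\<close> grows.  The last condition
  makes \<open>f\<close> unique.
\<close>

definition numbering :: "lattice \<Rightarrow> lattice \<Rightarrow> int \<Rightarrow> (int \<Rightarrow> lattice) \<Rightarrow> bool" where
  "numbering v v' j f \<longleftrightarrow> bij_betw f UNIV {u. pairing v u = j} \<and>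
     strict_mono (\<lambda>m. pairing v' (f m)) \<and> (\<forall>m. 0 < m \<longleftrightarrow> 0 < pairing v' (f m))"

definition line_point :: "lattice \<Rightarrow> lattice \<Rightarrow> int \<Rightarrow> int \<Rightarrow> lattice" where
  "line_point v v' j = (THE f. numbering v v' j f)"


section \<open>Monoid algebras and the affine plane\<close>

text \<open>
  \<open>lattice \<Rightarrow>\<^sub>0 'k\<close> is the group algebra \<open>k[M]\<close>; \<open>\<chi>\<^sup>w\<close> is \<open>Poly_Mapping.single w 1\<close>.
  Polynomials in variables indexed by \<open>'i\<close> are elements of \<open>('i \<Rightarrow>\<^sub>0 nat) \<Rightarrow>\<^sub>0 'k\<close>.
\<close>

definition monoid_algebra :: "lattice set \<Rightarrow> (lattice \<Rightarrow>\<^sub>0 'k::field) set" where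
  "monoid_algebra S = {f. Poly_Mapping.keys f \<subseteq> S}"

text \<open>
  \<open>Spec A\<close> is isomorphic to the affine plane over \<open>k\<close>: \<open>A\<close> is isomorphic, as a \<open>k\<close>-algebra, to
  the polynomial ring over \<open>k\<close> in two variables (indexed by the two elements of \<open>bool\<close>).
\<close>

definition is_affine_plane :: "(lattice \<Rightarrow>\<^sub>0 'k::field) set \<Rightarrow> bool" where
  "is_affine_plane A \<longleftrightarrow> (\<exists>F :: ((bool \<Rightarrow>\<^sub>0 nat) \<Rightarrow>\<^sub>0 'k) \<Rightarrow> (lattice \<Rightarrow>\<^sub>0 'k).
     bij_betw F UNIV A \<and>
     (\<forall>p q. F (p + q) = F p + F q) \<and> (\<forall>p q. F (p * q) = F p * F q) \<and>
     (\<forall>c. F (Poly_Mapping.single 0 c) = Poly_Mapping.single 0 c))"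


section \<open>The module \<open>T\<^sup>1\<close>\<close>

text \<open>
  \<open>g\<close> is a family of generators of \<open>S\<close> and \<open>A = k[S] = R / I\<close>, where \<open>R\<close> is the
  polynomial ring with a variable \<open>z\<^sub>i\<close> for each index \<open>i\<close>, mapped to \<open>\<chi>\<close> with exponent \<open>g i\<close>.
\<close>

definition weight :: "('i::finite \<Rightarrow> lattice) \<Rightarrow> ('i \<Rightarrow>\<^sub>0 nat) \<Rightarrow> lattice" where
  "weight g e = (\<Sum>i\<in>UNIV. zscale (int (Poly_Mapping.lookup e i)) (g i))"

definition presentation ::
  "('i::finite \<Rightarrow> lattice) \<Rightarrow> (('i \<Rightarrow>\<^sub>0 nat) \<Rightarrow>\<^sub>0 'k::field) \<Rightarrow> (lattice \<Rightarrow>\<^sub>0 'k)" where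
  "presentation g f =
     (\<Sum>e\<in>Poly_Mapping.keys f. Poly_Mapping.single (weight g e) (Poly_Mapping.lookup f e))"

definition toric_ideal :: "('i::finite \<Rightarrow> lattice) \<Rightarrow> (('i \<Rightarrow>\<^sub>0 nat) \<Rightarrow>\<^sub>0 'k::field) set" where
  "toric_ideal g = {f. presentation g f = 0}"

definition ideal_square :: "'r::comm_ring_1 set \<Rightarrow> 'r set" where
  "ideal_square J =
     {\<Sum>j<n. p j * q j | (n::nat) p q. \<forall>j<n. p j \<in> J \<and> q j \<in> J}"

definition conormal_class ::
  "('i::finite \<Rightarrow> lattice) \<Rightarrow> (('i \<Rightarrow>\<^sub>0 nat) \<Rightarrow>\<^sub>0 'k::field) \<Rightarrow> (('i \<Rightarrow>\<^sub>0 nat) \<Rightarrow>\<^sub>0 'k) set" where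
  "conormal_class g f = {f + h | h. h \<in> ideal_square (toric_ideal g)}"

definition conormal :: "('i::finite \<Rightarrow> lattice) \<Rightarrow> (('i \<Rightarrow>\<^sub>0 nat) \<Rightarrow>\<^sub>0 'k::field) set set" where
  "conormal g = conormal_class g ` toric_ideal g"

text \<open>
  \<open>Hom\<^sub>A(I/I\<^sup>2, A)\<close>, as functions on the set of residue classes, extended by \<open>0\<close>.  The module
  structure of \<open>I/I\<^sup>2\<close> over \<open>A\<close> is induced by that over \<open>R\<close>: the image of \<open>p \<in> R\<close> in \<open>A\<close> sends
  the class of \<open>f\<close> to the class of \<open>p * f\<close>.
\<close>

definition normal_module ::
  "lattice set \<Rightarrow> ('i::finite \<Rightarrow> lattice) \<Rightarrow>
     ((('i \<Rightarrow>\<^sub>0 nat) \<Rightarrow>\<^sub>0 'k::field) set \<Rightarrow> (lattice \<Rightarrow>\<^sub>0 'k)) set" where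
  "normal_module S g = {\<phi>.
     (\<forall>X\<in>conormal g. \<phi> X \<in> monoid_algebra S) \<and> (\<forall>X. X \<notin> conormal g \<longrightarrow> \<phi> X = 0) \<and>
     (\<forall>f\<in>toric_ideal g. \<forall>h\<in>toric_ideal g.
        \<phi> (conormal_class g (f + h)) = \<phi> (conormal_class g f) + \<phi> (conormal_class g h)) \<and>
     (\<forall>p. \<forall>f\<in>toric_ideal g.
        \<phi> (conormal_class g (p * f)) = presentation g p * \<phi> (conormal_class g f))}"

definition homogeneous ::
  "('i::finite \<Rightarrow> lattice) \<Rightarrow> lattice \<Rightarrow> (('i \<Rightarrow>\<^sub>0 nat) \<Rightarrow>\<^sub>0 'k::field) \<Rightarrow> bool" where
  "homogeneous g d f \<longleftrightarrow> (\<forall>e\<in>Poly_Mapping.keys f. weight g e = d)"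

definition normal_module_degree ::
  "lattice set \<Rightarrow> ('i::finite \<Rightarrow> lattice) \<Rightarrow> lattice \<Rightarrow>
     ((('i \<Rightarrow>\<^sub>0 nat) \<Rightarrow>\<^sub>0 'k::field) set \<Rightarrow> (lattice \<Rightarrow>\<^sub>0 'k)) set" where
  "normal_module_degree S g u = {\<phi>\<in>normal_module S g.
     \<forall>d. \<forall>f\<in>toric_ideal g. homogeneous g d f \<longrightarrow>
       Poly_Mapping.keys (\<phi> (conormal_class g f)) \<subseteq> {d + u}}"

definition partial_deriv ::
  "'i \<Rightarrow> (('i \<Rightarrow>\<^sub>0 nat) \<Rightarrow>\<^sub>0 'k::field) \<Rightarrow> (('i \<Rightarrow>\<^sub>0 nat) \<Rightarrow>\<^sub>0 'k)" where
  "partial_deriv i f = (\<Sum>e\<in>Poly_Mapping.keys f.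
     Poly_Mapping.single (e - Poly_Mapping.single i 1)
       (of_nat (Poly_Mapping.lookup e i) * Poly_Mapping.lookup f e))"

text \<open>
  The image of \<open>\<partial>f/\<partial>z\<^sub>i\<close> in \<open>A\<close> depends only on the class of \<open>f\<close> in \<open>I/I\<^sup>2\<close>, hence the set
  below is a singleton.
\<close>

definition derivation_hom ::
  "('i::finite \<Rightarrow> lattice) \<Rightarrow> 'i \<Rightarrow>
     (('i \<Rightarrow>\<^sub>0 nat) \<Rightarrow>\<^sub>0 'k::field) set \<Rightarrow> (lattice \<Rightarrow>\<^sub>0 'k)" where
  "derivation_hom g i X = (if X \<in> conormal g
     then the_elem ((\<lambda>f. presentation g (partial_deriv i f)) ` X) else 0)"

definition derivation_submodule ::
  "lattice set \<Rightarrow> ('i::finite \<Rightarrow> lattice) \<Rightarrow>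
     ((('i \<Rightarrow>\<^sub>0 nat) \<Rightarrow>\<^sub>0 'k::field) set \<Rightarrow> (lattice \<Rightarrow>\<^sub>0 'k)) set" where
  "derivation_submodule S g =
     {\<lambda>X. \<Sum>i\<in>UNIV. b i * derivation_hom g i X | b. \<forall>i. b i \<in> monoid_algebra S}"

text \<open>
  For subspaces \<open>V\<close> and \<open>W\<close> of a vector space: the image of \<open>V\<close> in the quotient by \<open>W\<close> has a
  basis of \<open>n\<close> elements, namely the classes of the elements of \<open>B\<close>.
\<close>

definition has_dimension_modulo ::
  "('k::field \<Rightarrow> 'v::ab_group_add \<Rightarrow> 'v) \<Rightarrow> 'v set \<Rightarrow> 'v set \<Rightarrow> nat \<Rightarrow> bool" where
  "has_dimension_modulo scl V W n \<longleftrightarrow> (\<exists>B. B \<subseteq> V \<and> finite B \<and> card B = n \<and>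
     (\<forall>c. (\<Sum>b\<in>B. scl (c b) b) \<in> W \<longrightarrow> (\<forall>b\<in>B. c b = 0)) \<and>
     (\<forall>v\<in>V. \<exists>c. v - (\<Sum>b\<in>B. scl (c b) b) \<in> W))"

definition hom_scale ::
  "'k::field \<Rightarrow> ('x \<Rightarrow> (lattice \<Rightarrow>\<^sub>0 'k)) \<Rightarrow> ('x \<Rightarrow> (lattice \<Rightarrow>\<^sub>0 'k))" where
  "hom_scale c \<phi> = (\<lambda>X. Poly_Mapping.single 0 c * \<phi> X)"

text \<open>
  \<open>T1_has_dimension TYPE('k) S g u n\<close>: the component of degree \<open>u\<close> of \<open>T\<^sup>1 = Hom\<^sub>A(I/I\<^sup>2, A) / D\<close>,
  that is, the space of classes of homomorphisms of degree \<open>u\<close>, has (finite) dimension \<open>n\<close>.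
\<close>

definition T1_has_dimension ::
  "'k::field itself \<Rightarrow> lattice set \<Rightarrow> ('i::finite \<Rightarrow> lattice) \<Rightarrow> lattice \<Rightarrow> nat \<Rightarrow> bool" where
  "T1_has_dimension _ S g u n \<longleftrightarrow>
     has_dimension_modulo (hom_scale :: 'k \<Rightarrow> _)
       (normal_module_degree S g u) (derivation_submodule S g) n"


section \<open>The numbers \<open>d\<^sub>i\<close> and \<open>d~\<close>\<close>

text \<open>
  \<open>d_ray v\<^sub>1 v\<^sub>2 \<ell>\<^sub>1\<close> is \<open>d\<^sub>1\<close> and \<open>d_ray v\<^sub>2 v\<^sub>1 \<ell>\<^sub>2\<close> is \<open>d\<^sub>2\<close>.  The values are integers:
  \<open>\<ell> - 2\<close> is negative for \<open>\<ell> = 1\<close>.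
\<close>

definition d_ray :: "lattice \<Rightarrow> lattice \<Rightarrow> int \<Rightarrow> lattice \<Rightarrow> int" where
  "d_ray v v' l u =
     (if \<exists>m. 1 \<le> m \<and> m < l \<and> u = - line_point v v' 0 m then 1
      else if \<exists>m\<le>0. u = - line_point v v' 1 m then l - 2
      else if u = - line_point v v' 1 1 then l - 1
      else if \<exists>m. 2 \<le> m \<and> m \<le> l \<and> u = - line_point v v' 1 m
        then l - (THE m. u = - line_point v v' 1 m) + 1
      else if \<exists>m\<le>1. u = - zscale 2 (line_point v v' 1 m) \<and> l = 2 then 1
      else 0)"

text \<open>
  The Kronecker deltas are read off from \<open>u = - w\<^sub>i\<close> itself, as the \<open>w\<^sub>i\<close> are pairwise
  distinct.
\<close>

definition d_normal :: "nat \<Rightarrow> (nat \<Rightarrow> lattice) \<Rightarrow> (nat \<Rightarrow> int) \<Rightarrow> lattice \<Rightarrow> int" where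
  "d_normal s w a u =
     (if \<exists>i\<in>{1..s}. \<exists>m. 2 \<le> m \<and> m < a i \<and> u = - zscale m (w i) then 1
      else if u = - zscale (a 1) (w 1) \<and> s = 1 \<and> a 1 > 1 then 1
      else if \<exists>i\<in>{1..s}. u = - w i
        then 2 - of_bool (u = - w 1) - of_bool (u = - w s)
      else 0)"

definition T1_formula ::
  "lattice \<Rightarrow> lattice \<Rightarrow> int \<Rightarrow> int \<Rightarrow> nat \<Rightarrow> (nat \<Rightarrow> lattice) \<Rightarrow> (nat \<Rightarrow> int) \<Rightarrow> lattice \<Rightarrow> int" where
  "T1_formula v1 v2 l1 l2 s w a u =
     max 0 (d_ray v1 v2 l1 u + d_ray v2 v1 l2 u + d_normal s w a u)"

end

theory Submission
  imports Defs
begin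

text \<open>
  Fix a degree \<open>u\<close> and put \<open>R = - u\<close>. A homomorphism \<open>I/I\<^sup>2 \<rightarrow> k[S]\<close> of degree \<open>u\<close> is a combination of
  the derivations \<open>\<chi>\<^sup>u z\<^sub>i \<partial>/\<partial>z\<^sub>i\<close>, and it takes values in \<open>k[S]\<close> if and only if its coefficients define
  a function on \<open>K = {x \<in> S. x - R \<notin> S}\<close>. This function is additive: \<open>h (x + y) = h x + h y\<close> for
  \<open>x, y \<in> S\<close> with \<open>x + y \<in> K\<close>. The submodule \<open>D\<close> corresponds to the restrictions of linear functions
  on \<open>M\<close>. So the component of \<open>T\<^sup>1\<close> in degree \<open>u\<close> is the space of additive functions on \<open>K\<close> modulo linear
  functions (\<open>T1_has_dimension_additive\<close>).

  By seminormality \<open>S\<close> is given by one condition for each ray: the height \<open>p x = \<langle>v\<^sub>i, x\<rangle>\<close> is positive,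
  or it is zero and \<open>x\<close> is a multiple of \<open>l\<^sub>i e\<^sub>i\<close>, where \<open>e\<^sub>i\<close> spans the edge (\<open>S_cases\<close>).
  Hence \<open>K\<close> is the union of two regions, one near each edge of the dual cone. Near one edge the
  additive functions are easy to describe, depending on the height of \<open>R\<close>. At height one they
  are arbitrary on the residue classes modulo \<open>l\<close> of the line \<open>p = 1\<close> other than that of \<open>R\<close>
  (\<open>basis_points_one\<close>). From height two on they are linear (\<open>additive_level_one_vanishes\<close>), except that
  for \<open>l = 2\<close> and \<open>R\<close> even at height two the parity along the edge is additive as well
  (\<open>basis_points_special\<close>).

  An additive function on \<open>K\<close> is a pair of additive functions on the two regions that agree on their
  overlap, and the dimension is found by counting coordinates. If both sides are linear, it is two minus
  the rank of the overlap. Here the generators \<open>w\<^sub>j\<close> of the normalisation enter: consecutive ones span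
  unimodular cones, and an element \<open>m w\<^sub>k\<close> with \<open>m < a\<^sub>k\<close> decomposes in the cone only along its own line
  (\<open>decomposition_multiplicity\<close>), which gives the contribution \<open>d~\<close>. The exceptional degrees are those
  in which an edge vector \<open>e\<^sub>i\<close> belongs to the overlap because \<open>l\<^sub>i = 1\<close>, or in which the two edges are so
  close that the contributions of the rays interfere, as for the affine plane (\<open>value_formula\<close>).

  What remains is the passage from cones in \<open>\<rat>\<^sup>2\<close>, minimal generators and numberings of lattice points to
  these coordinates (\<open>cone_chain_of_plane\<close>, \<open>line_point_eq\<close>). The normalisation is an affine plane exactly
  if \<open>\<bar>det (v\<^sub>1, v\<^sub>2)\<bar> = 1\<close>: otherwise there are three irreducible elements, hence three independent
  derivations at the origin (\<open>affine_plane_irreducibles\<close>).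
\<close>

section \<open>Weighted sums over monomials\<close>

definition exponent_pairing :: "('i::finite \<Rightarrow> 'k::comm_ring_1) \<Rightarrow> ('i \<Rightarrow>\<^sub>0 nat) \<Rightarrow> 'k" where
  "exponent_pairing \<eta> e = (\<Sum>i\<in>UNIV. of_nat (Poly_Mapping.lookup e i) * \<eta> i)"

lemma exponent_pairing_add: "exponent_pairing \<eta> (e + e') = exponent_pairing \<eta> e + exponent_pairing \<eta> e'"
  by (simp add: exponent_pairing_def lookup_add algebra_simps sum.distrib)

lemma exponent_pairing_zero [simp]: "exponent_pairing \<eta> 0 = 0"
  by (simp add: exponent_pairing_def)

lemma exponent_pairing_diff_weights:
  "exponent_pairing (\<lambda>i. \<eta> i - \<beta> i) e = exponent_pairing \<eta> e - exponent_pairing \<beta> e"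
  by (simp add: exponent_pairing_def algebra_simps sum_subtractf)

lemma exponent_pairing_single: "exponent_pairing \<eta> (Poly_Mapping.single i 1) = \<eta> i"
  unfolding exponent_pairing_def lookup_single when_def
  by (subst sum.cong[OF refl, where h="\<lambda>j. if j = i then \<eta> i else 0"]) auto

lemma zscale_zero_right [simp]: "zscale m 0 = 0" by (simp add: zscale_def zero_prod_def)
lemma zscale_zero_left [simp]: "zscale 0 x = 0" by (simp add: zscale_def zero_prod_def)
lemma zscale_one [simp]: "zscale 1 x = x" by (simp add: zscale_def)
lemma zscale_add_left: "zscale (a + b) x = zscale a x + zscale b x"
  by (simp add: zscale_def algebra_simps)
lemma zscale_add_right: "zscale a (x + y) = zscale a x + zscale a y"
  by (simp add: zscale_def algebra_simps)

lemma weight_zero [simp]: "weight g 0 = 0"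
  by (simp add: weight_def)

lemma weight_add: "weight g (e + e') = weight g e + weight g e'"
  by (simp add: weight_def lookup_add zscale_add_left sum.distrib)

lemma weight_single [simp]: "weight g (Poly_Mapping.single i 1) = g i"
proof -
  have "weight g (Poly_Mapping.single i 1) = (\<Sum>j\<in>UNIV. if j = i then g i else 0)"
    unfolding weight_def by (intro sum.cong) (auto simp: lookup_single when_def)
  then show ?thesis by simp
qed

lemma weight_range:
  assumes "is_submonoid hull (range g) = S"
  shows "range (weight g) = S"
proof
  have sub: "is_submonoid S"
    unfolding assms[symmetric] hull_def is_submonoid_def by auto
  have g: "g i \<in> S" for i
    using assms hull_subset[of "range g" is_submonoid] by auto
  have scale: "zscale (int m) x \<in> S" if "x \<in> S" for m x
    using that sub by (induction m) (auto simp: is_submonoid_def zscale_add_left)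
  have "(\<Sum>i\<in>F. zscale (int (Poly_Mapping.lookup e i)) (g i)) \<in> S" if "finite F" for F and e
    using that by induction (use sub g scale in \<open>auto simp: is_submonoid_def\<close>)
  then show "range (weight g) \<subseteq> S" by (auto simp: weight_def)
  have "is_submonoid (range (weight g))"
    unfolding is_submonoid_def by (auto simp flip: weight_add intro: range_eqI[of _ _ 0])
  moreover have "range g \<subseteq> range (weight g)"
    by (metis image_subset_iff rangeI weight_single)
  ultimately show "S \<subseteq> range (weight g)"
    unfolding assms[symmetric] by (intro hull_minimal) auto
qed

lemma poly_mapping_sum_singles:
  "f = (\<Sum>e\<in>Poly_Mapping.keys f. Poly_Mapping.single e (Poly_Mapping.lookup f e))"
  by (rule poly_mapping_eqI) (simp add: lookup_sum lookup_single when_def in_keys_iff)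

definition weighted_presentation ::
  "('i::finite \<Rightarrow> lattice) \<Rightarrow> (('i \<Rightarrow>\<^sub>0 nat) \<Rightarrow> 'k) \<Rightarrow> (('i \<Rightarrow>\<^sub>0 nat) \<Rightarrow>\<^sub>0 'k::field) \<Rightarrow> (lattice \<Rightarrow>\<^sub>0 'k)" where
  "weighted_presentation g c f =
     (\<Sum>e\<in>Poly_Mapping.keys f. Poly_Mapping.single (weight g e) (Poly_Mapping.lookup f e * c e))"

lemma weighted_presentation_superset:
  assumes "finite F" "Poly_Mapping.keys f \<subseteq> F"
  shows "weighted_presentation g c f =
     (\<Sum>e\<in>F. Poly_Mapping.single (weight g e) (Poly_Mapping.lookup f e * c e))"
  unfolding weighted_presentation_def using assms
  by (intro sum.mono_neutral_left) (auto simp: in_keys_iff)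

lemma weighted_presentation_zero [simp]: "weighted_presentation g c 0 = 0"
  by (simp add: weighted_presentation_def)

lemma weighted_presentation_add:
  "weighted_presentation g c (f + h) = weighted_presentation g c f + weighted_presentation g c h"
proof -
  let ?F = "Poly_Mapping.keys f \<union> Poly_Mapping.keys h"
  have "Poly_Mapping.keys (f + h) \<subseteq> ?F" by (rule keys_add)
  then show ?thesis
    by (simp add: weighted_presentation_superset[of ?F] lookup_add algebra_simps single_add sum.distrib)
qed

lemma weighted_presentation_sum:
  "weighted_presentation g c (sum f A) = (\<Sum>x\<in>A. weighted_presentation g c (f x))"
  by (induction A rule: infinite_finite_induct) (auto simp: weighted_presentation_add)

lemma weighted_presentation_single:
  "weighted_presentation g c (Poly_Mapping.single e a) = Poly_Mapping.single (weight g e) (a * c e)"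
  by (subst weighted_presentation_superset[of "{e}"]) auto

lemma presentation_weighted: "presentation g f = weighted_presentation g (\<lambda>_. 1) f"
  by (simp add: presentation_def weighted_presentation_def)

lemma presentation_add: "presentation g (f + h) = presentation g f + presentation g h"
  by (simp add: presentation_weighted weighted_presentation_add)

lemma presentation_zero [simp]: "presentation g 0 = 0"
  by (simp add: presentation_weighted)

lemma presentation_single:
  "presentation g (Poly_Mapping.single e a) = Poly_Mapping.single (weight g e) a"
  by (simp add: presentation_weighted weighted_presentation_single)

lemma presentation_sum:
  "presentation g (sum f A) = (\<Sum>x\<in>A. presentation g (f x))"
  by (simp add: presentation_weighted weighted_presentation_sum)

text \<open>The Leibniz rule: an additive function of the exponent defines a derivation along the
  presentation.  For \<open>c\<close> the \<open>i\<close>-th exponent it is \<open>z\<^sub>i \<partial>/\<partial>z\<^sub>i\<close>.\<close>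

lemma weighted_presentation_mult:
  assumes "\<And>e e'. c (e + e') = c e + c e'"
  shows "weighted_presentation g c (f * h) =
     presentation g f * weighted_presentation g c h + weighted_presentation g c f * presentation g h"
proof -
  let ?m = "\<lambda>f e. Poly_Mapping.single e (Poly_Mapping.lookup f e)"
  let ?A = "Poly_Mapping.keys f" let ?B = "Poly_Mapping.keys h"
  have f: "f = (\<Sum>e\<in>?A. ?m f e)" and h: "h = (\<Sum>e\<in>?B. ?m h e)"
    by (rule poly_mapping_sum_singles)+
  have "f * h = (\<Sum>e\<in>?A. \<Sum>e'\<in>?B. ?m f e * ?m h e')"
    unfolding sum_product[symmetric] by (rule arg_cong2[where f="(*)", OF f h])
  also have "weighted_presentation g c \<dots> = (\<Sum>e\<in>?A. \<Sum>e'\<in>?B.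
      presentation g (?m f e) * weighted_presentation g c (?m h e')
      + weighted_presentation g c (?m f e) * presentation g (?m h e'))"
    unfolding weighted_presentation_sum
    by (intro sum.cong refl) (simp add: mult_single weighted_presentation_single presentation_single
          weight_add assms algebra_simps flip: single_add)
  also have "\<dots> = (\<Sum>e\<in>?A. presentation g (?m f e)) * (\<Sum>e\<in>?B. weighted_presentation g c (?m h e))
      + (\<Sum>e\<in>?A. weighted_presentation g c (?m f e)) * (\<Sum>e\<in>?B. presentation g (?m h e))"
    by (simp add: sum_product sum.distrib)
  also have "\<dots> = presentation g f * weighted_presentation g c h
       + weighted_presentation g c f * presentation g h"
    unfolding presentation_sum[symmetric] weighted_presentation_sum[symmetric]
    unfolding f[symmetric] h[symmetric] ..
  finally show ?thesis .
qed

lemma weighted_presentation_mult_ideal: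
  assumes "\<And>e e'. c (e + e') = c e + c e'" "h \<in> toric_ideal g"
  shows "weighted_presentation g c (f * h) = presentation g f * weighted_presentation g c h"
  using assms by (simp add: weighted_presentation_mult toric_ideal_def)

lemma presentation_mult: "presentation g (f * h) = presentation g f * presentation g h"
proof -
  let ?m = "\<lambda>f e. Poly_Mapping.single e (Poly_Mapping.lookup f e)"
  let ?A = "Poly_Mapping.keys f" let ?B = "Poly_Mapping.keys h"
  have f: "f = (\<Sum>e\<in>?A. ?m f e)" and h: "h = (\<Sum>e\<in>?B. ?m h e)"
    by (rule poly_mapping_sum_singles)+
  have "f * h = (\<Sum>e\<in>?A. \<Sum>e'\<in>?B. ?m f e * ?m h e')"
    unfolding sum_product[symmetric] by (rule arg_cong2[where f="(*)", OF f h])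
  also have "presentation g \<dots> = (\<Sum>e\<in>?A. presentation g (?m f e)) * (\<Sum>e\<in>?B. presentation g (?m h e))"
    unfolding presentation_sum sum_product
    by (intro sum.cong refl) (simp add: mult_single presentation_single weight_add)
  also have "\<dots> = presentation g f * presentation g h"
    unfolding presentation_sum[symmetric] unfolding f[symmetric] h[symmetric] ..
  finally show ?thesis .
qed

lemma weighted_presentation_ideal_square:
  assumes "\<And>e e'. c (e + e') = c e + c e'" "h \<in> ideal_square (toric_ideal g)"
  shows "weighted_presentation g c h = 0"
proof -
  obtain n :: nat and p q where h: "h = (\<Sum>j<n. p j * q j)"
    and pq: "\<And>j. j < n \<Longrightarrow> p j \<in> toric_ideal g \<and> q j \<in> toric_ideal g"
    using assms(2) unfolding ideal_square_def by auto
  show ?thesis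
    unfolding h weighted_presentation_sum
    by (rule sum.neutral) (use pq in \<open>auto simp: weighted_presentation_mult[of c, OF assms(1)] toric_ideal_def\<close>)
qed

lemma lookup_weighted_presentation:
  "Poly_Mapping.lookup (weighted_presentation g c f) x =
     (\<Sum>e\<in>{e\<in>Poly_Mapping.keys f. weight g e = x}. Poly_Mapping.lookup f e * c e)"
  unfolding weighted_presentation_def lookup_sum lookup_single when_def
  by (simp add: sum.inter_filter)


section \<open>The partial derivatives\<close>

lemma single_zero_mult_lookup:
  "Poly_Mapping.lookup (Poly_Mapping.single (x::lattice) (a::'k::field) * p) y = a * Poly_Mapping.lookup p (y - x)"
proof -
  have "Poly_Mapping.single x a * p =
      (\<Sum>z\<in>Poly_Mapping.keys p. Poly_Mapping.single (x + z) (a * Poly_Mapping.lookup p z))"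
    by (subst (1) poly_mapping_sum_singles[of p]) (simp add: sum_distrib_left mult_single)
  then have "Poly_Mapping.lookup (Poly_Mapping.single x a * p) y =
      (\<Sum>z\<in>Poly_Mapping.keys p. if z = y - x then a * Poly_Mapping.lookup p z else 0)"
    by (auto simp: lookup_sum lookup_single when_def algebra_simps intro!: sum.cong)
  then show ?thesis by (auto simp: in_keys_iff)
qed

lemma lattice_single_cancel:
  "Poly_Mapping.single (- x) (1::'k::field) * (Poly_Mapping.single (x::lattice) 1 * p) = p"
  by (simp add: mult.assoc[symmetric] mult_single)

lemma single_mult_partial_deriv:
  "Poly_Mapping.single (g i) 1 * presentation g (partial_deriv i f) =
     weighted_presentation g (\<lambda>e. of_nat (Poly_Mapping.lookup e i)) f"
proof -
  have w: "g i + weight g (e - Poly_Mapping.single i (Suc 0)) = weight g e" if "Poly_Mapping.lookup e i \<noteq> 0" for e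
  proof -
    have "e - Poly_Mapping.single i 1 + Poly_Mapping.single i 1 = e"
      by (rule poly_mapping_eqI) (use that in \<open>auto simp: lookup_add lookup_minus lookup_single when_def\<close>)
    then show ?thesis by (metis One_nat_def add.commute weight_add weight_single)
  qed
  have "Poly_Mapping.single (g i) 1 * presentation g (Poly_Mapping.single (e - Poly_Mapping.single i 1)
        (of_nat (Poly_Mapping.lookup e i) * Poly_Mapping.lookup f e)) =
      Poly_Mapping.single (weight g e) (Poly_Mapping.lookup f e * of_nat (Poly_Mapping.lookup e i))" for e
    using w[of e] by (cases "Poly_Mapping.lookup e i = 0") (auto simp: presentation_single mult_single mult.commute)
  then show ?thesis
    unfolding partial_deriv_def presentation_sum weighted_presentation_def sum_distrib_left
    by (intro sum.cong refl)
qed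

lemma derivation_hom_class:
  assumes "f \<in> toric_ideal g"
  shows "derivation_hom g i (conormal_class g f) = presentation g (partial_deriv i f)"
proof -
  have eq: "presentation g (partial_deriv i (f + h)) = presentation g (partial_deriv i f)"
    if "h \<in> ideal_square (toric_ideal g)" for h
  proof -
    have "Poly_Mapping.single (g i) 1 * presentation g (partial_deriv i (f + h)) =
          Poly_Mapping.single (g i) 1 * presentation g (partial_deriv i f)"
      unfolding single_mult_partial_deriv weighted_presentation_add
      by (subst weighted_presentation_ideal_square[OF _ that]) (auto simp: lookup_add)
    then show ?thesis by (metis lattice_single_cancel)
  qed
  have "0 \<in> ideal_square (toric_ideal g)"
    unfolding ideal_square_def by (auto intro!: exI[of _ "0::nat"])
  then have "(\<lambda>f. presentation g (partial_deriv i f)) ` conormal_class g f = {presentation g (partial_deriv i f)}"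
    unfolding conormal_class_def using eq by (auto simp: image_iff intro!: exI[of _ f] exI[of _ 0])
  moreover have "conormal_class g f \<in> conormal g"
    using assms by (simp add: conormal_def)
  ultimately show ?thesis by (simp add: derivation_hom_def)
qed

text \<open>The candidate homomorphisms of degree \<open>u\<close>: combinations of the derivations \<open>\<chi>\<^sup>u z\<^sub>i \<partial>/\<partial>z\<^sub>i\<close>.  Their
  values need not lie in \<open>k[S]\<close>.\<close>

definition log_derivation ::
  "('i::finite \<Rightarrow> lattice) \<Rightarrow> lattice \<Rightarrow> ('i \<Rightarrow> 'k::field) \<Rightarrow>
     (('i \<Rightarrow>\<^sub>0 nat) \<Rightarrow>\<^sub>0 'k) set \<Rightarrow> (lattice \<Rightarrow>\<^sub>0 'k)" where
  "log_derivation g u \<eta> X = (\<Sum>i\<in>UNIV. Poly_Mapping.single (g i + u) (\<eta> i) * derivation_hom g i X)"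

lemma log_derivation_class:
  assumes "f \<in> toric_ideal g"
  shows "log_derivation g u \<eta> (conormal_class g f) =
     Poly_Mapping.single u 1 * weighted_presentation g (exponent_pairing \<eta>) f"
proof -
  have "log_derivation g u \<eta> (conormal_class g f) =
     (\<Sum>i\<in>UNIV. Poly_Mapping.single u 1 * (Poly_Mapping.single 0 (\<eta> i) *
        (Poly_Mapping.single (g i) 1 * presentation g (partial_deriv i f))))"
    unfolding log_derivation_def derivation_hom_class[OF assms]
    by (intro sum.cong refl) (simp add: mult.assoc[symmetric] mult_single add.commute)
  also have "\<dots> = Poly_Mapping.single u 1 *
      (\<Sum>i\<in>UNIV. Poly_Mapping.single 0 (\<eta> i) * weighted_presentation g (\<lambda>e. of_nat (Poly_Mapping.lookup e i)) f)"
    by (simp add: single_mult_partial_deriv sum_distrib_left)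
  also have "(\<Sum>i\<in>UNIV. Poly_Mapping.single 0 (\<eta> i) * weighted_presentation g (\<lambda>e. of_nat (Poly_Mapping.lookup e i)) f)
     = weighted_presentation g (exponent_pairing \<eta>) f"
    by (rule poly_mapping_eqI)
       (simp add: lookup_sum single_zero_mult_lookup lookup_weighted_presentation exponent_pairing_def
          sum_distrib_left sum.swap[of _ UNIV] mult_ac)
  finally show ?thesis .
qed


section \<open>Homomorphisms of degree \<open>u\<close>\<close>

lemma toric_ideal_add: "f \<in> toric_ideal g \<Longrightarrow> h \<in> toric_ideal g \<Longrightarrow> f + h \<in> toric_ideal g"
  by (simp add: toric_ideal_def presentation_add)

lemma toric_ideal_mult: "f \<in> toric_ideal g \<Longrightarrow> p * f \<in> toric_ideal g"
  by (simp add: toric_ideal_def presentation_mult)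

text \<open>If \<open>y\<close> is not in \<open>S\<close>, the pairing with \<open>\<eta>\<close> is constant on the exponents of weight \<open>y - u\<close>.
  So the coefficient of \<open>\<chi>\<^sup>y\<close> in the value at \<open>f\<close> is a multiple of the coefficient of \<open>\<chi>\<close> with
  exponent \<open>y - u\<close> in the image of \<open>f\<close>, which is zero.\<close>

lemma log_derivation_in_degree:
  assumes S: "range (weight g) = S"
    and fibre: "\<And>e e'. weight g e = weight g e' \<Longrightarrow> weight g e + u \<notin> S
      \<Longrightarrow> exponent_pairing \<eta> e = exponent_pairing \<eta> e'"
  shows "log_derivation g u \<eta> \<in> normal_module_degree S g u"
proof -
  let ?\<phi> = "log_derivation g u \<eta>"
  have coeff: "Poly_Mapping.lookup (?\<phi> (conormal_class g f)) y =
      (\<Sum>e\<in>{e\<in>Poly_Mapping.keys f. weight g e = y - u}. Poly_Mapping.lookup f e * exponent_pairing \<eta> e)"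
    if "f \<in> toric_ideal g" for f y
    by (simp add: log_derivation_class[OF that] single_zero_mult_lookup lookup_weighted_presentation)
  have alg: "?\<phi> (conormal_class g f) \<in> monoid_algebra S" if f: "f \<in> toric_ideal g" for f
    unfolding monoid_algebra_def
  proof (intro CollectI subsetI, rule ccontr)
    fix y assume y: "y \<in> Poly_Mapping.keys (?\<phi> (conormal_class g f))" "y \<notin> S"
    let ?E = "{e\<in>Poly_Mapping.keys f. weight g e = y - u}"
    have "(\<Sum>e\<in>?E. Poly_Mapping.lookup f e * exponent_pairing \<eta> e) \<noteq> 0"
      using y(1) coeff[OF f, of y] by (simp add: in_keys_iff)
    then obtain e0 where e0: "e0 \<in> ?E" by (metis (no_types, lifting) sum.neutral)
    have const: "exponent_pairing \<eta> e = exponent_pairing \<eta> e0" if "e \<in> ?E" for e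
      by (rule fibre) (use that e0 y(2) in auto)
    have "(\<Sum>e\<in>?E. Poly_Mapping.lookup f e * exponent_pairing \<eta> e) =
        (\<Sum>e\<in>?E. Poly_Mapping.lookup f e * 1) * exponent_pairing \<eta> e0"
      unfolding sum_distrib_right by (intro sum.cong refl) (simp only: const mult_1_right)
    also have "(\<Sum>e\<in>?E. Poly_Mapping.lookup f e * 1) = Poly_Mapping.lookup (presentation g f) (y - u)"
      unfolding presentation_weighted lookup_weighted_presentation ..
    also have "presentation g f = 0" using f by (simp add: toric_ideal_def)
    finally show False using \<open>_ \<noteq> 0\<close> by simp
  qed
  have "?\<phi> X = 0" if "X \<notin> conormal g" for X
    using that by (simp add: log_derivation_def derivation_hom_def)
  moreover have "?\<phi> (conormal_class g (f + h)) = ?\<phi> (conormal_class g f) + ?\<phi> (conormal_class g h)"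
    if "f \<in> toric_ideal g" "h \<in> toric_ideal g" for f h
    using that by (simp add: log_derivation_class toric_ideal_add weighted_presentation_add distrib_left)
  moreover have "?\<phi> (conormal_class g (p * f)) = presentation g p * ?\<phi> (conormal_class g f)"
    if "f \<in> toric_ideal g" for p f
    using that by (simp add: log_derivation_class toric_ideal_mult weighted_presentation_mult_ideal
        exponent_pairing_add mult.left_commute)
  moreover have "Poly_Mapping.keys (?\<phi> (conormal_class g f)) \<subseteq> {d + u}"
    if "f \<in> toric_ideal g" "homogeneous g d f" for d f
  proof
    fix y assume "y \<in> Poly_Mapping.keys (?\<phi> (conormal_class g f))"
    then have "{e\<in>Poly_Mapping.keys f. weight g e = y - u} \<noteq> {}"
      using coeff[OF that(1), of y] by (metis in_keys_iff sum.empty)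
    then show "y \<in> {d + u}" using that(2) by (auto simp: homogeneous_def algebra_simps)
  qed
  ultimately show ?thesis
    using alg unfolding normal_module_degree_def normal_module_def by (auto simp: conormal_def)
qed

lemma additive_on_integer_vectors:
  fixes F :: "('i::finite \<Rightarrow> int) \<Rightarrow> 'k::comm_ring_1"
  assumes add: "\<And>x y. F (\<lambda>i. x i + y i) = F x + F y"
  shows "F x = (\<Sum>i\<in>UNIV. of_int (x i) * F (\<lambda>j. if j = i then 1 else 0))"
proof -
  have z: "F (\<lambda>i. 0) = 0" using add[of "\<lambda>i. 0" "\<lambda>i. 0"] by simp
  have neg: "F (\<lambda>i. - x i) = - F x" for x
    using add[of x "\<lambda>i. - x i"] z by (simp add: eq_neg_iff_add_eq_0 add.commute)
  have natscale: "F (\<lambda>i. int m * x i) = of_nat m * F x" for m x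
    by (induction m) (simp_all add: z add distrib_right)
  have scale: "F (\<lambda>i. m * x i) = of_int m * F x" for m x
  proof (cases "m \<ge> 0")
    case True then show ?thesis using natscale[of "nat m" x] by simp
  next
    case False
    then have "F (\<lambda>i. - (m * x i)) = of_int (-m) * F x"
      using natscale[of "nat (-m)" x] by simp
    then show ?thesis using neg[of "\<lambda>i. m * x i"] by simp
  qed
  have "F (\<lambda>j. if j \<in> A then x j else 0) = (\<Sum>i\<in>A. of_int (x i) * F (\<lambda>j. if j = i then 1 else 0))"
    if "finite A" for A
    using that
  proof induction
    case empty then show ?case using z by simp
  next
    case (insert a A)
    have "(\<lambda>j. if j \<in> insert a A then x j else 0) =
        (\<lambda>j. x a * (if j = a then 1 else 0) + (if j \<in> A then x j else 0))"
      using insert by auto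
    then show ?case using insert by (simp only: add scale sum.insert) simp
  qed
  from this[of UNIV] show ?thesis by simp
qed

definition nat_part :: "('i::finite \<Rightarrow> int) \<Rightarrow> ('i \<Rightarrow>\<^sub>0 nat)" where
  "nat_part x = Abs_poly_mapping (\<lambda>i. nat (x i))"

lemma lookup_nat_part [simp]: "Poly_Mapping.lookup (nat_part x) i = nat (x i)"
  by (simp add: nat_part_def)

lemma zscale_sum: "zscale a (sum f A) = (\<Sum>x\<in>A. zscale a (f x))"
  by (induction A rule: infinite_finite_induct) (auto simp: zscale_add_right)

lemma zscale_assoc: "zscale a (zscale b x) = zscale (a * b) x"
  by (simp add: zscale_def)

lemma zscale_minus_left: "zscale (- a) x = - zscale a x"
  by (simp add: zscale_def)

lemma zscale_diff_left: "zscale (a - b) x = zscale a x - zscale b x"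
  by (simp add: zscale_def algebra_simps)

lemma weight_nat_part:
  "weight g (nat_part x) - weight g (nat_part (\<lambda>i. - x i)) = (\<Sum>i\<in>UNIV. zscale (x i) (g i))"
  unfolding weight_def sum_subtractf[symmetric]
  by (intro sum.cong refl) (auto simp flip: zscale_diff_left)

text \<open>Such a function is a homomorphism on the lattice of relations, the kernel of \<open>\<int>\<^sup>r \<rightarrow> M\<close>. As
  \<open>M\<close> is free, the map has a section, and the homomorphism extends to \<open>\<int>\<^sup>r\<close>.\<close>

lemma extend_relation_function:
  fixes \<psi> :: "('i::finite \<Rightarrow>\<^sub>0 nat) \<Rightarrow> ('i \<Rightarrow>\<^sub>0 nat) \<Rightarrow> 'k::comm_ring_1"
  assumes onto: "\<And>x. \<exists>e e'. x = weight g e - weight g e'"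
    and add: "\<And>e e' e''. weight g e = weight g e' \<Longrightarrow> weight g e' = weight g e''
      \<Longrightarrow> \<psi> e e' + \<psi> e' e'' = \<psi> e e''"
    and trans: "\<And>e e' c. weight g e = weight g e' \<Longrightarrow> \<psi> (c + e) (c + e') = \<psi> e e'"
  obtains \<eta> where "\<And>e e'. weight g e = weight g e'
      \<Longrightarrow> \<psi> e e' = exponent_pairing \<eta> e - exponent_pairing \<eta> e'"
proof -
  define W where "W x = (\<Sum>i\<in>UNIV. zscale (x i) (g i))" for x
  have W_add: "W (\<lambda>i. x i + y i) = W x + W y" for x y
    by (simp add: W_def zscale_add_left sum.distrib)
  have W_diff: "W (\<lambda>i. x i - y i) = W x - W y" for x y
    by (simp add: W_def zscale_diff_left sum_subtractf)
  have W_scale: "W (\<lambda>i. m * x i) = zscale m (W x)" for m x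
    by (simp add: W_def zscale_assoc zscale_sum)
  have weight_W: "weight g e = W (\<lambda>i. int (Poly_Mapping.lookup e i))" for e
    by (simp add: W_def weight_def)
  define \<Lambda> where "\<Lambda> x = \<psi> (nat_part x) (nat_part (\<lambda>i. - x i))" for x
  have \<Lambda>_eq: "\<psi> e e' = \<Lambda> (\<lambda>i. int (Poly_Mapping.lookup e i) - int (Poly_Mapping.lookup e' i))"
    if "weight g e = weight g e'" for e e'
  proof -
    let ?x = "\<lambda>i. int (Poly_Mapping.lookup e i) - int (Poly_Mapping.lookup e' i)"
    let ?c = "nat_part (\<lambda>i. min (int (Poly_Mapping.lookup e i)) (int (Poly_Mapping.lookup e' i)))"
    have "e = ?c + nat_part ?x" "e' = ?c + nat_part (\<lambda>i. - ?x i)"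
      by (auto intro!: poly_mapping_eqI simp: lookup_add)
    moreover have "weight g (nat_part ?x) = weight g (nat_part (\<lambda>i. - ?x i))"
      using weight_nat_part[of g ?x] W_diff that by (simp add: weight_W flip: W_def)
    ultimately show ?thesis
      using trans[of "nat_part ?x" "nat_part (\<lambda>i. - ?x i)" ?c] by (simp add: \<Lambda>_def)
  qed
  have W_nat: "weight g (nat_part x) = weight g (nat_part (\<lambda>i. - x i))" if "W x = 0" for x
    using weight_nat_part[of g x] that by (simp add: W_def)
  have \<Lambda>_add: "\<Lambda> (\<lambda>i. x i + y i) = \<Lambda> x + \<Lambda> y" if "W x = 0" "W y = 0" for x y
  proof -
    note w = W_nat[OF that(1)] W_nat[OF that(2)]
    have "\<Lambda> x = \<psi> (nat_part y + nat_part x) (nat_part y + nat_part (\<lambda>i. - x i))"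
      unfolding \<Lambda>_def using trans w by metis
    moreover have "\<Lambda> y = \<psi> (nat_part (\<lambda>i. - x i) + nat_part y) (nat_part (\<lambda>i. - x i) + nat_part (\<lambda>i. - y i))"
      unfolding \<Lambda>_def using trans w by metis
    ultimately have "\<Lambda> x + \<Lambda> y =
        \<psi> (nat_part x + nat_part y) (nat_part (\<lambda>i. - x i) + nat_part (\<lambda>i. - y i))"
      using add[of "nat_part x + nat_part y" "nat_part (\<lambda>i. - x i) + nat_part y"
         "nat_part (\<lambda>i. - x i) + nat_part (\<lambda>i. - y i)"] w
      by (simp add: add.commute weight_add)
    also have "\<dots> = \<Lambda> (\<lambda>i. x i + y i)"
      by (subst \<Lambda>_eq) (use w in \<open>auto simp: weight_add lookup_add intro!: arg_cong[where f=\<Lambda>]\<close>)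
    finally show ?thesis ..
  qed
  obtain a1 b1 a2 b2 where ab: "(1, 0) = weight g a1 - weight g b1" "(0, 1) = weight g a2 - weight g b2"
    using onto by metis
  define \<sigma>1 where "\<sigma>1 i = int (Poly_Mapping.lookup a1 i) - int (Poly_Mapping.lookup b1 i)" for i
  define \<sigma>2 where "\<sigma>2 i = int (Poly_Mapping.lookup a2 i) - int (Poly_Mapping.lookup b2 i)" for i
  have \<sigma>: "W \<sigma>1 = (1, 0)" "W \<sigma>2 = (0, 1)"
    unfolding \<sigma>1_def \<sigma>2_def W_diff using ab by (simp_all add: weight_W)
  define p where "p x i = x i - (fst (W x) * \<sigma>1 i + snd (W x) * \<sigma>2 i)" for x i
  have p0: "W (p x) = 0" for x
    unfolding p_def W_diff W_add W_scale \<sigma> by (simp add: zscale_def prod_eq_iff)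
  have p_add: "p (\<lambda>i. x i + y i) = (\<lambda>i. p x i + p y i)" for x y
    by (simp add: p_def W_add fun_eq_iff algebra_simps)
  have p_id: "p x = x" if "W x = 0" for x
    by (simp add: p_def that fun_eq_iff)
  define F where "F x = \<Lambda> (p x)" for x
  have F_add: "F (\<lambda>i. x i + y i) = F x + F y" for x y
    unfolding F_def p_add by (rule \<Lambda>_add) (rule p0)+
  define \<eta> where "\<eta> i = F (\<lambda>j. if j = i then 1 else 0)" for i
  have F_pair: "F (\<lambda>i. int (Poly_Mapping.lookup e i)) = exponent_pairing \<eta> e" for e
    by (subst additive_on_integer_vectors[OF F_add]) (simp add: exponent_pairing_def \<eta>_def)
  show ?thesis
  proof (rule that[of \<eta>])
    fix e e' assume w: "weight g e = weight g e'"
    let ?x = "\<lambda>i. int (Poly_Mapping.lookup e i) - int (Poly_Mapping.lookup e' i)"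
    have "W ?x = 0" using w by (simp add: W_diff weight_W)
    then have "\<psi> e e' = F ?x" by (simp add: \<Lambda>_eq[OF w] F_def p_id)
    also have "F ?x + F (\<lambda>i. int (Poly_Mapping.lookup e' i)) = F (\<lambda>i. int (Poly_Mapping.lookup e i))"
      by (subst F_add[symmetric]) simp
    then have "F ?x = exponent_pairing \<eta> e - exponent_pairing \<eta> e'"
      by (simp add: F_pair[symmetric] eq_diff_eq)
    finally show "\<psi> e e' = exponent_pairing \<eta> e - exponent_pairing \<eta> e'" .
  qed
qed

definition binomial_of ::
  "('i \<Rightarrow>\<^sub>0 nat) \<Rightarrow> ('i \<Rightarrow>\<^sub>0 nat) \<Rightarrow> (('i \<Rightarrow>\<^sub>0 nat) \<Rightarrow>\<^sub>0 'k::field)" where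
  "binomial_of e e' = Poly_Mapping.single e 1 - Poly_Mapping.single e' 1"

lemma weighted_presentation_diff:
  "weighted_presentation g c (f - h) = weighted_presentation g c f - weighted_presentation g c h"
  using weighted_presentation_add[of g c "f - h" h] by (simp add: eq_diff_eq)

lemma weighted_presentation_binomial:
  assumes "weight g e = weight g e'"
  shows "weighted_presentation g c (binomial_of e e') = Poly_Mapping.single (weight g e) (c e - c e')"
  using assms by (simp add: binomial_of_def weighted_presentation_diff weighted_presentation_single single_diff)

lemma binomial_in_toric_ideal: "weight g e = weight g e' \<Longrightarrow> binomial_of e e' \<in> toric_ideal g"
  by (simp add: toric_ideal_def presentation_weighted weighted_presentation_binomial)

lemma homogeneous_binomial: "weight g e = weight g e' \<Longrightarrow> homogeneous g (weight g e) (binomial_of e e')"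
  using keys_diff[of "Poly_Mapping.single e 1" "Poly_Mapping.single e' 1"]
  unfolding homogeneous_def binomial_of_def
  by (auto simp: in_keys_iff lookup_minus lookup_single when_def split: if_splits)

text \<open>Here \<open>r\<close> chooses one monomial in each weight. Replacing every monomial of \<open>f\<close> by the chosen
  one changes \<open>f\<close> by binomials and leaves nothing, because the coefficients of \<open>f\<close> in each weight
  add up to zero.\<close>

lemma toric_ideal_sum_binomials:
  assumes f: "f \<in> toric_ideal g" and r: "\<And>e. weight g (r (weight g e)) = weight g e"
  shows "f = (\<Sum>e\<in>Poly_Mapping.keys f.
     Poly_Mapping.single 0 (Poly_Mapping.lookup f e) * binomial_of e (r (weight g e)))"
proof -
  have "(\<Sum>e\<in>Poly_Mapping.keys f. Poly_Mapping.single (r (weight g e)) (Poly_Mapping.lookup f e)) = 0"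
  proof (rule poly_mapping_eqI)
    fix y
    have "(\<Sum>e\<in>Poly_Mapping.keys f. Poly_Mapping.lookup (Poly_Mapping.single (r (weight g e)) (Poly_Mapping.lookup f e)) y)
       = (\<Sum>e\<in>{e\<in>Poly_Mapping.keys f. r (weight g e) = y}. Poly_Mapping.lookup f e * 1)"
      by (simp add: lookup_single when_def sum.inter_filter)
    also have "\<dots> = 0"
    proof (cases "r (weight g y) = y")
      case True
      then have "{e\<in>Poly_Mapping.keys f. r (weight g e) = y} = {e\<in>Poly_Mapping.keys f. weight g e = weight g y}"
        by (intro Collect_cong conj_cong refl) (metis True r)
      then show ?thesis using f
        by (simp only: lookup_weighted_presentation[symmetric] presentation_weighted[symmetric])
           (simp add: toric_ideal_def)
    next
      case False
      then have "{e\<in>Poly_Mapping.keys f. r (weight g e) = y} = {}"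
        using r False by (intro equals0I) (metis (mono_tags, lifting) mem_Collect_eq)
      then show ?thesis by (metis (no_types, lifting) sum.empty)
    qed
    finally show "Poly_Mapping.lookup (\<Sum>e\<in>Poly_Mapping.keys f. Poly_Mapping.single (r (weight g e)) (Poly_Mapping.lookup f e)) y
       = Poly_Mapping.lookup 0 y" by (simp add: lookup_sum)
  qed
  moreover have "Poly_Mapping.single 0 (Poly_Mapping.lookup f e) * binomial_of e (r (weight g e)) =
     Poly_Mapping.single e (Poly_Mapping.lookup f e) - Poly_Mapping.single (r (weight g e)) (Poly_Mapping.lookup f e)" for e
    by (simp add: binomial_of_def right_diff_distrib mult_single)
  ultimately show ?thesis
    by (simp add: sum_subtractf flip: poly_mapping_sum_singles)
qed

text \<open>In degree \<open>u\<close> the value on the binomial of \<open>e\<close> and \<open>e'\<close> is a scalar multiple of one fixed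
  character. The scalar is a homomorphism on the lattice of relations, and its extension to \<open>\<int>\<^sup>r\<close>
  is \<open>\<eta>\<close>. The scalar vanishes when that character is not in \<open>k[S]\<close>.\<close>

lemma degree_homomorphism_is_log_derivation:
  fixes g :: "'i::finite \<Rightarrow> lattice"
    and \<phi> :: "(('i \<Rightarrow>\<^sub>0 nat) \<Rightarrow>\<^sub>0 'k::field) set \<Rightarrow> (lattice \<Rightarrow>\<^sub>0 'k)"
  assumes S: "range (weight g) = S"
    and onto: "\<And>x. \<exists>e e'. x = weight g e - weight g e'"
    and \<phi>: "\<phi> \<in> normal_module_degree S g u"
  obtains \<eta> where "\<phi> = log_derivation g u \<eta>"
    and "\<And>e e'. weight g e = weight g e' \<Longrightarrow> weight g e + u \<notin> S
      \<Longrightarrow> exponent_pairing \<eta> e = exponent_pairing \<eta> e'"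
proof -
  have alg: "\<phi> (conormal_class g f) \<in> monoid_algebra S" if "f \<in> toric_ideal g" for f
    using \<phi> that by (auto simp: normal_module_degree_def normal_module_def conormal_def)
  have out: "\<phi> X = 0" if "X \<notin> conormal g" for X
    using \<phi> that by (auto simp: normal_module_degree_def normal_module_def)
  have \<phi>_add: "\<phi> (conormal_class g (f + h)) = \<phi> (conormal_class g f) + \<phi> (conormal_class g h)"
    if "f \<in> toric_ideal g" "h \<in> toric_ideal g" for f h
    using \<phi> that by (auto simp: normal_module_degree_def normal_module_def)
  have \<phi>_mult: "\<phi> (conormal_class g (p * f)) = presentation g p * \<phi> (conormal_class g f)"
    if "f \<in> toric_ideal g" for p f
    using \<phi> that by (auto simp: normal_module_degree_def normal_module_def)
  have deg: "Poly_Mapping.keys (\<phi> (conormal_class g f)) \<subseteq> {d + u}"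
    if "f \<in> toric_ideal g" "homogeneous g d f" for d f
    using \<phi> that unfolding normal_module_degree_def by blast
  define \<psi> where "\<psi> e e' = Poly_Mapping.lookup (\<phi> (conormal_class g (binomial_of e e'))) (weight g e + u)" for e e'
  have \<phi>_binomial: "\<phi> (conormal_class g (binomial_of e e')) = Poly_Mapping.single (weight g e + u) (\<psi> e e')"
    if "weight g e = weight g e'" for e e'
    using deg[OF binomial_in_toric_ideal[OF that] homogeneous_binomial[OF that]]
    by (intro poly_mapping_eqI) (auto simp: \<psi>_def lookup_single when_def in_keys_iff)
  have \<psi>_add: "\<psi> e e' + \<psi> e' e'' = \<psi> e e''" if "weight g e = weight g e'" "weight g e' = weight g e''" for e e' e''
  proof -
    have "binomial_of e e'' = binomial_of e e' + (binomial_of e' e'' :: ('i \<Rightarrow>\<^sub>0 nat) \<Rightarrow>\<^sub>0 'k)"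
      by (simp add: binomial_of_def)
    then show ?thesis
      using \<phi>_add[OF binomial_in_toric_ideal[OF that(1)] binomial_in_toric_ideal[OF that(2)]] that
      by (simp add: \<psi>_def lookup_add)
  qed
  have \<psi>_trans: "\<psi> (c + e) (c + e') = \<psi> e e'" if "weight g e = weight g e'" for e e' c
  proof -
    have "binomial_of (c + e) (c + e') = Poly_Mapping.single c 1 * (binomial_of e e' :: ('i \<Rightarrow>\<^sub>0 nat) \<Rightarrow>\<^sub>0 'k)"
      by (simp add: binomial_of_def right_diff_distrib mult_single)
    then show ?thesis
      using \<phi>_mult[OF binomial_in_toric_ideal[OF that], of "Poly_Mapping.single c 1"]
      by (simp add: \<psi>_def presentation_single single_zero_mult_lookup weight_add algebra_simps)
  qed
  have \<psi>_zero: "\<psi> e e' = 0" if "weight g e = weight g e'" "weight g e + u \<notin> S" for e e'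
    using alg[OF binomial_in_toric_ideal[OF that(1)]] that
    by (auto simp: \<psi>_def monoid_algebra_def in_keys_iff)
  obtain \<eta> where \<eta>: "\<And>e e'. weight g e = weight g e'
      \<Longrightarrow> \<psi> e e' = exponent_pairing \<eta> e - exponent_pairing \<eta> e'"
    using extend_relation_function[of g \<psi>, OF onto \<psi>_add \<psi>_trans] by blast
  define r where "r x = (SOME e. weight g e = x)" for x
  have r: "weight g (r (weight g e)) = weight g e" for e
    unfolding r_def by (rule someI_ex) auto
  have zero_class: "\<phi> (conormal_class g 0) = 0"
    using \<phi>_mult[of 0 0] by (simp add: toric_ideal_def)
  have \<phi>_sum: "\<phi> (conormal_class g (\<Sum>x\<in>A. F x)) = (\<Sum>x\<in>A. \<phi> (conormal_class g (F x))) \<and> (\<Sum>x\<in>A. F x) \<in> toric_ideal g"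
    if "finite A" "\<And>x. x \<in> A \<Longrightarrow> F x \<in> toric_ideal g" for A :: "('i \<Rightarrow>\<^sub>0 nat) set" and F
    using that by induction (auto simp: zero_class \<phi>_add toric_ideal_add, simp add: toric_ideal_def)
  have "\<phi> (conormal_class g f) = log_derivation g u \<eta> (conormal_class g f)" if f: "f \<in> toric_ideal g" for f
  proof -
    let ?t = "\<lambda>e. Poly_Mapping.single 0 (Poly_Mapping.lookup f e) * binomial_of e (r (weight g e))"
    have t: "?t e \<in> toric_ideal g" for e
      by (rule toric_ideal_mult, rule binomial_in_toric_ideal) (simp add: r)
    have "\<phi> (conormal_class g (?t e)) = log_derivation g u \<eta> (conormal_class g (?t e))" for e
    proof -
      have b: "weight g e = weight g (r (weight g e))" by (simp add: r)
      then show ?thesis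
        unfolding \<phi>_mult[OF binomial_in_toric_ideal[OF b]] log_derivation_class[OF t]
          weighted_presentation_mult_ideal[of "exponent_pairing \<eta>", OF exponent_pairing_add binomial_in_toric_ideal[OF b]]
          \<phi>_binomial[OF b] \<eta>[OF b] weighted_presentation_binomial[OF b]
        by (simp add: presentation_single mult_single add.commute mult.left_commute)
    qed
    then have "(\<Sum>e\<in>Poly_Mapping.keys f. \<phi> (conormal_class g (?t e))) =
       Poly_Mapping.single u 1 * weighted_presentation g (exponent_pairing \<eta>) (\<Sum>e\<in>Poly_Mapping.keys f. ?t e)"
      by (simp add: log_derivation_class[OF t] weighted_presentation_sum sum_distrib_left)
    then show ?thesis
      using \<phi>_sum[of "Poly_Mapping.keys f" ?t] t toric_ideal_sum_binomials[OF f r]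
      by (simp add: log_derivation_class[OF f])
  qed
  moreover have "log_derivation g u \<eta> X = 0" if "X \<notin> conormal g" for X
    using that by (simp add: log_derivation_def derivation_hom_def)
  ultimately have "\<phi> = log_derivation g u \<eta>"
    using out by (intro ext) (metis conormal_def image_iff)
  then show ?thesis
    using that \<psi>_zero \<eta> by (metis right_minus_eq)
qed


section \<open>Reduction to additive functions\<close>

text \<open>Since \<open>S - K\<close> will be an ideal of \<open>S\<close>, only the values on \<open>K\<close> matter. Functions that vanish
  on \<open>K\<close> are kept, as they are linear in the sense of the next definition.\<close>

definition additive_functions :: "lattice set \<Rightarrow> lattice set \<Rightarrow> (lattice \<Rightarrow> 'k::field) set" where
  "additive_functions S K = {h. \<forall>x\<in>S. \<forall>y\<in>S. x + y \<in> K \<longrightarrow> h (x + y) = h x + h y}"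

definition linear_functions :: "lattice set \<Rightarrow> (lattice \<Rightarrow> 'k::field) set" where
  "linear_functions K = {h. \<exists>L. (\<forall>x y. L (x + y) = L x + L y) \<and> (\<forall>x\<in>K. h x = L x)}"

lemma group_closure_differences:
  assumes sub: "is_submonoid S" and x: "x \<in> group_closure S"
  shows "\<exists>a\<in>S. \<exists>b\<in>S. x = a - b"
  using x
proof induction
  case (base s)
  then have "s \<in> S" "0 \<in> S" using sub by (auto simp: is_submonoid_def)
  then show ?case by (intro bexI[of _ s] bexI[of _ 0]) auto
next
  case (diff s t)
  then obtain a b c d where "a \<in> S" "b \<in> S" "c \<in> S" "d \<in> S" "s = a - b" "t = c - d" by blast
  then have "a + d \<in> S" "b + c \<in> S" "s - t = (a + d) - (b + c)"
    using sub by (simp_all add: is_submonoid_def)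
  then show ?case by blast
qed

lemma additive_extends:
  fixes L :: "lattice \<Rightarrow> 'k::field"
  assumes sub: "is_submonoid S" and gen: "group_closure S = UNIV"
    and add: "\<And>x y. x \<in> S \<Longrightarrow> y \<in> S \<Longrightarrow> L (x + y) = L x + L y"
  shows "\<exists>\<mu>. (\<forall>x y. \<mu> (x + y) = \<mu> x + \<mu> y) \<and> (\<forall>x\<in>S. \<mu> x = L x)"
proof -
  have "\<exists>a b. a \<in> S \<and> b \<in> S \<and> x = a - b" for x
    using group_closure_differences[OF sub, of x] gen by (metis UNIV_I)
  then obtain P Q where PQ: "\<And>x. P x \<in> S" "\<And>x. Q x \<in> S" "\<And>x. x = P x - Q x" by metis
  define \<mu> where "\<mu> x = L (P x) - L (Q x)" for x
  have eq: "\<mu> (a - b) = L a - L b" if "a \<in> S" "b \<in> S" for a b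
  proof -
    have "a + Q (a - b) = b + P (a - b)"
      using arg_cong[OF PQ(3)[of "a - b"], of "\<lambda>z. z + b + Q (a - b)"] by (simp only: diff_add_cancel add_ac) (simp add: add_ac)
    then have "L (a + Q (a - b)) = L (b + P (a - b))" by (rule arg_cong)
    then have "L a + L (Q (a - b)) = L b + L (P (a - b))"
      using that PQ(1,2) by (simp only: add)
    then show ?thesis unfolding \<mu>_def by (simp add: algebra_simps)
  qed
  have z: "0 \<in> S" using sub by (simp add: is_submonoid_def)
  have l0: "L 0 = 0" using add[OF z z] by (simp only: add_0 add_cancel_right_right)
  show ?thesis
  proof (intro exI[of _ \<mu>] conjI allI ballI)
    fix x y
    have "x + y = (P x - Q x) + (P y - Q y)" by (rule arg_cong2[where f="(+)", OF PQ(3) PQ(3)])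
    then have "x + y = (P x + P y) - (Q x + Q y)" by (simp only: add_diff_add)
    moreover have "P x + P y \<in> S" "Q x + Q y \<in> S" using sub PQ(1,2) unfolding is_submonoid_def by blast+
    ultimately have "\<mu> (x + y) = L (P x + P y) - L (Q x + Q y)" by (simp only: eq)
    then show "\<mu> (x + y) = \<mu> x + \<mu> y" using PQ(1,2) by (simp add: add \<mu>_def)
  next
    fix x assume "x \<in> S" then show "\<mu> x = L x" using eq[of x 0] z l0 by simp
  qed
qed

lemma exponent_induct:
  fixes e :: "'i::finite \<Rightarrow>\<^sub>0 nat"
  assumes "P 0" and "\<And>e i. P e \<Longrightarrow> P (e + Poly_Mapping.single i 1)"
  shows "P e"
proof (induction "\<Sum>i\<in>UNIV. Poly_Mapping.lookup e i" arbitrary: e)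
  case 0
  then have "e = 0" by (intro poly_mapping_eqI) simp
  then show ?case using assms by simp
next
  case (Suc n)
  then obtain i where i: "Poly_Mapping.lookup e i \<noteq> 0" by (metis nat.distinct(1) sum.neutral)
  let ?e = "e - Poly_Mapping.single i 1"
  have e: "?e + Poly_Mapping.single i 1 = e"
    by (rule poly_mapping_eqI) (use i in \<open>auto simp: lookup_add lookup_minus lookup_single when_def\<close>)
  have "(\<Sum>j\<in>UNIV. Poly_Mapping.lookup e j) =
      (\<Sum>j\<in>UNIV. Poly_Mapping.lookup ?e j + Poly_Mapping.lookup (Poly_Mapping.single i 1) j)"
    by (simp only: lookup_add[symmetric] e)
  also have "\<dots> = (\<Sum>j\<in>UNIV. Poly_Mapping.lookup ?e j) + 1"
    by (simp add: sum.distrib lookup_single when_def)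
  finally have "(\<Sum>j\<in>UNIV. Poly_Mapping.lookup e j) = (\<Sum>j\<in>UNIV. Poly_Mapping.lookup ?e j) + 1" .
  then have "P ?e" using Suc by simp
  then show ?case using assms(2)[of ?e i] unfolding e by blast
qed

lemma log_derivation_scaleL:
  "log_derivation g u (\<lambda>i. c * \<eta> i) = hom_scale c (log_derivation g u \<eta>)"
proof (rule ext)
  fix X
  show "log_derivation g u (\<lambda>i. c * \<eta> i) X = hom_scale c (log_derivation g u \<eta>) X"
    unfolding hom_scale_def log_derivation_def sum_distrib_left
    by (intro sum.cong refl) (simp add: mult.assoc[symmetric] mult_single)
qed

lemma log_derivation_add:
  "log_derivation g u (\<lambda>i. \<eta> i + \<eta>' i) = log_derivation g u \<eta> + log_derivation g u \<eta>'"
  by (simp add: fun_eq_iff log_derivation_def single_add distrib_right sum.distrib)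

lemma log_derivation_zero: "log_derivation g u (\<lambda>i. 0) = 0"
  by (simp add: fun_eq_iff log_derivation_def)

lemma log_derivation_diff:
  "log_derivation g u (\<lambda>i. \<eta> i - \<eta>' i) = log_derivation g u \<eta> - log_derivation g u \<eta>'"
  using log_derivation_add[of g u "\<lambda>i. \<eta> i - \<eta>' i" \<eta>'] by simp

lemma log_derivation_sum:
  "log_derivation g u (\<lambda>i. \<Sum>b\<in>B. \<eta> b i) = (\<Sum>b\<in>B. log_derivation g u (\<eta> b))"
  by (induction B rule: infinite_finite_induct) (auto simp: log_derivation_zero log_derivation_add)

lemma log_derivation_in_submodule:
  assumes "\<And>i. \<eta> i \<noteq> 0 \<Longrightarrow> g i + u \<in> S"
  shows "log_derivation g u \<eta> \<in> derivation_submodule S g"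
  unfolding derivation_submodule_def mem_Collect_eq
  by (rule exI[of _ "\<lambda>i. Poly_Mapping.single (g i + u) (\<eta> i)"])
     (use assms in \<open>auto simp: log_derivation_def monoid_algebra_def fun_eq_iff\<close>)

text \<open>Only one homogeneous component of a combination of derivations contributes in degree \<open>u\<close>,
  the one with coefficients \<open>\<beta>\<^sub>i\<close> at the characters \<open>g\<^sub>i + u\<close>. Evaluation on binomials compares it
  with \<open>\<eta>\<close>.\<close>

lemma log_derivation_in_submoduleD:
  fixes \<eta> :: "'i::finite \<Rightarrow> 'k::field"
  assumes "log_derivation g u \<eta> \<in> derivation_submodule S g"
  obtains \<beta> where "\<And>i. \<beta> i \<noteq> 0 \<Longrightarrow> g i + u \<in> S"
    and "\<And>e e'. weight g e = weight g e' \<Longrightarrow> weight g e + u \<in> S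
      \<Longrightarrow> exponent_pairing (\<lambda>i. \<eta> i - \<beta> i) e = exponent_pairing (\<lambda>i. \<eta> i - \<beta> i) e'"
proof -
  obtain b where b: "log_derivation g u \<eta> = (\<lambda>X. \<Sum>i\<in>UNIV. b i * derivation_hom g i X)"
    "\<And>i. b i \<in> monoid_algebra S"
    using assms unfolding derivation_submodule_def by auto
  define \<beta> where "\<beta> i = Poly_Mapping.lookup (b i) (g i + u)" for i
  show ?thesis
  proof (rule that[of \<beta>])
    fix i assume "\<beta> i \<noteq> 0"
    then show "g i + u \<in> S" using b(2)[of i] by (auto simp: \<beta>_def monoid_algebra_def in_keys_iff)
  next
    fix e e' :: "'i \<Rightarrow>\<^sub>0 nat" assume w: "weight g e = weight g e'" and U: "weight g e + u \<in> S"
    let ?f = "binomial_of e e' :: ('i \<Rightarrow>\<^sub>0 nat) \<Rightarrow>\<^sub>0 'k"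
    have d: "derivation_hom g i (conormal_class g ?f) =
       Poly_Mapping.single (weight g e - g i) (of_nat (Poly_Mapping.lookup e i) - of_nat (Poly_Mapping.lookup e' i))" for i
    proof -
      have "derivation_hom g i (conormal_class g ?f) = Poly_Mapping.single (- g i) 1 *
         (Poly_Mapping.single (g i) 1 * presentation g (partial_deriv i ?f))"
        unfolding lattice_single_cancel derivation_hom_class[OF binomial_in_toric_ideal[OF w]] ..
      then show ?thesis
        by (simp add: single_mult_partial_deriv weighted_presentation_binomial[OF w] mult_single)
    qed
    have "Poly_Mapping.lookup (b i * Poly_Mapping.single (weight g e - g i) a) (weight g e + u) = a * \<beta> i" for i a
      by (subst mult.commute) (simp add: single_zero_mult_lookup \<beta>_def add.commute)
    then have "Poly_Mapping.lookup (log_derivation g u \<eta> (conormal_class g ?f)) (weight g e + u) =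
      (\<Sum>i\<in>UNIV. (of_nat (Poly_Mapping.lookup e i) - of_nat (Poly_Mapping.lookup e' i)) * \<beta> i)"
      unfolding b(1) lookup_sum d by simp
    moreover have "Poly_Mapping.lookup (log_derivation g u \<eta> (conormal_class g ?f)) (weight g e + u) =
       exponent_pairing \<eta> e - exponent_pairing \<eta> e'"
      unfolding log_derivation_class[OF binomial_in_toric_ideal[OF w]] weighted_presentation_binomial[OF w]
      by (simp add: mult_single lookup_single when_def)
    moreover have "(\<Sum>i\<in>UNIV. (of_nat (Poly_Mapping.lookup e i) - of_nat (Poly_Mapping.lookup e' i)) * \<beta> i) =
        exponent_pairing \<beta> e - exponent_pairing \<beta> e'"
      by (simp add: exponent_pairing_def left_diff_distrib sum_subtractf)
    ultimately have "exponent_pairing \<eta> e = exponent_pairing \<beta> e - exponent_pairing \<beta> e' + exponent_pairing \<eta> e'"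
      by (simp add: diff_eq_eq)
    then show "exponent_pairing (\<lambda>i. \<eta> i - \<beta> i) e = exponent_pairing (\<lambda>i. \<eta> i - \<beta> i) e'"
      by (simp add: exponent_pairing_diff_weights)
  qed
qed

text \<open>An additive function \<open>h\<close> gives the homomorphism \<open>\<Sum> h(g\<^sub>i) \<chi>\<^sup>u z\<^sub>i \<partial>/\<partial>z\<^sub>i\<close> over the
  generators \<open>g\<^sub>i\<close> in \<open>K\<close>. Every homomorphism of degree \<open>u\<close> is of this form up to terms with \<open>g\<^sub>i\<close>
  outside \<open>K\<close>, and those lie in \<open>D\<close>. If \<open>h\<close> is linear, the full sum over all generators is zero,
  so the homomorphism lies in \<open>D\<close>; conversely membership in \<open>D\<close> makes \<open>h\<close> the restriction of a
  function additive on all of \<open>S\<close>, hence of a linear one.\<close>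

theorem T1_has_dimension_additive:
  fixes g :: "'i::finite \<Rightarrow> lattice" and u :: lattice
  assumes gen: "is_submonoid hull (range g) = S" and span: "group_closure S = UNIV"
    and K: "K = {x\<in>S. x + u \<notin> S}"
    and dim: "has_dimension_modulo (\<lambda>c h x. (c::'k::field) * h x) (additive_functions S K) (linear_functions K) n"
  shows "T1_has_dimension TYPE('k) S g u n"
proof -
  note S = weight_range[OF gen]
  have sub: "is_submonoid S" unfolding gen[symmetric] hull_def is_submonoid_def by auto
  have S_add: "x + y \<in> S" if "x \<in> S" "y \<in> S" for x y using sub that by (auto simp: is_submonoid_def)
  have wS: "weight g e \<in> S" for e using S by auto
  have gS: "g i \<in> S" for i by (metis wS weight_single)
  have onto: "\<exists>e e'. x = weight g e - weight g e'" for x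
  proof -
    obtain a b where "a \<in> S" "b \<in> S" "x = a - b"
      using group_closure_differences[OF sub, of x] span by (metis UNIV_I)
    then show ?thesis using S by (metis rangeE)
  qed
  have ideal: "x \<in> K" if "x + y \<in> K" "x \<in> S" "y \<in> S" for x y
    using that S_add[of "x + u" y] by (auto simp: K add.commute add.left_commute)
  define H where "H h = log_derivation g u (\<lambda>i. if g i \<in> K then h (g i) else (0::'k))" for h :: "lattice \<Rightarrow> 'k"
  have h0: "h 0 = 0" if "h \<in> additive_functions S K" "0 \<in> K" for h :: "lattice \<Rightarrow> 'k"
  proof -
    have "0 \<in> S" using sub by (simp add: is_submonoid_def)
    then have "h (0 + 0) = h 0 + h 0" using that unfolding additive_functions_def by (metis (mono_tags, lifting) add_0 mem_Collect_eq)
    then show ?thesis by (simp only: add_0 add_cancel_right_right)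
  qed
  have pairing: "weight g e \<in> K \<Longrightarrow> exponent_pairing (\<lambda>i. if g i \<in> K then h (g i) else 0) e = h (weight g e)"
    if h: "h \<in> additive_functions S K" for h :: "lattice \<Rightarrow> 'k" and e
  proof (induction e rule: exponent_induct)
    case 1 then show ?case using h0[OF h] by simp
  next
    case (2 e i)
    have w: "weight g e + g i \<in> K" using 2(2) unfolding weight_add weight_single .
    then have "weight g e \<in> K" "g i \<in> K"
      using ideal[of "weight g e" "g i"] ideal[of "g i" "weight g e"] wS gS by (auto simp: add.commute)
    moreover have "h (weight g e + g i) = h (weight g e) + h (g i)"
      using h w wS gS unfolding additive_functions_def by blast
    ultimately show ?case
      using 2(1) unfolding exponent_pairing_add exponent_pairing_single weight_add weight_single by simp
  qed
  have H_in: "H h \<in> normal_module_degree S g u" if h: "h \<in> additive_functions S K" for h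
    unfolding H_def by (rule log_derivation_in_degree[OF S]) (metis (no_types, lifting) K mem_Collect_eq pairing[OF h] wS)
  have H_onto: "\<exists>h\<in>additive_functions S K. \<phi> - H h \<in> derivation_submodule S g"
    if \<phi>: "\<phi> \<in> normal_module_degree S g u" for \<phi> :: "(('i \<Rightarrow>\<^sub>0 nat) \<Rightarrow>\<^sub>0 'k) set \<Rightarrow> (lattice \<Rightarrow>\<^sub>0 'k)"
  proof -
    obtain \<eta> where \<eta>: "\<phi> = log_derivation g u \<eta>"
      and fibre: "\<And>e e'. weight g e = weight g e' \<Longrightarrow> weight g e + u \<notin> S
      \<Longrightarrow> exponent_pairing \<eta> e = exponent_pairing \<eta> e'"
      using degree_homomorphism_is_log_derivation[OF S onto \<phi>] by blast
    define h where "h x = exponent_pairing \<eta> (SOME e. weight g e = x)" for x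
    have h: "h (weight g e) = exponent_pairing \<eta> e" if "weight g e \<in> K" for e
    proof -
      have "weight g (SOME e'. weight g e' = weight g e) = weight g e"
        by (rule someI[of "\<lambda>e'. weight g e' = weight g e", OF refl])
      moreover have "weight g e + u \<notin> S" using that unfolding K by blast
      ultimately show ?thesis unfolding h_def by (intro fibre) simp_all
    qed
    have "h \<in> additive_functions S K"
      unfolding additive_functions_def
    proof (intro CollectI ballI impI)
      fix x y assume xy: "x \<in> S" "y \<in> S" "x + y \<in> K"
      then obtain e e' where e: "x = weight g e" "y = weight g e'" using S by blast
      have "x \<in> K" "y \<in> K" using ideal[of x y] ideal[of y x] xy by (simp_all only: add.commute[of y])
      then show "h (x + y) = h x + h y"
        using h[of e] h[of e'] h[of "e + e'"] xy(3) e by (simp add: weight_add exponent_pairing_add)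
    qed
    moreover have "\<phi> - H h \<in> derivation_submodule S g"
      unfolding \<eta> H_def log_derivation_diff[symmetric]
    proof (rule log_derivation_in_submodule)
      fix i assume "\<eta> i - (if g i \<in> K then h (g i) else 0) \<noteq> 0"
      moreover have "h (g i) = \<eta> i" if "g i \<in> K"
        using h[of "Poly_Mapping.single i 1"] that by (simp only: weight_single exponent_pairing_single)
      ultimately have "g i \<notin> K" by auto
      then show "g i + u \<in> S" using gS by (auto simp: K)
    qed
    ultimately show ?thesis by blast
  qed
  have H_D: "H h \<in> derivation_submodule S g \<longleftrightarrow> h \<in> linear_functions K" if h: "h \<in> additive_functions S K" for h
  proof
    assume "h \<in> linear_functions K"
    then obtain \<mu> where \<mu>: "\<And>x y. \<mu> (x + y) = \<mu> x + \<mu> y" "\<And>x. x \<in> K \<Longrightarrow> h x = \<mu> x"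
      unfolding linear_functions_def by blast
    have \<mu>0: "\<mu> 0 = 0" using \<mu>(1)[of 0 0] by (simp only: add_0 add_cancel_right_right)
    have pair: "exponent_pairing (\<lambda>i. \<mu> (g i)) e = \<mu> (weight g e)" for e
      by (induction e rule: exponent_induct)
         (simp_all only: exponent_pairing_zero weight_zero \<mu>0 exponent_pairing_add exponent_pairing_single weight_add weight_single \<mu>(1))
    have "log_derivation g u (\<lambda>i. \<mu> (g i)) = 0"
    proof
      fix X :: "(('i \<Rightarrow>\<^sub>0 nat) \<Rightarrow>\<^sub>0 'k) set"
      show "log_derivation g u (\<lambda>i. \<mu> (g i)) X = 0 X"
      proof (cases "X \<in> conormal g")
        case True
        then obtain f where f: "f \<in> toric_ideal g" "X = conormal_class g f" by (auto simp: conormal_def)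
        have "weighted_presentation g (exponent_pairing (\<lambda>i. \<mu> (g i))) f = 0"
        proof (rule poly_mapping_eqI)
          fix y
          have "Poly_Mapping.lookup (weighted_presentation g (exponent_pairing (\<lambda>i. \<mu> (g i))) f) y =
             (\<Sum>e\<in>{e\<in>Poly_Mapping.keys f. weight g e = y}. Poly_Mapping.lookup f e * 1) * \<mu> y"
            unfolding lookup_weighted_presentation pair sum_distrib_right by (intro sum.cong) auto
          also have "\<dots> = 0"
            unfolding lookup_weighted_presentation[symmetric] presentation_weighted[symmetric]
            using f(1) by (simp add: toric_ideal_def)
          finally show "Poly_Mapping.lookup (weighted_presentation g (exponent_pairing (\<lambda>i. \<mu> (g i))) f) y
            = Poly_Mapping.lookup 0 y" by simp
        qed
        then show ?thesis by (simp add: f log_derivation_class)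
      qed (simp add: log_derivation_def derivation_hom_def)
    qed
    then have "H h = log_derivation g u (\<lambda>i. (if g i \<in> K then h (g i) else 0) - \<mu> (g i))"
      unfolding log_derivation_diff H_def by simp
    also have "\<dots> \<in> derivation_submodule S g"
      by (rule log_derivation_in_submodule) (use \<mu>(2) gS in \<open>auto simp: K split: if_splits\<close>)
    finally show "H h \<in> derivation_submodule S g" .
  next
    assume *: "H h \<in> derivation_submodule S g"
    from *[unfolded H_def] obtain \<beta> where \<beta>: "\<And>i. \<beta> i \<noteq> 0 \<Longrightarrow> g i + u \<in> S"
      and rel: "\<And>e e'. weight g e = weight g e' \<Longrightarrow> weight g e + u \<in> S
      \<Longrightarrow> exponent_pairing (\<lambda>i. (if g i \<in> K then h (g i) else 0) - \<beta> i) e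
        = exponent_pairing (\<lambda>i. (if g i \<in> K then h (g i) else 0) - \<beta> i) e'"
      by (rule log_derivation_in_submoduleD) blast
    let ?\<mu> = "exponent_pairing (\<lambda>i. (if g i \<in> K then h (g i) else 0) - \<beta> i)"
    show "h \<in> linear_functions K"
    proof (cases "K = S")
      case True
      have "h (x + y) = h x + h y" if "x \<in> S" "y \<in> S" for x y
        using h S_add[OF that] that unfolding additive_functions_def True by blast
      then have "\<exists>L. (\<forall>x y. L (x + y) = L x + L y) \<and> (\<forall>x\<in>K. L x = h x)"
        unfolding True by (rule additive_extends[OF sub span])
      then show ?thesis unfolding linear_functions_def by force
    next
      case False
      then obtain x where "x \<in> S" "x + u \<in> S" unfolding K by blast
      then obtain c where c: "weight g c + u \<in> S" using S by blast
      \<comment> \<open>Multiplying by a monomial whose degree lies outside \<open>K\<close> moves any relation into the range of \<open>rel\<close>.\<close>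
      have all: "?\<mu> e = ?\<mu> e'" if "weight g e = weight g e'" for e e'
      proof -
        have "weight g (c + e) + u = (weight g c + u) + weight g e" by (simp add: weight_add)
        then have "weight g (c + e) + u \<in> S" using S_add[OF c wS] by metis
        then have "?\<mu> (c + e) = ?\<mu> (c + e')" by (intro rel) (auto simp: weight_add that)
        then show ?thesis unfolding exponent_pairing_add by simp
      qed
      define L where "L x = ?\<mu> (SOME e. weight g e = x)" for x
      have L: "L (weight g e) = ?\<mu> e" for e
        unfolding L_def by (rule all) (metis (mono_tags, lifting) someI_ex)
      have "L (x + y) = L x + L y" if "x \<in> S" "y \<in> S" for x y
      proof -
        obtain e e' where e: "x = weight g e" "y = weight g e'" using S \<open>x \<in> S\<close> \<open>y \<in> S\<close> by blast
        have "L (x + y) = ?\<mu> (e + e')" using L[of "e + e'"] by (simp only: weight_add e)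
        then show ?thesis unfolding exponent_pairing_add e L .
      qed
      then obtain L' where L': "\<forall>x y. L' (x + y) = L' x + L' y" "\<forall>x\<in>S. L' x = L x"
        using additive_extends[OF sub span, of L] by blast
      have "h x = L x" if "x \<in> K" for x
      proof -
        have "x \<in> S" using that unfolding K by simp
        then obtain e where e: "x = weight g e" using S by blast
        have "exponent_pairing \<beta> e = 0"
          unfolding exponent_pairing_def
        proof (rule sum.neutral, intro ballI)
          fix i
          show "of_nat (Poly_Mapping.lookup e i) * \<beta> i = 0"
          proof (cases "Poly_Mapping.lookup e i = 0")
            case False
            let ?e = "e - Poly_Mapping.single i 1"
            have "Poly_Mapping.single i 1 + ?e = e"
              by (rule poly_mapping_eqI) (use False in \<open>auto simp: lookup_add lookup_minus lookup_single when_def\<close>)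
            then have "g i + weight g ?e = x" unfolding e by (metis weight_add weight_single)
            then have "g i \<in> K" using ideal[of "g i" "weight g ?e"] wS gS that by metis
            then show ?thesis using \<beta>[of i] by (auto simp: K)
          qed simp
        qed
        then show ?thesis using pairing[OF h, of e] that e L[of e] by (simp add: exponent_pairing_diff_weights)
      qed
      then have "(\<forall>x y. L' (x + y) = L' x + L' y) \<and> (\<forall>x\<in>K. h x = L' x)"
        using L' unfolding K by simp
      then show ?thesis unfolding linear_functions_def by blast
    qed
  qed
  obtain B where "B \<subseteq> additive_functions S K \<and> finite B \<and> card B = n \<and>
     (\<forall>c. (\<Sum>b\<in>B. (\<lambda>x. (c b :: 'k) * b x)) \<in> linear_functions K \<longrightarrow> (\<forall>b\<in>B. c b = 0)) \<and>
     (\<forall>v\<in>additive_functions S K. \<exists>c. v - (\<Sum>b\<in>B. (\<lambda>x. c b * b x)) \<in> linear_functions K)"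
    using dim unfolding has_dimension_modulo_def by (elim exE)
  then have B: "B \<subseteq> additive_functions S K" "finite B" "card B = n"
    and indep: "\<And>c. (\<Sum>b\<in>B. (\<lambda>x. (c b :: 'k) * b x)) \<in> linear_functions K \<Longrightarrow> \<forall>b\<in>B. c b = 0"
    and spans: "\<And>v. v \<in> additive_functions S K \<Longrightarrow> \<exists>c. v - (\<Sum>b\<in>B. (\<lambda>x. c b * b x)) \<in> linear_functions K"
    by simp_all
  have comb_eq: "(\<Sum>b\<in>B. (\<lambda>x. c b * b x)) = (\<lambda>x. \<Sum>b\<in>B. c b * b x)" for c :: "(lattice \<Rightarrow> 'k) \<Rightarrow> 'k"
    using B(2) by induction auto
  have comb: "(\<Sum>b\<in>B. (\<lambda>x. c b * b x)) \<in> additive_functions S K" for c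
    unfolding comb_eq additive_functions_def
  proof (intro CollectI ballI impI)
    fix x y assume xy: "x \<in> S" "y \<in> S" "x + y \<in> K"
    have "b (x + y) = b x + b y" if "b \<in> B" for b
      using B(1) that xy unfolding additive_functions_def by blast
    then show "(\<Sum>b\<in>B. c b * b (x + y)) = (\<Sum>b\<in>B. c b * b x) + (\<Sum>b\<in>B. c b * b y)"
      unfolding sum.distrib[symmetric] distrib_left[symmetric]
      by (intro sum.cong refl arg_cong[where f="(*) _"]) blast
  qed
  have H_sum: "H (\<Sum>b\<in>B. (\<lambda>x. c b * b x)) = (\<Sum>b\<in>B. hom_scale (c b) (H b))" for c
  proof -
    have "H (\<Sum>b\<in>B. (\<lambda>x. c b * b x)) = log_derivation g u (\<lambda>i. \<Sum>b\<in>B. c b * (if g i \<in> K then b (g i) else 0))"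
      unfolding H_def comb_eq by (intro arg_cong[where f="log_derivation g u"]) (auto simp: fun_eq_iff)
    then show ?thesis unfolding log_derivation_sum log_derivation_scaleL H_def .
  qed
  have H_diff: "H (h - h') = H h - H h'" for h h'
    unfolding H_def log_derivation_diff[symmetric]
    by (intro arg_cong[where f="log_derivation g u"]) (auto simp: fun_eq_iff)
  have diff_in: "h - h' \<in> additive_functions S K"
    if "h \<in> additive_functions S K" "h' \<in> additive_functions S K" for h h' :: "lattice \<Rightarrow> 'k"
    using that by (auto simp: additive_functions_def)
  have inj: "inj_on H B"
  proof (rule inj_onI, rule ccontr)
    fix b b' assume b: "b \<in> B" "b' \<in> B" "H b = H b'" "b \<noteq> b'"
    let ?c = "\<lambda>a. if a = b then 1 else if a = b' then -1 else 0 :: 'k"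
    have "(\<Sum>a\<in>B. (\<lambda>x. ?c a * a x)) = (\<Sum>a\<in>B. (if a = b then b else 0) - (if a = b' then b' else 0))"
      using b(4) by (intro sum.cong) (auto simp: fun_eq_iff)
    also have "\<dots> = b - b'" using b B(2) by (simp add: sum_subtractf)
    finally have eq: "(\<Sum>a\<in>B. (\<lambda>x. ?c a * a x)) = b - b'" .
    have "H (b - b') = H 0" using b(3) H_diff[of b b'] H_diff[of b b] by simp
    moreover have "H 0 \<in> derivation_submodule S g"
      unfolding H_def by (rule log_derivation_in_submodule) (auto split: if_splits)
    ultimately have "b - b' \<in> linear_functions K"
      using H_D[OF diff_in[of b b']] b B(1) by auto
    then have "\<forall>a\<in>B. ?c a = 0" using indep[of ?c] eq by simp
    then show False using b(1) by auto
  qed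
  show ?thesis
    unfolding T1_has_dimension_def has_dimension_modulo_def
  proof (intro exI[of _ "H ` B"] conjI allI impI ballI)
    show "H ` B \<subseteq> normal_module_degree S g u" using H_in B(1) by auto
    show "finite (H ` B)" using B by simp
    show "card (H ` B) = n" using B inj by (simp add: card_image)
  next
    fix c and \<phi> :: "(('i \<Rightarrow>\<^sub>0 nat) \<Rightarrow>\<^sub>0 'k) set \<Rightarrow> (lattice \<Rightarrow>\<^sub>0 'k)"
    assume c: "(\<Sum>\<phi>\<in>H ` B. hom_scale (c \<phi>) \<phi>) \<in> derivation_submodule S g" and "\<phi> \<in> H ` B"
    then obtain b where b: "b \<in> B" "\<phi> = H b" by auto
    have "(\<Sum>\<phi>\<in>H ` B. hom_scale (c \<phi>) \<phi>) = H (\<Sum>b\<in>B. (\<lambda>x. c (H b) * b x))"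
      using inj by (simp add: sum.reindex H_sum)
    then have "(\<Sum>b\<in>B. (\<lambda>x. c (H b) * b x)) \<in> linear_functions K"
      using c H_D[OF comb] by simp
    then show "c \<phi> = 0" using indep[of "\<lambda>b. c (H b)"] b by simp
  next
    fix \<phi> :: "(('i \<Rightarrow>\<^sub>0 nat) \<Rightarrow>\<^sub>0 'k) set \<Rightarrow> (lattice \<Rightarrow>\<^sub>0 'k)"
    assume "\<phi> \<in> normal_module_degree S g u"
    then obtain h where h: "h \<in> additive_functions S K" "\<phi> - H h \<in> derivation_submodule S g"
      using H_onto by blast
    obtain c where c: "h - (\<Sum>b\<in>B. (\<lambda>x. c b * b x)) \<in> linear_functions K"
      using spans[OF h(1)] by blast
    have "H h - H (\<Sum>b\<in>B. (\<lambda>x. c b * b x)) \<in> derivation_submodule S g"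
      unfolding H_diff[symmetric] using H_D[OF diff_in[OF h(1) comb]] c by blast
    moreover have "\<phi> + \<psi> \<in> derivation_submodule S g"
      if D: "\<phi> \<in> derivation_submodule S g" "\<psi> \<in> derivation_submodule S g"
      for \<phi> \<psi> :: "(('i \<Rightarrow>\<^sub>0 nat) \<Rightarrow>\<^sub>0 'k) set \<Rightarrow> (lattice \<Rightarrow>\<^sub>0 'k)"
    proof -
      obtain a b where ab: "\<phi> = (\<lambda>X. \<Sum>i\<in>UNIV. a i * derivation_hom g i X)" "\<psi> = (\<lambda>X. \<Sum>i\<in>UNIV. b i * derivation_hom g i X)"
        "\<And>i. a i \<in> monoid_algebra S" "\<And>i. b i \<in> monoid_algebra S"
        using D unfolding derivation_submodule_def by blast
      have "a i + b i \<in> monoid_algebra S" for i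
        using keys_add[of "a i" "b i"] ab(3,4)[of i] by (auto simp: monoid_algebra_def)
      moreover have "\<phi> + \<psi> = (\<lambda>X. \<Sum>i\<in>UNIV. (a i + b i) * derivation_hom g i X)"
        by (simp add: fun_eq_iff ab distrib_right sum.distrib)
      ultimately show ?thesis
        unfolding derivation_submodule_def mem_Collect_eq by (intro exI[of _ "\<lambda>i. a i + b i"]) simp
    qed
    ultimately have "\<phi> - H h + (H h - H (\<Sum>b\<in>B. (\<lambda>x. c b * b x))) \<in> derivation_submodule S g"
      using h(2) by blast
    then have "\<phi> - (\<Sum>b\<in>B. hom_scale (c b) (H b)) \<in> derivation_submodule S g"
      by (simp add: H_sum)
    moreover have "(\<Sum>b\<in>B. hom_scale (c b) (H b)) = (\<Sum>\<phi>\<in>H ` B. hom_scale (c (inv_into B H \<phi>)) \<phi>)"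
      using inj by (simp add: sum.reindex)
    ultimately have "\<phi> - (\<Sum>\<phi>\<in>H ` B. hom_scale (c (inv_into B H \<phi>)) \<phi>) \<in> derivation_submodule S g"
      by simp
    then show "\<exists>c. \<phi> - (\<Sum>\<psi>\<in>H ` B. hom_scale (c \<psi>) \<psi>) \<in> derivation_submodule S g"
      by (intro exI[of _ "\<lambda>\<phi>. c (inv_into B H \<phi>)"])
  qed
qed


section \<open>Coordinates for additive functions\<close>

definition additive_dim :: "'k::field itself \<Rightarrow> lattice set \<Rightarrow> lattice set \<Rightarrow> nat \<Rightarrow> bool" where
  "additive_dim _ S K n \<longleftrightarrow>
     has_dimension_modulo (\<lambda>c h x. (c::'k) * h x) (additive_functions S K) (linear_functions K) n"

text \<open>The points of \<open>Y\<close> are coordinates: evaluation at them identifies the additive functions, up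
  to functions that vanish on \<open>K\<close>, with \<open>k\<^sup>Y\<close>.\<close>

definition basis_points :: "'k::field itself \<Rightarrow> lattice set \<Rightarrow> lattice set \<Rightarrow> lattice set \<Rightarrow> bool" where
  "basis_points _ S K Y \<longleftrightarrow> finite Y \<and> Y \<subseteq> K \<and>
     (\<forall>h\<in>additive_functions S K. (\<forall>y\<in>Y. h y = (0::'k)) \<longrightarrow> (\<forall>x\<in>K. h x = 0)) \<and>
     (\<forall>y\<in>Y. \<exists>h\<in>additive_functions S K. \<forall>z\<in>Y. h z = (if z = y then 1 else (0::'k)))"

lemma sum_of_functions: "(\<Sum>y\<in>Y. (\<lambda>x. F y x)) = (\<lambda>x. \<Sum>y\<in>Y. F y x)"
  by (induction Y rule: infinite_finite_induct) (auto simp: fun_eq_iff)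

lemma additive_functions_lincomb:
  assumes "\<And>y. y \<in> Y \<Longrightarrow> f y \<in> additive_functions S K"
  shows "(\<lambda>x. \<Sum>y\<in>Y. c y * f y x) \<in> additive_functions S K"
  unfolding additive_functions_def
proof (intro CollectI ballI impI)
  fix a b assume ab: "a \<in> S" "b \<in> S" "a + b \<in> K"
  have "f y (a + b) = f y a + f y b" if "y \<in> Y" for y
    using assms[OF that] ab unfolding additive_functions_def by blast
  then show "(\<Sum>y\<in>Y. c y * f y (a + b)) = (\<Sum>y\<in>Y. c y * f y a) + (\<Sum>y\<in>Y. c y * f y b)"
    unfolding sum.distrib[symmetric] distrib_left[symmetric]
    by (intro sum.cong refl arg_cong[where f="(*) _"]) blast
qed

lemma additive_functions_sum2:
  "f \<in> additive_functions S K \<Longrightarrow> h \<in> additive_functions S K \<Longrightarrow> (\<lambda>x. f x + h x) \<in> additive_functions S K"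
  by (simp add: additive_functions_def)

lemma additive_functions_diff:
  "f \<in> additive_functions S K \<Longrightarrow> h \<in> additive_functions S K \<Longrightarrow> (\<lambda>x. f x - h x) \<in> additive_functions S K"
  by (simp add: additive_functions_def)

lemma basis_points_zero:
  assumes "basis_points TYPE('k::field) S K Y" "h \<in> additive_functions S K" "\<And>y. y \<in> Y \<Longrightarrow> h y = (0::'k)" "x \<in> K"
  shows "h x = 0"
  using assms unfolding basis_points_def by blast

lemma basis_points_interpolate:
  assumes "basis_points TYPE('k::field) S K Y"
  obtains h where "h \<in> additive_functions S K" "\<And>y. y \<in> Y \<Longrightarrow> h y = (c y :: 'k)"
proof -
  have Y: "finite Y" and "\<forall>y\<in>Y. \<exists>h\<in>additive_functions S K. \<forall>z\<in>Y. h z = (if z = y then 1 else (0::'k))"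
    using assms unfolding basis_points_def by blast+
  then obtain f where f: "\<And>y. y \<in> Y \<Longrightarrow> f y \<in> additive_functions S K"
    "\<And>y z. y \<in> Y \<Longrightarrow> z \<in> Y \<Longrightarrow> f y z = (if z = y then 1 else (0::'k))" by metis
  show ?thesis
  proof (rule that[of "\<lambda>x. \<Sum>y\<in>Y. c y * f y x"])
    show "(\<lambda>x. \<Sum>y\<in>Y. c y * f y x) \<in> additive_functions S K"
      using f(1) by (rule additive_functions_lincomb)
    fix z assume z: "z \<in> Y"
    have "(\<Sum>y\<in>Y. c y * f y z) = (\<Sum>y\<in>Y. if y = z then c y else 0)"
      using f(2) z by (intro sum.cong) auto
    then show "(\<Sum>y\<in>Y. c y * f y z) = c z" using Y z by simp
  qed
qed

lemma additive_int_scale: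
  fixes L :: "lattice \<Rightarrow> 'k::field"
  assumes add: "\<And>x y. L (x + y) = L x + L y"
  shows "L (zscale m x) = of_int m * L x"
proof -
  have z: "L 0 = 0" using add[of 0 0] by (simp only: add_0 add_cancel_right_right)
  have neg: "L (- x) = - L x" for x
    using add[of x "- x"] z by (simp add: eq_neg_iff_add_eq_0 add.commute)
  have natscale: "L (zscale (int m) x) = of_nat m * L x" for m x
    by (induction m) (simp_all add: z add zscale_add_left distrib_right)
  show ?thesis
  proof (cases "m \<ge> 0")
    case True then show ?thesis using natscale[of "nat m" x] by simp
  next
    case False
    then have "L (- zscale m x) = of_int (- m) * L x"
      using natscale[of "nat (- m)" x] by (simp add: zscale_minus_left)
    then show ?thesis by (simp add: neg)
  qed
qed

lemma additive_dim_zero: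
  assumes "\<And>h::lattice \<Rightarrow> 'k::field. h \<in> additive_functions S K \<Longrightarrow> h \<in> linear_functions K"
  shows "additive_dim TYPE('k) S K 0"
  unfolding additive_dim_def has_dimension_modulo_def using assms by (intro exI[of _ "{}"]) simp

lemma additive_functions_mono:
  "K' \<subseteq> K \<Longrightarrow> h \<in> additive_functions S K \<Longrightarrow> h \<in> additive_functions S K'"
  unfolding additive_functions_def by blast

text \<open>Both regions contain the summands of their elements, so every additivity condition on the
  union takes place inside one of them.\<close>

lemma additive_functions_glue:
  assumes f: "f1 \<in> additive_functions S K1" "f2 \<in> additive_functions S K2"
    and agree: "\<And>x. x \<in> K1 \<Longrightarrow> x \<in> K2 \<Longrightarrow> f1 x = f2 x"
    and down: "\<And>x y. x \<in> S \<Longrightarrow> y \<in> S \<Longrightarrow> x + y \<in> K1 \<Longrightarrow> x \<in> K1"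
       "\<And>x y. x \<in> S \<Longrightarrow> y \<in> S \<Longrightarrow> x + y \<in> K2 \<Longrightarrow> x \<in> K2"
  obtains h where "h \<in> additive_functions S (K1 \<union> K2)" "\<And>x. x \<in> K1 \<Longrightarrow> h x = f1 x"
    "\<And>x. x \<in> K2 \<Longrightarrow> h x = f2 x"
proof (rule that[of "\<lambda>x. if x \<in> K1 then f1 x else f2 x"])
  let ?h = "\<lambda>x. if x \<in> K1 then f1 x else f2 x"
  have h2: "?h x = f2 x" if "x \<in> K2" for x using agree that by auto
  show "?h \<in> additive_functions S (K1 \<union> K2)"
    unfolding additive_functions_def
  proof (intro CollectI ballI impI)
    fix x y assume xy: "x \<in> S" "y \<in> S" "x + y \<in> K1 \<union> K2"
    show "?h (x + y) = ?h x + ?h y"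
    proof (cases "x + y \<in> K1")
      case True
      then have "x \<in> K1" "y \<in> K1" using down(1)[of x y] down(1)[of y x] xy by (simp_all only: add.commute[of y])
      then show ?thesis using True f(1) xy unfolding additive_functions_def by simp
    next
      case False
      then have "x + y \<in> K2" using xy by simp
      moreover then have "x \<in> K2" "y \<in> K2"
        using down(2)[of x y] down(2)[of y x] xy by (simp_all only: add.commute[of y])
      ultimately show ?thesis using h2 f(2) xy unfolding additive_functions_def by simp
    qed
  qed
qed (use agree in auto)


section \<open>Additive functions near one ray\<close>

text \<open>One ray of the cone, in coordinates: \<open>p\<close> is the height over the facet, that is, the pairing
  with the ray generator, \<open>e\<close> spans the edge \<open>p = 0\<close> and \<open>i\<close> is the position along the lines
  parallel to it. On the edge the monoid consists of the nonnegative multiples of \<open>l e\<close>.\<close>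

locale ray_side =
  fixes p i :: "lattice \<Rightarrow> int" and e b :: lattice and l :: int and S :: "lattice set"
  assumes p_add: "p (x + y) = p x + p y" and i_add: "i (x + y) = i x + i y"
    and coords: "x = zscale (p x) b + zscale (i x) e"
    and p_e [simp]: "p e = 0" and p_b [simp]: "p b = 1" and i_e [simp]: "i e = 1" and i_b [simp]: "i b = 0"
    and l_pos: "0 < l"
    and S_zero: "0 \<in> S" and S_add: "x \<in> S \<Longrightarrow> y \<in> S \<Longrightarrow> x + y \<in> S"
    and S_side: "x \<in> S \<Longrightarrow> 0 < p x \<or> (p x = 0 \<and> l dvd i x \<and> 0 \<le> i x)"
    and S_quadrant: "0 < p x \<Longrightarrow> 0 \<le> i x \<Longrightarrow> x \<in> S"
    and S_ray: "p x = 0 \<Longrightarrow> l dvd i x \<Longrightarrow> 0 \<le> i x \<Longrightarrow> x \<in> S"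
begin

definition pt :: "int \<Rightarrow> int \<Rightarrow> lattice" where
  "pt a j = zscale a b + zscale j e"

text \<open>The elements \<open>x\<close> of \<open>S\<close> for which \<open>x - R\<close> violates the condition that this ray imposes on
  \<open>S\<close>.\<close>

definition bad :: "lattice \<Rightarrow> lattice set" where
  "bad R = {x\<in>S. p x < p R \<or> (p x = p R \<and> \<not> l dvd (i x - i R))}"

lemma p_scale [simp]: "p (zscale m x) = m * p x"
proof -
  have "real_of_int (p (zscale m x)) = real_of_int (m * p x)"
    using additive_int_scale[of "\<lambda>x. real_of_int (p x)" m x] by (simp add: p_add)
  then show ?thesis by linarith
qed

lemma i_scale [simp]: "i (zscale m x) = m * i x"
proof -
  have "real_of_int (i (zscale m x)) = real_of_int (m * i x)"
    using additive_int_scale[of "\<lambda>x. real_of_int (i x)" m x] by (simp add: i_add)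
  then show ?thesis by linarith
qed

lemma p_pt [simp]: "p (pt a j) = a" and i_pt [simp]: "i (pt a j) = j"
  by (simp_all add: pt_def p_add i_add)

lemma pt_eta: "x = pt (p x) (i x)"
  unfolding pt_def by (rule coords)

lemma pt_eqI: "p x = p y \<Longrightarrow> i x = i y \<Longrightarrow> x = y"
  by (metis pt_eta)

lemma pt_inject [simp]: "pt a j = pt a' j' \<longleftrightarrow> a = a' \<and> j = j'"
  by (metis p_pt i_pt)

lemma pt_add: "pt a j + pt a' j' = pt (a + a') (j + j')"
  by (rule pt_eqI) (simp_all add: p_add i_add)

lemma p_zero [simp]: "p 0 = 0" and i_zero [simp]: "i 0 = 0"
  using p_scale[of 0 0] i_scale[of 0 0] by simp_all

lemma pt_zero [simp]: "pt 0 0 = 0"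
  by (simp add: pt_def)

lemma p_diff: "p (x - y) = p x - p y" and i_diff: "i (x - y) = i x - i y"
  using p_add[of "x - y" y] i_add[of "x - y" y] by simp_all

lemma p_nonneg: "x \<in> S \<Longrightarrow> 0 \<le> p x"
  using S_side[of x] by force

lemma ray_dvd: "x \<in> S \<Longrightarrow> p x = 0 \<Longrightarrow> l dvd i x"
  using S_side[of x] by force

lemma bad_S: "x \<in> bad R \<Longrightarrow> x \<in> S"
  by (simp add: bad_def)

lemma bad_down: "x \<in> bad R" if "x \<in> S" "y \<in> S" "x + y \<in> bad R"
proof -
  have "0 < p y \<or> (p y = 0 \<and> l dvd i y)" using S_side[OF that(2)] by blast
  moreover have "p x + p y < p R \<or> (p x + p y = p R \<and> \<not> l dvd (i x + i y - i R))"
    using that(3) by (simp add: bad_def p_add i_add)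
  ultimately show ?thesis
    using that(1) unfolding bad_def by (auto simp: dvd_add_left_iff diff_add_eq[symmetric] add.commute)
qed

lemma linear_form_additive: "(\<lambda>x. \<alpha> * of_int (p x) + \<beta> * of_int (i x)) \<in> additive_functions S K"
  by (simp add: additive_functions_def p_add i_add algebra_simps)

lemma linear_form_linear:
  assumes "\<And>x. x \<in> K \<Longrightarrow> h x = \<alpha> * of_int (p x) + \<beta> * of_int (i x)"
  shows "h \<in> linear_functions K"
proof -
  let ?L = "\<lambda>x. \<alpha> * of_int (p x) + \<beta> * of_int (i x)"
  have "(\<forall>x y. ?L (x + y) = ?L x + ?L y) \<and> (\<forall>x\<in>K. h x = ?L x)"
    using assms by (simp add: p_add i_add algebra_simps)
  then show ?thesis unfolding linear_functions_def mem_Collect_eq by (rule exI[of _ ?L])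
qed

lemma linear_functionsD:
  fixes h :: "lattice \<Rightarrow> 'k::field"
  assumes "h \<in> linear_functions K"
  obtains \<alpha> \<beta> where "\<And>x. x \<in> K \<Longrightarrow> h x = \<alpha> * of_int (p x) + \<beta> * of_int (i x)"
proof -
  obtain L where L: "\<And>x y. L (x + y) = L x + L y" "\<And>x. x \<in> K \<Longrightarrow> h x = L x"
    using assms unfolding linear_functions_def by blast
  have Lx: "L x = L b * of_int (p x) + L e * of_int (i x)" for x
  proof -
    have "L x = L (zscale (p x) b + zscale (i x) e)" using coords[of x] by simp
    then show ?thesis by (simp add: L(1) additive_int_scale[of L, OF L(1)] mult.commute)
  qed
  show ?thesis
  proof (rule that[of "L b" "L e"])
    fix x assume "x \<in> K"
    then show "h x = L b * of_int (p x) + L e * of_int (i x)" by (rule L(2)[THEN trans, OF _ Lx])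
  qed
qed

text \<open>Modulo linear functions, an additive function can be normalised to vanish at two independent
  points; the remaining coordinates are then free.\<close>

lemma dim_basis_points:
  assumes Y: "basis_points TYPE('k::field_char_0) S K Y"
    and x: "x1 \<in> Y" "x2 \<in> Y" and indep: "p x1 * i x2 \<noteq> p x2 * i x1"
  shows "additive_dim TYPE('k) S K (card Y - 2)"
proof -
  define \<Delta> where "\<Delta> = (of_int (p x1 * i x2 - p x2 * i x1) :: 'k)"
  have \<Delta>: "\<Delta> \<noteq> 0" unfolding \<Delta>_def using indep by (simp only: of_int_eq_0_iff right_minus_eq not_False_eq_True)
  have fin: "finite Y" and sub: "Y \<subseteq> K" using Y by (auto simp: basis_points_def)
  define X where "X = Y - {x1, x2}"
  have "\<forall>y\<in>Y. \<exists>h\<in>additive_functions S K. \<forall>z\<in>Y. h z = (if z = y then 1 else (0::'k))"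
    using Y unfolding basis_points_def by blast
  then obtain f where f: "\<And>y. y \<in> Y \<Longrightarrow> f y \<in> additive_functions S K"
    and f_val: "\<And>y z. y \<in> Y \<Longrightarrow> z \<in> Y \<Longrightarrow> f y z = (if z = y then 1 else (0::'k))" by metis
  have linear_zero: "\<alpha> = 0 \<and> \<beta> = 0"
    if "\<alpha> * of_int (p x1) + \<beta> * of_int (i x1) = 0" "\<alpha> * of_int (p x2) + \<beta> * of_int (i x2) = 0" for \<alpha> \<beta> :: 'k
  proof -
    have "\<alpha> * \<Delta> = (\<alpha> * of_int (p x1) + \<beta> * of_int (i x1)) * of_int (i x2) - (\<alpha> * of_int (p x2) + \<beta> * of_int (i x2)) * of_int (i x1)"
      by (simp add: \<Delta>_def algebra_simps)
    moreover have "\<beta> * \<Delta> = (\<alpha> * of_int (p x2) + \<beta> * of_int (i x2)) * of_int (p x1) - (\<alpha> * of_int (p x1) + \<beta> * of_int (i x1)) * of_int (p x2)"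
      by (simp add: \<Delta>_def algebra_simps)
    ultimately have "\<alpha> * \<Delta> = 0" "\<beta> * \<Delta> = 0" by (simp_all only: that mult_zero_left diff_self)
    then show ?thesis using \<Delta> by simp
  qed
  have inj: "inj_on f X"
  proof (rule inj_onI)
    fix y z assume "y \<in> X" "z \<in> X" and eq: "f y = f z"
    then have "y \<in> Y" "z \<in> Y" by (simp_all add: X_def)
    then have "f y y = 1" "f z y = (if y = z then 1 else 0)" using f_val by simp_all
    then show "y = z" using eq by (cases "y = z") simp_all
  qed
  have comb: "(\<Sum>b\<in>f ` X. (\<lambda>x. c b * b x)) = (\<lambda>x. \<Sum>y\<in>X. c (f y) * f y x)" for c
    unfolding sum_of_functions by (simp add: sum.reindex[OF inj])
  have value_at: "(\<Sum>y\<in>X. c y * f y z) = (if z \<in> X then c z else 0)" if "z \<in> Y" for c z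
  proof -
    have "(\<Sum>y\<in>X. c y * f y z) = (\<Sum>y\<in>X. if y = z then c y else 0)"
      using f_val that by (intro sum.cong) (auto simp: X_def)
    also have "\<dots> = (if z \<in> X then c z else 0)" using fin by (intro sum.delta) (simp add: X_def)
    finally show ?thesis .
  qed
  have X_add: "(\<lambda>x. \<Sum>y\<in>X. c y * f y x) \<in> additive_functions S K" for c
    by (rule additive_functions_lincomb) (simp add: X_def f)
  have card: "card (f ` X) = card Y - 2"
  proof -
    have "x1 \<noteq> x2" using indep by auto
    then have "card {x1, x2} = 2" by simp
    moreover have "card (Y - {x1, x2}) = card Y - card {x1, x2}"
      using x by (intro card_Diff_subset) auto
    ultimately have "card X = card Y - 2" by (simp add: X_def)
    then show ?thesis by (simp only: card_image[OF inj])
  qed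
  show ?thesis
    unfolding additive_dim_def has_dimension_modulo_def
  proof (intro exI[of _ "f ` X"] conjI allI impI ballI)
    show "f ` X \<subseteq> additive_functions S K" using f by (auto simp: X_def)
    show "finite (f ` X)" using fin by (simp add: X_def)
    show "card (f ` X) = card Y - 2" by (rule card)
  next
    fix c b assume "(\<Sum>b\<in>f ` X. (\<lambda>x. c b * b x)) \<in> linear_functions K" and b: "b \<in> f ` X"
    then obtain \<alpha> \<beta> where lin: "\<And>x. x \<in> K \<Longrightarrow> (\<Sum>y\<in>X. c (f y) * f y x) = \<alpha> * of_int (p x) + \<beta> * of_int (i x)"
      unfolding comb using linear_functionsD by blast
    have "\<alpha> * of_int (p z) + \<beta> * of_int (i z) = 0" if "z \<in> {x1, x2}" for z
      using lin[of z] value_at[of z "\<lambda>y. c (f y)"] that x sub by (auto simp: X_def)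
    then have "\<alpha> = 0 \<and> \<beta> = 0" using linear_zero by blast
    moreover obtain y where "y \<in> X" "b = f y" using b by auto
    ultimately show "c b = 0"
      using lin[of y] value_at[of y "\<lambda>y. c (f y)"] sub by (auto simp: X_def)
  next
    fix h :: "lattice \<Rightarrow> 'k" assume h: "h \<in> additive_functions S K"
    define \<alpha> where "\<alpha> = (h x1 * of_int (i x2) - h x2 * of_int (i x1)) / \<Delta>"
    define \<beta> where "\<beta> = (h x2 * of_int (p x1) - h x1 * of_int (p x2)) / \<Delta>"
    let ?L = "\<lambda>x. \<alpha> * of_int (p x) + \<beta> * of_int (i x)"
    have \<alpha>\<beta>: "\<alpha> * \<Delta> = h x1 * of_int (i x2) - h x2 * of_int (i x1)" "\<beta> * \<Delta> = h x2 * of_int (p x1) - h x1 * of_int (p x2)"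
      using \<Delta> by (simp_all add: \<alpha>_def \<beta>_def)
    have L\<Delta>: "?L z * \<Delta> = (\<alpha> * \<Delta>) * of_int (p z) + (\<beta> * \<Delta>) * of_int (i z)" for z
      by (simp add: algebra_simps)
    have "?L x1 * \<Delta> = h x1 * \<Delta>" "?L x2 * \<Delta> = h x2 * \<Delta>"
      unfolding L\<Delta> \<alpha>\<beta> by (simp_all add: \<Delta>_def algebra_simps)
    then have L: "?L x1 = h x1" "?L x2 = h x2" using \<Delta> by simp_all
    let ?c = "\<lambda>y. h y - ?L y"
    let ?k = "\<lambda>x. h x - (?L x + (\<Sum>y\<in>X. ?c y * f y x))"
    have "?k \<in> additive_functions S K"
      by (intro additive_functions_diff additive_functions_sum2 h linear_form_additive X_add)
    moreover have "?k z = 0" if "z \<in> Y" for z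
      using value_at[OF that, of ?c] L that by (auto simp: X_def)
    ultimately have k: "?k x = 0" if "x \<in> K" for x
      by (rule basis_points_zero[OF Y _ _ that])
    have "(\<lambda>x. h x - (\<Sum>y\<in>X. ?c y * f y x)) \<in> linear_functions K"
    proof (rule linear_form_linear)
      fix x assume "x \<in> K"
      from k[OF this] show "h x - (\<Sum>y\<in>X. ?c y * f y x) = ?L x" by (simp only: right_minus_eq) simp
    qed
    moreover have "(\<Sum>b\<in>f ` X. (\<lambda>x. ?c (inv_into X f b) * b x)) = (\<lambda>x. \<Sum>y\<in>X. ?c y * f y x)"
      unfolding comb using inj by (intro ext sum.cong) auto
    ultimately show "\<exists>c. h - (\<Sum>b\<in>f ` X. (\<lambda>x. c b * b x)) \<in> linear_functions K"
      by (intro exI[of _ "\<lambda>b. ?c (inv_into X f b)"]) (simp add: fun_diff_def)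
  qed
qed

end


lemma additive_functionsD:
  "h \<in> additive_functions S K \<Longrightarrow> x \<in> S \<Longrightarrow> y \<in> S \<Longrightarrow> x + y \<in> K \<Longrightarrow> h (x + y) = h x + h y"
  by (simp add: additive_functions_def)

lemma additive_functions_cmult:
  "h \<in> additive_functions S K \<Longrightarrow> (\<lambda>x. c * h x) \<in> additive_functions S K"
  by (simp add: additive_functions_def distrib_left)

lemma basis_pointsI:
  assumes "finite Y" "Y \<subseteq> K"
    and "\<And>h x. h \<in> additive_functions S K \<Longrightarrow> (\<And>y. y \<in> Y \<Longrightarrow> h y = (0::'k::field)) \<Longrightarrow> x \<in> K \<Longrightarrow> h x = 0"
    and "\<And>y. y \<in> Y \<Longrightarrow> \<exists>h\<in>additive_functions S K. \<forall>z\<in>Y. h z = (if z = y then 1 else (0::'k))"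
  shows "basis_points TYPE('k) S K Y"
  unfolding basis_points_def
proof (intro conjI ballI impI)
  fix h :: "lattice \<Rightarrow> 'k" and x assume h: "h \<in> additive_functions S K" "\<forall>y\<in>Y. h y = 0" "x \<in> K"
  show "h x = 0" by (rule assms(3)[OF h(1) _ h(3)]) (use h(2) in blast)
qed (fact assms)+

context ray_side
begin

lemma ray_in_S: "0 \<le> j \<Longrightarrow> pt 0 (l * j) \<in> S"
  using l_pos by (intro S_ray) simp_all

lemma bad_shift: "x + pt 0 (l * j) \<in> bad R" if "x \<in> bad R" "0 \<le> j"
proof -
  have "i x + l * j - i R = (i x - i R) + l * j" by simp
  then have "l dvd (i x + l * j - i R) \<longleftrightarrow> l dvd (i x - i R)" by (simp only: dvd_add_left_iff dvd_triv_left)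
  then show ?thesis using that S_add[OF _ ray_in_S[OF that(2)]] by (simp add: bad_def p_add i_add)
qed

lemma bad_zero: "x \<in> bad R \<Longrightarrow> 0 \<in> bad R"
  using bad_down[of 0 x R] S_zero bad_S by simp

lemma additive_at_zero:
  assumes "h \<in> additive_functions S (bad R)" "x \<in> bad R"
  shows "h 0 = 0"
  using additive_functionsD[OF assms(1) S_zero S_zero] bad_zero[OF assms(2)]
  by (simp only: add_0 add_cancel_right_right)

lemma additive_shift:
  fixes h :: "lattice \<Rightarrow> 'k::field_char_0"
  assumes h: "h \<in> additive_functions S (bad R)" and x: "x \<in> bad R" and "0 \<le> j"
  shows "h (x + pt 0 (l * j)) = h x + of_int j * h (pt 0 l)"
  using \<open>0 \<le> j\<close>
proof (induction j rule: int_ge_induct)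
  case base then show ?case by simp
next
  case (step j)
  have eq: "x + pt 0 (l * (j + 1)) = (x + pt 0 (l * j)) + pt 0 l"
    by (simp add: add.assoc pt_add distrib_left)
  have "h ((x + pt 0 (l * j)) + pt 0 l) = h (x + pt 0 (l * j)) + h (pt 0 l)"
  proof (rule additive_functionsD[OF h])
    show "x + pt 0 (l * j) \<in> S" using bad_shift[OF x step(1)] bad_S by blast
    show "pt 0 l \<in> S" using ray_in_S[of 1] by simp
    show "x + pt 0 (l * j) + pt 0 l \<in> bad R" unfolding eq[symmetric] using step(1) by (intro bad_shift x) simp
  qed
  then show ?case unfolding eq step(2) by (simp add: distrib_right)
qed

lemma additive_same_class:
  fixes h :: "lattice \<Rightarrow> 'k::field_char_0"
  assumes h: "h \<in> additive_functions S (bad R)" and x: "x \<in> bad R" "y \<in> bad R"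
    and "p x = p y" "i x = i y + l * j"
  shows "h x = h y + of_int j * h (pt 0 l)"
proof (cases "0 \<le> j")
  case True
  have "x = y + pt 0 (l * j)" by (rule pt_eqI) (use assms in \<open>simp_all add: p_add i_add\<close>)
  then show ?thesis using additive_shift[OF h x(2) True] by simp
next
  case False
  have "y = x + pt 0 (l * (- j))" by (rule pt_eqI) (use assms in \<open>simp_all add: p_add i_add\<close>)
  then have "h y = h x + of_int (- j) * h (pt 0 l)" using additive_shift[OF h x(1), of "- j"] False by simp
  then show ?thesis by simp
qed

lemma additive_on_ray:
  fixes h :: "lattice \<Rightarrow> 'k::field_char_0"
  assumes h: "h \<in> additive_functions S (bad R)" and x: "x \<in> bad R" "p x = 0"
  shows "h x = of_int (i x) * (h (pt 0 l) / of_int l)"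
proof -
  obtain j where j: "i x = l * j" using ray_dvd[OF bad_S[OF x(1)] x(2)] by (auto elim: dvdE)
  have "h x = h 0 + of_int j * h (pt 0 l)"
    by (rule additive_same_class[OF h x(1) bad_zero[OF x(1)]]) (use x j in simp_all)
  then show ?thesis using additive_at_zero[OF h x(1)] l_pos j by simp
qed

text \<open>Far along the ray, an element of height at least two is the sum of \<open>pt 1 0\<close> and an element
  of smaller height.\<close>

lemma additive_zero_from_level_one:
  fixes h :: "lattice \<Rightarrow> 'k::field_char_0"
  assumes h: "h \<in> additive_functions S (bad R)" and ray: "h (pt 0 l) = 0"
    and one: "\<And>x. x \<in> bad R \<Longrightarrow> p x = 1 \<Longrightarrow> h x = 0"
    and x: "x \<in> bad R"
  shows "h x = 0"
  using x
proof (induction "nat (p x)" arbitrary: x rule: less_induct)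
  case (less x)
  have "0 \<le> p x" using p_nonneg bad_S less by blast
  then consider "p x = 0" | "p x = 1" | "2 \<le> p x" by linarith
  then show ?case
  proof cases
    case 1 then show ?thesis using additive_on_ray[OF h less(2)] ray by simp
  next
    case 2 then show ?thesis using one less(2) by blast
  next
    case 3
    have j: "0 \<le> \<bar>i x\<bar>" by simp
    define z where "z = x + pt 0 (l * \<bar>i x\<bar>)"
    have "1 * \<bar>i x\<bar> \<le> l * \<bar>i x\<bar>" using l_pos by (intro mult_right_mono) simp_all
    then have iz: "0 \<le> i z" by (simp add: z_def i_add)
    have z: "z \<in> bad R" unfolding z_def by (rule bad_shift[OF less(2) j])
    have eq: "z = pt 1 0 + pt (p x - 1) (i z)"
      by (rule pt_eqI) (simp_all add: z_def p_add i_add)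
    have S: "pt 1 0 \<in> S" "pt (p x - 1) (i z) \<in> S" using 3 iz by (auto intro: S_quadrant)
    have "pt (p x - 1) (i z) + pt 1 0 \<in> bad R" "pt 1 0 + pt (p x - 1) (i z) \<in> bad R"
      using z eq by (simp_all add: add.commute)
    then have bad: "pt 1 0 \<in> bad R" "pt (p x - 1) (i z) \<in> bad R" using bad_down S by blast+
    have "h z = h (pt 1 0) + h (pt (p x - 1) (i z))"
      using additive_functionsD[OF h S] z eq by simp
    also have "\<dots> = 0" using one[OF bad(1)] less(1)[OF _ bad(2)] 3 by simp
    finally show ?thesis using additive_shift[OF h less(2) j] ray by (simp add: z_def)
  qed
qed

text \<open>The residues \<open>F t\<close> of \<open>h\<close> on the line \<open>p = 1\<close> satisfy \<open>F s + F (t - s) = F t\<close> whenever the class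
  \<open>t\<close> is represented at height two.  Summing over \<open>s\<close> gives \<open>l F t = 2 \<Sum> F\<close>, so \<open>F\<close> is constant on
  those classes; at most one class is excluded.  The value of the sum at the class zero, or the sum over
  the other classes, gives \<open>(l - 2) \<Sum> F = 0\<close>; the hypothesis rules out \<open>l = 2\<close> in the latter case.\<close>

lemma additive_level_one_vanishes:
  fixes h :: "lattice \<Rightarrow> 'k::field_char_0"
  assumes h: "h \<in> additive_functions S (bad R)" and ray: "h (pt 0 l) = 0" and base: "h (pt 1 0) = 0"
    and P: "2 \<le> p R" and ns: "\<not> (p R = 2 \<and> l = 2 \<and> even (i R))"
    and x: "x \<in> bad R" "p x = 1"
  shows "h x = 0"
proof -
  have one_bad: "pt 1 j \<in> bad R" if "0 \<le> j" for j
    using P S_quadrant[of "pt 1 j"] that by (simp add: bad_def)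
  define F where "F t = h (pt 1 (t mod l))" for t
  have F_mod: "F (t mod l) = F t" for t by (simp add: F_def)
  have F_h: "h y = F (i y)" if "y \<in> bad R" "p y = 1" for y
  proof -
    have "h y = h (pt 1 (i y mod l)) + of_int (i y div l) * h (pt 0 l)"
      using that l_pos by (intro additive_same_class[OF h] one_bad) simp_all
    then show ?thesis using ray by (simp add: F_def)
  qed
  have F0: "F 0 = 0" by (simp add: F_def base)
  define good where "good t \<longleftrightarrow> \<not> (p R = 2 \<and> l dvd (t - i R))" for t
  have F_add: "F s + F (t - s) = F t" if g: "good t" for s t
  proof -
    let ?s = "s mod l" and ?t = "(t - s) mod l"
    have nn: "0 \<le> ?s" "0 \<le> ?t" using l_pos by simp_all
    have S: "pt 1 ?s \<in> S" "pt 1 ?t \<in> S" "pt 1 0 \<in> S" "pt 1 (?s + ?t) \<in> S"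
      using nn by (auto intro: S_quadrant)
    have "(?s + ?t) mod l = (s + (t - s)) mod l" by (rule mod_add_eq)
    then have mod: "(?s + ?t) mod l = t mod l" by simp
    then have "l dvd (?s + ?t - t)" by (simp only: mod_eq_dvd_iff)
    moreover have "?s + ?t - i R = (?s + ?t - t) + (t - i R)" by simp
    ultimately have "l dvd (?s + ?t - i R) \<longleftrightarrow> l dvd (t - i R)" by (simp only: dvd_add_right_iff)
    then have bad: "pt 2 (?s + ?t) \<in> bad R"
      using g P nn S_quadrant[of "pt 2 (?s + ?t)"] by (auto simp: bad_def good_def)
    have "h (pt 1 ?s + pt 1 ?t) = h (pt 1 ?s) + h (pt 1 ?t)"
      by (rule additive_functionsD[OF h S(1,2)]) (use bad in \<open>simp add: pt_add\<close>)
    moreover have "h (pt 1 0 + pt 1 (?s + ?t)) = h (pt 1 0) + h (pt 1 (?s + ?t))"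
      by (rule additive_functionsD[OF h S(3,4)]) (use bad in \<open>simp add: pt_add\<close>)
    moreover have "h (pt 1 (?s + ?t)) = F t"
    proof -
      have "0 \<le> ?s + ?t" using nn by simp
      then have "h (pt 1 (?s + ?t)) = F (?s + ?t)" using F_h[OF one_bad[of "?s + ?t"]] by simp
      also have "\<dots> = F t" by (simp only: F_def mod)
      finally show ?thesis .
    qed
    ultimately show ?thesis using base by (simp add: F_def pt_add)
  qed
  define T where "T = (\<Sum>s\<in>{0..<l}. F s)"
  have sum: "of_int l * F t = 2 * T" if "good t" for t
  proof -
    have "(\<Sum>s\<in>{0..<l}. F (t - s)) = T"
      unfolding T_def using l_pos
      by (intro sum.reindex_bij_witness[of _ "\<lambda>s. (t - s) mod l" "\<lambda>s. (t - s) mod l"])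
         (simp_all add: F_mod mod_diff_right_eq)
    moreover have "(\<Sum>s\<in>{0..<l}. F s + F (t - s)) = of_int l * F t"
      using F_add[OF that] l_pos by simp
    ultimately show ?thesis by (simp add: sum.distrib T_def)
  qed
  have l0: "(of_int l :: 'k) \<noteq> 0" using l_pos by simp
  have T0: "T = 0"
  proof (cases "good 0")
    case True then show ?thesis using sum[OF True] F0 by simp
  next
    case False
    then have P2: "p R = 2" and "l dvd i R" by (simp_all add: good_def)
    then have "l \<noteq> 2" using ns by auto
    have "good s" if "s \<in> {0..<l} - {0}" for s
    proof -
      have "\<not> l dvd s" using that zdvd_not_zless[of s l] by auto
      then show ?thesis using \<open>l dvd i R\<close> dvd_add[of l "s - i R" "i R"] by (auto simp: good_def)
    qed
    then have "of_int l * T = (\<Sum>s\<in>{0..<l} - {0}. 2 * T)"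
      unfolding T_def using l_pos F0 sum
      by (subst sum.remove[of _ 0]) (auto simp: sum_distrib_left T_def)
    also have "\<dots> = of_int (l - 1) * (2 * T)" using l_pos by (simp add: of_nat_nat)
    finally have "of_int (l - 2) * T = 0" by (simp add: algebra_simps)
    then show ?thesis using \<open>l \<noteq> 2\<close> by (simp only: mult_eq_0_iff of_int_eq_0_iff) simp
  qed
  have good0: "F t = 0" if "good t" for t using sum[OF that] T0 l0 by simp
  have "F t = 0" if "\<not> good t" for t
  proof -
    have t: "good s" if "s \<in> {0..<l} - {t mod l}" for s
    proof -
      have "\<not> l dvd (s - t)"
      proof
        assume "l dvd (s - t)"
        then have "s mod l = t mod l" by (simp add: mod_eq_dvd_iff)
        then show False using that by simp
      qed
      then show ?thesis using \<open>\<not> good t\<close> dvd_diff[of l "s - i R" "t - i R"] by (auto simp: good_def)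
    qed
    have "T = F (t mod l) + (\<Sum>s\<in>{0..<l} - {t mod l}. F s)"
      unfolding T_def using l_pos by (intro sum.remove) simp_all
    also have "(\<Sum>s\<in>{0..<l} - {t mod l}. F s) = 0" using good0 t by (intro sum.neutral) blast
    finally show ?thesis using T0 F_mod by simp
  qed
  then show ?thesis using F_h[OF x] good0 by metis
qed

lemma additive_linear_form:
  fixes h :: "lattice \<Rightarrow> 'k::field_char_0"
  assumes h: "h \<in> additive_functions S (bad R)"
    and P: "2 \<le> p R" and ns: "\<not> (p R = 2 \<and> l = 2 \<and> even (i R))"
  obtains \<alpha> \<beta> where "\<And>x. x \<in> bad R \<Longrightarrow> h x = \<alpha> * of_int (p x) + \<beta> * of_int (i x)"
proof -
  define \<alpha> where "\<alpha> = h (pt 1 0)"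
  define \<beta> where "\<beta> = h (pt 0 l) / of_int l"
  let ?k = "\<lambda>x. h x - (\<alpha> * of_int (p x) + \<beta> * of_int (i x))"
  have k: "?k \<in> additive_functions S (bad R)"
    by (intro additive_functions_diff h linear_form_additive)
  have ray: "?k (pt 0 l) = 0" and base: "?k (pt 1 0) = 0" using l_pos by (simp_all add: \<alpha>_def \<beta>_def)
  have "?k x = 0" if "x \<in> bad R" for x
    by (rule additive_zero_from_level_one[OF k ray _ that])
       (rule additive_level_one_vanishes[OF k ray base P ns]; assumption)
  then have "h x = \<alpha> * of_int (p x) + \<beta> * of_int (i x)" if "x \<in> bad R" for x
    using that by (metis right_minus_eq)
  then show ?thesis by (rule that)
qed

text \<open>At height zero only the edge itself is left.\<close>

lemma basis_points_ray:
  assumes "p R = 0" "\<not> l dvd i R"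
  shows "basis_points TYPE('k::field_char_0) S (bad R) {pt 0 l}"
proof -
  have in_bad: "pt 0 l \<in> bad R"
    using assms ray_in_S[of 1] dvd_diff[of l l "l - i R"] by (auto simp: bad_def)
  have p0: "p x = 0" if "x \<in> bad R" for x
    using that p_nonneg[OF bad_S[OF that]] assms by (auto simp: bad_def)
  have f: "(\<lambda>x. of_int (i x) / of_int l) \<in> (additive_functions S (bad R) :: (lattice \<Rightarrow> 'k) set)"
    by (simp add: additive_functions_def i_add add_divide_distrib)
  show ?thesis
  proof (rule basis_pointsI)
    fix h :: "lattice \<Rightarrow> 'k" and x
    assume h: "h \<in> additive_functions S (bad R)" "\<And>y. y \<in> {pt 0 l} \<Longrightarrow> h y = 0" "x \<in> bad R"
    show "h x = 0" using additive_on_ray[OF h(1,3) p0[OF h(3)]] h(2) by simp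
  next
    fix y assume "y \<in> {pt 0 l}"
    then show "\<exists>h\<in>additive_functions S (bad R). \<forall>z\<in>{pt 0 l}. h z = (if z = y then 1 else (0::'k))"
      using l_pos by (intro bexI[OF _ f]) simp
  qed (use in_bad in simp_all)
qed

lemma basis_points_linear:
  assumes P: "2 \<le> p R" and ns: "\<not> (p R = 2 \<and> l = 2 \<and> even (i R))"
  shows "basis_points TYPE('k::field_char_0) S (bad R) {pt 0 l, pt 1 0}"
proof -
  have in_bad: "pt 0 l \<in> bad R" "pt 1 0 \<in> bad R"
    using P ray_in_S[of 1] S_quadrant[of "pt 1 0"] by (simp_all add: bad_def)
  have f: "(\<lambda>x. of_int (i x) / of_int l) \<in> (additive_functions S (bad R) :: (lattice \<Rightarrow> 'k) set)"
    by (simp add: additive_functions_def i_add add_divide_distrib)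
  have f': "(\<lambda>x. of_int (p x)) \<in> (additive_functions S (bad R) :: (lattice \<Rightarrow> 'k) set)"
    by (simp add: additive_functions_def p_add)
  show ?thesis
  proof (rule basis_pointsI)
    fix h :: "lattice \<Rightarrow> 'k" and x
    assume h: "h \<in> additive_functions S (bad R)" "\<And>y. y \<in> {pt 0 l, pt 1 0} \<Longrightarrow> h y = 0" "x \<in> bad R"
    have ray: "h (pt 0 l) = 0" and base: "h (pt 1 0) = 0" using h(2) by blast+
    show "h x = 0"
      by (rule additive_zero_from_level_one[OF h(1) ray _ h(3)])
         (rule additive_level_one_vanishes[OF h(1) ray base P ns]; assumption)
  next
    fix y assume "y \<in> {pt 0 l, pt 1 0}"
    then consider "y = pt 0 l" | "y = pt 1 0" by blast
    then show "\<exists>h\<in>additive_functions S (bad R). \<forall>z\<in>{pt 0 l, pt 1 0}. h z = (if z = y then 1 else (0::'k))"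
    proof cases
      case 1 then show ?thesis using l_pos by (intro bexI[OF _ f]) simp
    next
      case 2 then show ?thesis by (intro bexI[OF _ f']) simp
    qed
  qed (use in_bad in simp_all)
qed

text \<open>At height at most one, no two elements of height one are ever added: each residue class
  modulo \<open>l\<close> on the line \<open>p = 1\<close> can be given its own value.\<close>

lemma class_function_additive:
  assumes "p R \<le> 1"
  shows "(\<lambda>x. if p x = 1 \<and> l dvd (i x - c) then 1 else 0) \<in> (additive_functions S (bad R) :: (lattice \<Rightarrow> 'k::field) set)"
  unfolding additive_functions_def
proof (intro CollectI ballI impI)
  fix x y assume xy: "x \<in> S" "y \<in> S" "x + y \<in> bad R"
  have "p x + p y \<le> 1" using xy(3) assms by (auto simp: bad_def p_add)
  then consider "p x = 0" "p y = 0" | "p x = 1" "p y = 0" | "p x = 0" "p y = 1"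
    using p_nonneg[OF xy(1)] p_nonneg[OF xy(2)] by linarith
  then show "(if p (x + y) = 1 \<and> l dvd (i (x + y) - c) then 1 else 0::'k) =
      (if p x = 1 \<and> l dvd (i x - c) then 1 else 0) + (if p y = 1 \<and> l dvd (i y - c) then 1 else 0)"
  proof cases
    case 2
    have "i x + i y - c = (i x - c) + i y" by simp
    then show ?thesis using 2 ray_dvd[OF xy(2)] by (simp only: p_add i_add dvd_add_left_iff) simp
  next
    case 3
    have "i x + i y - c = (i y - c) + i x" by simp
    then show ?thesis using 3 ray_dvd[OF xy(1)] by (simp only: p_add i_add dvd_add_left_iff) simp
  qed (simp add: p_add)
qed

lemma quotient_shift: "(a + l * k - t) div l = (a - t) div l + k"
proof -
  have "a + l * k - t = (a - t) + l * k" by simp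
  then show ?thesis using l_pos by (simp only:) simp
qed

lemma quotient_function_additive:
  assumes "p R \<le> 1"
  shows "(\<lambda>x. of_int (if p x = 1 then (i x - t) div l else i x div l)) \<in> (additive_functions S (bad R) :: (lattice \<Rightarrow> 'k::field) set)"
  unfolding additive_functions_def
proof (intro CollectI ballI impI)
  fix x y assume xy: "x \<in> S" "y \<in> S" "x + y \<in> bad R"
  let ?f = "\<lambda>x. (if p x = 1 then (i x - t) div l else i x div l)"
  have "p x + p y \<le> 1" using xy(3) assms by (auto simp: bad_def p_add)
  then consider "p x = 0" "p y = 0" | "p x = 1" "p y = 0" | "p x = 0" "p y = 1"
    using p_nonneg[OF xy(1)] p_nonneg[OF xy(2)] by linarith
  then have "?f (x + y) = ?f x + ?f y"
  proof cases
    case 1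
    obtain j k where "i x = l * j" "i y = l * k" using 1 ray_dvd[OF xy(1)] ray_dvd[OF xy(2)] by (auto elim!: dvdE)
    then show ?thesis using 1 l_pos by (simp add: p_add i_add flip: distrib_left)
  next
    case 2
    obtain k where "i y = l * k" using 2 ray_dvd[OF xy(2)] by (auto elim!: dvdE)
    then show ?thesis using 2 l_pos by (simp add: p_add i_add quotient_shift)
  next
    case 3
    obtain k where "i x = l * k" using 3 ray_dvd[OF xy(1)] by (auto elim!: dvdE)
    then show ?thesis using 3 l_pos by (simp add: p_add i_add quotient_shift add.commute[of "l * k"])
  qed
  then show "of_int (?f (x + y)) = of_int (?f x) + (of_int (?f y) :: 'k)" by (simp only: of_int_add)
qed

text \<open>The value at \<open>l e\<close> and one value for each residue class modulo \<open>l\<close> on the line \<open>p = 1\<close>,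
  except the class of \<open>R\<close>. The window of representatives may start at any \<open>J\<close> in that class whose
  successors lie in \<open>S\<close>.\<close>

lemma basis_points_one:
  assumes P: "p R = 1" and J: "- 1 \<le> J" "l dvd (J - i R)"
  shows "basis_points TYPE('k::field_char_0) S (bad R) (insert (pt 0 l) (pt 1 ` {J+1..J+l-1}))"
proof -
  have class_eq: "l dvd (j - i R) \<longleftrightarrow> l dvd (j - J)" for j
  proof -
    have "j - i R = (j - J) + (J - i R)" by simp
    then show ?thesis using J(2) by (simp only: dvd_add_left_iff)
  qed
  have window: "\<not> l dvd (j - k)" if "j \<in> {J+1..J+l-1}" "k \<in> {J..J+l-1}" "j \<noteq> k" for j k
  proof
    assume "l dvd (j - k)"
    then have "l dvd \<bar>j - k\<bar>" by simp
    moreover have "\<bar>j - k\<bar> < l" "0 < \<bar>j - k\<bar>" using that by (auto simp: abs_less_iff)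
    ultimately show False using zdvd_not_zless by blast
  qed
  have "pt 0 l \<in> bad R" using P ray_in_S[of 1] by (simp add: bad_def)
  moreover have "pt 1 j \<in> bad R" if "j \<in> {J+1..J+l-1}" for j
    using that P J window[of j J] S_quadrant[of "pt 1 j"] by (simp add: bad_def class_eq)
  ultimately have sub: "insert (pt 0 l) (pt 1 ` {J+1..J+l-1}) \<subseteq> bad R" by blast
  have uniq: "h x = 0" if h: "h \<in> additive_functions S (bad R)" "h (pt 0 l) = 0"
    "\<forall>j\<in>{J+1..J+l-1}. h (pt 1 j) = 0" and x: "x \<in> bad R" for h :: "lattice \<Rightarrow> 'k" and x
  proof (rule additive_zero_from_level_one[OF h(1,2) _ x])
    fix y assume y: "y \<in> bad R" "p y = 1"
    define m where "m = (i y - J) mod l"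
    define j where "j = J + m"
    have "\<not> l dvd (i y - J)" using y P by (simp add: bad_def class_eq)
    then have "m \<noteq> 0" by (simp add: m_def dvd_eq_mod_eq_0)
    moreover have "0 \<le> m" "m < l" unfolding m_def using l_pos by simp_all
    ultimately have j: "j \<in> {J+1..J+l-1}" unfolding j_def by simp
    have "l * ((i y - J) div l) + m = i y - J" unfolding m_def by (rule mult_div_mod_eq)
    then have "i y = j + l * ((i y - J) div l)" unfolding j_def by linarith
    then have "h y = h (pt 1 j) + of_int ((i y - J) div l) * h (pt 0 l)"
      using y j sub by (intro additive_same_class[OF h(1)]) auto
    then show "h y = 0" using h j by simp
  qed
  have dual: "\<exists>h\<in>additive_functions S (bad R). \<forall>z\<in>insert (pt 0 l) (pt 1 ` {J+1..J+l-1}). h z = (if z = y then 1 else (0::'k))"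
    if y: "y \<in> insert (pt 0 l) (pt 1 ` {J+1..J+l-1})" for y
  proof (cases "y = pt 0 l")
    case True
    let ?f = "\<lambda>x. of_int (if p x = 1 then (i x - J) div l else i x div l) :: 'k"
    have "?f z = (if z = y then 1 else 0)" if "z \<in> insert (pt 0 l) (pt 1 ` {J+1..J+l-1})" for z
      using that l_pos True by auto
    moreover have "?f \<in> additive_functions S (bad R)"
      using P by (intro quotient_function_additive) simp
    ultimately show ?thesis by (intro bexI[of _ ?f] ballI)
  next
    case False
    then obtain c where c: "y = pt 1 c" "c \<in> {J+1..J+l-1}" using y by auto
    let ?f = "\<lambda>x. if p x = 1 \<and> l dvd (i x - c) then 1 else 0 :: 'k"
    have "?f z = (if z = y then 1 else 0)" if "z \<in> insert (pt 0 l) (pt 1 ` {J+1..J+l-1})" for z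
    proof -
      have "l dvd (j - c) \<longleftrightarrow> j = c" if "j \<in> {J+1..J+l-1}" for j
        using window[of j c] that c(2) by (cases "j = c") simp_all
      then show ?thesis using that c by auto
    qed
    moreover have "?f \<in> additive_functions S (bad R)"
      using P by (intro class_function_additive) simp
    ultimately show ?thesis by (intro bexI[of _ ?f] ballI)
  qed
  show ?thesis
  proof (rule basis_pointsI)
    fix h :: "lattice \<Rightarrow> 'k" and x
    assume h: "h \<in> additive_functions S (bad R)" "x \<in> bad R"
      "\<And>y. y \<in> insert (pt 0 l) (pt 1 ` {J+1..J+l-1}) \<Longrightarrow> h y = 0"
    show "h x = 0" by (rule uniq[OF h(1) _ _ h(2)]) (use h(3) in blast)+
  qed (use sub dual in simp_all)
qed

text \<open>The exceptional side: for \<open>l = 2\<close> the sum of two odd elements of height one is in the class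
  of \<open>R\<close> at height two, hence outside the region. So one of two summands is always even, and the
  parity of \<open>i\<close> is an additive function.\<close>

lemma parity_split:
  assumes "p R = 2" "l = 2" "even (i R)" "x \<in> S" "y \<in> S" "x + y \<in> bad R"
  shows "even (i x) \<or> even (i y)"
proof (rule ccontr)
  assume odd: "\<not> (even (i x) \<or> even (i y))"
  then have "p x \<noteq> 0" "p y \<noteq> 0" using ray_dvd assms by blast+
  then have "1 \<le> p x" "1 \<le> p y" using p_nonneg[OF assms(4)] p_nonneg[OF assms(5)] by linarith+
  moreover have "p x + p y < 2 \<or> (p x + p y = 2 \<and> \<not> 2 dvd (i x + i y - i R))"
    using assms unfolding bad_def p_add i_add mem_Collect_eq by simp
  ultimately show False using odd assms(3) by auto
qed

lemma parity_function_additive: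
  assumes "p R = 2" "l = 2" "even (i R)"
  shows "(\<lambda>x. of_int (i x mod 2)) \<in> (additive_functions S (bad R) :: (lattice \<Rightarrow> 'k::field) set)"
  unfolding additive_functions_def
proof (intro CollectI ballI impI)
  fix x y assume "x \<in> S" "y \<in> S" "x + y \<in> bad R"
  then have "even (i x) \<or> even (i y)" by (rule parity_split[OF assms])
  then have "i (x + y) mod 2 = i x mod 2 + i y mod 2" by (auto simp: i_add elim!: evenE oddE)
  then show "of_int (i (x + y) mod 2) = of_int (i x mod 2) + (of_int (i y mod 2) :: 'k)" by (simp only: of_int_add)
qed

lemma half_function_additive:
  assumes "p R = 2" "l = 2" "even (i R)"
  shows "(\<lambda>x. of_int (i x div 2)) \<in> (additive_functions S (bad R) :: (lattice \<Rightarrow> 'k::field) set)"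
  unfolding additive_functions_def
proof (intro CollectI ballI impI)
  fix x y assume "x \<in> S" "y \<in> S" "x + y \<in> bad R"
  then have "even (i x) \<or> even (i y)" by (rule parity_split[OF assms])
  then have "i (x + y) div 2 = i x div 2 + i y div 2" by (auto simp: i_add elim!: evenE oddE)
  then show "of_int (i (x + y) div 2) = of_int (i x div 2) + (of_int (i y div 2) :: 'k)" by (simp only: of_int_add)
qed

lemma additive_zero_special:
  fixes h :: "lattice \<Rightarrow> 'k::field_char_0"
  assumes sp: "p R = 2" "l = 2" "even (i R)"
    and h: "h \<in> additive_functions S (bad R)" "h (pt 0 2) = 0" "h (pt 1 0) = 0" "h (pt 1 1) = 0" and x: "x \<in> bad R"
  shows "h x = 0"
proof (rule additive_zero_from_level_one[OF h(1) _ _ x])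
  show "h (pt 0 l) = 0" using h sp by simp
  fix y assume y: "y \<in> bad R" "p y = 1"
  have "pt 1 (i y mod 2) \<in> bad R" unfolding bad_def using sp(1) S_quadrant[of "pt 1 (i y mod 2)"] by simp
  then have "h y = h (pt 1 (i y mod 2)) + of_int (i y div 2) * h (pt 0 l)"
    using y(2) by (intro additive_same_class[OF h(1) y(1)]) (simp_all add: sp(2))
  moreover have "i y mod 2 = 0 \<or> i y mod 2 = 1" by auto
  ultimately show "h y = 0" using h sp by auto
qed

lemma basis_points_special:
  assumes sp: "p R = 2" "l = 2" "even (i R)"
  shows "basis_points TYPE('k::field_char_0) S (bad R) {pt 0 2, pt 1 0, pt 1 1}"
proof -
  have sub: "{pt 0 2, pt 1 0, pt 1 1} \<subseteq> bad R"
    unfolding bad_def using sp ray_in_S[of 1] S_quadrant[of "pt 1 0"] S_quadrant[of "pt 1 1"] by simp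
  have p1: "(\<lambda>x. of_int (p x) - of_int (i x mod 2)) \<in> (additive_functions S (bad R) :: (lattice \<Rightarrow> 'k) set)"
    using linear_form_additive[of 1 0]
    by (intro additive_functions_diff parity_function_additive[OF sp]) simp
  have "\<exists>h\<in>additive_functions S (bad R). \<forall>z\<in>{pt 0 2, pt 1 0, pt 1 1}. h z = (if z = y then 1 else (0::'k))"
    if "y \<in> {pt 0 2, pt 1 0, pt 1 1}" for y
    using that
  proof (elim insertE emptyE)
    assume "y = pt 0 2" then show ?thesis by (intro bexI[OF _ half_function_additive[OF sp]]) simp
  next
    assume "y = pt 1 0" then show ?thesis by (intro bexI[OF _ p1]) simp
  next
    assume "y = pt 1 1" then show ?thesis by (intro bexI[OF _ parity_function_additive[OF sp]]) simp
  qed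
  moreover have "h x = 0" if h: "h \<in> additive_functions S (bad R)" "x \<in> bad R"
      "\<And>y. y \<in> {pt 0 2, pt 1 0, pt 1 1} \<Longrightarrow> h y = 0" for h :: "lattice \<Rightarrow> 'k" and x
    by (rule additive_zero_special[OF sp h(1) _ _ _ h(2)]) (use h(3) in blast)+
  ultimately show ?thesis using sub by (intro basis_pointsI) simp_all
qed

end


lemma basis_points_nonzero:
  assumes "basis_points TYPE('k::field) S K Y" "0 \<in> S"
  shows "0 \<notin> Y"
proof
  assume "0 \<in> Y"
  then obtain h where h: "h \<in> additive_functions S K" "h 0 = (1::'k)" "0 \<in> K"
    using assms(1) unfolding basis_points_def by (metis subsetD)
  have "h (0 + 0) = h 0 + h 0" by (rule additive_functionsD[OF h(1) assms(2,2)]) (simp add: h(3))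
  then have "h 0 = 0" by (simp only: add_0 add_cancel_right_right)
  then show False using h(2) by simp
qed

text \<open>The coordinates in \<open>N\<close> need to be dual only to each other: subtracting a combination of the
  functions dual to \<open>X\<close> makes them vanish on \<open>X\<close>.\<close>

lemma basis_points_extend:
  assumes fin: "finite X" "finite N" and disj: "X \<inter> N = {}" and sub: "X \<union> N \<subseteq> K"
    and uniq: "\<And>h x. h \<in> additive_functions S K \<Longrightarrow> (\<And>y. y \<in> X \<union> N \<Longrightarrow> h y = (0::'k::field)) \<Longrightarrow> x \<in> K \<Longrightarrow> h x = 0"
    and dual: "\<And>y. y \<in> X \<Longrightarrow> \<exists>h\<in>additive_functions S K. \<forall>z\<in>X \<union> N. h z = (if z = y then 1 else (0::'k))"
    and dual_N: "\<And>y. y \<in> N \<Longrightarrow> \<exists>h\<in>additive_functions S K. \<forall>z\<in>N. h z = (if z = y then 1 else (0::'k))"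
  shows "basis_points TYPE('k) S K (X \<union> N)"
proof (rule basis_pointsI)
  obtain f where f: "\<And>y. y \<in> X \<Longrightarrow> f y \<in> additive_functions S K"
    and f_val: "\<And>y z. y \<in> X \<Longrightarrow> z \<in> X \<union> N \<Longrightarrow> f y z = (if z = y then 1 else (0::'k))"
    using dual by metis
  fix y assume "y \<in> X \<union> N"
  then consider "y \<in> X" | "y \<in> N" by blast
  then show "\<exists>h\<in>additive_functions S K. \<forall>z\<in>X \<union> N. h z = (if z = y then 1 else (0::'k))"
  proof cases
    case 1 then show ?thesis by (rule dual)
  next
    case 2
    then obtain h where h: "h \<in> additive_functions S K" and h_val: "\<And>z. z \<in> N \<Longrightarrow> h z = (if z = y then 1 else (0::'k))"
      using dual_N by metis
    let ?h = "\<lambda>x. h x - (\<Sum>x'\<in>X. h x' * f x' x)"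
    have add: "?h \<in> additive_functions S K"
      by (intro additive_functions_diff h additive_functions_lincomb f)
    have "?h z = (if z = y then 1 else 0)" if z: "z \<in> X \<union> N" for z
    proof -
      have "(\<Sum>x'\<in>X. h x' * f x' z) = (\<Sum>x'\<in>X. if x' = z then h x' else 0)"
        using f_val z by (intro sum.cong) auto
      also have "\<dots> = (if z \<in> X then h z else 0)" using fin(1) by (rule sum.delta)
      finally have sum: "(\<Sum>x'\<in>X. h x' * f x' z) = (if z \<in> X then h z else 0)" .
      show ?thesis
      proof (cases "z \<in> X")
        case True
        then have "z \<noteq> y" using 2 disj by blast
        then show ?thesis using sum True by simp
      next
        case False
        then show ?thesis using sum h_val[of z] z by simp
      qed
    qed
    then show ?thesis by (intro bexI[OF _ add] ballI)
  qed
next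
  show "finite (X \<union> N)" using fin by simp
  show "X \<union> N \<subseteq> K" by (fact sub)
qed (rule uniq)


section \<open>Two rays\<close>

text \<open>Both rays at once. The coordinates \<open>p, i, e, b\<close> and \<open>l\<close> belong to the first ray,
  \<open>q, i', e', b'\<close> and \<open>l'\<close> to the second, and \<open>n\<close> is the index of the lattice spanned by the
  primitive edge vectors \<open>e\<close> and \<open>e'\<close>. The points \<open>b\<close> and \<open>b'\<close> are the first interior points at
  height one over the respective ray.\<close>

locale two_rays =
  fixes p i q i' :: "lattice \<Rightarrow> int" and e b e' b' :: lattice and l l' n :: int and S :: "lattice set"
  assumes p_add: "p (x + y) = p x + p y" and i_add: "i (x + y) = i x + i y"
    and q_add: "q (x + y) = q x + q y" and i'_add: "i' (x + y) = i' x + i' y"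
    and coords: "x = zscale (p x) b + zscale (i x) e"
    and coords': "x = zscale (q x) b' + zscale (i' x) e'"
    and basis: "p e = 0" "p b = 1" "i e = 1" "i b = 0"
    and basis': "q e' = 0" "q b' = 1" "i' e' = 1" "i' b' = 0"
    and l_pos: "0 < l" and l'_pos: "0 < l'"
    and q_e [simp]: "q e = n" and p_e' [simp]: "p e' = n"
    and q_b: "1 \<le> q b" "q b \<le> n" and p_b': "1 \<le> p b'" "p b' \<le> n"
    and S_iff: "x \<in> S \<longleftrightarrow> (0 < p x \<or> p x = 0 \<and> l dvd i x) \<and> (0 < q x \<or> q x = 0 \<and> l' dvd i' x)"
begin

lemma swap: "two_rays q i' p i e' b' e b l' l n S"
  by unfold_locales
     (rule q_add i'_add p_add i_add coords' coords basis basis' l_pos l'_pos q_e p_e' q_b p_b' | subst S_iff, blast)+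

lemma additive_scale:
  fixes f :: "lattice \<Rightarrow> int"
  assumes "\<And>x y. f (x + y) = f x + f y"
  shows "f (zscale m x) = m * f x"
proof -
  have "real_of_int (f (zscale m x)) = of_int m * real_of_int (f x)"
    by (rule additive_int_scale) (simp add: assms)
  then have "real_of_int (f (zscale m x)) = real_of_int (m * f x)" by simp
  then show ?thesis by linarith
qed

lemma q_coords: "q x = p x * q b + i x * n"
  by (subst coords[of x]) (simp add: q_add additive_scale[of q, OF q_add])

lemma p_coords: "p x = q x * p b' + i' x * n"
  by (subst coords'[of x]) (simp add: p_add additive_scale[of p, OF p_add])

lemma n_pos: "0 < n"
  using q_b by linarith

lemma zero_coords: "p 0 = 0" "i 0 = 0" "q 0 = 0" "i' 0 = 0"
  using p_add[of 0 0] i_add[of 0 0] q_add[of 0 0] i'_add[of 0 0] by simp_all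

lemma S_zero: "0 \<in> S"
  unfolding S_iff by (simp add: zero_coords)

lemma S_closed: "x + y \<in> S" if "x \<in> S" "y \<in> S"
  using that unfolding S_iff p_add i_add q_add i'_add by auto

lemma S_side1: "0 < p x \<or> (p x = 0 \<and> l dvd i x \<and> 0 \<le> i x)" if "x \<in> S"
proof -
  have "0 \<le> q x" "0 < p x \<or> p x = 0 \<and> l dvd i x" using that unfolding S_iff by auto
  then show ?thesis using q_coords[of x] n_pos by (auto simp: zero_le_mult_iff)
qed

lemma S_quadrant1: "x \<in> S" if "0 < p x" "0 \<le> i x"
proof -
  have "0 < p x * q b" "0 \<le> i x * n" using that q_b n_pos by simp_all
  then have "0 < q x" unfolding q_coords[of x] by linarith
  then show ?thesis using that S_iff by blast
qed

lemma S_ray1: "x \<in> S" if "p x = 0" "l dvd i x" "0 \<le> i x"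
proof (cases "i x = 0")
  case True
  then have "x = 0" using coords[of x] that by simp
  then show ?thesis unfolding S_iff by (simp add: zero_coords)
next
  case False
  then have "0 < i x * n" using that n_pos by simp
  then have "0 < q x" using q_coords[of x] that by simp
  then show ?thesis using that S_iff by blast
qed

end

sublocale two_rays \<subseteq> side1: ray_side p i e b l S
  by unfold_locales
     (erule (1) S_closed | erule S_side1 | erule (1) S_quadrant1 | erule (2) S_ray1
      | rule p_add i_add coords basis l_pos S_zero)+

sublocale two_rays \<subseteq> side2: ray_side q i' e' b' l' S
proof -
  interpret sw: two_rays q i' p i e' b' e b l' l n S by (rule swap)
  show "ray_side q i' e' b' l' S" by (rule sw.side1.ray_side_axioms)
qed

context two_rays
begin

definition K :: "lattice \<Rightarrow> lattice set" where
  "K R = side1.bad R \<union> side2.bad R"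

text \<open>Membership of \<open>x - R\<close> in \<open>S\<close> is a conjunction of one condition for each ray, so the region
  where it fails is a union.\<close>

lemma K_eq: "K R = {x\<in>S. x - R \<notin> S}"
  unfolding K_def side1.bad_def side2.bad_def S_iff side1.p_diff side1.i_diff side2.p_diff side2.i_diff
  by auto

lemma glue:
  assumes "f1 \<in> additive_functions S (side1.bad R)" "f2 \<in> additive_functions S (side2.bad R)"
    and "\<And>x. x \<in> side1.bad R \<Longrightarrow> x \<in> side2.bad R \<Longrightarrow> f1 x = f2 x"
  obtains h where "h \<in> additive_functions S (K R)" "\<And>x. x \<in> side1.bad R \<Longrightarrow> h x = f1 x"
    "\<And>x. x \<in> side2.bad R \<Longrightarrow> h x = f2 x"
proof (rule additive_functions_glue[OF assms side1.bad_down side2.bad_down])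
  fix h assume "h \<in> additive_functions S (side1.bad R \<union> side2.bad R)"
    "\<And>x. x \<in> side1.bad R \<Longrightarrow> h x = f1 x" "\<And>x. x \<in> side2.bad R \<Longrightarrow> h x = f2 x"
  then show thesis by (intro that[of h]) (simp_all add: K_def)
qed

lemma restrict1: "h \<in> additive_functions S (K R) \<Longrightarrow> h \<in> additive_functions S (side1.bad R)"
  by (erule additive_functions_mono[rotated]) (simp add: K_def)

lemma restrict2: "h \<in> additive_functions S (K R) \<Longrightarrow> h \<in> additive_functions S (side2.bad R)"
  by (erule additive_functions_mono[rotated]) (simp add: K_def)

text \<open>If the overlap consists of common coordinate points and zero, functions on the two regions
  with the same prescribed coordinates agree on it.\<close>

lemma basis_points_amalgam:
  assumes Y: "basis_points TYPE('k::field_char_0) S (side1.bad R) Y1" "basis_points TYPE('k) S (side2.bad R) Y2"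
    and inter: "\<And>x. x \<in> side1.bad R \<Longrightarrow> x \<in> side2.bad R \<Longrightarrow> x = 0 \<or> (x \<in> Y1 \<and> x \<in> Y2)"
  shows "basis_points TYPE('k) S (K R) (Y1 \<union> Y2)"
proof (rule basis_pointsI)
  have sub: "Y1 \<subseteq> side1.bad R" "Y2 \<subseteq> side2.bad R" and fin: "finite Y1" "finite Y2"
    using Y by (simp_all add: basis_points_def)
  show "finite (Y1 \<union> Y2)" using fin by simp
  show "Y1 \<union> Y2 \<subseteq> K R" using sub by (auto simp: K_def)
  fix h :: "lattice \<Rightarrow> 'k" and x
  assume h: "h \<in> additive_functions S (K R)" "\<And>y. y \<in> Y1 \<union> Y2 \<Longrightarrow> h y = 0" "x \<in> K R"
  show "h x = 0"
    using h(3) unfolding K_def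
    using basis_points_zero[OF Y(1) restrict1[OF h(1)] h(2)] basis_points_zero[OF Y(2) restrict2[OF h(1)] h(2)]
    by blast
next
  have sub: "Y1 \<subseteq> side1.bad R" "Y2 \<subseteq> side2.bad R" using Y by (simp_all add: basis_points_def)
  have nz: "0 \<notin> Y1" "0 \<notin> Y2" using basis_points_nonzero[OF Y(1)] basis_points_nonzero[OF Y(2)] side1.S_zero by blast+
  fix y assume y: "y \<in> Y1 \<union> Y2"
  let ?c = "\<lambda>z. if z = y then 1 else 0 :: 'k"
  obtain f1 where f1: "f1 \<in> additive_functions S (side1.bad R)" "\<And>z. z \<in> Y1 \<Longrightarrow> f1 z = ?c z"
    using basis_points_interpolate[OF Y(1), of ?c] by blast
  obtain f2 where f2: "f2 \<in> additive_functions S (side2.bad R)" "\<And>z. z \<in> Y2 \<Longrightarrow> f2 z = ?c z"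
    using basis_points_interpolate[OF Y(2), of ?c] by blast
  have "f1 x = f2 x" if x: "x \<in> side1.bad R" "x \<in> side2.bad R" for x
    using inter[OF x]
  proof
    assume "x = 0"
    then show ?thesis using side1.additive_at_zero[OF f1(1) x(1)] side2.additive_at_zero[OF f2(1) x(2)] by simp
  next
    assume "x \<in> Y1 \<and> x \<in> Y2"
    then show ?thesis using f1(2)[of x] f2(2)[of x] by simp
  qed
  then obtain h where h: "h \<in> additive_functions S (K R)" "\<And>x. x \<in> side1.bad R \<Longrightarrow> h x = f1 x"
    "\<And>x. x \<in> side2.bad R \<Longrightarrow> h x = f2 x"
    using glue[OF f1(1) f2(1)] by blast
  have "\<forall>z\<in>Y1 \<union> Y2. h z = ?c z" using h f1 f2 sub by (metis UnE subsetD)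
  then show "\<exists>h\<in>additive_functions S (K R). \<forall>z\<in>Y1 \<union> Y2. h z = ?c z" by (rule bexI[OF _ h(1)])
qed

lemma independent_rays:
  "p (side1.pt 0 l) * i (side2.pt 0 l') \<noteq> p (side2.pt 0 l') * i (side1.pt 0 l)"
proof -
  have "p (side2.pt 0 l') = l' * n" using p_coords[of "side2.pt 0 l'"] by simp
  then show ?thesis using l_pos l'_pos n_pos by simp
qed

lemma dim_direct_sum:
  assumes Y: "basis_points TYPE('k::field_char_0) S (side1.bad R) Y1" "basis_points TYPE('k) S (side2.bad R) Y2"
    and inter: "\<And>x. x \<in> side1.bad R \<Longrightarrow> x \<in> side2.bad R \<Longrightarrow> x = 0"
    and rays: "side1.pt 0 l \<in> Y1" "side2.pt 0 l' \<in> Y2"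
  shows "additive_dim TYPE('k) S (K R) (card Y1 + card Y2 - 2)"
proof -
  have "basis_points TYPE('k) S (K R) (Y1 \<union> Y2)" using inter by (intro basis_points_amalgam Y) blast
  then have "additive_dim TYPE('k) S (K R) (card (Y1 \<union> Y2) - 2)"
    by (rule side1.dim_basis_points[OF _ _ _ independent_rays]) (use rays in blast)+
  moreover have "card (Y1 \<union> Y2) = card Y1 + card Y2"
  proof (rule card_Un_disjoint)
    show "finite Y1" "finite Y2" using Y by (simp_all add: basis_points_def)
    have "Y1 \<subseteq> side1.bad R" "Y2 \<subseteq> side2.bad R" using Y by (simp_all add: basis_points_def)
    then show "Y1 \<inter> Y2 = {}"
      using inter basis_points_nonzero[OF Y(1) side1.S_zero] by blast
  qed
  ultimately show ?thesis by simp
qed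

text \<open>If every additive function near the second ray is linear, it can be subtracted; what remains are
  the additive functions near the first ray that vanish on the overlap.\<close>

lemma dim_linear_side2:
  assumes lin: "2 \<le> q R" "\<not> (q R = 2 \<and> l' = 2 \<and> even (i' R))"
    and X: "finite X" "X \<subseteq> side1.bad R"
    and uniq: "\<And>h. h \<in> additive_functions S (side1.bad R) \<Longrightarrow>
      (\<And>x. x \<in> side1.bad R \<Longrightarrow> x \<in> side2.bad R \<Longrightarrow> h x = 0) \<Longrightarrow> (\<And>x. x \<in> X \<Longrightarrow> h x = (0::'k::field_char_0)) \<Longrightarrow>
      \<forall>x\<in>side1.bad R. h x = 0"
    and dual: "\<And>y. y \<in> X \<Longrightarrow> \<exists>f\<in>additive_functions S (side1.bad R).
      (\<forall>x\<in>side1.bad R \<inter> side2.bad R. f x = 0) \<and> (\<forall>z\<in>X. f z = (if z = y then 1 else (0::'k)))"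
  shows "additive_dim TYPE('k) S (K R) (card X)"
proof -
  let ?N = "{side2.pt 0 l', side2.pt 1 0}"
  have N: "basis_points TYPE('k) S (side2.bad R) ?N" by (rule side2.basis_points_linear[OF lin])
  then have N_sub: "?N \<subseteq> side2.bad R" by (simp add: basis_points_def)
  have X_disj: "x \<notin> side2.bad R" if x: "x \<in> X" for x
  proof
    assume "x \<in> side2.bad R"
    then have "x \<in> side1.bad R \<inter> side2.bad R" using x X(2) by blast
    moreover obtain f where f: "\<forall>x\<in>side1.bad R \<inter> side2.bad R. f x = (0::'k)" "\<forall>z\<in>X. f z = (if z = x then 1 else 0)"
      using dual[OF x] by blast
    moreover have "f x = 1" using f(2) x by simp
    ultimately show False by simp
  qed
  have "basis_points TYPE('k) S (K R) (X \<union> ?N)"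
  proof (rule basis_points_extend)
    show "X \<inter> ?N = {}" using X_disj N_sub by blast
    show "X \<union> ?N \<subseteq> K R" using X N_sub by (auto simp: K_def)
  next
    fix h :: "lattice \<Rightarrow> 'k" and x
    assume h: "h \<in> additive_functions S (K R)" "\<And>y. y \<in> X \<union> ?N \<Longrightarrow> h y = 0" and x: "x \<in> K R"
    have 2: "h z = 0" if "z \<in> side2.bad R" for z
      by (rule basis_points_zero[OF N restrict2[OF h(1)] _ that]) (use h(2) in blast)
    have "\<forall>x\<in>side1.bad R. h x = 0"
      by (rule uniq[OF restrict1[OF h(1)]]) (use 2 h(2) in blast)+
    then show "h x = 0" using x 2 unfolding K_def by blast
  next
    fix y assume "y \<in> X"
    then obtain f where f: "f \<in> additive_functions S (side1.bad R)"
      "\<forall>x\<in>side1.bad R \<inter> side2.bad R. f x = 0" "\<forall>z\<in>X. f z = (if z = y then 1 else (0::'k))"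
      using dual by blast
    have z: "(\<lambda>x. 0::'k) \<in> additive_functions S (side2.bad R)" by (simp add: additive_functions_def)
    obtain h where h: "h \<in> additive_functions S (K R)" "\<And>x. x \<in> side1.bad R \<Longrightarrow> h x = f x"
      "\<And>x. x \<in> side2.bad R \<Longrightarrow> h x = 0"
      using glue[OF f(1) z] f(2) by blast
    have "h z = (if z = y then 1 else 0)" if "z \<in> X \<union> ?N" for z
      using that
    proof
      assume "z \<in> X" then show ?thesis using h(2) f(3) X(2) by (metis subsetD)
    next
      assume z: "z \<in> ?N"
      then have "z \<noteq> y" using X_disj[OF \<open>y \<in> X\<close>] N_sub by blast
      then show ?thesis using h(3) z N_sub by (metis subsetD)
    qed
    then show "\<exists>h\<in>additive_functions S (K R). \<forall>z\<in>X \<union> ?N. h z = (if z = y then 1 else (0::'k))"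
      by (intro bexI[OF _ h(1)] ballI)
  next
    fix y assume "y \<in> ?N"
    then consider "y = side2.pt 0 l'" | "y = side2.pt 1 0" by blast
    then show "\<exists>h\<in>additive_functions S (K R). \<forall>z\<in>?N. h z = (if z = y then 1 else (0::'k))"
    proof cases
      case 1
      have f: "(\<lambda>x. 0 * of_int (q x) + (1 / of_int l') * of_int (i' x)) \<in> (additive_functions S (K R) :: (lattice \<Rightarrow> 'k) set)"
        by (rule side2.linear_form_additive)
      show ?thesis using l'_pos 1 by (intro bexI[OF _ f]) simp
    next
      case 2
      have f: "(\<lambda>x. 1 * of_int (q x) + 0 * of_int (i' x)) \<in> (additive_functions S (K R) :: (lattice \<Rightarrow> 'k) set)"
        by (rule side2.linear_form_additive)
      show ?thesis using 2 by (intro bexI[OF _ f]) simp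
    qed
  qed (use X in simp_all)
  then have "additive_dim TYPE('k) S (K R) (card (X \<union> ?N) - 2)"
    by (rule side2.dim_basis_points[where ?x1.0 = "side2.pt 0 l'" and ?x2.0 = "side2.pt 1 0"]) (use l'_pos in auto)
  moreover have "X \<inter> ?N = {}" using X_disj N_sub by blast
  then have "card (X \<union> ?N) = card X + card ?N"
    using X(1) by (intro card_Un_disjoint) simp_all
  ultimately show ?thesis by simp
qed

end


section \<open>Dimensions without an overlap\<close>

context ray_side
begin

lemma dim_low:
  assumes "p R \<le> 0"
  shows "additive_dim TYPE('k::field_char_0) S (bad R) 0"
proof (rule additive_dim_zero)
  fix h :: "lattice \<Rightarrow> 'k" assume h: "h \<in> additive_functions S (bad R)"
  show "h \<in> linear_functions (bad R)"
  proof (rule linear_form_linear)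
    fix x assume x: "x \<in> bad R"
    have "p x = 0" using x p_nonneg[OF bad_S[OF x]] assms by (simp add: bad_def)
    then show "h x = 0 * of_int (p x) + h (pt 0 l) / of_int l * of_int (i x)"
      using additive_on_ray[OF h x] by simp
  qed
qed

lemma basis_points_one_ex:
  assumes "p R = 1"
  obtains Y where "basis_points TYPE('k::field_char_0) S (bad R) Y" "card Y = nat l" "pt 0 l \<in> Y"
    "\<And>y. y \<in> Y \<Longrightarrow> p y = 1 \<or> y = pt 0 l"
proof -
  define J where "J = i R mod l"
  have "J mod l = i R mod l" by (simp add: J_def)
  then have J2: "l dvd (J - i R)" by (simp only: mod_eq_dvd_iff)
  have "0 \<le> J" using l_pos unfolding J_def by simp
  then have J: "- 1 \<le> J" "l dvd (J - i R)" using J2 by simp_all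
  let ?Y = "insert (pt 0 l) (pt 1 ` {J+1..J+l-1})"
  have "card (pt 1 ` {J+1..J+l-1}) = nat (l - 1)"
    by (subst card_image) (auto simp: inj_on_def)
  moreover have "pt 0 l \<notin> pt 1 ` {J+1..J+l-1}" by auto
  ultimately have "card ?Y = nat l" using l_pos by simp
  then show ?thesis by (rule that[OF basis_points_one[OF assms J]]) auto
qed

lemma dim_one:
  assumes P: "p R = 1"
  shows "additive_dim TYPE('k::field_char_0) S (bad R) (nat (l - 2))"
proof (cases "l = 1")
  case True
  have "additive_dim TYPE('k) S (bad R) 0"
  proof (rule additive_dim_zero)
    fix h :: "lattice \<Rightarrow> 'k" assume h: "h \<in> additive_functions S (bad R)"
    show "h \<in> linear_functions (bad R)"
    proof (rule linear_form_linear)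
      fix x assume x: "x \<in> bad R"
      have "p x = 0" using x p_nonneg[OF bad_S[OF x]] P True unfolding bad_def by simp
      then show "h x = 0 * of_int (p x) + h (pt 0 l) / of_int l * of_int (i x)"
        using additive_on_ray[OF h x] by simp
    qed
  qed
  then show ?thesis using True by simp
next
  case False
  obtain Y where Y: "basis_points TYPE('k) S (bad R) Y" "card Y = nat l" "pt 0 l \<in> Y"
    "\<And>y. y \<in> Y \<Longrightarrow> p y = 1 \<or> y = pt 0 l"
    using basis_points_one_ex[OF P, where 'k='k] by blast
  have "\<not> Y \<subseteq> {pt 0 l}"
  proof
    assume "Y \<subseteq> {pt 0 l}"
    then have "card Y \<le> 1" using card_mono[of "{pt 0 l}" Y] by simp
    then show False using Y(2) l_pos False by simp
  qed
  then obtain y where y: "y \<in> Y" "y \<noteq> pt 0 l" by blast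
  then have "p y = 1" using Y(4) by blast
  then have "p (pt 0 l) * i y \<noteq> p y * i (pt 0 l)" using l_pos by simp
  then have "additive_dim TYPE('k) S (bad R) (card Y - 2)"
    by (rule dim_basis_points[OF Y(1,3) y(1)])
  moreover have "card Y - 2 = nat (l - 2)" using Y(2) by arith
  ultimately show ?thesis by simp
qed

lemma dim_special:
  assumes sp: "p R = 2" "l = 2" "even (i R)"
  shows "additive_dim TYPE('k::field_char_0) S (bad R) 1"
proof -
  have "additive_dim TYPE('k) S (bad R) (card {pt 0 2, pt 1 0, pt 1 1} - 2)"
    by (rule dim_basis_points[OF basis_points_special[OF sp], of "pt 0 2" "pt 1 0"]) simp_all
  then show ?thesis by simp
qed

lemma dim_linear:
  assumes lin: "2 \<le> p R" "\<not> (p R = 2 \<and> l = 2 \<and> even (i R))"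
  shows "additive_dim TYPE('k::field_char_0) S (bad R) 0"
proof -
  have "additive_dim TYPE('k) S (bad R) (card {pt 0 l, pt 1 0} - 2)"
    by (rule dim_basis_points[OF basis_points_linear[OF lin], of "pt 0 l" "pt 1 0"]) (use l_pos in simp_all)
  then show ?thesis by simp
qed

lemma additive_special_form:
  fixes h :: "lattice \<Rightarrow> 'k::field_char_0"
  assumes sp: "p R = 2" "l = 2" "even (i R)" and h: "h \<in> additive_functions S (bad R)"
  obtains \<alpha> \<beta> \<gamma> where
    "\<And>x. x \<in> bad R \<Longrightarrow> h x = \<alpha> * of_int (p x) + \<beta> * of_int (i x div 2) + \<gamma> * of_int (i x mod 2)"
proof -
  define \<alpha> where "\<alpha> = h (pt 1 0)"
  define \<beta> where "\<beta> = h (pt 0 2)"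
  define \<gamma> where "\<gamma> = h (pt 1 1) - h (pt 1 0)"
  let ?L = "\<lambda>x. \<alpha> * of_int (p x) + \<beta> * of_int (i x div 2) + \<gamma> * of_int (i x mod 2)"
  have p: "(\<lambda>x. of_int (p x)) \<in> (additive_functions S (bad R) :: (lattice \<Rightarrow> 'k) set)"
    by (simp add: additive_functions_def p_add)
  have k: "(\<lambda>x. h x - ?L x) \<in> additive_functions S (bad R)"
    by (intro additive_functions_diff additive_functions_sum2 additive_functions_cmult h p
        half_function_additive[OF sp] parity_function_additive[OF sp])
  have "h x - ?L x = 0" if "x \<in> bad R" for x
    by (rule additive_zero_special[OF sp k _ _ _ that]) (simp_all add: \<alpha>_def \<beta>_def \<gamma>_def)
  then have "h x = ?L x" if "x \<in> bad R" for x
    using that by (metis right_minus_eq)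
  then show ?thesis by (rule that)
qed

end

context two_rays
begin

lemma dim_side1:
  assumes "side2.bad R = {}" "additive_dim TYPE('k::field_char_0) S (side1.bad R) d"
  shows "additive_dim TYPE('k) S (K R) d"
  using assms by (simp add: K_def)

lemma p_on_ray2: "q x = 0 \<Longrightarrow> p x = i' x * n"
  using p_coords[of x] by simp

lemma ray2_eq_zero: "q x = 0 \<Longrightarrow> i' x = 0 \<Longrightarrow> x = 0"
  using side2.pt_eta[of x] by simp

lemma bad2_on_ray:
  assumes "q R = 0" "x \<in> side2.bad R"
  obtains k where "0 \<le> k" "q x = 0" "i' x = l' * k" "p x = l' * k * n"
proof -
  have S: "x \<in> S" using assms(2) by (rule side2.bad_S)
  then have q0: "q x = 0" using assms side2.p_nonneg[OF S] by (simp add: side2.bad_def)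
  then obtain k where k: "i' x = l' * k" using side2.ray_dvd[OF S] by (auto elim: dvdE)
  have "0 \<le> i' x" using side2.S_side[OF S] q0 by simp
  then have "0 \<le> k" using k l'_pos by (simp add: zero_le_mult_iff)
  then show ?thesis using that q0 k p_on_ray2[OF q0] by simp
qed

lemma dim_one_ray:
  assumes P: "p R = 1" and Q: "q R = 0" "\<not> l' dvd i' R"
  shows "additive_dim TYPE('k::field_char_0) S (K R) (nat (l - 1))"
proof -
  have inter: "x = 0" if x: "x \<in> side1.bad R" "x \<in> side2.bad R" for x
  proof -
    obtain k where k: "0 \<le> k" "q x = 0" "i' x = l' * k" "p x = l' * k * n"
      using bad2_on_ray[OF Q(1) x(2)] by blast
    have "p x \<le> 1" using x(1) P by (auto simp: side1.bad_def)
    have "k = 0"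
    proof (rule ccontr)
      assume "k \<noteq> 0"
      then have "1 \<le> k * n" using k(1) n_pos int_one_le_iff_zero_less[of "k * n"] by simp
      then have "l' * 1 \<le> l' * (k * n)" using l'_pos by (intro mult_left_mono) simp_all
      moreover have "l' * (k * n) \<le> 1" using \<open>p x \<le> 1\<close> k(4) by (simp add: mult.assoc)
      ultimately have "l' = 1" using l'_pos by linarith
      then show False using Q(2) by simp
    qed
    then show ?thesis using ray2_eq_zero k by simp
  qed
  obtain Y where Y: "basis_points TYPE('k) S (side1.bad R) Y" "card Y = nat l" "side1.pt 0 l \<in> Y"
    using side1.basis_points_one_ex[OF P, where 'k='k] by blast
  have "additive_dim TYPE('k) S (K R) (card Y + card {side2.pt 0 l'} - 2)"
    by (rule dim_direct_sum[OF Y(1) side2.basis_points_ray[OF Q] inter Y(3)]) simp_all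
  then show ?thesis using Y(2) l_pos by (simp add: nat_diff_distrib')
qed

lemma dim_special_ray:
  assumes sp: "p R = 2" "l = 2" "even (i R)" and Q: "q R = 0" "\<not> l' dvd i' R"
  shows "additive_dim TYPE('k::field_char_0) S (K R) 2"
proof -
  have pR: "i' R * n = 2" using p_on_ray2[OF Q(1)] sp(1) by simp
  have l': "2 \<le> l'" using Q(2) l'_pos by (cases "l' = 1") auto
  have inter: "x = 0" if x: "x \<in> side1.bad R" "x \<in> side2.bad R" for x
  proof -
    obtain k where k: "0 \<le> k" "q x = 0" "i' x = l' * k" "p x = l' * k * n"
      using bad2_on_ray[OF Q(1) x(2)] by blast
    have "p x \<le> 2" using x(1) sp(1) unfolding side1.bad_def by auto
    have "k = 0"
    proof (rule ccontr)
      assume "k \<noteq> 0"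
      then have kn: "1 \<le> k * n" using k(1) n_pos int_one_le_iff_zero_less[of "k * n"] by simp
      have "l' * (k * n) \<le> 2" using \<open>p x \<le> 2\<close> k(4) by (simp add: mult.assoc)
      moreover have "2 * (k * n) \<le> l' * (k * n)" using l' kn by (intro mult_right_mono) simp_all
      ultimately have "k * n = 1" using kn by linarith
      then have "l' = 2" "n = 1"
        using \<open>l' * (k * n) \<le> 2\<close> l' k(1) n_pos by (simp_all add: zmult_eq_1_iff)
      then show False using pR Q(2) by simp
    qed
    then show ?thesis using ray2_eq_zero k by simp
  qed
  have "additive_dim TYPE('k) S (K R) (card {side1.pt 0 2, side1.pt 1 0, side1.pt 1 1} + card {side2.pt 0 l'} - 2)"
    by (rule dim_direct_sum[OF side1.basis_points_special[OF sp] side2.basis_points_ray[OF Q] inter]) (simp_all add: sp(2))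
  then show ?thesis by (simp add: numeral_2_eq_2)
qed

lemma dim_linear_ray:
  assumes lin: "2 \<le> p R" "\<not> (p R = 2 \<and> l = 2 \<and> even (i R))" and Q: "q R = 0" "\<not> l' dvd i' R"
  shows "additive_dim TYPE('k::field_char_0) S (K R) (if i' R < l' then 1 else 0)"
proof (cases "i' R < l'")
  case True
  have inter: "x = 0" if x: "x \<in> side1.bad R" "x \<in> side2.bad R" for x
  proof -
    obtain k where k: "0 \<le> k" "q x = 0" "i' x = l' * k" "p x = l' * k * n"
      using bad2_on_ray[OF Q(1) x(2)] by blast
    have "p x \<le> p R" using x(1) by (auto simp: side1.bad_def)
    then have "(l' * k) * n \<le> i' R * n" using k(4) p_on_ray2[OF Q(1)] by simp
    then have "l' * k < l' * 1" using n_pos True by simp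
    then have "k = 0" using k(1) l'_pos by (simp add: mult_less_cancel_left_pos del: mult_1_right)
    then show ?thesis using ray2_eq_zero k by simp
  qed
  have "additive_dim TYPE('k) S (K R) (card {side1.pt 0 l, side1.pt 1 0} + card {side2.pt 0 l'} - 2)"
    by (rule dim_direct_sum[OF side1.basis_points_linear[OF lin] side2.basis_points_ray[OF Q] inter]) simp_all
  then show ?thesis using True by simp
next
  case False
  interpret sw: two_rays q i' p i e' b' e b l' l n S by (rule swap)
  have "l' \<noteq> i' R" using Q(2) by auto
  then have "l' * n < i' R * n" using False n_pos by simp
  moreover have "p (side2.pt 0 l') = l' * n" using p_on_ray2[of "side2.pt 0 l'"] by simp
  ultimately have "side2.pt 0 l' \<in> side1.bad R"
    using side2.ray_in_S[of 1] p_on_ray2[OF Q(1)] by (simp add: side1.bad_def)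
  moreover have "side2.pt 0 l' \<in> side2.bad R"
    using side2.basis_points_ray[OF Q, where 'k='k] by (simp add: basis_points_def)
  ultimately have both: "side2.pt 0 l' \<in> side2.bad R" "side2.pt 0 l' \<in> side1.bad R" by simp_all
  have "additive_dim TYPE('k) S (sw.K R) (card ({} :: lattice set))"
  proof (rule sw.dim_linear_side2[OF lin])
    fix h :: "lattice \<Rightarrow> 'k" assume h: "h \<in> additive_functions S (side2.bad R)"
      "\<And>x. x \<in> side2.bad R \<Longrightarrow> x \<in> side1.bad R \<Longrightarrow> h x = 0"
    show "\<forall>x\<in>side2.bad R. h x = 0"
      using basis_points_zero[OF side2.basis_points_ray[OF Q] h(1)] h(2)[OF both] by simp
  qed simp_all
  then show ?thesis using False by (simp add: K_def sw.K_def Un_commute)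
qed

lemma dim_one_one:
  assumes P: "p R = 1" and Q: "q R = 1" and inter: "\<And>x. x \<in> side1.bad R \<Longrightarrow> x \<in> side2.bad R \<Longrightarrow> x = 0"
  shows "additive_dim TYPE('k::field_char_0) S (K R) (nat (l + l' - 2))"
proof -
  obtain Y where Y: "basis_points TYPE('k) S (side1.bad R) Y" "card Y = nat l" "side1.pt 0 l \<in> Y"
    using side1.basis_points_one_ex[OF P, where 'k='k] by blast
  obtain Y' where Y': "basis_points TYPE('k) S (side2.bad R) Y'" "card Y' = nat l'" "side2.pt 0 l' \<in> Y'"
    using side2.basis_points_one_ex[OF Q, where 'k='k] by blast
  have "additive_dim TYPE('k) S (K R) (card Y + card Y' - 2)"
    by (rule dim_direct_sum[OF Y(1) Y'(1) inter Y(3) Y'(3)])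
  then show ?thesis using Y(2) Y'(2) l_pos l'_pos by (simp add: nat_diff_distrib' nat_add_distrib)
qed


section \<open>Gluing along an overlap of the two regions\<close>

text \<open>If the functions near both rays are linear, the dimension is two minus the rank of the
  overlap: a pair of linear forms is taken modulo the diagonal, and must agree on the overlap.\<close>

lemma dim_linear_linear_0:
  assumes lin: "2 \<le> p R" "\<not> (p R = 2 \<and> l = 2 \<and> even (i R))"
    and lin': "2 \<le> q R" "\<not> (q R = 2 \<and> l' = 2 \<and> even (i' R))"
    and inter: "\<And>x. x \<in> side1.bad R \<Longrightarrow> x \<in> side2.bad R \<Longrightarrow> x = 0"
  shows "additive_dim TYPE('k::field_char_0) S (K R) 2"
proof -
  have "additive_dim TYPE('k) S (K R) (card {side1.pt 0 l, side1.pt 1 0} + card {side2.pt 0 l', side2.pt 1 0} - 2)"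
    by (rule dim_direct_sum[OF side1.basis_points_linear[OF lin] side2.basis_points_linear[OF lin'] inter]) simp_all
  then show ?thesis by (simp add: numeral_2_eq_2)
qed

lemma dim_linear_linear_1:
  assumes lin: "2 \<le> p R" "\<not> (p R = 2 \<and> l = 2 \<and> even (i R))"
    and lin': "2 \<le> q R" "\<not> (q R = 2 \<and> l' = 2 \<and> even (i' R))"
    and y: "y \<in> side1.bad R" "y \<in> side2.bad R" "0 < p y"
    and inter: "\<And>x. x \<in> side1.bad R \<Longrightarrow> x \<in> side2.bad R \<Longrightarrow> p x * i y = p y * i x"
  shows "additive_dim TYPE('k::field_char_0) S (K R) 1"
proof -
  have "additive_dim TYPE('k) S (K R) (card {side1.pt 0 l})"
  proof (rule dim_linear_side2[OF lin'])
    fix h :: "lattice \<Rightarrow> 'k"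
    assume h: "h \<in> additive_functions S (side1.bad R)"
      "\<And>x. x \<in> side1.bad R \<Longrightarrow> x \<in> side2.bad R \<Longrightarrow> h x = 0" "\<And>x. x \<in> {side1.pt 0 l} \<Longrightarrow> h x = 0"
    obtain \<alpha> \<beta> where f: "\<And>x. x \<in> side1.bad R \<Longrightarrow> h x = \<alpha> * of_int (p x) + \<beta> * of_int (i x)"
      using side1.additive_linear_form[OF h(1) lin] by blast
    have "side1.pt 0 l \<in> side1.bad R" using side1.basis_points_linear[OF lin, where 'k='k] by (simp add: basis_points_def)
    then have "\<beta> = 0" using f[of "side1.pt 0 l"] h(3)[of "side1.pt 0 l"] l_pos by simp
    moreover have "\<alpha> = 0" using f[OF y(1)] h(2)[OF y(1,2)] y(3) \<open>\<beta> = 0\<close> by simp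
    ultimately show "\<forall>x\<in>side1.bad R. h x = 0" using f by simp
  next
    show "{side1.pt 0 l} \<subseteq> side1.bad R"
      using side1.basis_points_linear[OF lin, where 'k='k] by (simp add: basis_points_def)
  next
    fix z assume z: "z \<in> {side1.pt 0 l}"
    let ?\<beta> = "1 / of_int l :: 'k" and ?\<alpha> = "- (of_int (i y) / (of_int (p y) * of_int l)) :: 'k"
    let ?f = "\<lambda>x. ?\<alpha> * of_int (p x) + ?\<beta> * of_int (i x)"
    have "?f x = 0" if "x \<in> side1.bad R \<inter> side2.bad R" for x
    proof -
      have "p x * i y = p y * i x" using inter that by blast
      then have "of_int (p x) * of_int (i y) = (of_int (p y) * of_int (i x) :: 'k)" by (metis of_int_mult)
      then show ?thesis using y(3) l_pos by (simp add: field_simps)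
    qed
    moreover have "?f (side1.pt 0 l) = 1" using l_pos by simp
    ultimately show "\<exists>f\<in>additive_functions S (side1.bad R).
      (\<forall>x\<in>side1.bad R \<inter> side2.bad R. f x = 0) \<and> (\<forall>z'\<in>{side1.pt 0 l}. f z' = (if z' = z then 1 else (0::'k)))"
      using z by (intro bexI[OF _ side1.linear_form_additive[of ?\<alpha> ?\<beta>]] conjI ballI) simp_all
  qed simp
  then show ?thesis by simp
qed

lemma dim_linear_linear_2:
  assumes lin: "2 \<le> p R" "\<not> (p R = 2 \<and> l = 2 \<and> even (i R))"
    and lin': "2 \<le> q R" "\<not> (q R = 2 \<and> l' = 2 \<and> even (i' R))"
    and y: "y \<in> side1.bad R" "y \<in> side2.bad R" "z \<in> side1.bad R" "z \<in> side2.bad R" "p y * i z \<noteq> p z * i y"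
  shows "additive_dim TYPE('k::field_char_0) S (K R) 0"
proof -
  have "additive_dim TYPE('k) S (K R) (card ({} :: lattice set))"
  proof (rule dim_linear_side2[OF lin'])
    fix h :: "lattice \<Rightarrow> 'k"
    assume h: "h \<in> additive_functions S (side1.bad R)"
      "\<And>x. x \<in> side1.bad R \<Longrightarrow> x \<in> side2.bad R \<Longrightarrow> h x = 0"
    obtain \<alpha> \<beta> where f: "\<And>x. x \<in> side1.bad R \<Longrightarrow> h x = \<alpha> * of_int (p x) + \<beta> * of_int (i x)"
      using side1.additive_linear_form[OF h(1) lin] by blast
    have fy: "\<alpha> * of_int (p y) + \<beta> * of_int (i y) = 0" using f[OF y(1)] h(2)[OF y(1,2)] by simp
    have fz: "\<alpha> * of_int (p z) + \<beta> * of_int (i z) = 0" using f[OF y(3)] h(2)[OF y(3,4)] by simp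
    let ?\<Delta> = "of_int (p y * i z - p z * i y) :: 'k"
    have \<Delta>: "?\<Delta> \<noteq> 0" using y(5) by (simp only: of_int_eq_0_iff right_minus_eq not_False_eq_True)
    have "\<alpha> * ?\<Delta> = (\<alpha> * of_int (p y) + \<beta> * of_int (i y)) * of_int (i z) - (\<alpha> * of_int (p z) + \<beta> * of_int (i z)) * of_int (i y)"
      by (simp add: algebra_simps)
    then have "\<alpha> = 0" using \<Delta> by (simp only: fy fz mult_zero_left diff_self mult_eq_0_iff) simp
    have "\<beta> * ?\<Delta> = (\<alpha> * of_int (p z) + \<beta> * of_int (i z)) * of_int (p y) - (\<alpha> * of_int (p y) + \<beta> * of_int (i y)) * of_int (p z)"
      by (simp add: algebra_simps)
    then have "\<beta> = 0" using \<Delta> by (simp only: fy fz mult_zero_left diff_self mult_eq_0_iff) simp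
    show "\<forall>x\<in>side1.bad R. h x = 0" using f \<open>\<alpha> = 0\<close> \<open>\<beta> = 0\<close> by simp
  qed simp_all
  then show ?thesis by simp
qed

text \<open>For \<open>l = 1\<close> the first region is part of the edge, and the values there are multiples of the
  value at \<open>e\<close>. As \<open>e\<close> lies in the second region, the first ray contributes nothing.\<close>

lemma dim_one_one_overlap:
  assumes P: "p R = 1" and Q: "q R = 1" and l: "l = 1" and e: "e \<in> side2.bad R" and l': "2 \<le> l'"
  shows "additive_dim TYPE('k::field_char_0) S (K R) (nat (l' - 2))"
proof -
  have e_pt: "e = side1.pt 0 1" by (rule side1.pt_eqI) simp_all
  have bad1: "p x = 0" if "x \<in> side1.bad R" for x
    using that side1.p_nonneg[OF side1.bad_S[OF that]] P l unfolding side1.bad_def by simp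
  obtain Y where Y: "basis_points TYPE('k) S (side2.bad R) Y" "card Y = nat l'" "side2.pt 0 l' \<in> Y"
    "\<And>y. y \<in> Y \<Longrightarrow> q y = 1 \<or> y = side2.pt 0 l'"
    using side2.basis_points_one_ex[OF Q, where 'k='k] by blast
  have Y_sub: "Y \<subseteq> side2.bad R" using Y(1) by (simp add: basis_points_def)
  have e_bad: "e \<in> side1.bad R" unfolding side1.bad_def using P side1.ray_in_S[of 1] e_pt l by simp
  have KY: "basis_points TYPE('k) S (K R) Y"
  proof (rule basis_pointsI)
    show "finite Y" using Y(1) by (simp add: basis_points_def)
    show "Y \<subseteq> K R" using Y_sub by (auto simp: K_def)
    fix h :: "lattice \<Rightarrow> 'k" and x
    assume h: "h \<in> additive_functions S (K R)" "\<And>y. y \<in> Y \<Longrightarrow> h y = 0" "x \<in> K R"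
    have 2: "h z = 0" if "z \<in> side2.bad R" for z
      using basis_points_zero[OF Y(1) restrict2[OF h(1)] h(2) that] by blast
    have "h z = 0" if z: "z \<in> side1.bad R" for z
      using side1.additive_on_ray[OF restrict1[OF h(1)] z bad1[OF z]] 2[OF e] e_pt l by simp
    then show "h x = 0" using h(3) 2 unfolding K_def by blast
  next
    fix y assume "y \<in> Y"
    then obtain f where f: "f \<in> additive_functions S (side2.bad R)" "\<forall>z\<in>Y. f z = (if z = y then 1 else (0::'k))"
      using Y(1) unfolding basis_points_def by blast
    have f1: "(\<lambda>x. 0 * of_int (p x) + f e * of_int (i x)) \<in> additive_functions S (side1.bad R)"
      by (rule side1.linear_form_additive)
    have agree: "0 * of_int (p x) + f e * of_int (i x) = f x" if x: "x \<in> side1.bad R" "x \<in> side2.bad R" for x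
    proof -
      have "0 \<le> i x" using side1.S_side[OF side1.bad_S[OF x(1)]] bad1[OF x(1)] by simp
      moreover have "q x \<le> 1" using x(2) Q by (auto simp: side2.bad_def)
      moreover have "q x = i x * n" using q_coords[of x] bad1[OF x(1)] by simp
      ultimately have "i x = 0 \<or> i x = 1"
      proof -
        have "i x * 1 \<le> i x * n" using \<open>0 \<le> i x\<close> n_pos by (intro mult_left_mono) simp_all
        then show ?thesis using \<open>0 \<le> i x\<close> \<open>q x \<le> 1\<close> \<open>q x = i x * n\<close> by linarith
      qed
      moreover have "x = side1.pt 0 (i x)" using side1.pt_eta[of x] bad1[OF x(1)] by simp
      ultimately have "x = 0 \<or> x = e" using e_pt side1.pt_zero by metis
      then show ?thesis using side2.additive_at_zero[OF f(1) x(2)] by auto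
    qed
    obtain h where h: "h \<in> additive_functions S (K R)" "\<And>x. x \<in> side2.bad R \<Longrightarrow> h x = f x"
      using glue[OF f1 f(1) agree] by blast
    have "\<forall>z\<in>Y. h z = (if z = y then 1 else 0)" using h(2) f(2) Y_sub by (metis subsetD)
    then show "\<exists>h\<in>additive_functions S (K R). \<forall>z\<in>Y. h z = (if z = y then 1 else (0::'k))"
      by (rule bexI[OF _ h(1)])
  qed
  have "\<not> Y \<subseteq> {side2.pt 0 l'}"
  proof
    assume "Y \<subseteq> {side2.pt 0 l'}"
    then have "card Y \<le> 1" using card_mono[of "{side2.pt 0 l'}" Y] by simp
    then show False using Y(2) l' by simp
  qed
  then obtain y where y: "y \<in> Y" "y \<noteq> side2.pt 0 l'" by blast
  then have "q y = 1" using Y(4) by blast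
  then have "q (side2.pt 0 l') * i' y \<noteq> q y * i' (side2.pt 0 l')" using l'_pos by simp
  then have "additive_dim TYPE('k) S (K R) (card Y - 2)"
    by (rule side2.dim_basis_points[OF KY Y(3) y(1)])
  moreover have "card Y - 2 = nat (l' - 2)" using Y(2) by arith
  ultimately show ?thesis by simp
qed

text \<open>On the line \<open>p = 1\<close> the overlap of the two regions consists of the points between the boundary of
  the cone, at index \<open>i0\<close>, and \<open>R\<close>.  The classes it does not meet contribute one dimension each, and
  so does the value on the ray if the overlap leaves it undetermined.\<close>

lemma dim_one_linear:
  assumes P: "p R = 1" and lin: "2 \<le> q R" "\<not> (q R = 2 \<and> l' = 2 \<and> even (i' R))"
    and I: "0 \<le> i R" "i0 \<le> i R"
    and low: "\<And>x. x \<in> S \<Longrightarrow> p x = 1 \<Longrightarrow> i0 \<le> i x"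
    and below: "\<And>j. i0 \<le> j \<Longrightarrow> j < i R \<Longrightarrow> \<not> l dvd (j - i R) \<Longrightarrow> side1.pt 1 j \<in> side2.bad R"
    and above: "\<And>j. i R < j \<Longrightarrow> side1.pt 1 j \<notin> side2.bad R"
    and ray: "side1.pt 0 l \<in> side2.bad R \<or> i R - i0 \<le> l"
  shows "additive_dim TYPE('k::field_char_0) S (K R)
    (nat (i0 + l - 1 - i R) + (if side1.pt 0 l \<in> side2.bad R then 0 else 1))"
proof -
  let ?A = "side1.pt 1 ` {i R + 1..i0 + l - 1}"
  let ?B = "if side1.pt 0 l \<in> side2.bad R then {} else {side1.pt 0 l}"
  have ray_bad: "side1.pt 0 l \<in> side1.bad R"
    unfolding side1.bad_def using P side1.ray_in_S[of 1] by simp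
  have window: "\<not> l dvd (j - k)" if "j \<in> {i0..i0+l-1}" "k \<in> {i0..i0+l-1}" "j \<noteq> k" for j k
  proof
    assume "l dvd (j - k)"
    then have "l dvd \<bar>j - k\<bar>" by simp
    moreover have "\<bar>j - k\<bar> < l" "0 < \<bar>j - k\<bar>" using that by (auto simp: abs_less_iff)
    ultimately show False using zdvd_not_zless by blast
  qed
  have A_bad: "side1.pt 1 j \<in> side1.bad R" if j: "j \<in> {i R + 1..i0 + l - 1}" for j
  proof -
    have "\<not> l dvd (j - i R)" using window[of j "i R"] j I by simp
    then show ?thesis unfolding side1.bad_def using P I j side1.S_quadrant[of "side1.pt 1 j"] by simp
  qed
  have "additive_dim TYPE('k) S (K R) (card (?A \<union> ?B))"
  proof (rule dim_linear_side2[OF lin])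
    show "finite (?A \<union> ?B)" by simp
    show "?A \<union> ?B \<subseteq> side1.bad R" using A_bad ray_bad by auto
  next
    fix h :: "lattice \<Rightarrow> 'k"
    assume h: "h \<in> additive_functions S (side1.bad R)"
      "\<And>x. x \<in> side1.bad R \<Longrightarrow> x \<in> side2.bad R \<Longrightarrow> h x = 0" "\<And>x. x \<in> ?A \<union> ?B \<Longrightarrow> h x = 0"
    have h_ray: "h (side1.pt 0 l) = 0" using h(2)[OF ray_bad] h(3)[of "side1.pt 0 l"] by (cases "side1.pt 0 l \<in> side2.bad R") simp_all
    show "\<forall>x\<in>side1.bad R. h x = 0"
    proof (rule ballI, rule side1.additive_zero_from_level_one[OF h(1) h_ray])
      fix y assume y: "y \<in> side1.bad R" "p y = 1"
      define m where "m = (i y - i0) mod l"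
      define j where "j = i0 + m"
      have m: "0 \<le> m" "m < l" unfolding m_def using l_pos by simp_all
      have "l * ((i y - i0) div l) + m = i y - i0" unfolding m_def by (rule mult_div_mod_eq)
      then have iy: "i y = j + l * ((i y - i0) div l)" unfolding j_def by linarith
      have ndvd: "\<not> l dvd (j - i R)"
      proof
        assume d: "l dvd (j - i R)"
        have "i y - i R = (j - i R) + l * ((i y - i0) div l)" using iy by linarith
        then have "l dvd (i y - i R)" using d by (simp only: dvd_add_left_iff dvd_triv_left)
        then show False using y P unfolding side1.bad_def by simp
      qed
      then have "j \<noteq> i R" by auto
      then consider "j < i R" | "i R < j" by linarith
      then have "side1.pt 1 j \<in> side1.bad R \<and> h (side1.pt 1 j) = 0"
      proof cases
        case 1
        have in2: "side1.pt 1 j \<in> side2.bad R" by (rule below) (use 1 m ndvd j_def in simp_all)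
        then have "side1.pt 1 j \<in> side1.bad R"
          unfolding side1.bad_def using side2.bad_S[OF in2] P ndvd by simp
        then show ?thesis using h(2) in2 by blast
      next
        case 2
        then have "j \<in> {i R + 1..i0 + l - 1}" using m j_def by simp
        then show ?thesis using A_bad h(3) by blast
      qed
      moreover have "h y = h (side1.pt 1 j) + of_int ((i y - i0) div l) * h (side1.pt 0 l)" if "side1.pt 1 j \<in> side1.bad R"
        by (rule side1.additive_same_class[OF h(1) y(1) that]) (use y iy in simp_all)
      ultimately show "h y = 0" using h_ray by simp
    qed
  next
    fix y assume y: "y \<in> ?A \<union> ?B"
    have overlap: "p x = 0 \<or> (p x = 1 \<and> i0 \<le> i x \<and> i x < i R)" if x: "x \<in> side1.bad R" "x \<in> side2.bad R" for x
    proof -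
      have "p x \<le> 1" "\<not> (p x = 1 \<and> i x = i R)" using x(1) P unfolding side1.bad_def by auto
      then consider "p x = 0" | "p x = 1" "i x \<noteq> i R"
        using side1.p_nonneg[OF side1.bad_S[OF x(1)]] by linarith
      then show ?thesis
      proof cases
        case 2
        have "x = side1.pt 1 (i x)" using side1.pt_eta[of x] 2 by simp
        then have "\<not> i R < i x" using above[of "i x"] x(2) by metis
        then show ?thesis using 2 low[OF side1.bad_S[OF x(1)]] by simp
      qed simp
    qed
    show "\<exists>f\<in>additive_functions S (side1.bad R).
      (\<forall>x\<in>side1.bad R \<inter> side2.bad R. f x = 0) \<and> (\<forall>z\<in>?A \<union> ?B. f z = (if z = y then 1 else (0::'k)))"
    proof (cases "y = side1.pt 0 l")
      case True
      then have nr: "side1.pt 0 l \<notin> side2.bad R" using y by (auto split: if_splits)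
      let ?f = "\<lambda>x. of_int (if p x = 1 then (i x - i0) div l else i x div l) :: 'k"
      have f: "?f \<in> additive_functions S (side1.bad R)"
        using P by (intro side1.quotient_function_additive) simp
      have "?f x = 0" if "x \<in> side1.bad R \<inter> side2.bad R" for x
      proof -
        have x: "x \<in> side1.bad R" "x \<in> side2.bad R" using that by simp_all
        from overlap[OF x] show ?thesis
        proof
          assume p0: "p x = 0"
          obtain k where k: "i x = l * k" using side1.ray_dvd[OF side1.bad_S[OF x(1)] p0] by (auto elim: dvdE)
          have "0 \<le> l * k" using side1.S_side[OF side1.bad_S[OF x(1)]] p0 k by simp
          then have k0: "0 \<le> k" using l_pos by (simp add: zero_le_mult_iff)
          have "k = 0"
          proof (rule ccontr)
            assume "k \<noteq> 0"
            then have "x = side1.pt 0 l + side1.pt 0 (l * (k - 1))" "0 \<le> k - 1"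
              using p0 k k0 by (auto intro!: side1.pt_eqI simp: p_add i_add algebra_simps)
            then have "side1.pt 0 l \<in> side2.bad R"
              using side2.bad_down[of "side1.pt 0 l" "side1.pt 0 (l * (k - 1))" R] x(2) side1.ray_in_S[of 1] side1.ray_in_S[of "k - 1"]
              by simp
            then show False using nr by simp
          qed
          then show ?thesis using p0 k by simp
        next
          assume "p x = 1 \<and> i0 \<le> i x \<and> i x < i R"
          then show ?thesis using ray nr by simp
        qed
      qed
      moreover have "?f z = (if z = y then 1 else 0)" if z: "z \<in> ?A \<union> ?B" for z
      proof (cases "z = side1.pt 0 l")
        case z_ray: True
        then show ?thesis using True l_pos by simp
      next
        case False
        then obtain j where "z = side1.pt 1 j" "j \<in> {i R + 1..i0 + l - 1}" using z by (auto split: if_splits)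
        then show ?thesis using True False I by simp
      qed
      ultimately show ?thesis by (intro bexI[OF _ f] conjI ballI)
    next
      case False
      then obtain c where c: "y = side1.pt 1 c" "c \<in> {i R + 1..i0 + l - 1}" using y by (auto split: if_splits)
      let ?f = "\<lambda>x. if p x = 1 \<and> l dvd (i x - c) then 1 else 0 :: 'k"
      have f: "?f \<in> additive_functions S (side1.bad R)"
        using P by (intro side1.class_function_additive) simp
      have "?f x = 0" if "x \<in> side1.bad R \<inter> side2.bad R" for x
      proof -
        have x: "x \<in> side1.bad R" "x \<in> side2.bad R" using that by simp_all
        from overlap[OF x] show ?thesis
        proof
          assume "p x = 1 \<and> i0 \<le> i x \<and> i x < i R"
          then have "\<not> l dvd (i x - c)" using window[of "i x" c] c(2) I by simp
          then show ?thesis by simp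
        qed simp
      qed
      moreover have "?f z = (if z = y then 1 else 0)" if z: "z \<in> ?A \<union> ?B" for z
      proof (cases "z = side1.pt 0 l")
        case True
        then show ?thesis using False by simp
      next
        case z1: False
        then obtain j where j: "z = side1.pt 1 j" "j \<in> {i R + 1..i0 + l - 1}" using z by (auto split: if_splits)
        then have "l dvd (j - c) \<longleftrightarrow> j = c" using window[of j c] c(2) I by (cases "j = c") simp_all
        then show ?thesis using j c by simp
      qed
      ultimately show ?thesis by (intro bexI[OF _ f] conjI ballI)
    qed
  qed
  moreover have "card (?A \<union> ?B) = card ?A + card ?B"
    by (intro card_Un_disjoint) auto
  moreover have "card ?A = nat (i0 + l - 1 - i R)"
    by (subst card_image) (auto simp: inj_on_def)
  ultimately show ?thesis by (simp split: if_splits)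
qed

lemma dim_special_special:
  assumes sp: "p R = 2" "l = 2" "even (i R)" and sp': "q R = 2" "l' = 2" "even (i' R)"
    and bb: "b = b'" and inter: "\<And>x. x \<in> side1.bad R \<Longrightarrow> x \<in> side2.bad R \<Longrightarrow> x = 0 \<or> x = b"
  shows "additive_dim TYPE('k::field_char_0) S (K R) 3"
proof -
  let ?Y1 = "{side1.pt 0 2, side1.pt 1 0, side1.pt 1 1}" and ?Y2 = "{side2.pt 0 2, side2.pt 1 0, side2.pt 1 1}"
  have b1: "side1.pt 1 0 = b" by (rule side1.pt_eqI) simp_all
  have b2: "side2.pt 1 0 = b" unfolding bb by (rule side2.pt_eqI) simp_all
  have basis1: "basis_points TYPE('k) S (side1.bad R) ?Y1" by (rule side1.basis_points_special[OF sp])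
  have basis2: "basis_points TYPE('k) S (side2.bad R) ?Y2" by (rule side2.basis_points_special[OF sp'])
  have bY: "b \<in> ?Y1" "b \<in> ?Y2" by (metis b1 insertCI, metis b2 insertCI)
  have "basis_points TYPE('k) S (K R) (?Y1 \<union> ?Y2)"
  proof (rule basis_points_amalgam[OF basis1 basis2])
    fix x assume "x \<in> side1.bad R" "x \<in> side2.bad R"
    then have "x = 0 \<or> x = b" by (rule inter)
    then show "x = 0 \<or> x \<in> ?Y1 \<and> x \<in> ?Y2" using bY by metis
  qed
  then have "additive_dim TYPE('k) S (K R) (card (?Y1 \<union> ?Y2) - 2)"
    by (rule side1.dim_basis_points[of _ _ "side1.pt 0 2" "side1.pt 1 0"]) simp_all
  moreover have "card (?Y1 \<union> ?Y2) = 5"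
  proof -
    have "?Y1 \<inter> ?Y2 = {b}"
    proof
      show "{b} \<subseteq> ?Y1 \<inter> ?Y2" using bY by simp
      have sub: "?Y1 \<subseteq> side1.bad R" "?Y2 \<subseteq> side2.bad R" using basis1 basis2 by (simp_all only: basis_points_def)
      show "?Y1 \<inter> ?Y2 \<subseteq> {b}"
      proof
        fix x assume x: "x \<in> ?Y1 \<inter> ?Y2"
        then have "x = 0 \<or> x = b" using sub by (intro inter) (meson IntD1 IntD2 subsetD)+
        moreover have "x \<noteq> 0" using basis_points_nonzero[OF basis1 side1.S_zero] x by (metis IntD1)
        ultimately show "x \<in> {b}" by simp
      qed
    qed
    moreover have "card ?Y1 = 3" "card ?Y2 = 3" by simp_all
    ultimately show ?thesis using card_Un_Int[of ?Y1 ?Y2] by simp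
  qed
  ultimately show ?thesis by simp
qed

text \<open>An exceptional side has three coordinates. If the functions near the other ray are linear,
  they can be subtracted, and every independent condition that the overlap imposes removes one
  dimension.\<close>

lemma dim_special_linear_2:
  assumes sp: "p R = 2" "l = 2" "even (i R)"
    and lin: "2 \<le> q R" "\<not> (q R = 2 \<and> l' = 2 \<and> even (i' R))"
    and b: "b \<in> side1.bad R" "b \<in> side2.bad R"
    and inter: "\<And>x. x \<in> side1.bad R \<Longrightarrow> x \<in> side2.bad R \<Longrightarrow> x = 0 \<or> x = b"
  shows "additive_dim TYPE('k::field_char_0) S (K R) 2"
proof -
  let ?X = "{side1.pt 0 2, side1.pt 1 1}"
  have b1: "side1.pt 1 0 = b" by (rule side1.pt_eqI) simp_all
  have "additive_dim TYPE('k) S (K R) (card ?X)"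
  proof (rule dim_linear_side2[OF lin])
    show "?X \<subseteq> side1.bad R"
      using side1.basis_points_special[OF sp, where 'k='k] unfolding basis_points_def by blast
    fix h :: "lattice \<Rightarrow> 'k"
    assume h: "h \<in> additive_functions S (side1.bad R)"
      "\<And>x. x \<in> side1.bad R \<Longrightarrow> x \<in> side2.bad R \<Longrightarrow> h x = 0" "\<And>x. x \<in> ?X \<Longrightarrow> h x = 0"
    show "\<forall>x\<in>side1.bad R. h x = 0"
      by (rule ballI, rule side1.additive_zero_special[OF sp h(1)]) (use h(2)[OF b] h(3) b1 in simp_all)
  next
    fix y assume "y \<in> ?X"
    then consider "y = side1.pt 0 2" | "y = side1.pt 1 1" by blast
    then show "\<exists>f\<in>additive_functions S (side1.bad R).
      (\<forall>x\<in>side1.bad R \<inter> side2.bad R. f x = 0) \<and> (\<forall>z\<in>?X. f z = (if z = y then 1 else (0::'k)))"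
    proof cases
      case 1
      have "of_int (i x div 2) = (0::'k)" if "x \<in> side1.bad R \<inter> side2.bad R" for x
        using inter[of x] that by auto
      then show ?thesis using 1 by (intro bexI[OF _ side1.half_function_additive[OF sp]] conjI ballI) auto
    next
      case 2
      have "of_int (i x mod 2) = (0::'k)" if "x \<in> side1.bad R \<inter> side2.bad R" for x
        using inter[of x] that by auto
      then show ?thesis using 2 by (intro bexI[OF _ side1.parity_function_additive[OF sp]] conjI ballI) auto
    qed
  qed simp
  then show ?thesis by (simp add: numeral_2_eq_2)
qed

lemma dim_special_linear_1:
  assumes sp: "p R = 2" "l = 2" "even (i R)"
    and lin: "2 \<le> q R" "\<not> (q R = 2 \<and> l' = 2 \<and> even (i' R))"
    and b: "b \<in> side1.bad R" "b \<in> side2.bad R"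
    and inter: "\<And>x. x \<in> side1.bad R \<Longrightarrow> x \<in> side2.bad R \<Longrightarrow> x = 0 \<or> x = b \<or> i x = - 1"
    and z: "z \<in> side1.bad R" "z \<in> side2.bad R" "i z = - 1"
  shows "additive_dim TYPE('k::field_char_0) S (K R) 1"
proof -
  let ?X = "{side1.pt 0 2}"
  have "additive_dim TYPE('k) S (K R) (card ?X)"
  proof (rule dim_linear_side2[OF lin])
    show X: "?X \<subseteq> side1.bad R"
      using side1.basis_points_special[OF sp, where 'k='k] unfolding basis_points_def by blast
    fix h :: "lattice \<Rightarrow> 'k"
    assume h: "h \<in> additive_functions S (side1.bad R)"
      "\<And>x. x \<in> side1.bad R \<Longrightarrow> x \<in> side2.bad R \<Longrightarrow> h x = 0" "\<And>x. x \<in> ?X \<Longrightarrow> h x = 0"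
    obtain \<alpha> \<beta> \<gamma> where f: "\<And>x. x \<in> side1.bad R \<Longrightarrow> h x = \<alpha> * of_int (p x) + \<beta> * of_int (i x div 2) + \<gamma> * of_int (i x mod 2)"
      using side1.additive_special_form[OF sp h(1)] by blast
    have "\<alpha> = 0" using f[OF b(1)] h(2)[OF b] by simp
    moreover have "\<beta> = 0" using f[of "side1.pt 0 2"] X h(3) by simp
    moreover have "\<gamma> = 0" using f[OF z(1)] h(2)[OF z(1,2)] z(3) \<open>\<alpha> = 0\<close> \<open>\<beta> = 0\<close> by simp
    ultimately show "\<forall>x\<in>side1.bad R. h x = 0" using f by simp
  next
    fix y assume y: "y \<in> ?X"
    have "of_int (i x div 2) + of_int (i x mod 2) = (0::'k)" if "x \<in> side1.bad R \<inter> side2.bad R" for x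
      using inter[of x] that by auto
    then show "\<exists>f\<in>additive_functions S (side1.bad R).
      (\<forall>x\<in>side1.bad R \<inter> side2.bad R. f x = 0) \<and> (\<forall>z\<in>?X. f z = (if z = y then 1 else (0::'k)))"
      using y by (intro bexI[OF _ additive_functions_sum2[OF side1.half_function_additive[OF sp] side1.parity_function_additive[OF sp]]] conjI ballI) auto
  qed simp
  then show ?thesis by simp
qed

lemma dim_special_linear_0:
  assumes sp: "p R = 2" "l = 2" "even (i R)"
    and lin: "2 \<le> q R" "\<not> (q R = 2 \<and> l' = 2 \<and> even (i' R))"
    and inter: "side1.pt 1 0 \<in> side2.bad R" "side1.pt 1 1 \<in> side2.bad R" "side1.pt 1 2 \<in> side2.bad R \<or> side1.pt 0 2 \<in> side2.bad R"
  shows "additive_dim TYPE('k::field_char_0) S (K R) 0"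
proof -
  have "additive_dim TYPE('k) S (K R) (card ({} :: lattice set))"
  proof (rule dim_linear_side2[OF lin])
    fix h :: "lattice \<Rightarrow> 'k"
    assume h: "h \<in> additive_functions S (side1.bad R)"
      "\<And>x. x \<in> side1.bad R \<Longrightarrow> x \<in> side2.bad R \<Longrightarrow> h x = 0"
    obtain \<alpha> \<beta> \<gamma> where f: "\<And>x. x \<in> side1.bad R \<Longrightarrow> h x = \<alpha> * of_int (p x) + \<beta> * of_int (i x div 2) + \<gamma> * of_int (i x mod 2)"
      using side1.additive_special_form[OF sp h(1)] by blast
    have low: "x \<in> side1.bad R" if "x \<in> side2.bad R" "p x < 2" for x
      using side2.bad_S[OF that(1)] that(2) sp(1) unfolding side1.bad_def by simp
    have v: "\<alpha> * of_int (p x) + \<beta> * of_int (i x div 2) + \<gamma> * of_int (i x mod 2) = 0" if "x \<in> side2.bad R" "p x < 2" for x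
      using f[OF low[OF that]] h(2)[OF low[OF that] that(1)] by simp
    have "\<alpha> = 0" using v[OF inter(1)] by simp
    moreover have "\<gamma> = 0" using v[OF inter(2)] \<open>\<alpha> = 0\<close> by simp
    moreover have "\<beta> = 0" using inter(3) v[of "side1.pt 1 2"] v[of "side1.pt 0 2"] \<open>\<alpha> = 0\<close> by auto
    ultimately show "\<forall>x\<in>side1.bad R. h x = 0" using f by simp
  qed simp_all
  then show ?thesis by simp
qed

text \<open>The case of two special sides over the affine plane: the coordinates \<open>i\<close> and \<open>i'\<close> have the same
  parity, so that the parity function is defined on both sides at once.\<close>

lemma dim_special_special_smooth:
  assumes sp: "p R = 2" "l = 2" "even (i R)" and sp': "q R = 2" "l' = 2" "even (i' R)" and n: "n = 1"
  shows "additive_dim TYPE('k::field_char_0) S (K R) 1"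
proof -
  let ?Y = "{side1.pt 0 2, side1.pt 1 0, side1.pt 1 1}"
  have qb: "q b = 1" and pb': "p b' = 1" using q_b p_b' n by auto
  have qx: "q x = p x + i x" for x using q_coords[of x] qb n by simp
  have i'x: "i' x = - i x" for x using p_coords[of x] qx[of x] pb' n by simp
  have basis1: "basis_points TYPE('k) S (side1.bad R) ?Y" by (rule side1.basis_points_special[OF sp])
  have par1: "(\<lambda>x. of_int (i x mod 2)) \<in> (additive_functions S (side1.bad R) :: (lattice \<Rightarrow> 'k) set)"
    by (rule side1.parity_function_additive[OF sp])
  have "(\<lambda>x. of_int (i' x mod 2)) \<in> (additive_functions S (side2.bad R) :: (lattice \<Rightarrow> 'k) set)"
    by (rule side2.parity_function_additive[OF sp'])
  moreover have "i' x mod 2 = i x mod 2" for x unfolding i'x by presburger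
  ultimately have par2: "(\<lambda>x. of_int (i x mod 2)) \<in> (additive_functions S (side2.bad R) :: (lattice \<Rightarrow> 'k) set)"
    by simp
  have par: "(\<lambda>x. of_int (i x mod 2)) \<in> (additive_functions S (K R) :: (lattice \<Rightarrow> 'k) set)"
    using par1 par2 unfolding K_def additive_functions_def by blast
  have f1: "(\<lambda>x. (0 * of_int (p x) + 1/2 * of_int (i x)) - 1/2 * of_int (i x mod 2)) \<in> (additive_functions S (K R) :: (lattice \<Rightarrow> 'k) set)"
    by (intro additive_functions_diff side1.linear_form_additive additive_functions_cmult par)
  have f2: "(\<lambda>x. (1 * of_int (p x) + 0 * of_int (i x)) - of_int (i x mod 2)) \<in> (additive_functions S (K R) :: (lattice \<Rightarrow> 'k) set)"
    by (intro additive_functions_diff side1.linear_form_additive par)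
  have "basis_points TYPE('k) S (K R) ?Y"
  proof (rule basis_pointsI)
    show "?Y \<subseteq> K R" using basis1 unfolding basis_points_def K_def by blast
    fix h :: "lattice \<Rightarrow> 'k" and x
    assume h: "h \<in> additive_functions S (K R)" "\<And>y. y \<in> ?Y \<Longrightarrow> h y = 0" and x: "x \<in> K R"
    have 1: "h z = 0" if "z \<in> side1.bad R" for z
      by (rule basis_points_zero[OF basis1 restrict1[OF h(1)] h(2) that])
    obtain \<alpha> \<beta> \<gamma> where f: "\<And>x. x \<in> side2.bad R \<Longrightarrow> h x = \<alpha> * of_int (q x) + \<beta> * of_int (i' x div 2) + \<gamma> * of_int (i' x mod 2)"
      using side2.additive_special_form[OF sp' restrict2[OF h(1)]] by blast
    have S: "side1.pt a j \<in> S" if "0 < a" "0 < a + j" for a j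
      using that unfolding S_iff by (simp add: qx)
    have v: "\<alpha> * of_int (a + j) + \<beta> * of_int ((- j) div 2) + \<gamma> * of_int ((- j) mod 2) = 0"
      if "0 < a" "0 < a + j" "a + j < 2 \<or> (a + j = 2 \<and> odd j)" "a < 2 \<or> (a = 2 \<and> odd j)" for a j
    proof -
      have "side1.pt a j \<in> side1.bad R" unfolding side1.bad_def using that S sp by simp
      moreover have "side1.pt a j \<in> side2.bad R"
        unfolding side2.bad_def using that S[of a j] sp' by (simp add: qx i'x)
      ultimately show ?thesis using 1[of "side1.pt a j"] f[of "side1.pt a j"] by (simp add: qx i'x)
    qed
    have "\<alpha> = 0" using v[of 1 0] by simp
    moreover have "\<gamma> = 0" using v[of 2 "-1"] \<open>\<alpha> = 0\<close> by simp
    moreover have "\<beta> = 0" using v[of 1 1] \<open>\<alpha> = 0\<close> \<open>\<gamma> = 0\<close> by simp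
    ultimately have "h z = 0" if "z \<in> side2.bad R" for z using f[OF that] by simp
    then show "h x = 0" using 1 x unfolding K_def by blast
  next
    fix y assume "y \<in> ?Y"
    then consider "y = side1.pt 0 2" | "y = side1.pt 1 0" | "y = side1.pt 1 1" by blast
    then show "\<exists>h\<in>additive_functions S (K R). \<forall>z\<in>?Y. h z = (if z = y then 1 else (0::'k))"
    proof cases
      case 1 then show ?thesis by (intro bexI[OF _ f1]) simp
    next
      case 2 then show ?thesis by (intro bexI[OF _ f2]) simp
    next
      case 3 then show ?thesis by (intro bexI[OF _ par]) simp
    qed
  qed simp
  then have "additive_dim TYPE('k) S (K R) (card ?Y - 2)"
    by (rule side1.dim_basis_points[of _ _ "side1.pt 0 2" "side1.pt 1 0"]) simp_all
  then show ?thesis by simp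
qed

lemma both_bad_interior:
  assumes "x \<in> S" "p x < p R" "q x < q R"
  shows "x \<in> side1.bad R" "x \<in> side2.bad R"
  using assms unfolding side1.bad_def side2.bad_def by blast+

lemma both_bad_edge1:
  assumes "x \<in> S" "p x = p R" "\<not> l dvd (i x - i R)" "q x < q R"
  shows "x \<in> side1.bad R" "x \<in> side2.bad R"
  using assms unfolding side1.bad_def side2.bad_def by blast+

lemma both_bad_edge2:
  assumes "x \<in> S" "p x < p R" "q x = q R" "\<not> l' dvd (i' x - i' R)"
  shows "x \<in> side1.bad R" "x \<in> side2.bad R"
  using assms unfolding side1.bad_def side2.bad_def by blast+

lemma both_badD:
  assumes "x \<in> side1.bad R" "x \<in> side2.bad R"
  shows "x \<in> S" "0 \<le> p x" "0 \<le> q x" "p x \<le> p R" "q x \<le> q R" "x \<noteq> R"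
    "p x = p R \<Longrightarrow> \<not> l dvd (i x - i R)" "q x = q R \<Longrightarrow> \<not> l' dvd (i' x - i' R)"
    "p x = 0 \<Longrightarrow> l dvd i x" "q x = 0 \<Longrightarrow> l' dvd i' x"
proof -
  show S: "x \<in> S" using assms by (simp add: side1.bad_def)
  show "0 \<le> p x" "0 \<le> q x" using side1.p_nonneg[OF S] side2.p_nonneg[OF S] by simp_all
  show "p x \<le> p R" "q x \<le> q R" using assms by (auto simp: side1.bad_def side2.bad_def)
  show "x \<noteq> R" using assms by (auto simp: side1.bad_def)
  show "p x = p R \<Longrightarrow> \<not> l dvd (i x - i R)" "q x = q R \<Longrightarrow> \<not> l' dvd (i' x - i' R)"
    using assms by (auto simp: side1.bad_def side2.bad_def)
  show "p x = 0 \<Longrightarrow> l dvd i x" "q x = 0 \<Longrightarrow> l' dvd i' x"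
    using side1.ray_dvd[OF S] side2.ray_dvd[OF S] by simp_all
qed

lemma interior_S: "0 < p x \<Longrightarrow> 0 < q x \<Longrightarrow> x \<in> S"
  unfolding S_iff by blast

lemma independent_pq: "q x * p y \<noteq> p x * q y \<Longrightarrow> p x * i y \<noteq> p y * i x"
  unfolding q_coords[of x] q_coords[of y] by (auto simp: algebra_simps)

lemma pq_eqI: "p x = p y \<Longrightarrow> q x = q y \<Longrightarrow> x = y"
  using q_coords[of x] q_coords[of y] n_pos by (intro side1.pt_eqI) simp_all

end


section \<open>The chain of generators of the normalisation\<close>

locale cone_chain = two_rays p i q i' e b e' b' l l' n S
  for p i q i' :: "lattice \<Rightarrow> int" and e b e' b' :: lattice and l l' n :: int and S :: "lattice set" +
  fixes s :: nat and w :: "nat \<Rightarrow> lattice" and a :: "nat \<Rightarrow> int"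
  assumes s_pos: "1 \<le> s" and w_first: "w 0 = e" "w 1 = b" and w_last: "w s = b'" "w (Suc s) = e'"
    and rec: "1 \<le> j \<Longrightarrow> j \<le> s \<Longrightarrow> w (j - 1) + w (j + 1) = zscale (a j) (w j)"
    and kind: "(n = 1 \<and> s = 1 \<and> a 1 = 1) \<or> (2 \<le> n \<and> (\<forall>j\<in>{1..s}. 2 \<le> a j))"
begin

lemma swap_chain: "cone_chain q i' p i e' b' e b l' l n S s (\<lambda>j. w (Suc s - j)) (\<lambda>j. a (Suc s - j))"
proof -
  interpret sw: two_rays q i' p i e' b' e b l' l n S by (rule swap)
  show ?thesis
  proof unfold_locales
    show "1 \<le> s" by (rule s_pos)
    show "w (Suc s - 0) = e'" "w (Suc s - 1) = b'" "w (Suc s - s) = b" "w (Suc s - Suc s) = e"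
      using w_first w_last by simp_all
    show "w (Suc s - (j - 1)) + w (Suc s - (j + 1)) = zscale (a (Suc s - j)) (w (Suc s - j))" if "1 \<le> j" "j \<le> s" for j
    proof -
      have "Suc s - (j - 1) = (Suc s - j) + 1" "Suc s - (j + 1) = (Suc s - j) - 1" using that by simp_all
      then show ?thesis using rec[of "Suc s - j"] that by (simp only: add.commute)
    qed
    have "Suc s - j \<in> {1..s}" if "j \<in> {1..s}" for j using that by auto
    then show "(n = 1 \<and> s = 1 \<and> a (Suc s - 1) = 1) \<or> (2 \<le> n \<and> (\<forall>j\<in>{1..s}. 2 \<le> a (Suc s - j)))"
      using kind by auto
  qed
qed

lemma a_ge_2: "2 \<le> n \<Longrightarrow> 1 \<le> j \<Longrightarrow> j \<le> s \<Longrightarrow> 2 \<le> a j"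
  using kind by auto

lemma rec_p: "1 \<le> j \<Longrightarrow> j \<le> s \<Longrightarrow> p (w (j - 1)) + p (w (j + 1)) = a j * p (w j)"
  using arg_cong[OF rec, of j p] by (simp add: p_add)

text \<open>As \<open>a j \<ge> 2\<close>, the heights along the chain form a convex sequence.\<close>

lemma p_step:
  assumes n: "2 \<le> n"
  shows "j \<le> s \<Longrightarrow> 0 \<le> p (w j) \<and> p (w j) < p (w (Suc j))"
proof (induction j)
  case 0 show ?case using w_first by simp
next
  case (Suc j)
  have "2 * p (w (Suc j)) \<le> a (Suc j) * p (w (Suc j))"
    using a_ge_2[OF n, of "Suc j"] Suc by (intro mult_right_mono) simp_all
  moreover have "p (w j) + p (w (Suc (Suc j))) = a (Suc j) * p (w (Suc j))"
    using rec_p[of "Suc j"] Suc.prems by simp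
  moreover have "0 \<le> p (w j) \<and> p (w j) < p (w (Suc j))" using Suc by simp
  ultimately show ?case by linarith
qed

lemma q_step:
  assumes n: "2 \<le> n" and "j \<le> s"
  shows "q (w (Suc j)) < q (w j)"
proof -
  interpret sw: cone_chain q i' p i e' b' e b l' l n S s "\<lambda>j. w (Suc s - j)" "\<lambda>j. a (Suc s - j)"
    by (rule swap_chain)
  have "q (w (Suc s - (s - j))) < q (w (Suc s - Suc (s - j)))"
    using sw.p_step[OF n, of "s - j"] by simp
  then show ?thesis using \<open>j \<le> s\<close> by (simp add: Suc_diff_le)
qed

lemma p_strict:
  assumes n: "2 \<le> n" and "j < k" "k \<le> Suc s"
  shows "p (w j) < p (w k)"
  using assms(2,3)
proof (induction k)
  case (Suc k)
  have "p (w k) < p (w (Suc k))" using p_step[OF n, of k] Suc by simp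
  then show ?case using Suc by (cases "j = k") auto
qed simp

lemma q_strict:
  assumes n: "2 \<le> n" and "j < k" "k \<le> Suc s"
  shows "q (w k) < q (w j)"
  using assms(2,3)
proof (induction k)
  case (Suc k)
  have "q (w (Suc k)) < q (w k)" using q_step[OF n, of k] Suc by simp
  then show ?case using Suc by (cases "j = k") auto
qed simp

lemma p_w_pos: "2 \<le> n \<Longrightarrow> 1 \<le> j \<Longrightarrow> j \<le> Suc s \<Longrightarrow> 0 < p (w j)"
  using p_strict[of 0 j] w_first by simp

lemma q_w_pos: "2 \<le> n \<Longrightarrow> j \<le> s \<Longrightarrow> 0 < q (w j)"
  using q_strict[of j "Suc s"] w_last by simp

lemma w_in_S: "2 \<le> n \<Longrightarrow> 1 \<le> j \<Longrightarrow> j \<le> s \<Longrightarrow> w j \<in> S"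
  by (intro interior_S p_w_pos q_w_pos) simp_all

definition det :: "lattice \<Rightarrow> lattice \<Rightarrow> int" where
  "det x y = i x * p y - p x * i y"

lemma det_add_right: "det z (x + y) = det z x + det z y"
  by (simp add: det_def p_add i_add algebra_simps)

lemma det_scale_right: "det z (zscale m x) = m * det z x"
  by (simp add: det_def algebra_simps)

lemma det_scale_left: "det (zscale m x) z = m * det x z"
  by (simp add: det_def algebra_simps)

lemma det_self [simp]: "det x x = 0"
  by (simp add: det_def)

lemma det_swap: "det x y = - det y x"
  by (simp add: det_def)

lemma det_pq: "n * det x y = q x * p y - p x * q y"
  unfolding det_def q_coords[of x] q_coords[of y] by (simp add: algebra_simps)

text \<open>The recursion preserves the determinant of consecutive elements, and it is one at the start.\<close>

lemma det_w: "j \<le> s \<Longrightarrow> det (w j) (w (Suc j)) = 1"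
proof (induction j)
  case 0 then show ?case using w_first by (simp add: det_def)
next
  case (Suc j)
  have "det (w (Suc j)) (w j + w (Suc (Suc j))) = 0"
    using rec[of "Suc j"] Suc by (simp add: det_scale_right)
  then have "det (w (Suc j)) (w (Suc (Suc j))) = - det (w (Suc j)) (w j)" by (simp add: det_add_right)
  then show ?case using Suc det_swap[of "w (Suc j)" "w j"] by simp
qed

lemma coordinates_w:
  assumes "j \<le> s"
  shows "x = zscale (det x (w (Suc j))) (w j) + zscale (det (w j) x) (w (Suc j))"
proof -
  let ?u = "w j" and ?v = "w (Suc j)"
  have D: "i ?u * p ?v - p ?u * i ?v = 1" using det_w[OF assms] by (simp add: det_def)
  have "p x = p x * (i ?u * p ?v - p ?u * i ?v)" "i x = i x * (i ?u * p ?v - p ?u * i ?v)" using D by simp_all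
  then show ?thesis
    by (intro side1.pt_eqI) (simp_all add: p_add i_add det_def algebra_simps)
qed

text \<open>Consecutive elements of the chain span the cone between them, so every interior point lies in one
  of these unimodular cones.\<close>

lemma interior_decomposition:
  assumes "0 < p R" "0 < q R"
  obtains j \<alpha> \<beta> where "j \<le> s" "0 < \<alpha>" "0 \<le> \<beta>" "R = zscale \<alpha> (w j) + zscale \<beta> (w (Suc j))"
proof -
  have e: "det (w 0) R = p R" using w_first by (simp add: det_def)
  have "n * det (w (Suc s)) R = n * (- q R)" using det_pq[of "w (Suc s)" R] w_last by simp
  then have e': "det (w (Suc s)) R = - q R" using n_pos by (simp only: mult_cancel_left) simp
  define j where "j = Max {j. j \<le> s \<and> 0 \<le> det (w j) R}"
  have fin: "finite {j. j \<le> s \<and> 0 \<le> det (w j) R}" by (rule finite_subset[of _ "{..s}"]) auto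
  have "0 \<in> {j. j \<le> s \<and> 0 \<le> det (w j) R}" using e assms by simp
  then have j: "j \<le> s" "0 \<le> det (w j) R" using Max_in[OF fin] unfolding j_def by blast+
  have "det (w (Suc j)) R < 0"
  proof (cases "j = s")
    case True then show ?thesis using e' assms by simp
  next
    case False
    show ?thesis
    proof (rule ccontr)
      assume "\<not> det (w (Suc j)) R < 0"
      then have "Suc j \<in> {j. j \<le> s \<and> 0 \<le> det (w j) R}" using j False by simp
      then have "Suc j \<le> j" unfolding j_def using Max_ge[OF fin] by blast
      then show False by simp
    qed
  qed
  then have "0 < det R (w (Suc j))" using det_swap[of R "w (Suc j)"] by simp
  then show ?thesis using that[OF j(1) _ j(2) coordinates_w[OF j(1)]] by blast
qed

text \<open>A multiple \<open>m w\<^sub>k\<close> with \<open>m < a\<^sub>k\<close> decomposes inside the cone only along \<open>w\<^sub>k\<close>: a summand off the line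
  contributes at least \<open>\<beta> (a\<^sub>k - 2) + 2\<close> to the multiplicity.\<close>

lemma decomposition_multiplicity:
  assumes n: "2 \<le> n" and k: "1 \<le> k" "k \<le> s" and R: "x + y = zscale m (w k)"
    and x: "0 \<le> q x" and y: "0 \<le> p y" and off: "0 < det (w k) x"
  shows "a k \<le> m" and "s = 1 \<Longrightarrow> m = a k \<Longrightarrow> x = w (k + 1) \<and> y = w (k - 1)"
proof -
  define \<beta> where "\<beta> = det (w k) x"
  define \<alpha> where "\<alpha> = det x (w (Suc k))"
  define \<gamma> where "\<gamma> = m - \<alpha> - \<beta> * a k"
  have x_eq: "x = zscale \<alpha> (w k) + zscale \<beta> (w (Suc k))"
    unfolding \<alpha>_def \<beta>_def by (rule coordinates_w[OF k(2)])
  have rk: "w (k - 1) + w (Suc k) = zscale (a k) (w k)" using rec[OF k] by simp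
  have y_eq: "y = zscale \<gamma> (w k) + zscale \<beta> (w (k - 1))"
  proof -
    have "zscale \<beta> (w (k - 1)) + zscale \<beta> (w (Suc k)) = zscale (\<beta> * a k) (w k)"
      unfolding zscale_add_right[symmetric] rk by (simp add: zscale_assoc)
    then have "zscale \<gamma> (w k) = zscale m (w k) - zscale \<alpha> (w k) - (zscale \<beta> (w (k - 1)) + zscale \<beta> (w (Suc k)))"
      by (simp only: \<gamma>_def zscale_diff_left)
    moreover have "y = zscale m (w k) - (zscale \<alpha> (w k) + zscale \<beta> (w (Suc k)))"
      unfolding x_eq[symmetric] R[symmetric] by simp
    ultimately show ?thesis by simp
  qed
  have \<beta>: "1 \<le> \<beta>" using off by (simp add: \<beta>_def)
  have qk: "0 < q (w k)" "q (w (Suc k)) < q (w k)" using q_w_pos[OF n k(2)] q_step[OF n k(2)] by simp_all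
  have pk: "0 < p (w k)" "p (w (k - 1)) < p (w k)" using p_w_pos[OF n k(1)] k p_strict[OF n, of "k - 1" k] by simp_all
  have qx: "0 \<le> \<alpha> * q (w k) + \<beta> * q (w (Suc k))" using x unfolding x_eq by (simp add: q_add)
  have py: "0 \<le> \<gamma> * p (w k) + \<beta> * p (w (k - 1))" using y unfolding y_eq by (simp add: p_add)
  have "0 < (\<alpha> + \<beta>) * q (w k)"
  proof -
    have "\<beta> * q (w (Suc k)) < \<beta> * q (w k)" using \<beta> qk by simp
    then show ?thesis using qx by (simp add: distrib_right)
  qed
  then have \<alpha>\<beta>: "1 \<le> \<alpha> + \<beta>" using qk by (simp add: zero_less_mult_iff)
  have "0 < (\<gamma> + \<beta>) * p (w k)"
  proof -
    have "\<beta> * p (w (k - 1)) < \<beta> * p (w k)" using \<beta> pk by simp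
    then show ?thesis using py by (simp add: distrib_right)
  qed
  then have \<gamma>\<beta>: "1 \<le> \<gamma> + \<beta>" using pk by (simp add: zero_less_mult_iff)
  have a2: "2 \<le> a k" using a_ge_2[OF n k] .
  have m: "m = \<alpha> + \<gamma> + \<beta> * a k" by (simp add: \<gamma>_def)
  have "1 * (a k - 2) \<le> \<beta> * (a k - 2)" using \<beta> a2 by (intro mult_right_mono) simp_all
  then show "a k \<le> m" using m \<alpha>\<beta> \<gamma>\<beta> by (simp add: algebra_simps)
  assume s1: "s = 1" and ma: "m = a k"
  then have k1: "k = 1" using k by simp
  have "q (w (Suc k)) = 0" "p (w (k - 1)) = 0" using w_last w_first s1 k1 by simp_all
  then have "0 \<le> \<alpha>" "0 \<le> \<gamma>" using qx py qk pk by (simp_all add: zero_le_mult_iff)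
  then have "\<beta> * a k \<le> 1 * a k" using m ma by simp
  then have "\<beta> = 1" using a2 \<beta> by simp
  then have "\<alpha> = 0" "\<gamma> = 0" using m ma \<open>0 \<le> \<alpha>\<close> \<open>0 \<le> \<gamma>\<close> by simp_all
  then show "x = w (k + 1) \<and> y = w (k - 1)" using x_eq y_eq \<open>\<beta> = 1\<close> by simp
qed

end


section \<open>The predicted values\<close>

text \<open>The contribution of a ray in the coordinates of \<open>R = - u\<close>: \<open>P\<close> is the height of \<open>R\<close> and \<open>I\<close>
  its position. The points on the line at height one are numbered from \<open>I = 0\<close> here and from one
  in the formula for \<open>d\<^sub>i\<close>, whence the shifts.\<close>

definition ray_term :: "int \<Rightarrow> int \<Rightarrow> int \<Rightarrow> int" where
  "ray_term l P I =
     (if P = 0 \<and> 1 \<le> I \<and> I < l then 1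
      else if P = 1 \<and> I < 0 then l - 2
      else if P = 1 \<and> I = 0 then l - 1
      else if P = 1 \<and> 1 \<le> I \<and> I \<le> l - 1 then l - I
      else if P = 2 \<and> l = 2 \<and> even I \<and> I \<le> 0 then 1
      else 0)"

context cone_chain
begin

definition chain_term :: "lattice \<Rightarrow> int" where
  "chain_term R =
     (if \<exists>j\<in>{1..s}. \<exists>m. 2 \<le> m \<and> m < a j \<and> R = zscale m (w j) then 1
      else if R = zscale (a 1) (w 1) \<and> s = 1 \<and> a 1 > 1 then 1
      else if \<exists>j\<in>{1..s}. R = w j then 2 - of_bool (R = w 1) - of_bool (R = w s)
      else 0)"

definition generic_value :: "lattice \<Rightarrow> int" where
  "generic_value R = max 0 (ray_term l (p R) (i R) + ray_term l' (q R) (i' R) + chain_term R)"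

text \<open>The asserted dimension, exceptions included, in the coordinates of \<open>R = - u\<close>.\<close>

definition expected_value :: "lattice \<Rightarrow> int" where
  "expected_value R =
     (if n \<noteq> 1 then
        (if s = 1 \<and> R = zscale (a 1) (w 1) \<and> (l = 1 \<and> l' \<noteq> 1 \<or> l \<noteq> 1 \<and> l' = 1)
         then generic_value R - 1 else generic_value R)
      else
        (if l \<ge> 2 \<and> l' \<ge> 2 \<and> (R = side1.pt 1 (l - 1) \<or> R = side2.pt 1 (l' - 1)) then 0
         else if (l = 1 \<and> (\<exists>m. 1 \<le> m \<and> m \<le> l' - 1 \<and> R = side2.pt 1 (m - 1))) \<or>
                 (l' = 1 \<and> (\<exists>m. 1 \<le> m \<and> m \<le> l - 1 \<and> R = side1.pt 1 (m - 1)))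
         then generic_value R - 1
         else if R = zscale 2 b then (if l \<le> 2 \<and> l' \<le> 2 \<and> (l, l') \<noteq> (1, 1) then 1 else 0)
         else generic_value R))"

definition has_value :: "'k::field_char_0 itself \<Rightarrow> lattice \<Rightarrow> int \<Rightarrow> bool" where
  "has_value _ R v \<longleftrightarrow> (\<exists>d. additive_dim TYPE('k) S (K R) d \<and> int d = v)"

lemma has_valueI: "additive_dim TYPE('k::field_char_0) S (K R) d \<Longrightarrow> int d = v \<Longrightarrow> has_value TYPE('k) R v"
  unfolding has_value_def by blast

lemma b_pt: "b = side1.pt 1 0" by (rule side1.pt_eqI) simp_all
lemma b'_pt: "b' = side2.pt 1 0" by (rule side2.pt_eqI) simp_all

lemma n_cases:
  obtains (smooth) "n = 1" "s = 1" "a 1 = 1" | (singular) "2 \<le> n"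
  using kind by blast

lemma smooth_facts:
  assumes "n = 1"
  shows "s = 1" "a 1 = 1" "q b = 1" "p b' = 1" "b' = b" "q x = p x + i x" "i' x = - i x"
    "side2.pt a1 j = side1.pt (a1 + j) (- j)"
proof -
  show s: "s = 1" "a 1 = 1" using kind assms by auto
  show qb: "q b = 1" and pb': "p b' = 1" using q_b p_b' assms by auto
  show "b' = b" using w_first w_last s by simp
  have qx: "q x = p x + i x" for x using q_coords[of x] qb assms by simp
  then show "q x = p x + i x" .
  have i'x: "i' x = - i x" for x using p_coords[of x] qx[of x] pb' assms by simp
  then show "i' x = - i x" .
  show "side2.pt a1 j = side1.pt (a1 + j) (- j)"
    using p_coords[of "side2.pt a1 j"] i'x[of "side2.pt a1 j"]
    by (intro side1.pt_eqI) (simp_all add: pb' assms)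
qed

lemma smooth_chain_term: "n = 1 \<Longrightarrow> chain_term R = 0"
  unfolding chain_term_def using smooth_facts(1,2) by auto

text \<open>The slope \<open>p / q\<close> increases along the chain, so different elements lie on different rays.\<close>

lemma multiple_unique:
  assumes n: "2 \<le> n" and k: "1 \<le> k" "k \<le> s" "1 \<le> k'" "k' \<le> s" and m: "1 \<le> m" "1 \<le> m'"
    and eq: "zscale m (w k) = zscale m' (w k')"
  shows "k = k' \<and> m = m'"
proof -
  have less: False if kk: "k < k'" "1 \<le> k" "k' \<le> s" and m: "1 \<le> m" "1 \<le> m'" and eq: "zscale m (w k) = zscale m' (w k')" for k k' m m'
  proof -
    have p: "m * p (w k) = m' * p (w k')" and q: "m * q (w k) = m' * q (w k')"
      using arg_cong[OF eq, of p] arg_cong[OF eq, of q] by simp_all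
    have "p (w k) < p (w k')" "q (w k') < q (w k)" using p_strict[OF n] q_strict[OF n] kk by simp_all
    then have "m' * p (w k) < m * p (w k)" "m * q (w k') < m' * q (w k')"
      using p q m mult_strict_left_mono[of "p (w k)" "p (w k')" m'] mult_strict_left_mono[of "q (w k')" "q (w k)" m] by simp_all
    moreover have "0 < p (w k)" "0 < q (w k')" using p_w_pos[OF n] q_w_pos[OF n] kk by simp_all
    ultimately show False by (simp add: mult_less_cancel_right)
  qed
  have "k = k'" using less[of k k' m m'] less[of k' k m' m] k m eq by (cases k k' rule: linorder_cases) auto
  moreover have "m * p (w k) = m' * p (w k)" using arg_cong[OF eq, of p] \<open>k = k'\<close> by simp
  ultimately show ?thesis using p_w_pos[OF n, of k] k by simp
qed

lemma chain_term_multiple: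
  assumes n: "2 \<le> n" and k: "1 \<le> k" "k \<le> s" and m: "1 \<le> m" and R: "R = zscale m (w k)"
  shows "chain_term R = (if 2 \<le> m \<and> m < a k then 1 else if s = 1 \<and> m = a k then 1
     else if m = 1 then 2 - of_bool (k = 1) - of_bool (k = s) else 0)"
proof -
  have u: "R = zscale m' (w k') \<longleftrightarrow> k' = k \<and> m' = m" if "1 \<le> k'" "k' \<le> s" "1 \<le> m'" for k' m'
    using multiple_unique[OF n k that(1,2) m that(3)] R by auto
  have u1: "R = w k' \<longleftrightarrow> k' = k \<and> m = 1" if "1 \<le> k'" "k' \<le> s" for k'
    using u[OF that, of 1] by auto
  have a1: "2 \<le> a 1" using a_ge_2[OF n, of 1] s_pos by simp
  have c1: "(\<exists>j\<in>{1..s}. \<exists>m'. 2 \<le> m' \<and> m' < a j \<and> R = zscale m' (w j)) \<longleftrightarrow> 2 \<le> m \<and> m < a k"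
  proof
    assume "\<exists>j\<in>{1..s}. \<exists>m'. 2 \<le> m' \<and> m' < a j \<and> R = zscale m' (w j)"
    then obtain j m' where "1 \<le> j" "j \<le> s" "2 \<le> m'" "m' < a j" "R = zscale m' (w j)" by auto
    moreover then have "j = k \<and> m' = m" using u[of j m'] by simp
    ultimately show "2 \<le> m \<and> m < a k" by simp
  next
    assume "2 \<le> m \<and> m < a k"
    then show "\<exists>j\<in>{1..s}. \<exists>m'. 2 \<le> m' \<and> m' < a j \<and> R = zscale m' (w j)"
      using k R by (intro bexI[of _ k] exI[of _ m]) simp_all
  qed
  have c2: "(R = zscale (a 1) (w 1) \<and> s = 1 \<and> a 1 > 1) \<longleftrightarrow> s = 1 \<and> m = a k"
    using u[of 1 "a 1"] a1 k s_pos by auto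
  have c3: "(\<exists>j\<in>{1..s}. R = w j) \<longleftrightarrow> m = 1"
    using u1 k by auto
  have "m = 1 \<Longrightarrow> (R = w 1 \<longleftrightarrow> k = 1)" "m = 1 \<Longrightarrow> (R = w s \<longleftrightarrow> k = s)"
    using u1[of 1] u1[of s] s_pos by auto
  then show ?thesis unfolding chain_term_def c1 c2 c3 by simp
qed

lemma chain_term_zero:
  assumes "\<And>k m. 1 \<le> k \<Longrightarrow> k \<le> s \<Longrightarrow> 1 \<le> m \<Longrightarrow> R \<noteq> zscale m (w k)"
  shows "chain_term R = 0"
proof -
  have "\<not> (\<exists>j\<in>{1..s}. \<exists>m. 2 \<le> m \<and> m < a j \<and> R = zscale m (w j))" using assms by auto
  moreover have "\<not> (R = zscale (a 1) (w 1) \<and> s = 1 \<and> a 1 > 1)" using assms[of 1 "a 1"] s_pos by auto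
  moreover have "\<not> (\<exists>j\<in>{1..s}. R = w j)"
  proof
    assume "\<exists>j\<in>{1..s}. R = w j"
    then obtain j where "1 \<le> j" "j \<le> s" "R = zscale 1 (w j)" by auto
    then show False using assms[of j 1] by simp
  qed
  ultimately show ?thesis unfolding chain_term_def by simp
qed

lemma chain_term_boundary:
  assumes "q R \<le> 0"
  shows "chain_term R = 0"
proof (cases rule: n_cases)
  case smooth then show ?thesis using smooth_chain_term by simp
next
  case singular
  show ?thesis
  proof (rule chain_term_zero)
    fix k and m :: int assume "1 \<le> k" "k \<le> s" "1 \<le> m"
    then have "0 < q (zscale m (w k))" using q_w_pos[OF singular, of k] by simp
    then show "R \<noteq> zscale m (w k)" using assms by auto
  qed
qed

lemma expected_boundary:
  assumes Q: "q R \<le> 0"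
  shows "expected_value R = max 0 (ray_term l (p R) (i R) + ray_term l' (q R) (i' R))"
proof (cases rule: n_cases)
  case smooth
  note sm = smooth_facts[OF smooth(1)]
  have 1: "R \<noteq> side1.pt 1 j" if "0 \<le> j" for j
  proof
    assume "R = side1.pt 1 j"
    then have "q R = 1 + j" by (simp add: sm)
    then show False using Q that by simp
  qed
  have 2: "R \<noteq> side2.pt 1 j" for j
  proof
    assume "R = side2.pt 1 j"
    then have "q R = 1" by simp
    then show False using Q by simp
  qed
  have 3: "R \<noteq> zscale 2 b"
  proof
    assume "R = zscale 2 b"
    then have "q R = 2" by (simp add: sm)
    then show False using Q by simp
  qed
  have 4: "\<not> (\<exists>m. 1 \<le> m \<and> m \<le> l - 1 \<and> R = side1.pt 1 (m - 1))"
  proof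
    assume "\<exists>m. 1 \<le> m \<and> m \<le> l - 1 \<and> R = side1.pt 1 (m - 1)"
    then obtain m where "1 \<le> m" "R = side1.pt 1 (m - 1)" by blast
    then show False using 1[of "m - 1"] by simp
  qed
  have "R \<noteq> side1.pt 1 (l - 1)" using 1[of "l - 1"] l_pos by simp
  then show ?thesis
    unfolding expected_value_def generic_value_def
    using 2 3 4 smooth(1) smooth_chain_term[OF smooth(1)] by simp
next
  case singular
  have "R \<noteq> zscale (a 1) (w 1)"
  proof
    assume R: "R = zscale (a 1) (w 1)"
    have "2 \<le> a 1" using a_ge_2[OF singular, of 1] s_pos by simp
    then have "0 < a 1 * q (w 1)" using q_w_pos[OF singular, of 1] s_pos by simp
    then show False using Q R by simp
  qed
  then show ?thesis
    using singular chain_term_boundary[OF Q] by (simp add: expected_value_def generic_value_def)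
qed

lemma i_neg_below: "i R < 0" if "1 \<le> p R" "q R \<le> 0"
proof (rule ccontr)
  assume "\<not> i R < 0"
  then have "0 \<le> i R * n" using n_pos by simp
  moreover have "0 < p R * q b" using that q_b by simp
  ultimately show False using that(2) q_coords[of R] by simp
qed


section \<open>Degrees outside the interior of the cone\<close>

text \<open>If the second region is empty, the dimension is the one found near the first ray alone.\<close>

lemma value_empty:
  assumes E: "q R < 0 \<or> (q R = 0 \<and> l' dvd i' R)"
  shows "has_value TYPE('k::field_char_0) R (expected_value R)"
proof -
  have Q: "q R \<le> 0" using E by auto
  have empty: "side2.bad R = {}"
  proof (rule ccontr)
    assume "side2.bad R \<noteq> {}"
    then obtain x where x: "x \<in> side2.bad R" by blast
    have S: "x \<in> S" using x by (rule side2.bad_S)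
    have "0 \<le> q x" by (rule side2.p_nonneg[OF S])
    moreover have "q x < q R \<or> (q x = q R \<and> \<not> l' dvd (i' x - i' R))" using x by (simp add: side2.bad_def)
    ultimately have "q x = 0" "q R = 0" "\<not> l' dvd (i' x - i' R)" using E by auto
    moreover have "l' dvd i' x" using side2.ray_dvd[OF S] \<open>q x = 0\<close> by simp
    ultimately show False using E by simp
  qed
  have r2: "ray_term l' (q R) (i' R) = 0"
    using E zdvd_not_zless[of "i' R" l'] by (auto simp: ray_term_def)
  have exp: "expected_value R = max 0 (ray_term l (p R) (i R))"
    using expected_boundary[OF Q] r2 by simp
  consider "p R \<le> 0" | "p R = 1" | "p R = 2" "l = 2" "even (i R)" | "2 \<le> p R" "\<not> (p R = 2 \<and> l = 2 \<and> even (i R))"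
    by linarith
  then show ?thesis
  proof cases
    case 1
    have "ray_term l (p R) (i R) = 0"
    proof -
      have "i R \<le> 0" if "p R = 0"
      proof -
        have "i R * n \<le> 0" using that Q q_coords[of R] by simp
        then show ?thesis using n_pos by (simp add: mult_le_0_iff)
      qed
      then show ?thesis using 1 by (auto simp: ray_term_def)
    qed
    then show ?thesis using exp by (intro has_valueI[OF dim_side1[OF empty side1.dim_low[OF 1]]]) simp
  next
    case 2
    then have "ray_term l (p R) (i R) = l - 2" using i_neg_below Q by (simp add: ray_term_def)
    then show ?thesis using exp by (intro has_valueI[OF dim_side1[OF empty side1.dim_one[OF 2]]]) simp
  next
    case 3
    then have "i R < 0" using i_neg_below Q by simp
    then have "ray_term l (p R) (i R) = 1" using 3 by (simp add: ray_term_def)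
    then show ?thesis using exp by (intro has_valueI[OF dim_side1[OF empty side1.dim_special[OF 3]]]) simp
  next
    case 4
    then have "ray_term l (p R) (i R) = 0" by (auto simp: ray_term_def)
    then show ?thesis using exp by (intro has_valueI[OF dim_side1[OF empty side1.dim_linear[OF 4]]]) simp
  qed
qed

text \<open>If \<open>R\<close> lies on an edge but not in its group, the second region is contained in that edge and
  adds one coordinate, unless the first region already contains \<open>l' e'\<close>.\<close>

lemma value_ray:
  assumes Q: "q R = 0" "\<not> l' dvd i' R" and P: "0 < p R"
  shows "has_value TYPE('k::field_char_0) R (expected_value R)"
proof -
  have pR: "p R = i' R * n" using p_on_ray2[OF Q(1)] .
  then have J: "1 \<le> i' R" using P n_pos by (simp add: zero_less_mult_iff)
  have l'2: "2 \<le> l'" using Q(2) l'_pos by (cases "l' = 1") auto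
  have exp: "expected_value R = max 0 (ray_term l (p R) (i R) + ray_term l' (q R) (i' R))"
    using expected_boundary Q(1) by simp
  have r2: "ray_term l' (q R) (i' R) = (if i' R < l' then 1 else 0)"
    using Q J by (simp add: ray_term_def)
  have I: "i R < 0" using i_neg_below P Q(1) by simp
  consider "p R = 1" | "p R = 2" "l = 2" "even (i R)" | "2 \<le> p R" "\<not> (p R = 2 \<and> l = 2 \<and> even (i R))"
    using P by linarith
  then show ?thesis
  proof cases
    case 1
    then have "i' R = 1" using pR J n_pos by (simp add: zmult_eq_1_iff)
    then have "ray_term l' (q R) (i' R) = 1" using r2 l'2 by simp
    moreover have "ray_term l (p R) (i R) = l - 2" using 1 I by (simp add: ray_term_def)
    ultimately show ?thesis using exp l_pos by (intro has_valueI[OF dim_one_ray[OF 1 Q]]) simp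
  next
    case 2
    \<comment> \<open>\<open>R\<close> is twice a lattice point, so it is not the primitive vector \<open>e'\<close>.\<close>
    have "i' R \<noteq> 1"
    proof
      assume "i' R = 1"
      then have "R = e'" using Q(1) by (intro side2.pt_eqI) simp_all
      moreover obtain k where k: "i R = 2 * k" using 2(3) by (auto elim: evenE)
      have "R = zscale 2 (side1.pt 1 k)" by (rule side1.pt_eqI) (simp_all add: 2 k)
      then have "i' R = 2 * i' (side1.pt 1 k)" by simp
      then show False using \<open>i' R = 1\<close> by presburger
    qed
    moreover have "i' R * 1 \<le> i' R * n" using J n_pos by (intro mult_left_mono) simp_all
    ultimately have "i' R = 2" using J pR 2(1) by linarith
    then have "2 < l'" using Q(2) l'2 by (cases "l' = 2") auto
    then have "ray_term l' (q R) (i' R) = 1" using r2 \<open>i' R = 2\<close> by simp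
    moreover have "ray_term l (p R) (i R) = 1" using 2 I by (simp add: ray_term_def)
    ultimately show ?thesis using exp by (intro has_valueI[OF dim_special_ray[OF 2 Q]]) simp
  next
    case 3
    then have "ray_term l (p R) (i R) = 0" by (auto simp: ray_term_def)
    then show ?thesis using exp r2 by (intro has_valueI[OF dim_linear_ray[OF 3 Q]]) simp
  qed
qed


section \<open>Degrees at height one over a ray\<close>

lemma level_one_range:
  assumes "p R = 1" "0 < q R"
  shows "0 \<le> i R"
proof (rule ccontr)
  assume "\<not> 0 \<le> i R"
  then have "i R * n \<le> - 1 * n" using n_pos by (intro mult_right_mono) simp_all
  then show False using assms q_coords[of R] q_b by simp
qed

lemma singular_q_b: "2 \<le> n \<Longrightarrow> q b < n"
proof (rule ccontr)
  assume n: "2 \<le> n" and "\<not> q b < n"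
  then have "q b = n" using q_b by simp
  then have "q (side1.pt 1 (- 1)) = 0" using q_coords[of "side1.pt 1 (- 1)"] by simp
  then have "i' (side1.pt 1 (- 1)) * n = 1" using p_on_ray2[of "side1.pt 1 (- 1)"] by simp
  then show False using n zmult_eq_1_iff[of "i' (side1.pt 1 (- 1))" n] by auto
qed

lemma level_one_one:
  assumes P: "p R = 1" and Q: "q R = 1"
  shows "i R = 0" "q b = 1" "R = b"
proof -
  have I: "0 \<le> i R" using level_one_range P Q by simp
  have eq: "q b + i R * n = 1" using q_coords[of R] P Q by simp
  show I0: "i R = 0"
  proof (rule ccontr)
    assume "i R \<noteq> 0"
    then have "1 \<le> i R * n" using I n_pos by (simp add: int_one_le_iff_zero_less)
    then show False using eq q_b by simp
  qed
  show "q b = 1" using eq I0 by simp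
  show "R = b" using I0 P by (intro side1.pt_eqI) simp_all
qed

text \<open>Here \<open>R = b = b'\<close>. For \<open>n \<ge> 2\<close> the overlap is zero. For \<open>n = 1\<close> it contains \<open>e\<close> if \<open>l = 1\<close>
  and \<open>l' \<ge> 2\<close>, and symmetrically \<open>e'\<close>, which costs one dimension.\<close>

lemma value_one_one:
  assumes P: "p R = 1" and Q: "q R = 1"
  shows "has_value TYPE('k::field_char_0) R (expected_value R)"
proof -
  interpret sw: cone_chain q i' p i e' b' e b l' l n S s "\<lambda>j. w (Suc s - j)" "\<lambda>j. a (Suc s - j)"
    by (rule swap_chain)
  note L = level_one_one[OF P Q] and L' = sw.level_one_one[OF Q P]
  have r: "ray_term l (p R) (i R) = l - 1" "ray_term l' (q R) (i' R) = l' - 1"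
    using P Q L(1) L'(1) by (simp_all add: ray_term_def)
  show ?thesis
  proof (cases rule: n_cases)
    case singular
    have "w 1 = w s" using w_first w_last L(3) L'(3) by simp
    then have s1: "s = 1" using p_strict[OF singular, of 1 s] s_pos by (cases "s = 1") auto
    have R1: "R = zscale 1 (w 1)" using L(3) w_first by simp
    have a1: "2 \<le> a 1" using a_ge_2[OF singular, of 1] s_pos by simp
    have "chain_term R = 0"
      using chain_term_multiple[OF singular _ _ _ R1] s1 a1 by simp
    moreover have "R \<noteq> zscale (a 1) (w 1)"
      using multiple_unique[OF singular, of 1 1 1 "a 1"] R1 s1 a1 by auto
    ultimately have exp: "expected_value R = l + l' - 2"
      using r singular l_pos l'_pos by (simp add: expected_value_def generic_value_def)
    have inter: "x = 0" if x: "x \<in> side1.bad R" "x \<in> side2.bad R" for x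
    proof -
      note B = both_badD[OF x]
      have qx: "q x = p x + i x * n" using q_coords[of x] L(2) by simp
      have "p x = 0 \<or> p x = 1" using B(2,4) P by linarith
      moreover have "i x = 0"
      proof (rule ccontr)
        assume "i x \<noteq> 0"
        then consider "1 \<le> i x" | "i x \<le> - 1" by linarith
        then show False
        proof cases
          case 1
          then have "1 * n \<le> i x * n" using n_pos by (intro mult_right_mono) simp_all
          then show False using qx B(2,5) Q singular by linarith
        next
          case 2
          then have "i x * n \<le> - 1 * n" using n_pos by (intro mult_right_mono) simp_all
          then show False using qx B(3,4) P singular by linarith
        qed
      qed
      ultimately have "x = 0 \<or> x = b"
        using side1.pt_eta[of x] b_pt side1.pt_zero by metis
      then show ?thesis using B(6) L(3) by blast
    qed
    show ?thesis using exp l_pos l'_pos by (intro has_valueI[OF dim_one_one[OF P Q inter]]) simp_all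
  next
    case smooth
    note sm = smooth_facts[OF smooth(1)]
    have R0: "R = side1.pt 1 0" using L(3) b_pt by simp
    have R0': "R = side2.pt 1 0" using L'(3) b'_pt by simp
    have gen: "generic_value R = l + l' - 2"
      using r smooth_chain_term[OF smooth(1)] l_pos l'_pos by (simp add: generic_value_def)
    have R2: "R \<noteq> zscale 2 b"
    proof
      assume "R = zscale 2 b"
      then have "p R = 2" by simp
      then show False using P by simp
    qed
    have eq1: "R = side1.pt 1 j \<longleftrightarrow> j = 0" for j unfolding R0 by auto
    have eq2: "R = side2.pt 1 j \<longleftrightarrow> j = 0" for j unfolding R0' by auto
    have c: "(\<exists>m. 1 \<le> m \<and> m \<le> l' - 1 \<and> R = side2.pt 1 (m - 1)) \<longleftrightarrow> 2 \<le> l'"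
            "(\<exists>m. 1 \<le> m \<and> m \<le> l - 1 \<and> R = side1.pt 1 (m - 1)) \<longleftrightarrow> 2 \<le> l"
      unfolding eq1 eq2 by presburger+
    have d: "R = side1.pt 1 (l - 1) \<longleftrightarrow> l = 1" "R = side2.pt 1 (l' - 1) \<longleftrightarrow> l' = 1"
      unfolding eq1 eq2 by presburger+
    have exp: "expected_value R = (if (l = 1 \<and> 2 \<le> l') \<or> (l' = 1 \<and> 2 \<le> l) then l + l' - 3 else l + l' - 2)"
      unfolding expected_value_def c d using R2 smooth(1) gen by auto
    have e_p: "p e' = 1" "q e = 1" using smooth(1) by simp_all
    have inter: "x = 0 \<or> (x = e \<and> l = 1 \<and> 2 \<le> l') \<or> (x = e' \<and> l' = 1 \<and> 2 \<le> l)"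
      if x: "x \<in> side1.bad R" "x \<in> side2.bad R" for x
    proof -
      note B = both_badD[OF x]
      have qx: "q x = p x + i x" by (rule sm)
      have "p x = 0 \<or> p x = 1" "q x = 0 \<or> q x = 1" using B(2-5) P Q by linarith+
      then consider "p x = 0" "q x = 0" | "p x = 0" "q x = 1" | "p x = 1" "q x = 0" | "p x = 1" "q x = 1" by blast
      then show ?thesis
      proof cases
        case 1
        then have "x = 0" by (intro pq_eqI) simp_all
        then show ?thesis by simp
      next
        case 2
        then have "x = e" using smooth(1) by (intro pq_eqI) simp_all
        moreover have "l = 1" using B(9) 2 qx l_pos zdvd1_eq[of l] by simp
        moreover have "\<not> l' dvd 1" using B(8) 2 Q qx L'(1) by (simp add: sm(7))
        then have "l' \<noteq> 1" by auto
        ultimately show ?thesis using l'_pos by simp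
      next
        case 3
        then have "x = e'" using smooth(1) by (intro pq_eqI) simp_all
        moreover have ix: "i x = - 1" using 3 qx by simp
        have "l' dvd 1" using B(10) 3 ix by (simp add: sm(7))
        then have "l' = 1" using l'_pos by simp
        moreover have "\<not> l dvd 1" using B(7) 3 P ix L(1) by simp
        then have "l \<noteq> 1" by auto
        ultimately show ?thesis using l_pos by simp
      next
        case 4
        then have "x = R" using P Q by (intro pq_eqI) simp_all
        then show ?thesis using B(6) by blast
      qed
    qed
    consider "l = 1" "2 \<le> l'" | "l' = 1" "2 \<le> l" | "\<not> (l = 1 \<and> 2 \<le> l')" "\<not> (l' = 1 \<and> 2 \<le> l)" by blast
    then show ?thesis
    proof cases
      case 1
      have "\<not> l' dvd 1" using 1 zdvd_not_zless[of 1 l'] by simp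
      then have "e \<in> side2.bad R"
        unfolding side2.bad_def using side1.ray_in_S[of 1] 1 Q L'(1) e_p
        by (simp add: sm(7) side1.pt_def)
      then show ?thesis using exp 1 by (intro has_valueI[OF dim_one_one_overlap[OF P Q 1(1) _ 1(2)]]) simp_all
    next
      case 2
      have "\<not> l dvd 1" using 2 zdvd_not_zless[of 1 l] by simp
      moreover have "i e' = - 1" using sm(7)[of e'] by simp
      ultimately have "e' \<in> side1.bad R"
        unfolding side1.bad_def using side2.ray_in_S[of 1] 2 P L(1) e_p
        by (simp add: side2.pt_def)
      then have "additive_dim TYPE('k) S (sw.K R) (nat (l - 2))" by (rule sw.dim_one_one_overlap[OF Q P 2(1) _ 2(2)])
      then have "additive_dim TYPE('k) S (K R) (nat (l - 2))" by (simp add: K_def sw.K_def Un_commute)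
      then show ?thesis using exp 2 by (intro has_valueI) (assumption, simp)
    next
      case 3
      have "x = 0" if "x \<in> side1.bad R" "x \<in> side2.bad R" for x using inter[OF that] 3 by blast
      then show ?thesis using exp 3 l_pos l'_pos by (intro has_valueI[OF dim_one_one[OF P Q]]) (blast, simp)
    qed
  qed
qed

text \<open>The boundary index of \<open>dim_one_linear\<close> is zero, except for \<open>n = 1\<close> and \<open>l' = 1\<close>: then the
  point with \<open>i = - 1\<close>, which lies on the other edge, belongs to \<open>S\<close>.\<close>

lemma value_one_linear:
  assumes P: "p R = 1" and lin: "2 \<le> q R" "\<not> (q R = 2 \<and> l' = 2 \<and> even (i' R))"
  shows "has_value TYPE('k::field_char_0) R (expected_value R)"
proof -
  have I: "0 \<le> i R" using level_one_range P lin by simp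
  have r2: "ray_term l' (q R) (i' R) = 0" using lin by (auto simp: ray_term_def)
  have r1: "ray_term l (p R) (i R) = (if i R = 0 then l - 1 else if i R \<le> l - 1 then l - i R else 0)"
    using P I by (simp add: ray_term_def)
  have qR: "q R = q b + i R * n" using q_coords[of R] P by simp
  have Rpt: "R = side1.pt 1 (i R)" using side1.pt_eta[of R] P by simp
  have q1: "q (side1.pt 1 j) = q b + j * n" for j using q_coords[of "side1.pt 1 j"] by simp
  have above: "side1.pt 1 j \<notin> side2.bad R" if "i R < j" for j
  proof
    assume "side1.pt 1 j \<in> side2.bad R"
    then have "q b + j * n \<le> q b + i R * n" unfolding side2.bad_def using q1 qR by auto
    then show False using that n_pos by simp
  qed
  have below: "side1.pt 1 j \<in> side2.bad R" if "side1.pt 1 j \<in> S" "j < i R" for j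
    unfolding side2.bad_def using that q1[of j] qR n_pos by simp
  have ray_S: "side1.pt 0 l \<in> S" using side1.ray_in_S[of 1] by simp
  have q_ray: "q (side1.pt 0 l) = l * n" using q_coords[of "side1.pt 0 l"] by simp
  show ?thesis
  proof (cases rule: n_cases)
    case singular
    have qb: "q b < n" by (rule singular_q_b[OF singular])
    have ray: "side1.pt 0 l \<in> side2.bad R \<longleftrightarrow> l \<le> i R"
    proof
      assume "side1.pt 0 l \<in> side2.bad R"
      then have le: "l * n \<le> q b + i R * n" unfolding side2.bad_def using q_ray qR by auto
      show "l \<le> i R"
      proof (rule ccontr)
        assume "\<not> l \<le> i R"
        then have "(i R + 1) * n \<le> l * n" using n_pos by (intro mult_right_mono) simp_all
        then have "i R * n + n \<le> l * n" by (simp add: distrib_right)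
        then show False using le qb by linarith
      qed
    next
      assume "l \<le> i R"
      then have "l * n \<le> i R * n" using n_pos by (intro mult_right_mono) simp_all
      then have "l * n < q R" using qR q_b by linarith
      then show "side1.pt 0 l \<in> side2.bad R" unfolding side2.bad_def using ray_S q_ray by simp
    qed
    have low: "0 \<le> i x" if "x \<in> S" "p x = 1" for x
    proof (rule ccontr)
      assume "\<not> 0 \<le> i x"
      then have "i x * n \<le> - 1 * n" using n_pos by (intro mult_right_mono) simp_all
      then have "q x < 0" using q_coords[of x] that(2) qb by simp
      then show False using side2.p_nonneg[OF that(1)] by simp
    qed
    have below': "side1.pt 1 j \<in> side2.bad R" if "0 \<le> j" "j < i R" for j
      using that by (intro below side1.S_quadrant) simp_all
    have dim: "additive_dim TYPE('k) S (K R)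
      (nat (0 + l - 1 - i R) + (if side1.pt 0 l \<in> side2.bad R then 0 else 1))"
      by (rule dim_one_linear[OF P lin I I]) (use low below' above ray in \<open>auto\<close>)
    have chain: "chain_term R = of_bool (i R = 0)"
    proof (cases "i R = 0")
      case True
      then have R: "R = zscale 1 (w 1)" using Rpt b_pt w_first by simp
      have "s \<noteq> 1"
      proof
        assume "s = 1"
        then have "q b = 1" using w_first w_last basis' by simp
        then show False using qR True lin(1) by simp
      qed
      then show ?thesis using chain_term_multiple[OF singular _ _ _ R] s_pos True by simp
    next
      case False
      have "chain_term R = 0"
      proof (rule chain_term_zero)
        fix k and m :: int assume k: "1 \<le> k" "k \<le> s" "1 \<le> m"
        show "R \<noteq> zscale m (w k)"
        proof
          assume R: "R = zscale m (w k)"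
          then have "m * p (w k) = 1" using P by simp
          then have pk: "p (w k) = 1" "m = 1" using k p_w_pos[OF singular, of k] by (simp_all add: zmult_eq_1_iff)
          have "k = 1" using p_strict[OF singular, of 1 k] pk k w_first by (cases "k = 1") auto
          then have "R = b" using R pk w_first by simp
          then show False using False by simp
        qed
      qed
      then show ?thesis using False by simp
    qed
    have "\<not> (s = 1 \<and> R = zscale (a 1) (w 1))"
    proof
      assume "s = 1 \<and> R = zscale (a 1) (w 1)"
      then have "a 1 = 1" using P w_first by simp
      then show False using a_ge_2[OF singular, of 1] s_pos by simp
    qed
    then have "expected_value R = generic_value R" unfolding expected_value_def using singular by auto
    also have "\<dots> = (if i R \<le> l - 1 then l - i R else 0)"
      using r1 r2 chain I l_pos by (simp add: generic_value_def)
    finally have exp: "expected_value R = (if i R \<le> l - 1 then l - i R else 0)" .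
    show ?thesis by (rule has_valueI[OF dim]) (simp add: exp ray)
  next
    case smooth
    note sm = smooth_facts[OF smooth(1)]
    have I1: "1 \<le> i R" using qR sm(3) smooth(1) lin(1) by simp
    have chain: "chain_term R = 0" by (rule smooth_chain_term[OF smooth(1)])
    have gen: "generic_value R = (if i R \<le> l - 1 then l - i R else 0)"
      using r1 r2 chain I1 by (simp add: generic_value_def)
    have R2: "R \<noteq> zscale 2 b"
    proof
      assume "R = zscale 2 b"
      then have "p R = 2" by simp
      then show False using P by simp
    qed
    have R': "R \<noteq> side2.pt 1 j" for j
    proof
      assume "R = side2.pt 1 j"
      then have "q R = 1" by simp
      then show False using lin(1) by simp
    qed
    have c: "(\<exists>m. 1 \<le> m \<and> m \<le> l - 1 \<and> R = side1.pt 1 (m - 1)) \<longleftrightarrow> i R \<le> l - 2"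
    proof
      assume "\<exists>m. 1 \<le> m \<and> m \<le> l - 1 \<and> R = side1.pt 1 (m - 1)"
      then obtain m where "m \<le> l - 1" "R = side1.pt 1 (m - 1)" by blast
      then show "i R \<le> l - 2" by simp
    next
      assume "i R \<le> l - 2"
      then show "\<exists>m. 1 \<le> m \<and> m \<le> l - 1 \<and> R = side1.pt 1 (m - 1)"
        using I Rpt by (intro exI[of _ "i R + 1"]) simp
    qed
    have d: "R = side1.pt 1 (l - 1) \<longleftrightarrow> i R = l - 1"
      using Rpt by (metis side1.i_pt)
    have exp: "expected_value R = (if l' \<ge> 2 then (if i R \<le> l - 2 then l - i R else 0)
        else (if i R \<le> l - 2 then l - i R - 1 else if i R = l - 1 then 1 else 0))"
      unfolding expected_value_def c d using R2 R' smooth(1) gen l'_pos I1 by auto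
    have qx: "q x = p x + i x" for x by (rule sm)
    have qR': "q R = 1 + i R" using qx[of R] P by simp
    show ?thesis
    proof (cases "2 \<le> l'")
      case True
      have nd: "\<not> l' dvd 1" using True zdvd_not_zless[of 1 l'] by simp
      have ray: "side1.pt 0 l \<in> side2.bad R \<longleftrightarrow> l \<le> i R + 1"
      proof -
        have "side1.pt 0 l \<in> side2.bad R \<longleftrightarrow> l < 1 + i R \<or> (l = 1 + i R \<and> \<not> l' dvd (i R - l))"
          unfolding side2.bad_def using ray_S by (simp add: qx sm(7) P)
        moreover have "\<not> l' dvd (i R - l)" if "l = 1 + i R"
        proof -
          have "i R - l = - 1" using that by simp
          then show ?thesis using nd by (simp only: dvd_minus_iff not_False_eq_True)
        qed
        ultimately show ?thesis by (cases "l = 1 + i R") auto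
      qed
      have low: "0 \<le> i x" if "x \<in> S" "p x = 1" for x
      proof (rule ccontr)
        assume "\<not> 0 \<le> i x"
        moreover have "0 \<le> q x" by (rule side2.p_nonneg[OF that(1)])
        ultimately have "i x = - 1" "q x = 0" using qx[of x] that(2) by simp_all
        then show False using side2.ray_dvd[OF that(1)] nd by (simp add: sm(7))
      qed
      have below': "side1.pt 1 j \<in> side2.bad R" if "0 \<le> j" "j < i R" for j
        using that by (intro below side1.S_quadrant) simp_all
      have dim: "additive_dim TYPE('k) S (K R)
        (nat (0 + l - 1 - i R) + (if side1.pt 0 l \<in> side2.bad R then 0 else 1))"
        by (rule dim_one_linear[OF P lin I I]) (use low below' above ray in \<open>auto\<close>)
      show ?thesis by (rule has_valueI[OF dim]) (use True in \<open>auto simp: exp ray\<close>)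
    next
      case False
      then have l': "l' = 1" using l'_pos by simp
      have ray: "side1.pt 0 l \<in> side2.bad R \<longleftrightarrow> l \<le> i R"
        unfolding side2.bad_def using ray_S l' by (simp add: qx P) linarith
      have low: "- 1 \<le> i x" if "x \<in> S" "p x = 1" for x
        using side2.p_nonneg[OF that(1)] qx[of x] that(2) by simp
      have below': "side1.pt 1 j \<in> side2.bad R" if "- 1 \<le> j" "j < i R" for j
      proof (rule below)
        show "side1.pt 1 j \<in> S" unfolding S_iff using that l' by (simp add: qx) linarith
      qed (use that in simp)
      have dim: "additive_dim TYPE('k) S (K R)
        (nat (- 1 + l - 1 - i R) + (if side1.pt 0 l \<in> side2.bad R then 0 else 1))"
        by (rule dim_one_linear[OF P lin I]) (use I low below' above ray in \<open>auto\<close>)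
      show ?thesis by (rule has_valueI[OF dim]) (use False in \<open>auto simp: exp ray\<close>)
    qed
  qed
qed


section \<open>Degrees with an exceptional side\<close>

lemma special_even_range:
  assumes sp: "p R = 2" "even (i R)" and "0 < q R"
  shows "0 \<le> i R"
proof (rule ccontr)
  assume "\<not> 0 \<le> i R"
  then have "i R \<le> - 2" using sp(2) by presburger
  then have "i R * n \<le> - 2 * n" using n_pos by (intro mult_right_mono) simp_all
  then show False using assms q_coords[of R] q_b by simp
qed

lemma expected_value_smooth:
  assumes n: "n = 1" and P: "2 \<le> p R" and Q: "2 \<le> q R"
  shows "expected_value R = (if R = zscale 2 b then (if l \<le> 2 \<and> l' \<le> 2 \<and> (l, l') \<noteq> (1, 1) then 1 else 0)
    else generic_value R)"
proof -
  have "R \<noteq> side1.pt 1 j" for j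
  proof
    assume "R = side1.pt 1 j"
    then have "p R = 1" by simp
    then show False using P by simp
  qed
  moreover have "R \<noteq> side2.pt 1 j" for j
  proof
    assume "R = side2.pt 1 j"
    then have "q R = 1" by simp
    then show False using Q by simp
  qed
  ultimately show ?thesis unfolding expected_value_def using n by simp
qed

text \<open>Two exceptional sides force \<open>R = 2 b = 2 b'\<close>.\<close>

lemma value_special_special:
  assumes sp: "p R = 2" "l = 2" "even (i R)" and sp': "q R = 2" "l' = 2" "even (i' R)"
  shows "has_value TYPE('k::field_char_0) R (expected_value R)"
proof -
  interpret sw: cone_chain q i' p i e' b' e b l' l n S s "\<lambda>j. w (Suc s - j)" "\<lambda>j. a (Suc s - j)"
    by (rule swap_chain)
  have zero: "i R = 0 \<and> q b = 1"
  proof -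
    have I: "0 \<le> i R" using special_even_range[OF sp(1,3)] sp'(1) by simp
    have eq: "2 * q b + i R * n = 2" using q_coords[of R] sp(1) sp'(1) by simp
    have "0 \<le> i R * n" using I n_pos by simp
    then have "i R * n = 0" using eq q_b by linarith
    then show ?thesis using n_pos eq by simp
  qed
  have zero': "i' R = 0"
  proof -
    have I: "0 \<le> i' R" using sw.special_even_range[OF sp'(1,3)] sp(1) by simp
    have eq: "2 * p b' + i' R * n = 2" using p_coords[of R] sp(1) sp'(1) by simp
    have "0 \<le> i' R * n" using I n_pos by simp
    then have "i' R * n = 0" using eq p_b' by linarith
    then show ?thesis using n_pos by simp
  qed
  have Rb: "R = zscale 2 b" by (rule side1.pt_eqI) (simp_all add: sp zero)
  have Rb': "R = zscale 2 b'" by (rule side2.pt_eqI) (simp_all add: sp' zero')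
  have bb: "b = b'" using Rb Rb' by (simp add: zscale_def prod_eq_iff)
  show ?thesis
  proof (cases rule: n_cases)
    case smooth
    have "expected_value R = 1"
      using expected_value_smooth[OF smooth(1)] sp sp' Rb by simp
    then show ?thesis by (intro has_valueI[OF dim_special_special_smooth[OF sp sp' smooth(1)]]) simp
  next
    case singular
    have s1: "s = 1" using p_strict[OF singular, of 1 s] w_first w_last bb s_pos by (cases "s = 1") auto
    have R: "R = zscale 2 (w 1)" using Rb w_first by simp
    have a2: "2 \<le> a 1" using a_ge_2[OF singular, of 1] s_pos by simp
    have chain: "chain_term R = 1"
      using chain_term_multiple[OF singular _ _ _ R] s1 a2 by (auto split: if_splits)
    have "ray_term l (p R) (i R) = 1" "ray_term l' (q R) (i' R) = 1"
      using sp sp' zero zero' by (simp_all add: ray_term_def)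
    then have exp: "expected_value R = 3"
      unfolding expected_value_def generic_value_def using singular sp(2) sp'(2) chain by simp
    have inter: "x = 0 \<or> x = b" if x: "x \<in> side1.bad R" "x \<in> side2.bad R" for x
    proof -
      note B = both_badD[OF x]
      have qx: "q x = p x + i x * n" using q_coords[of x] zero by simp
      have up: "2 * n \<le> i x * n" if "2 \<le> i x" using that n_pos by (intro mult_right_mono) simp_all
      have up1: "1 * n \<le> i x * n" if "1 \<le> i x" using that n_pos by (intro mult_right_mono) simp_all
      have down: "i x * n \<le> - 1 * n" if "i x \<le> - 1" using that n_pos by (intro mult_right_mono) simp_all
      have down2: "i x * n \<le> - 2 * n" if "i x \<le> - 2" using that n_pos by (intro mult_right_mono) simp_all
      consider "p x = 0" | "p x = 1" | "p x = 2" using B(2,4) sp(1) by linarith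
      then show ?thesis
      proof cases
        case 1
        then have "even (i x)" using B(9) sp(2) by simp
        moreover have "\<not> 2 \<le> i x" using up qx 1 B(5) sp'(1) singular by linarith
        moreover have "\<not> i x \<le> - 1" using down qx 1 B(3) singular by linarith
        ultimately have "i x = 0" by presburger
        then have "x = 0" using side1.pt_eta[of x] 1 by simp
        then show ?thesis ..
      next
        case 2
        have "\<not> 1 \<le> i x" using up1 qx 2 B(5) sp'(1) singular by linarith
        moreover have "\<not> i x \<le> - 1" using down qx 2 B(3) singular by linarith
        ultimately have "i x = 0" by linarith
        then have "x = b" using side1.pt_eta[of x] 2 b_pt by simp
        then show ?thesis ..
      next
        case 3
        then have odd: "odd (i x)" using B(7) sp zero by simp
        moreover have "\<not> 1 \<le> i x" using up1 qx 3 B(5) sp'(1) singular by linarith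
        moreover have "\<not> i x \<le> - 2" using down2 qx 3 B(3) singular by linarith
        ultimately have ix: "i x = - 1" by presburger
        then have "q x = 0" "n = 2" using qx 3 B(3) singular by simp_all
        then have "i' x * 2 = 2" using p_on_ray2[of x] 3 by simp
        then show ?thesis using B(10) \<open>q x = 0\<close> sp'(2) by simp
      qed
    qed
    show ?thesis using exp by (intro has_valueI[OF dim_special_special[OF sp sp' bb inter]]) simp_all
  qed
qed

text \<open>If \<open>i R > 0\<close>, the overlap has full rank. Otherwise \<open>R = 2 b\<close>, and for \<open>n \<ge> 2\<close> the overlap
  consists of \<open>0\<close>, \<open>b\<close> and possibly the point \<open>z\<close> at height two with \<open>i z = - 1\<close>; the latter is
  \<open>w 2\<close> if \<open>a 1 = 2\<close>, and lies outside the cone if \<open>a 1 > 2\<close>.\<close>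

lemma value_special_linear:
  assumes sp: "p R = 2" "l = 2" "even (i R)" and lin: "2 \<le> q R" "\<not> (q R = 2 \<and> l' = 2 \<and> even (i' R))"
  shows "has_value TYPE('k::field_char_0) R (expected_value R)"
proof -
  have I: "0 \<le> i R" using special_even_range[OF sp(1,3)] lin(1) by simp
  have qR: "q R = 2 * q b + i R * n" using q_coords[of R] sp(1) by simp
  have r2: "ray_term l' (q R) (i' R) = 0" using lin by (auto simp: ray_term_def)
  have r1: "ray_term l (p R) (i R) = of_bool (i R = 0)" using sp I by (simp add: ray_term_def)
  have q1: "q (side1.pt c j) = c * q b + j * n" for c j using q_coords[of "side1.pt c j"] by simp
  have S1: "side1.pt 1 j \<in> S" if "0 \<le> j" for j using that by (intro side1.S_quadrant) simp_all
  show ?thesis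
  proof (cases "i R = 0")
    case False
    then have I2: "2 \<le> i R" using I sp(3) by presburger
    then have "2 * n \<le> i R * n" using n_pos by (intro mult_right_mono) simp_all
    then have in2: "side1.pt 1 j \<in> side2.bad R" if "0 \<le> j" "j \<le> 2" for j
    proof -
      have "j * n \<le> 2 * n" using that n_pos by (intro mult_right_mono) simp_all
      then have "q (side1.pt 1 j) < q R" using q1[of 1 j] qR q_b \<open>2 * n \<le> i R * n\<close> by linarith
      then show ?thesis unfolding side2.bad_def using S1[OF that(1)] by simp
    qed
    have dim: "additive_dim TYPE('k) S (K R) 0"
      by (rule dim_special_linear_0[OF sp lin]) (simp_all add: in2)
    obtain k where k: "i R = 2 * k" using sp(3) by (auto elim: evenE)
    have R: "R = zscale 2 (side1.pt 1 k)" by (rule side1.pt_eqI) (simp_all add: sp k)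
    have chain: "chain_term R = 0 \<and> \<not> (s = 1 \<and> R = zscale (a 1) (w 1) \<and> n \<noteq> 1)"
    proof (cases rule: n_cases)
      case smooth then show ?thesis using smooth_chain_term by simp
    next
      case singular
      have none: "R \<noteq> zscale m (w j)" if j: "1 \<le> j" "j \<le> s" "1 \<le> m" for j m
      proof
        assume eq: "R = zscale m (w j)"
        then have pj: "m * p (w j) = 2" "m * i (w j) = i R" using sp by simp_all
        have "0 < p (w j)" using p_w_pos[OF singular] j by simp
        have "m dvd 2" using pj(1) by (metis dvd_triv_left)
        then have "m \<le> 2" by (rule zdvd_imp_le) simp
        then consider "m = 1" | "m = 2" using j(3) by linarith
        then show False
        proof cases
          case 1
          then have "w j = zscale 2 (side1.pt 1 k)" using eq R by simp
          then have "2 * det (side1.pt 1 k) (w (Suc j)) = 1" using det_w[OF j(2)] by (simp add: det_scale_left)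
          then show False by presburger
        next
          case 2
          then have "p (w j) = 1" using pj by simp
          then have "j = 1" using p_strict[OF singular, of 1 j] j w_first by (cases "j = 1") auto
          then have "i (w j) = 0" using w_first by simp
          then show False using pj(2) False by simp
        qed
      qed
      have "R \<noteq> zscale (a 1) (w 1)" using none[of 1 "a 1"] a_ge_2[OF singular, of 1] s_pos by simp
      then show ?thesis using chain_term_zero none by blast
    qed
    have "expected_value R = 0"
    proof (cases "n = 1")
      case True
      have "R \<noteq> zscale 2 b" using False by auto
      then show ?thesis using expected_value_smooth[OF True] sp(1) lin(1) chain r1 r2 False by (simp add: generic_value_def)
    next
      case nn: False
      then show ?thesis unfolding expected_value_def generic_value_def using chain r1 r2 False by auto
    qed
    then show ?thesis by (intro has_valueI[OF dim]) simp
  next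
    case True
    have Rb: "R = zscale 2 b" by (rule side1.pt_eqI) (simp_all add: sp True)
    have qR2: "q R = 2 * q b" using qR True by simp
    have b_bad: "b \<in> side1.bad R" "b \<in> side2.bad R"
      using both_bad_interior[of b R] S1[of 0] b_pt sp(1) qR2 q_b by simp_all
    have r1': "ray_term l (p R) (i R) = 1" using r1 True by simp
    show ?thesis
    proof (cases rule: n_cases)
      case smooth
      note sm = smooth_facts[OF smooth(1)]
      have qx: "q x = p x + i x" for x by (rule sm)
      have Q2: "q R = 2" using qR2 sm(3) by simp
      have l'2: "l' \<noteq> 2" using lin Q2 True by (simp add: sm(7))
      have exp: "expected_value R = (if l' \<le> 2 then 1 else 0)"
        using expected_value_smooth[OF smooth(1)] sp lin(1) Rb by simp
      show ?thesis
      proof (cases "l' = 1")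
        case l': True
        have z_S: "e' \<in> S" using side2.ray_in_S[of 1] l' by (simp add: side2.pt_def)
        have z: "e' \<in> side1.bad R" "e' \<in> side2.bad R" "i e' = - 1"
          using both_bad_interior[OF z_S, of R] smooth(1) sp(1) Q2 sm(7)[of e'] by simp_all
        have inter: "x = 0 \<or> x = b \<or> i x = - 1" if x: "x \<in> side1.bad R" "x \<in> side2.bad R" for x
        proof -
          note B = both_badD[OF x]
          have "q x \<noteq> q R" using B(8) l' by auto
          then have qle: "p x + i x \<le> 1" using B(5) Q2 qx[of x] by simp
          have qge: "0 \<le> p x + i x" using B(3) qx[of x] by simp
          consider "p x = 0" | "p x = 1" | "p x = 2" using B(2,4) sp(1) by linarith
          then show ?thesis
          proof cases
            case 1
            then have "i x = 0" using B(9) sp(2) qle qge by presburger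
            then have "x = 0" using side1.pt_eta[of x] 1 by simp
            then show ?thesis ..
          next
            case 2
            then have "i x = 0 \<or> i x = - 1" using qle qge by linarith
            then show ?thesis using side1.pt_eta[of x] 2 b_pt by auto
          next
            case 3
            then have "odd (i x)" using B(7) sp True by simp
            then have "i x = - 1" using 3 qle qge by presburger
            then show ?thesis by simp
          qed
        qed
        show ?thesis using exp l' by (intro has_valueI[OF dim_special_linear_1[OF sp lin b_bad inter z]]) simp_all
      next
        case False
        then have l': "3 \<le> l'" using l'_pos l'2 by linarith
        have nd: "\<not> l' dvd 1" "\<not> l' dvd 2" using l' zdvd_not_zless[of 1 l'] zdvd_not_zless[of 2 l'] by simp_all
        have ray: "side1.pt 0 2 \<in> S" using side1.ray_in_S[of 1] sp(2) by simp
        have in2: "side1.pt 1 0 \<in> side2.bad R" "side1.pt 1 1 \<in> side2.bad R" "side1.pt 0 2 \<in> side2.bad R"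
          unfolding side2.bad_def using S1[of 0] S1[of 1] ray nd True Q2 by (simp_all add: qx sm(7))
        show ?thesis using exp l' in2 by (intro has_valueI[OF dim_special_linear_0[OF sp lin]]) simp_all
      qed
    next
      case singular
      have qb: "q b < n" by (rule singular_q_b[OF singular])
      have R: "R = zscale 2 (w 1)" using Rb w_first by simp
      have a2: "2 \<le> a 1" using a_ge_2[OF singular, of 1] s_pos by simp
      have chain: "chain_term R = (if 2 < a 1 then 1 else if s = 1 then 1 else 0)"
        using chain_term_multiple[OF singular _ _ _ R] s_pos a2 by auto
      have Ra: "R = zscale (a 1) (w 1) \<longleftrightarrow> a 1 = 2"
        using multiple_unique[OF singular, of 1 1 2 "a 1"] s_pos a2 R by auto
      have exp: "expected_value R = (if 2 < a 1 then 2 else if s = 1 then (if l' = 1 then 1 else 2) else 1)"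
        unfolding expected_value_def generic_value_def Ra using singular chain r1' r2 sp(2) a2 by auto
      define z where "z = side1.pt 2 (- 1)"
      have z_co: "p z = 2" "i z = - 1" "q z = 2 * q b - n" using q1[of 2 "- 1"] by (simp_all add: z_def)
      have inter: "x = 0 \<or> x = b \<or> x = z" if x: "x \<in> side1.bad R" "x \<in> side2.bad R" for x
      proof -
        note B = both_badD[OF x]
        have qx: "q x = p x * q b + i x * n" by (rule q_coords)
        have up: "2 * n \<le> i x * n" if "2 \<le> i x" using that n_pos by (intro mult_right_mono) simp_all
        have up1: "1 * n \<le> i x * n" if "1 \<le> i x" using that n_pos by (intro mult_right_mono) simp_all
        have down: "i x * n \<le> - 1 * n" if "i x \<le> - 1" using that n_pos by (intro mult_right_mono) simp_all
        have down2: "i x * n \<le> - 2 * n" if "i x \<le> - 2" using that n_pos by (intro mult_right_mono) simp_all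
        consider "p x = 0" | "p x = 1" | "p x = 2" using B(2,4) sp(1) by linarith
        then show ?thesis
        proof cases
          case 1
          then have qx1: "q x = i x * n" using qx by simp
          have "even (i x)" using B(9) sp(2) 1 by simp
          moreover have "\<not> 2 \<le> i x" using up qx1 B(5) qR2 qb by linarith
          moreover have "\<not> i x \<le> - 1" using down qx1 B(3) n_pos by linarith
          ultimately have "i x = 0" by presburger
          then have "x = 0" using side1.pt_eta[of x] 1 by simp
          then show ?thesis ..
        next
          case 2
          then have qx1: "q x = q b + i x * n" using qx by simp
          have "\<not> 1 \<le> i x" using up1 qx1 B(5) qR2 qb by linarith
          moreover have "\<not> i x \<le> - 1" using down qx1 B(3) qb by linarith
          ultimately have "i x = 0" by linarith
          then have "x = b" using side1.pt_eta[of x] 2 b_pt by simp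
          then show ?thesis by simp
        next
          case 3
          then have qx1: "q x = 2 * q b + i x * n" using qx by simp
          have "odd (i x)" using B(7) sp True 3 by simp
          moreover have "\<not> 1 \<le> i x" using up1 qx1 B(5) qR2 n_pos by linarith
          moreover have "\<not> i x \<le> - 2" using down2 qx1 B(3) qb by linarith
          ultimately have ix: "i x = - 1" by presburger
          then have "x = z" using side1.pt_eta[of x] 3 by (simp add: z_def)
          then show ?thesis by simp
        qed
      qed
      have w2: "e + w 2 = zscale (a 1) b" using rec[of 1] s_pos w_first by (simp add: numeral_2_eq_2)
      have w2q: "n + q (w 2) = a 1 * q b" using arg_cong[OF w2, of q] by (simp add: q_add)
      show ?thesis
      proof (cases "a 1 = 2 \<and> (s = 1 \<longrightarrow> l' = 1)")
        case case1: True
        have "w 2 = z"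
        proof (rule side1.pt_eqI)
          show "p (w 2) = p z" using arg_cong[OF w2, of p] case1 z_co by (simp add: p_add)
          show "i (w 2) = i z" using arg_cong[OF w2, of i] case1 z_co by (simp add: i_add)
        qed
        have qz: "q z < q R" using z_co qR2 n_pos by simp
        have zS: "z \<in> S"
        proof (cases "s = 1")
          case True
          then have "z = side2.pt 0 1" using \<open>w 2 = z\<close> w_last by (simp add: numeral_2_eq_2 side2.pt_def)
          then show ?thesis using side2.ray_in_S[of 1] case1 True by simp
        next
          case False
          then show ?thesis using w_in_S[OF singular, of 2] s_pos \<open>w 2 = z\<close> by simp
        qed
        have z_bad: "z \<in> side1.bad R" "z \<in> side2.bad R"
          using both_bad_edge1[OF zS _ _ qz] z_co sp True by simp_all
        have inter': "x = 0 \<or> x = b \<or> i x = - 1" if "x \<in> side1.bad R" "x \<in> side2.bad R" for x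
          using inter[OF that] z_co by auto
        show ?thesis using exp case1 by (intro has_valueI[OF dim_special_linear_1[OF sp lin b_bad inter' z_bad z_co(2)]]) auto
      next
        case case2: False
        have "z \<notin> S"
        proof
          assume zS: "z \<in> S"
          show False
          proof (cases "a 1 = 2")
            case True
            then have s1: "s = 1" "l' \<noteq> 1" using case2 by auto
            have "q (w 2) = 0" "i' (w 2) = 1" using w_last s1 by (simp_all add: numeral_2_eq_2)
            moreover have "w 2 = z"
            proof (rule side1.pt_eqI)
              show "p (w 2) = p z" using arg_cong[OF w2, of p] True z_co by (simp add: p_add)
              show "i (w 2) = i z" using arg_cong[OF w2, of i] True z_co by (simp add: i_add)
            qed
            ultimately have "l' dvd 1" using side2.ray_dvd[OF zS] by simp
            then show False using s1 l'_pos by simp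
          next
            case False
            then have "3 * q b \<le> a 1 * q b" using a2 q_b by (intro mult_right_mono) simp_all
            moreover have "q (w 2) < q b" using q_step[OF singular, of 1] s_pos w_first by (simp add: numeral_2_eq_2)
            ultimately have "q z < 0" using w2q z_co(3) by linarith
            then show False using side2.p_nonneg[OF zS] by simp
          qed
        qed
        then have inter': "x = 0 \<or> x = b" if "x \<in> side1.bad R" "x \<in> side2.bad R" for x
          using inter[OF that] side1.bad_S[OF that(1)] by auto
        have "expected_value R = 2" using exp case2 a2 by auto
        then show ?thesis by (intro has_valueI[OF dim_special_linear_2[OF sp lin b_bad inter']]) simp_all
      qed
    qed
  qed
qed


section \<open>Degrees with linear behaviour along both rays\<close>

text \<open>The dimension is two minus the rank of the overlap. If \<open>R = m w\<^sub>k\<close> with \<open>m < a\<^sub>k\<close>, the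
  overlap lies on the line through \<open>w\<^sub>k\<close>; it is zero for \<open>m = 1\<close>. If \<open>R\<close> is no multiple of an
  interior \<open>w\<^sub>k\<close> or if \<open>m > a\<^sub>k\<close>, two independent elements of the overlap are found among the
  neighbouring elements of the chain and their sums. The borderline is \<open>m = a\<^sub>k\<close>, where
  \<open>R = w\<^sub>k\<^sub>-\<^sub>1 + w\<^sub>k\<^sub>+\<^sub>1\<close>: for \<open>s = 1\<close> the only candidates off the line are \<open>e\<close> and \<open>e'\<close>, and one
  of them is in the overlap exactly if one of \<open>l, l'\<close> is one and the other is not.\<close>

lemma value_linear_linear:
  assumes lin: "2 \<le> p R" "\<not> (p R = 2 \<and> l = 2 \<and> even (i R))"
    and lin': "2 \<le> q R" "\<not> (q R = 2 \<and> l' = 2 \<and> even (i' R))"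
  shows "has_value TYPE('k::field_char_0) R (expected_value R)"
proof -
  have r: "ray_term l (p R) (i R) = 0" "ray_term l' (q R) (i' R) = 0" using lin lin' by (auto simp: ray_term_def)
  have rank2: "additive_dim TYPE('k) S (K R) 0"
    if "y \<in> side1.bad R \<and> y \<in> side2.bad R" "z \<in> side1.bad R \<and> z \<in> side2.bad R" "q y * p z \<noteq> p y * q z" for y z
    using that independent_pq[of y z] by (intro dim_linear_linear_2[OF lin lin', of y z]) simp_all
  show ?thesis
  proof (cases rule: n_cases)
    case smooth
    note sm = smooth_facts[OF smooth(1)]
    have qx: "q x = p x + i x" for x by (rule sm)
    have pq_S: "side1.pt c (d - c) \<in> S" if "0 < c" "0 < d" for c d
      using that by (intro interior_S) (simp_all add: qx)
    have b: "side1.pt 1 0 \<in> side1.bad R \<and> side1.pt 1 0 \<in> side2.bad R"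
      using both_bad_interior[of "side1.pt 1 0" R] side1.S_quadrant[of "side1.pt 1 0"] lin(1) lin'(1) by (simp add: qx)
    have "expected_value R = 0"
    proof (cases "R = zscale 2 b")
      case True
      then have "p R = 2" "q R = 2" "i R = 0" "i' R = 0" by (simp_all add: sm)
      then have "l \<noteq> 2" "l' \<noteq> 2" using lin lin' by simp_all
      then show ?thesis using expected_value_smooth[OF smooth(1) lin(1) lin'(1)] True l_pos l'_pos by auto
    next
      case False
      then show ?thesis
        using expected_value_smooth[OF smooth(1) lin(1) lin'(1)] r smooth_chain_term[OF smooth(1)]
        by (simp add: generic_value_def)
    qed
    moreover have "additive_dim TYPE('k) S (K R) 0"
    proof -
      consider "3 \<le> q R" | "3 \<le> p R" | "p R = 2" "q R = 2" "l = 1" | "p R = 2" "q R = 2" "l \<noteq> 1"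
        using lin(1) lin'(1) by linarith
      then show ?thesis
      proof cases
        case 1
        have "side1.pt 1 1 \<in> side1.bad R \<and> side1.pt 1 1 \<in> side2.bad R"
          using both_bad_interior[of "side1.pt 1 1" R] pq_S[of 1 2] lin(1) 1 by (simp add: qx)
        then show ?thesis by (rule rank2[OF b]) (simp add: qx)
      next
        case 2
        have "side1.pt 2 (- 1) \<in> side1.bad R \<and> side1.pt 2 (- 1) \<in> side2.bad R"
          using both_bad_interior[of "side1.pt 2 (- 1)" R] pq_S[of 2 1] lin'(1) 2 by (simp add: qx)
        then show ?thesis by (rule rank2[OF b]) (simp add: qx)
      next
        case 3
        have "side1.pt 0 1 \<in> S" using side1.ray_in_S[of 1] 3 by simp
        then have "side1.pt 0 1 \<in> side1.bad R \<and> side1.pt 0 1 \<in> side2.bad R"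
          using both_bad_interior[of "side1.pt 0 1" R] 3 by (simp add: qx)
        then show ?thesis by (rule rank2[OF b]) (simp add: qx)
      next
        case 4
        have I: "i R = 0" using 4 qx[of R] by simp
        then have "l \<noteq> 2" using lin 4 by simp
        then have "\<not> l dvd 1" using 4 l_pos by simp
        then have "side1.pt 2 (- 1) \<in> side1.bad R \<and> side1.pt 2 (- 1) \<in> side2.bad R"
          using both_bad_edge1[of "side1.pt 2 (- 1)" R] pq_S[of 2 1] 4 I by (simp add: qx)
        then show ?thesis by (rule rank2[OF b]) (simp add: qx)
      qed
    qed
    ultimately show ?thesis by (intro has_valueI) (assumption, simp)
  next
    case singular
    have generic: "expected_value R = chain_term R" if "0 \<le> chain_term R" "\<not> (s = 1 \<and> R = zscale (a 1) (w 1) \<and> (l = 1 \<and> l' \<noteq> 1 \<or> l \<noteq> 1 \<and> l' = 1))"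
      using that singular r unfolding expected_value_def generic_value_def by auto
    have w_coords: "det (w j) (w (Suc j)) \<noteq> 0" if "j \<le> s" for j using det_w[OF that] by simp
    have w_indep: "q (w j) * p (w (Suc j)) \<noteq> p (w j) * q (w (Suc j))" if "j \<le> s" for j
      using det_w[OF that] det_pq[of "w j" "w (Suc j)"] n_pos by simp
    show ?thesis
    proof (cases "\<exists>k m. 1 \<le> k \<and> k \<le> s \<and> 1 \<le> m \<and> R = zscale m (w k)")
      case False
      then have none: "R \<noteq> zscale m (w k)" if "1 \<le> k" "k \<le> s" "1 \<le> m" for k m using that by blast
      have exp: "expected_value R = 0"
        using generic chain_term_zero[of R] none none[of 1 "a 1"] a_ge_2[OF singular, of 1] s_pos by simp
      obtain j \<alpha> \<beta> where j: "j \<le> s" "0 < \<alpha>" "0 \<le> \<beta>" "R = zscale \<alpha> (w j) + zscale \<beta> (w (Suc j))"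
        using interior_decomposition[of R] lin(1) lin'(1) by (metis less_le_trans zero_less_numeral)
      have pR: "p R = \<alpha> * p (w j) + \<beta> * p (w (Suc j))" and qR: "q R = \<alpha> * q (w j) + \<beta> * q (w (Suc j))"
        using j(4) by (simp_all add: p_add q_add)
      have "\<beta> \<noteq> 0"
      proof
        assume "\<beta> = 0"
        then have R: "R = zscale \<alpha> (w j)" using j(4) by simp
        show False
        proof (cases "j = 0")
          case True
          then show False using R w_first lin(1) by simp
        next
          case False
          then show False using none[of j \<alpha>] j R by simp
        qed
      qed
      then have \<beta>: "1 \<le> \<beta>" and \<alpha>: "1 \<le> \<alpha>" using j by simp_all
      have mono: "x \<le> c * x" if "1 \<le> c" "0 \<le> x" for c x :: int
        using mult_right_mono[of 1 c x] that by simp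
      have "additive_dim TYPE('k) S (K R) 0"
      proof -
        consider "j = 0" | "1 \<le> j" "j < s" | "j = s" "1 \<le> j" using j(1) by linarith
        then show ?thesis
        proof cases
          case 1
          have co: "p R = \<beta>" "q R = \<alpha> * n + \<beta> * q b" using pR qR 1 w_first by simp_all
          have \<beta>2: "2 \<le> \<beta>" using co(1) lin(1) by simp
          then have "2 * q b \<le> \<beta> * q b" using q_b by (intro mult_right_mono) simp_all
          then have big: "q b + n < q R" using co(2) mono[OF \<alpha>, of n] n_pos q_b by linarith
          have "side1.pt 1 0 \<in> side1.bad R \<and> side1.pt 1 0 \<in> side2.bad R"
            using both_bad_interior[of "side1.pt 1 0" R] side1.S_quadrant[of "side1.pt 1 0"] lin(1) big n_pos
              q_coords[of "side1.pt 1 0"] by simp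
          moreover have "side1.pt 1 1 \<in> side1.bad R \<and> side1.pt 1 1 \<in> side2.bad R"
            using both_bad_interior[of "side1.pt 1 1" R] side1.S_quadrant[of "side1.pt 1 1"] lin(1) big
              q_coords[of "side1.pt 1 1"] by simp
          ultimately show ?thesis
            by (rule rank2) (use q_coords[of "side1.pt 1 0"] q_coords[of "side1.pt 1 1"] n_pos in simp)
        next
          case 2
          have pos: "0 < p (w j)" "0 < p (w (Suc j))" "0 < q (w j)" "0 < q (w (Suc j))"
            using p_w_pos[OF singular] q_w_pos[OF singular] 2 by simp_all
          have "p (w j) \<le> \<alpha> * p (w j)" "p (w (Suc j)) \<le> \<beta> * p (w (Suc j))"
            "q (w j) \<le> \<alpha> * q (w j)" "q (w (Suc j)) \<le> \<beta> * q (w (Suc j))"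
            using mono \<alpha> \<beta> pos by simp_all
          then have "p (w j) < p R" "p (w (Suc j)) < p R" "q (w j) < q R" "q (w (Suc j)) < q R"
            using pR qR pos by linarith+
          then have "w j \<in> side1.bad R \<and> w j \<in> side2.bad R" "w (Suc j) \<in> side1.bad R \<and> w (Suc j) \<in> side2.bad R"
            using both_bad_interior[of "w j" R] both_bad_interior[of "w (Suc j)" R] w_in_S[OF singular] 2 by simp_all
          then show ?thesis by (rule rank2) (rule w_indep[OF j(1)])
        next
          case 3
          have co: "q R = \<alpha>" "p R = \<alpha> * p b' + \<beta> * n" using pR qR 3 w_last basis' by simp_all
          have \<alpha>2: "2 \<le> \<alpha>" using co(1) lin'(1) by simp
          then have "2 * p b' \<le> \<alpha> * p b'" using p_b' by (intro mult_right_mono) simp_all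
          then have big: "p b' + n < p R" using co(2) mono[OF \<beta>, of n] n_pos p_b' by linarith
          have "side2.pt 1 0 \<in> side1.bad R \<and> side2.pt 1 0 \<in> side2.bad R"
            using both_bad_interior[of "side2.pt 1 0" R] side2.S_quadrant[of "side2.pt 1 0"] lin'(1) big n_pos
              p_coords[of "side2.pt 1 0"] by simp
          moreover have "side2.pt 1 1 \<in> side1.bad R \<and> side2.pt 1 1 \<in> side2.bad R"
            using both_bad_interior[of "side2.pt 1 1" R] side2.S_quadrant[of "side2.pt 1 1"] lin'(1) big
              p_coords[of "side2.pt 1 1"] by simp
          ultimately show ?thesis
            by (rule rank2) (use p_coords[of "side2.pt 1 0"] p_coords[of "side2.pt 1 1"] n_pos in simp)
        qed
      qed
      then show ?thesis using exp by (intro has_valueI) (assumption, simp)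
    next
      case True
      then obtain k m where k: "1 \<le> k" "k \<le> s" and m: "1 \<le> m" and R: "R = zscale m (w k)" by blast
      note ct = chain_term_multiple[OF singular k m R]
      have a2: "2 \<le> a k" by (rule a_ge_2[OF singular k])
      have pos: "0 < p (w k)" "0 < q (w k)" using p_w_pos[OF singular] q_w_pos[OF singular] k by simp_all
      have pR: "p R = m * p (w k)" and qR: "q R = m * q (w k)" using R by simp_all
      have Ra: "s = 1 \<and> R = zscale (a 1) (w 1) \<longleftrightarrow> s = 1 \<and> m = a k"
        using multiple_unique[OF singular k _ _ m, of 1 "a 1"] R k a2 by auto
      have wk_bad: "w k \<in> side1.bad R \<and> w k \<in> side2.bad R" if "2 \<le> m"
      proof -
        have "2 * p (w k) \<le> m * p (w k)" "2 * q (w k) \<le> m * q (w k)"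
          using that pos by (auto intro: mult_right_mono)
        then show ?thesis using both_bad_interior[OF w_in_S[OF singular k], of R] pR qR pos by simp
      qed
      \<comment> \<open>An element of the overlap off the line through \<open>w\<^sub>k\<close> forces \<open>m \<ge> a\<^sub>k\<close>.\<close>
      have off_line: "a k \<le> m \<and> (s = 1 \<and> m = a k \<longrightarrow> x = e' \<or> x = e)"
        if x: "x \<in> side1.bad R" "x \<in> side2.bad R" and d: "det (w k) x \<noteq> 0" for x
      proof -
        note B = both_badD[OF x]
        have sum: "x + (R - x) = zscale m (w k)" "(R - x) + x = zscale m (w k)" using R by simp_all
        have nn: "0 \<le> p (R - x)" "0 \<le> q (R - x)" using B(4,5) by (simp_all add: side1.p_diff side2.p_diff)
        have dd: "det (w k) (R - x) = - det (w k) x"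
        proof -
          have "det (w k) (x + (R - x)) = 0" unfolding sum(1) by (simp add: det_scale_right)
          then show ?thesis unfolding det_add_right by simp
        qed
        show ?thesis
        proof (cases "0 < det (w k) x")
          case True
          then show ?thesis
            using decomposition_multiplicity[OF singular k sum(1) B(3) nn(1) True] k w_last w_first by auto
        next
          case False
          then have "0 < det (w k) (R - x)" using d dd by simp
          then show ?thesis
            using decomposition_multiplicity[OF singular k sum(2) nn(2) B(2)] k w_last w_first by auto
        qed
      qed
      have line: "p x * i (w k) = p (w k) * i x" if "det (w k) x = 0" for x
        using that by (simp add: det_def mult.commute)
      consider "m = 1" | "2 \<le> m" "m < a k" | "m = a k" "s = 1" "(l = 1) = (l' = 1)"
        | "m = a k" "s = 1" "(l = 1) \<noteq> (l' = 1)" | "m = a k" "s \<noteq> 1" | "a k < m"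
        using m by linarith
      then show ?thesis
      proof cases
        case 1
        have "k \<noteq> 1"
        proof
          assume "k = 1"
          then have "R = b" using R 1 w_first by simp
          then show False using lin(1) basis by simp
        qed
        moreover have "k \<noteq> s"
        proof
          assume "k = s"
          then have "R = b'" using R 1 w_last by simp
          then show False using lin'(1) basis' by simp
        qed
        ultimately have ct2: "chain_term R = 2" using ct 1 k a2 by auto
        have "\<not> (s = 1 \<and> R = zscale (a 1) (w 1))" unfolding Ra using 1 a2 by simp
        then have exp: "expected_value R = 2" using generic ct2 by auto
        have inter: "x = 0" if x: "x \<in> side1.bad R" "x \<in> side2.bad R" for x
        proof -
          have d: "det (w k) x = 0" using off_line[OF x] 1 a2 by force
          define c where "c = det x (w (Suc k))"
          have x_eq: "x = zscale c (w k)" unfolding c_def using coordinates_w[OF k(2), of x] d by simp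
          note B = both_badD[OF x]
          have "0 \<le> c * p (w k)" "c * p (w k) \<le> 1 * p (w k)" using B(2,4) x_eq pR 1 by simp_all
          then have "0 \<le> c" "c \<le> 1" using pos by (simp_all add: zero_le_mult_iff)
          moreover have "c \<noteq> 1" using B(6) x_eq R 1 by auto
          ultimately have "c = 0" by simp
          then show ?thesis using x_eq by simp
        qed
        show ?thesis using exp by (intro has_valueI[OF dim_linear_linear_0[OF lin lin' inter]]) simp_all
      next
        case 2
        have "\<not> (s = 1 \<and> R = zscale (a 1) (w 1))" unfolding Ra using 2 by simp
        then have exp: "expected_value R = 1" using generic ct 2 by auto
        have "det (w k) x = 0" if "x \<in> side1.bad R" "x \<in> side2.bad R" for x
          using off_line[OF that] 2 by force
        then show ?thesis using exp wk_bad[OF 2(1)] line pos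
          by (intro has_valueI[OF dim_linear_linear_1[OF lin lin', of "w k"]]) simp_all
      next
        case 3
        have ct1: "chain_term R = 1" using ct 3 a2 by auto
        then have exp: "expected_value R = 1" using generic 3(3) by auto
        have k1: "k = 1" using k 3(2) by simp
        have "e + e' = zscale (a k) (w k)" using rec[OF k] k1 w_first w_last 3(2) by simp
        then have Ree: "R = e + e'" using R 3(1) by simp
        have "det (w k) x = 0" if x: "x \<in> side1.bad R" "x \<in> side2.bad R" for x
        proof (rule ccontr)
          note B = both_badD[OF x]
          assume "det (w k) x \<noteq> 0"
          then have "x = e' \<or> x = e" using off_line[OF x] 3 by blast
          then show False
          proof
            assume xe: "x = e'"
            have "l' dvd 1" using B(10) xe basis' by simp
            then have "l = 1" using 3(3) l'_pos by simp
            then show False using B(7) xe Ree by (simp add: p_add i_add)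
          next
            assume xe: "x = e"
            have "l dvd 1" using B(9) xe basis by simp
            then have "l' = 1" using 3(3) l_pos by simp
            then show False using B(8) xe Ree basis' by (simp add: q_add i'_add)
          qed
        qed
        then show ?thesis using exp wk_bad 3(1) a2 line pos
          by (intro has_valueI[OF dim_linear_linear_1[OF lin lin', of "w k"]]) simp_all
      next
        case 4
        have ct1: "chain_term R = 1" using ct 4 a2 by auto
        have "s = 1 \<and> R = zscale (a 1) (w 1)" unfolding Ra using 4 by simp
        then have exp: "expected_value R = 0"
          unfolding expected_value_def generic_value_def using singular r ct1 4(3) by auto
        have k1: "k = 1" using k 4(2) by simp
        have "e + e' = zscale (a k) (w k)" using rec[OF k] k1 w_first w_last 4(2) by simp
        then have Ree: "R = e + e'" using R 4(1) by simp
        have co: "p R = n" "q R = n" using Ree basis basis' by (simp_all add: p_add q_add)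
        have wk: "w k \<in> side1.bad R \<and> w k \<in> side2.bad R" using wk_bad 4(1) a2 by simp
        \<comment> \<open>\<open>R = e + e'\<close> has the heights of \<open>e'\<close> and \<open>e\<close>, and differs from each of them by a
          generator of the edge, which is not in the group of that edge if the index is not one.\<close>
        have "additive_dim TYPE('k) S (K R) 0"
        proof (cases "l = 1")
          case True
          then have nd: "\<not> l' dvd 1" using 4(3) l'_pos by simp
          have eS: "e \<in> S" using side1.ray_in_S[of 1] True by (simp add: side1.pt_def)
          have "i' R = i' e + 1" unfolding Ree i'_add using basis' by simp
          then have d: "i' e - i' R = - 1" by simp
          have "\<not> l' dvd (i' e - i' R)" unfolding d using nd by simp
          then have "e \<in> side1.bad R \<and> e \<in> side2.bad R"
            using both_bad_edge2[OF eS, of R] co n_pos by simp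
          then show ?thesis by (rule rank2[OF wk]) (use pos basis n_pos in simp)
        next
          case False
          then have l': "l' = 1" and nd: "\<not> l dvd 1" using 4(3) l_pos by auto
          have eS: "e' \<in> S" using side2.ray_in_S[of 1] l' by (simp add: side2.pt_def)
          have "i R = i e' + 1" unfolding Ree i_add using basis by simp
          then have d: "i e' - i R = - 1" by simp
          have "\<not> l dvd (i e' - i R)" unfolding d using nd by simp
          then have "e' \<in> side1.bad R \<and> e' \<in> side2.bad R"
            using both_bad_edge1[OF eS, of R] co n_pos basis' by simp
          then show ?thesis by (rule rank2[OF wk]) (use pos basis' n_pos in simp)
        qed
        then show ?thesis using exp by (intro has_valueI) (assumption, simp)
      next
        case 5
        have ct0: "chain_term R = 0" using ct 5 a2 by auto
        then have exp: "expected_value R = 0" using generic 5(2) by auto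
        have wk: "w k \<in> side1.bad R \<and> w k \<in> side2.bad R" using wk_bad 5(1) a2 by simp
        have sum: "R = w (k - 1) + w (Suc k)" using rec[OF k] R 5(1) by simp
        have co: "p R = p (w (k - 1)) + p (w (Suc k))" "q R = q (w (k - 1)) + q (w (Suc k))"
          using sum by (simp_all add: p_add q_add)
        \<comment> \<open>A neighbour of \<open>w\<^sub>k\<close> that is an edge vector belongs to \<open>S\<close> only if the index of that edge is
          one; if it is not, the other neighbour avoids the class of \<open>R\<close> and is in the overlap.\<close>
        have "additive_dim TYPE('k) S (K R) 0"
        proof (cases "k = s")
          case False
          then have ks: "k < s" using k by simp
          have q_pos: "0 < q (w (Suc k))" "0 < q (w (k - 1))" using q_w_pos[OF singular] ks by simp_all
          show ?thesis
          proof (cases "k = 1 \<and> l = 1")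
            case True
            have "e \<in> S" using side1.ray_in_S[of 1] True by (simp add: side1.pt_def)
            then have "e \<in> side1.bad R \<and> e \<in> side2.bad R"
              using both_bad_interior[of e R] co True w_first q_pos p_w_pos[OF singular, of "Suc k"] k by simp
            then show ?thesis by (rule rank2[OF wk]) (use pos basis n_pos in simp)
          next
            case nl: False
            have S: "w (Suc k) \<in> S" using w_in_S[OF singular] ks by simp
            have "w (Suc k) \<in> side1.bad R \<and> w (Suc k) \<in> side2.bad R"
            proof (cases "k = 1")
              case True
              then have nd: "\<not> l dvd 1" using nl l_pos by simp
              have "i R = 1 + i (w (Suc k))" unfolding sum i_add using True w_first basis by simp
              then have d: "i (w (Suc k)) - i R = - 1" by simp
              have "\<not> l dvd (i (w (Suc k)) - i R)" unfolding d using nd by simp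
              then show ?thesis using both_bad_edge1[OF S, of R] co True w_first q_pos by simp
            next
              case False
              then have "0 < p (w (k - 1))" using p_w_pos[OF singular, of "k - 1"] k by simp
              then show ?thesis using both_bad_interior[OF S, of R] co q_pos by simp
            qed
            then show ?thesis by (rule rank2[OF wk]) (rule w_indep[OF k(2)])
          qed
        next
          case ks: True
          then have k2: "2 \<le> k" using 5(2) k by simp
          have last: "w (Suc k) = e'" using ks w_last by simp
          have p_pos: "0 < p (w (k - 1))" "0 < q (w (k - 1))" using p_w_pos[OF singular] q_w_pos[OF singular] k2 k by simp_all
          show ?thesis
          proof (cases "l' = 1")
            case True
            have "e' \<in> S" using side2.ray_in_S[of 1] True by (simp add: side2.pt_def)
            then have "e' \<in> side1.bad R \<and> e' \<in> side2.bad R"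
              using both_bad_interior[of e' R] co last p_pos basis' by simp
            then show ?thesis by (rule rank2[OF wk]) (use pos basis' n_pos in simp)
          next
            case False
            then have nd: "\<not> l' dvd 1" using l'_pos by simp
            have S: "w (k - 1) \<in> S" using w_in_S[OF singular] k2 k by simp
            have "i' R = i' (w (k - 1)) + 1" unfolding sum i'_add using last basis' by simp
            then have d: "i' (w (k - 1)) - i' R = - 1" by simp
            have "\<not> l' dvd (i' (w (k - 1)) - i' R)" unfolding d using nd by simp
            then have "w (k - 1) \<in> side1.bad R \<and> w (k - 1) \<in> side2.bad R"
              using both_bad_edge2[OF S, of R] co last n_pos basis' by simp
            then show ?thesis by (rule rank2[OF _ wk]) (use w_indep[of "k - 1"] k2 k in simp)
          qed
        qed
        then show ?thesis using exp by (intro has_valueI) (assumption, simp)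
      next
        case 6
        have ct0: "chain_term R = 0" using ct 6 a2 by auto
        have "\<not> (s = 1 \<and> R = zscale (a 1) (w 1))" unfolding Ra using 6 by simp
        then have exp: "expected_value R = 0" using generic ct0 by auto
        have wk: "w k \<in> side1.bad R \<and> w k \<in> side2.bad R" using wk_bad 6 a2 by simp
        have sum: "w (k - 1) + w (Suc k) = zscale (a k) (w k)" using rec[OF k] by simp
        have sum_p: "p (w (k - 1)) + p (w (Suc k)) = a k * p (w k)" and sum_q: "q (w (k - 1)) + q (w (Suc k)) = a k * q (w k)"
          using arg_cong[OF sum, of p] arg_cong[OF sum, of q] by (simp_all add: p_add q_add)
        have "(a k + 1) * p (w k) \<le> m * p (w k)" "(a k + 1) * q (w k) \<le> m * q (w k)"
          using 6 pos by (auto intro: mult_right_mono)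
        then have big: "p (w (k - 1)) + p (w (Suc k)) + p (w k) \<le> p R" "q (w (k - 1)) + q (w (Suc k)) + q (w k) \<le> q R"
          unfolding pR qR sum_p sum_q by (simp_all add: distrib_right)
        have nn: "0 \<le> p (w (k - 1))" "0 \<le> q (w (Suc k))" "0 < p (w (Suc k))" "0 < q (w (k - 1))"
        proof -
          show "0 \<le> p (w (k - 1))" using p_step[OF singular, of "k - 1"] k by simp
          show "0 < p (w (Suc k))" using p_w_pos[OF singular] k by simp
          show "0 < q (w (k - 1))" using q_w_pos[OF singular] k by simp
          show "0 \<le> q (w (Suc k))" using q_w_pos[OF singular, of "Suc k"] w_last k basis' by (cases "k = s") auto
        qed
        have prev: "w (k - 1) \<in> side1.bad R \<and> w (k - 1) \<in> side2.bad R" if "w (k - 1) \<in> S"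
          using both_bad_interior[OF that, of R] big nn pos by simp
        have succ: "w (Suc k) \<in> side1.bad R \<and> w (Suc k) \<in> side2.bad R" if "w (Suc k) \<in> S"
          using both_bad_interior[OF that, of R] big nn pos by simp
        have use_prev: "additive_dim TYPE('k) S (K R) 0" if "w (k - 1) \<in> S"
          by (rule rank2[OF prev[OF that] wk]) (use w_indep[of "k - 1"] k in simp)
        have use_succ: "additive_dim TYPE('k) S (K R) 0" if "w (Suc k) \<in> S"
          by (rule rank2[OF wk succ[OF that]]) (rule w_indep[OF k(2)])
        have "additive_dim TYPE('k) S (K R) 0"
        proof -
          consider "2 \<le> k" | "k < s" | "k = 1" "s = 1" "l = 1" | "k = 1" "s = 1" "l' = 1" | "k = 1" "s = 1" "l \<noteq> 1" "l' \<noteq> 1"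
            using k by linarith
          then show ?thesis
          proof cases
            case 1 then show ?thesis using use_prev w_in_S[OF singular, of "k - 1"] k by simp
          next
            case 2 then show ?thesis using use_succ w_in_S[OF singular, of "Suc k"] k by simp
          next
            case 3
            then show ?thesis using use_prev side1.ray_in_S[of 1] w_first by (simp add: side1.pt_def)
          next
            case 4
            then show ?thesis using use_succ side2.ray_in_S[of 1] w_last by (simp add: side2.pt_def)
          next
            case 5
            have nd: "\<not> l' dvd 1" using 5(4) l'_pos by simp
            have wb: "w k = b" and qb: "q b = 1" using 5 w_first w_last basis' by simp_all
            have pk: "p (w k) = 1" unfolding wb by simp
            have "p (w (k - 1)) = 0" "p (w (Suc k)) = n" using 5 w_first w_last by simp_all
            then have an: "a k = n" using sum_p pk by simp
            let ?z = "side1.pt 1 1"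
            have zS: "?z \<in> S" by (intro side1.S_quadrant) simp_all
            have qz: "q ?z = 1 + n" using q_coords[of ?z] qb by simp
            have pz: "p ?z < p R" using lin(1) by simp
            have qRm: "q R = m" using qR wb qb by simp
            have "?z \<in> side1.bad R \<and> ?z \<in> side2.bad R"
            proof (cases "m = a k + 1")
              case True
              have "e + e' = zscale (a k) (w k)" using sum 5 w_first w_last by simp
              then have "R = e + e' + b" using R True wb by (simp add: zscale_add_left)
              moreover have "?z = b + e" by (rule side1.pt_eqI) (simp_all add: p_add i_add)
              ultimately have "i' ?z - i' R = - 1" using basis' by (simp add: i'_add)
              then have "\<not> l' dvd (i' ?z - i' R)" using nd by simp
              then show ?thesis using both_bad_edge2[OF zS pz] qz qRm True an by simp
            next
              case False
              then show ?thesis using both_bad_interior[OF zS pz] qz qRm 6 an by simp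
            qed
            then show ?thesis by (rule rank2[OF wk]) (use n_pos in \<open>simp add: wb qb qz\<close>)
          qed
        qed
        then show ?thesis using exp by (intro has_valueI) (assumption, simp)
      qed
    qed
  qed
qed


section \<open>The value in every degree\<close>

text \<open>Everything is symmetric in the two rays, by reversal of the chain. Up to this symmetry the
  cases are distinguished by the position of \<open>R\<close> and by the behaviour near each ray.\<close>

theorem value_formula: "has_value TYPE('k::field_char_0) R (expected_value R)"
proof -
  interpret sw: cone_chain q i' p i e' b' e b l' l n S s "\<lambda>j. w (Suc s - j)" "\<lambda>j. a (Suc s - j)"
    by (rule swap_chain)
  have ex_rev: "(\<exists>j\<in>{1..s}. P (Suc s - j)) \<longleftrightarrow> (\<exists>j\<in>{1..s}. P j)" for P
  proof
    assume "\<exists>j\<in>{1..s}. P (Suc s - j)"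
    then obtain j where "1 \<le> j" "j \<le> s" "P (Suc s - j)" by auto
    then show "\<exists>j\<in>{1..s}. P j" by (intro bexI[of _ "Suc s - j"]) auto
  next
    assume "\<exists>j\<in>{1..s}. P j"
    then obtain j where "1 \<le> j" "j \<le> s" "P j" by auto
    then show "\<exists>j\<in>{1..s}. P (Suc s - j)" by (intro bexI[of _ "Suc s - j"]) auto
  qed
  have idx: "Suc s - 1 = s" "Suc s - s = 1" by simp_all
  have s1: "(R = zscale (a s) (w s) \<and> s = 1 \<and> 1 < a s) = (R = zscale (a 1) (w 1) \<and> s = 1 \<and> 1 < a 1)"
    by (cases "s = 1") simp_all
  have chain: "sw.chain_term R = chain_term R"
    unfolding chain_term_def sw.chain_term_def
      ex_rev[of "\<lambda>j. \<exists>m. 2 \<le> m \<and> m < a j \<and> R = zscale m (w j)"] ex_rev[of "\<lambda>j. R = w j"] idx s1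
    by (intro if_cong refl diff_right_commute)
  have generic: "sw.generic_value R = generic_value R"
    unfolding generic_value_def sw.generic_value_def chain by (simp add: add.commute add.left_commute)
  have exp: "sw.expected_value R = expected_value R"
  proof (cases rule: n_cases)
    case smooth
    have n: "(n \<noteq> 1) = False" using smooth(1) by simp
    have bb: "zscale 2 b' = zscale 2 b" using smooth_facts(5)[OF smooth(1)] by simp
    show ?thesis
      unfolding expected_value_def sw.expected_value_def generic n if_False bb prod.inject
      by (intro if_cong refl) blast+
  next
    case singular
    have n: "(n \<noteq> 1) = True" using singular by simp
    have s2: "(s = 1 \<and> R = zscale (a s) (w s) \<and> (l' = 1 \<and> l \<noteq> 1 \<or> l' \<noteq> 1 \<and> l = 1)) =
        (s = 1 \<and> R = zscale (a 1) (w 1) \<and> (l = 1 \<and> l' \<noteq> 1 \<or> l \<noteq> 1 \<and> l' = 1))"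
      by (cases "s = 1") (simp, blast, simp)
    show ?thesis
      unfolding expected_value_def sw.expected_value_def generic n if_True idx s2 ..
  qed
  have K: "sw.K R = K R" by (simp add: K_def sw.K_def Un_commute)
  have flip: "has_value TYPE('k) R (expected_value R)" if "sw.has_value TYPE('k) R (sw.expected_value R)"
    using that unfolding has_value_def sw.has_value_def K exp .
  have parity2: "even (p R)" if "q R = 2" "even (i' R)"
    using p_coords[of R] that by simp
  have parity1: "even (q R)" if "p R = 2" "even (i R)"
    using q_coords[of R] that by simp
  consider (E2) "q R < 0 \<or> (q R = 0 \<and> l' dvd i' R)" | (E1) "p R < 0 \<or> (p R = 0 \<and> l dvd i R)"
    | (R2) "q R = 0" "\<not> l' dvd i' R" "0 < p R" | (R1) "p R = 0" "\<not> l dvd i R" "0 < q R"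
    | (zero) "p R = 0" "q R = 0" | (pos) "0 < p R" "0 < q R"
    by linarith
  then show ?thesis
  proof cases
    case E2 then show ?thesis by (rule value_empty)
  next
    case E1 then show ?thesis by (intro flip sw.value_empty)
  next
    case R2 then show ?thesis by (rule value_ray)
  next
    case R1 then show ?thesis by (intro flip sw.value_ray)
  next
    case zero
    then have "R = 0" by (intro pq_eqI) simp_all
    then show ?thesis by (intro value_empty) simp
  next
    case pos
    let ?sp1 = "p R = 2 \<and> l = 2 \<and> even (i R)" and ?sp2 = "q R = 2 \<and> l' = 2 \<and> even (i' R)"
    consider (oo) "p R = 1" "q R = 1" | (ol) "p R = 1" "2 \<le> q R" | (lo) "2 \<le> p R" "q R = 1" | (ll) "2 \<le> p R" "2 \<le> q R"
      using pos by linarith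
    then show ?thesis
    proof cases
      case oo then show ?thesis by (rule value_one_one)
    next
      case ol
      then have "\<not> ?sp2" using parity2 by auto
      then show ?thesis using ol by (intro value_one_linear)
    next
      case lo
      then have "\<not> ?sp1" using parity1 by auto
      then show ?thesis using lo by (intro flip sw.value_one_linear)
    next
      case ll
      consider "?sp1" "?sp2" | "?sp1" "\<not> ?sp2" | "\<not> ?sp1" "?sp2" | "\<not> ?sp1" "\<not> ?sp2" by blast
      then show ?thesis
      proof cases
        case 1 then show ?thesis by (intro value_special_special) simp_all
      next
        case 2 then show ?thesis using ll by (intro value_special_linear) simp_all
      next
        case 3 then show ?thesis using ll by (intro flip sw.value_special_linear) simp_all
      next
        case 4 then show ?thesis using ll by (intro value_linear_linear)
      qed
    qed
  qed
qed

end


section \<open>Cones in the plane\<close>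

interpretation qplane: vector_space qscale
  by unfold_locales (simp_all add: qscale_def algebra_simps)

lemma qpairing_add_right: "qpairing n (x + y) = qpairing n x + qpairing n y"
  by (simp add: qpairing_def algebra_simps)
lemma qpairing_add_left: "qpairing (m + n) x = qpairing m x + qpairing n x"
  by (simp add: qpairing_def algebra_simps)
lemma qpairing_scale_right: "qpairing n (qscale c x) = c * qpairing n x"
  by (simp add: qpairing_def qscale_def algebra_simps)
lemma qpairing_scale_left: "qpairing (qscale c n) x = c * qpairing n x"
  by (simp add: qpairing_def qscale_def algebra_simps)
lemma qpairing_zero [simp]: "qpairing n 0 = 0" "qpairing 0 x = 0"
  by (simp_all add: qpairing_def)
lemma qpairing_commute: "qpairing n x = qpairing x n"
  by (simp add: qpairing_def mult.commute)
lemma qpairing_sum_left: "qpairing (sum f F) x = (\<Sum>y\<in>F. qpairing (f y) x)"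
  by (induction F rule: infinite_finite_induct) (auto simp: qpairing_add_left)
lemma qpairing_diff_right: "qpairing n (x - y) = qpairing n x - qpairing n y"
  by (simp add: qpairing_def algebra_simps)
lemma qpairing_to_q: "qpairing (to_q v) (to_q u) = of_int (pairing v u)"
  by (simp add: qpairing_def to_q_def pairing_def)
lemma pairing_add: "pairing v (x + y) = pairing v x + pairing v y"
  by (simp add: pairing_def algebra_simps)
lemma pairing_zero [simp]: "pairing v 0 = 0"
  by (simp add: pairing_def)

lemma qcone_base: "x \<in> X \<Longrightarrow> x \<in> qcone X"
proof -
  assume "x \<in> X"
  then have "finite {x} \<and> {x} \<subseteq> X \<and> (\<forall>y\<in>{x}. 0 \<le> (1::rat)) \<and> x = (\<Sum>y\<in>{x}. qscale 1 y)"
    by (simp add: qscale_def)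
  then show ?thesis unfolding qcone_def by (intro CollectI exI[of _ "{x}"] exI[of _ "\<lambda>_. 1"]) blast
qed

lemma qcone_pairing_nonneg:
  assumes "\<And>y. y \<in> X \<Longrightarrow> 0 \<le> qpairing y n" "x \<in> qcone X"
  shows "0 \<le> qpairing x n"
proof -
  obtain F c where F: "x = (\<Sum>y\<in>F. qscale (c y) y)" "F \<subseteq> X" "\<forall>y\<in>F. 0 \<le> c y"
    using assms(2) unfolding qcone_def by blast
  show ?thesis unfolding F(1) qpairing_sum_left qpairing_scale_left
    by (rule sum_nonneg) (use F assms in auto)
qed

lemma qcone_pairing_zero:
  assumes "\<And>y. y \<in> X \<Longrightarrow> qpairing y n = 0" "x \<in> qcone X"
  shows "qpairing x n = 0"
proof -
  obtain F c where F: "x = (\<Sum>y\<in>F. qscale (c y) y)" "F \<subseteq> X" "\<forall>y\<in>F. 0 \<le> c y"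
    using assms(2) unfolding qcone_def by blast
  show ?thesis unfolding F(1) qpairing_sum_left qpairing_scale_left
    by (rule sum.neutral) (use F assms in auto)
qed

lemma dual_qcone: "dual_cone (qcone X) = {n. \<forall>x\<in>X. 0 \<le> qpairing n x}"
proof (intro set_eqI iffI)
  fix n assume "n \<in> {n. \<forall>x\<in>X. 0 \<le> qpairing n x}"
  then have "\<And>y. y \<in> X \<Longrightarrow> 0 \<le> qpairing y n" by (simp add: qpairing_commute)
  then have "\<And>x. x \<in> qcone X \<Longrightarrow> 0 \<le> qpairing x n" by (rule qcone_pairing_nonneg)
  then show "n \<in> dual_cone (qcone X)" unfolding dual_cone_def by (simp add: qpairing_commute)
next
  fix n assume "n \<in> dual_cone (qcone X)"
  then show "n \<in> {n. \<forall>x\<in>X. 0 \<le> qpairing n x}" unfolding dual_cone_def using qcone_base by blast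
qed

lemma perp_qcone: "perp (qcone X) = {x. \<forall>n\<in>X. qpairing n x = 0}"
proof (intro set_eqI iffI)
  fix x assume "x \<in> {x. \<forall>n\<in>X. qpairing n x = 0}"
  then show "x \<in> perp (qcone X)" unfolding perp_def using qcone_pairing_zero[of X x] by blast
next
  fix x assume "x \<in> perp (qcone X)"
  then show "x \<in> {x. \<forall>n\<in>X. qpairing n x = 0}" unfolding perp_def using qcone_base by blast
qed

lemma qcone_pairD:
  assumes "x \<in> qcone {a, b}"
  obtains c d where "0 \<le> c" "0 \<le> d" "x = qscale c a + qscale d b"
proof -
  obtain F f where F: "x = (\<Sum>y\<in>F. qscale (f y) y)" "F \<subseteq> {a, b}" "\<forall>y\<in>F. 0 \<le> f y"
    using assms unfolding qcone_def by blast
  have z: "qscale 0 y = 0" for y by (simp add: qscale_def zero_prod_def)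
  have "F = {} \<or> F = {a} \<or> F = {b} \<or> (F = {a, b} \<and> a \<noteq> b)" using F(2) by blast
  then show ?thesis
  proof (elim disjE conjE)
    assume "F = {}" then show ?thesis using F that[of 0 0] z by simp
  next
    assume "F = {a}" then show ?thesis using F that[of "f a" 0] z by simp
  next
    assume "F = {b}" then show ?thesis using F that[of 0 "f b"] z by simp
  next
    assume "F = {a, b}" "a \<noteq> b" then show ?thesis using F that[of "f a" "f b"] by simp
  qed
qed


section \<open>Relative interiors\<close>

lemma relintI:
  assumes "x \<in> C" "0 < \<epsilon>"
    and "\<And>y. y \<in> module.span qscale C \<Longrightarrow> max \<bar>fst y - fst x\<bar> \<bar>snd y - snd x\<bar> < \<epsilon> \<Longrightarrow> y \<in> C"
  shows "x \<in> relint C"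
  unfolding relint_def using assms by blast

text \<open>This shows that a functional which is nonnegative on the cone and positive somewhere on it
  is positive on the relative interior.\<close>

lemma relint_retract:
  assumes x: "x \<in> relint C" and z: "z \<in> C"
  obtains \<delta> where "0 < \<delta>" "x - qscale \<delta> z \<in> C"
proof -
  obtain \<epsilon> where \<epsilon>: "0 < \<epsilon>" and C: "\<And>y. y \<in> module.span qscale C \<Longrightarrow>
     max \<bar>fst y - fst x\<bar> \<bar>snd y - snd x\<bar> < \<epsilon> \<Longrightarrow> y \<in> C" and xC: "x \<in> C"
    using x unfolding relint_def by blast
  define M where "M = \<bar>fst z\<bar> + \<bar>snd z\<bar> + 1"
  have M: "0 < M" "\<bar>fst z\<bar> < M" "\<bar>snd z\<bar> < M" by (simp_all add: M_def)
  define \<delta> where "\<delta> = \<epsilon> / M"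
  have \<delta>: "0 < \<delta>" "\<delta> * M = \<epsilon>" using \<epsilon> M by (simp_all add: \<delta>_def)
  have "\<delta> * \<bar>fst z\<bar> < \<delta> * M" "\<delta> * \<bar>snd z\<bar> < \<delta> * M" using M \<delta> by (auto intro: mult_strict_left_mono)
  then have "max \<bar>fst (x - qscale \<delta> z) - fst x\<bar> \<bar>snd (x - qscale \<delta> z) - snd x\<bar> < \<epsilon>"
    using \<delta> by (simp add: qscale_def abs_mult)
  moreover have "x - qscale \<delta> z \<in> module.span qscale C"
    using xC z by (intro qplane.span_diff qplane.span_scale qplane.span_base)
  ultimately show ?thesis using that \<delta>(1) C by blast
qed

lemma functional_open:
  assumes "0 < qpairing n x"
  obtains \<epsilon> where "0 < \<epsilon>" "\<And>y. max \<bar>fst y - fst x\<bar> \<bar>snd y - snd x\<bar> < \<epsilon> \<Longrightarrow> 0 < qpairing n y"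
proof -
  define M where "M = \<bar>fst n\<bar> + \<bar>snd n\<bar> + 1"
  have M: "0 < M" by (simp add: M_def add_nonneg_pos)
  define \<epsilon> where "\<epsilon> = qpairing n x / M"
  have \<epsilon>: "0 < \<epsilon>" "\<epsilon> * M = qpairing n x" using assms M by (simp_all add: \<epsilon>_def)
  have "0 < qpairing n y" if y: "max \<bar>fst y - fst x\<bar> \<bar>snd y - snd x\<bar> < \<epsilon>" for y
  proof -
    have "\<bar>fst n * (fst y - fst x)\<bar> \<le> \<bar>fst n\<bar> * \<epsilon>" "\<bar>snd n * (snd y - snd x)\<bar> \<le> \<bar>snd n\<bar> * \<epsilon>"
      unfolding abs_mult using y by (auto intro!: mult_left_mono)
    moreover have "qpairing n y = qpairing n x + fst n * (fst y - fst x) + snd n * (snd y - snd x)"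
      by (simp add: qpairing_def algebra_simps)
    moreover have "qpairing n x = \<bar>fst n\<bar> * \<epsilon> + \<bar>snd n\<bar> * \<epsilon> + \<epsilon>"
      using \<epsilon>(2) by (simp add: M_def algebra_simps)
    ultimately show ?thesis using \<epsilon>(1) by linarith
  qed
  then show ?thesis using that \<epsilon>(1) by blast
qed

text \<open>The three relative interiors needed: of the cone \<open>P \<ge> 0, Q \<ge> 0\<close>, of its edges and of its vertex.\<close>

lemma relint_open_cone:
  assumes z: "0 < qpairing a z" "0 < qpairing b z"
  shows "x \<in> relint {x. 0 \<le> qpairing a x \<and> 0 \<le> qpairing b x} \<longleftrightarrow> 0 < qpairing a x \<and> 0 < qpairing b x"
    (is "x \<in> relint ?C \<longleftrightarrow> ?r")
proof
  assume x: "x \<in> relint ?C"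
  obtain \<delta> where "0 < \<delta>" "x - qscale \<delta> z \<in> ?C" using relint_retract[OF x, of z] z by auto
  moreover have "0 < \<delta> * qpairing a z" "0 < \<delta> * qpairing b z" using \<open>0 < \<delta>\<close> z by simp_all
  ultimately show ?r by (auto simp: qpairing_diff_right qpairing_scale_right)
next
  assume r: ?r
  obtain \<epsilon>1 where 1: "0 < \<epsilon>1" "\<And>y. max \<bar>fst y - fst x\<bar> \<bar>snd y - snd x\<bar> < \<epsilon>1 \<Longrightarrow> 0 < qpairing a y"
    using functional_open r by blast
  obtain \<epsilon>2 where 2: "0 < \<epsilon>2" "\<And>y. max \<bar>fst y - fst x\<bar> \<bar>snd y - snd x\<bar> < \<epsilon>2 \<Longrightarrow> 0 < qpairing b y"
    using functional_open r by blast
  show "x \<in> relint ?C"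
  proof (rule relintI)
    show "x \<in> ?C" using r by simp
    show "0 < min \<epsilon>1 \<epsilon>2" using 1 2 by simp
    fix y assume y: "max \<bar>fst y - fst x\<bar> \<bar>snd y - snd x\<bar> < min \<epsilon>1 \<epsilon>2"
    have "0 < qpairing a y" by (rule 1(2)) (use y in simp)
    moreover have "0 < qpairing b y" by (rule 2(2)) (use y in simp)
    ultimately show "y \<in> ?C" by simp
  qed
qed

lemma relint_edge:
  assumes z: "qpairing a z = 0" "0 < qpairing b z"
  shows "x \<in> relint {x. qpairing a x = 0 \<and> 0 \<le> qpairing b x} \<longleftrightarrow> qpairing a x = 0 \<and> 0 < qpairing b x"
    (is "x \<in> relint ?C \<longleftrightarrow> ?r")
proof
  assume x: "x \<in> relint ?C"
  obtain \<delta> where "0 < \<delta>" "x - qscale \<delta> z \<in> ?C" using relint_retract[OF x, of z] z by auto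
  moreover have "0 < \<delta> * qpairing b z" using \<open>0 < \<delta>\<close> z by simp
  moreover have "x \<in> ?C" using x by (simp add: relint_def)
  ultimately show ?r by (auto simp: qpairing_diff_right qpairing_scale_right)
next
  assume r: ?r
  obtain \<epsilon> where \<epsilon>: "0 < \<epsilon>" "\<And>y. max \<bar>fst y - fst x\<bar> \<bar>snd y - snd x\<bar> < \<epsilon> \<Longrightarrow> 0 < qpairing b y"
    using functional_open r by blast
  have sub: "qplane.subspace {x. qpairing a x = 0}"
    by (rule qplane.subspaceI) (auto simp: qpairing_add_right qpairing_scale_right)
  have "qplane.span ?C \<subseteq> {x. qpairing a x = 0}" by (rule qplane.span_minimal[OF _ sub]) auto
  then have span: "qpairing a y = 0" if "y \<in> module.span qscale ?C" for y using that by blast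
  show "x \<in> relint ?C"
  proof (rule relintI)
    show "x \<in> ?C" using r by simp
    fix y assume y: "y \<in> module.span qscale ?C" "max \<bar>fst y - fst x\<bar> \<bar>snd y - snd x\<bar> < \<epsilon>"
    show "y \<in> ?C" using span[OF y(1)] \<epsilon>(2)[OF y(2)] by simp
  qed (rule \<epsilon>(1))
qed

lemma relint_origin: "x \<in> relint {0} \<longleftrightarrow> x = 0"
proof
  assume "x = 0"
  then show "x \<in> relint {0}"
    by (intro relintI[of _ _ 1]) (use qplane.span_insert_0[of "{}"] in simp_all)
qed (simp add: relint_def)


section \<open>Seminormal monoids in the plane\<close>

lemma to_q_add: "to_q (x + y) = to_q x + to_q y"
  by (simp add: to_q_def)

lemma to_q_eq_0 [simp]: "to_q u = 0 \<longleftrightarrow> u = 0"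
  by (cases u) (simp add: to_q_def zero_prod_def)

locale plane_cone =
  fixes S :: "lattice set" and v1 v2 :: lattice
  assumes affine: "affine_monoid S" and span: "group_closure S = UNIV"
    and dim2: "vector_space.dim qscale (sigma_cone S) = 2" and semi: "seminormal S"
    and prim: "primitive v1" "primitive v2"
    and sigma: "sigma_cone S = qcone {to_q v1, to_q v2}"
begin

definition \<Delta> :: int where "\<Delta> = fst v1 * snd v2 - snd v1 * fst v2"
text \<open>The multiplicity of the cone.\<close>

definition n :: int where "n = \<bar>\<Delta>\<bar>"
text \<open>The primitive generator of the edge of the dual cone orthogonal to the first ray; the sign
  makes it point into the dual cone.\<close>

definition e1 :: lattice where "e1 = zscale (sgn \<Delta>) (- snd v1, fst v1)"
definition e2 :: lattice where "e2 = zscale (sgn \<Delta>) (snd v2, - fst v2)"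
text \<open>The determinant, with the sign for which \<open>D e1 x\<close> and \<open>D x e2\<close> are the heights of \<open>x\<close>.\<close>

definition D :: "lattice \<Rightarrow> lattice \<Rightarrow> int" where
  "D x y = - sgn \<Delta> * (fst x * snd y - snd x * fst y)"

text \<open>Otherwise both rays would span the same line, and the cone would not have dimension two.\<close>

lemma Delta_nonzero: "\<Delta> \<noteq> 0"
proof
  assume 0: "\<Delta> = 0"
  have cop: "coprime (fst v1) (snd v1)" using prim by (simp add: primitive_def)
  have "\<exists>c. to_q v2 = qscale c (to_q v1)"
  proof (cases "fst v1 = 0")
    case True
    then have "snd v1 \<noteq> 0" using cop by auto
    moreover then have "fst v2 = 0" using 0 True by (simp add: \<Delta>_def)
    ultimately show ?thesis using True
      by (intro exI[of _ "of_int (snd v2) / of_int (snd v1)"]) (simp add: to_q_def qscale_def)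
  next
    case False
    have "fst v1 * snd v2 = snd v1 * fst v2" using 0 by (simp add: \<Delta>_def)
    then have "(of_int (fst v1) * of_int (snd v2) :: rat) = of_int (snd v1) * of_int (fst v2)" by (metis of_int_mult)
    then show ?thesis using False
      by (intro exI[of _ "of_int (fst v2) / of_int (fst v1)"]) (simp add: to_q_def qscale_def field_simps)
  qed
  then obtain c where c: "to_q v2 = qscale c (to_q v1)" by blast
  have "sigma_cone S \<subseteq> qplane.span {to_q v1}"
  proof
    fix x assume "x \<in> sigma_cone S"
    then obtain r t where "x = qscale r (to_q v1) + qscale t (to_q v2)" unfolding sigma using qcone_pairD by metis
    then show "x \<in> qplane.span {to_q v1}" unfolding c
      by (simp only:) (intro qplane.span_add qplane.span_scale qplane.span_base, simp_all)
  qed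
  then have "qplane.dim (sigma_cone S) \<le> card {to_q v1}" by (rule qplane.dim_le_card) simp
  then show False using dim2 by simp
qed

lemma sgn_Delta: "sgn \<Delta> * sgn \<Delta> = 1" "sgn \<Delta> * \<Delta> = n"
  using Delta_nonzero by (simp_all add: n_def sgn_if)

lemma n_pos: "0 < n"
  using Delta_nonzero by (simp add: n_def)

lemma D_e1: "D e1 x = pairing v1 x"
proof -
  have "D e1 x = (sgn \<Delta> * sgn \<Delta>) * pairing v1 x" by (simp add: D_def e1_def zscale_def pairing_def algebra_simps)
  then show ?thesis by (simp only: sgn_Delta mult_1_left)
qed

lemma D_e2: "D x e2 = pairing v2 x"
proof -
  have "D x e2 = (sgn \<Delta> * sgn \<Delta>) * pairing v2 x" by (simp add: D_def e2_def zscale_def pairing_def algebra_simps)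
  then show ?thesis by (simp only: sgn_Delta mult_1_left)
qed

lemma pairing_e: "pairing v1 e1 = 0" "pairing v2 e1 = n" "pairing v1 e2 = n" "pairing v2 e2 = 0"
proof -
  have "pairing v2 e1 = sgn \<Delta> * \<Delta>" "pairing v1 e2 = sgn \<Delta> * \<Delta>"
    by (simp_all add: pairing_def e1_def e2_def zscale_def \<Delta>_def algebra_simps)
  then show "pairing v2 e1 = n" "pairing v1 e2 = n" by (simp_all only: sgn_Delta)
qed (simp_all add: pairing_def e1_def e2_def zscale_def algebra_simps)

text \<open>Cramer's rule, which gives the coordinates with respect to an edge vector and a point at
  height one.\<close>

lemma D_cramer: "zscale (D x y) z = zscale (D x z) y + zscale (D z y) x"
  by (simp add: D_def zscale_def algebra_simps prod_eq_iff)

lemma kernel_1: "pairing v1 u = 0 \<Longrightarrow> \<exists>k. u = zscale k e1"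
proof -
  assume 0: "pairing v1 u = 0"
  have cop: "coprime (fst v1) (snd v1)" using prim by (simp add: primitive_def)
  obtain r t where "r * fst v1 + t * snd v1 = 1" using cop by (metis bezout_int coprime_iff_gcd_eq_1)
  then have "pairing v1 (r, t) = 1" by (simp add: pairing_def algebra_simps)
  then have "D e1 (r, t) = 1" "D e1 u = 0" using 0 by (simp_all add: D_e1)
  then have "u = zscale (D u (r, t)) e1" using D_cramer[of e1 "(r, t)" u] by simp
  then show ?thesis ..
qed

lemma sigma_dual: "dual_cone (sigma_cone S) = {x. 0 \<le> qpairing (to_q v1) x \<and> 0 \<le> qpairing (to_q v2) x}"
  unfolding sigma dual_qcone by (auto simp: qpairing_commute)

lemma saturation_eq: "saturation S = {u. 0 \<le> pairing v1 u \<and> 0 \<le> pairing v2 u}"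
  unfolding saturation_def sigma_dual by (simp add: qpairing_to_q)

lemma S_subset: "S \<subseteq> saturation S"
proof
  fix u assume u: "u \<in> S"
  have "0 \<le> qpairing m (to_q u)" if "m \<in> sigma_cone S" for m
    using that u unfolding sigma_cone_def dual_qcone by blast
  moreover have "to_q v1 \<in> sigma_cone S" "to_q v2 \<in> sigma_cone S" unfolding sigma by (simp_all add: qcone_base)
  ultimately have "0 \<le> qpairing (to_q v1) (to_q u)" "0 \<le> qpairing (to_q v2) (to_q u)" by blast+
  then show "u \<in> saturation S" unfolding saturation_eq by (simp add: qpairing_to_q)
qed

lemma ray_perp: "to_q u \<in> perp (ray v) \<longleftrightarrow> pairing v u = 0"
  unfolding ray_def perp_qcone by (simp add: qpairing_to_q)

definition G1 where "G1 = face_group S (ray v1)"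
definition G2 where "G2 = face_group S (ray v2)"

lemma G1_eq: "G1 = group_closure {u\<in>S. pairing v1 u = 0}"
  unfolding G1_def face_group_def ray_perp ..

lemma G2_eq: "G2 = group_closure {u\<in>S. pairing v2 u = 0}"
  unfolding G2_def face_group_def ray_perp ..

lemma qpairing_both_zero:
  assumes "qpairing (to_q v1) x = 0" "qpairing (to_q v2) x = 0"
  shows "x = 0"
proof -
  let ?\<Delta> = "of_int \<Delta> :: rat"
  have "?\<Delta> * fst x = of_int (snd v2) * qpairing (to_q v1) x - of_int (snd v1) * qpairing (to_q v2) x"
    "?\<Delta> * snd x = of_int (fst v1) * qpairing (to_q v2) x - of_int (fst v2) * qpairing (to_q v1) x"
    by (simp_all add: \<Delta>_def qpairing_def to_q_def algebra_simps)
  then show ?thesis using assms Delta_nonzero by (simp add: prod_eq_iff zero_prod_def)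
qed

text \<open>The face of \<open>\<sigma>\<close> orthogonal to a point \<open>x\<close> of the dual cone depends only on which of
  \<open>\<langle>v\<^sub>1, x\<rangle>\<close> and \<open>\<langle>v\<^sub>2, x\<rangle>\<close> vanish. So there are four faces, and seminormality describes \<open>S\<close> on
  the interior, the two edges and the vertex of the dual cone; on the interior the group is all of
  \<open>M\<close>.\<close>

lemma S_cases:
  "u \<in> S \<longleftrightarrow> (0 < pairing v1 u \<and> 0 < pairing v2 u) \<or> (pairing v1 u = 0 \<and> 0 < pairing v2 u \<and> u \<in> G1)
     \<or> (pairing v2 u = 0 \<and> 0 < pairing v1 u \<and> u \<in> G2) \<or> u = 0"
proof -
  let ?\<sigma> = "sigma_cone S" let ?a = "to_q v1" let ?b = "to_q v2"
  have e1q: "qpairing ?a (to_q e1) = 0" "0 < qpairing ?b (to_q e1)" using n_pos by (simp_all add: qpairing_to_q pairing_e)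
  have e2q: "qpairing ?b (to_q e2) = 0" "0 < qpairing ?a (to_q e2)" using n_pos by (simp_all add: qpairing_to_q pairing_e)
  have inner: "0 < qpairing ?a (to_q (e1 + e2))" "0 < qpairing ?b (to_q (e1 + e2))"
    using e1q e2q by (simp_all add: to_q_add qpairing_add_right)
  have ab: "?a \<in> ?\<sigma>" "?b \<in> ?\<sigma>" unfolding sigma by (simp_all add: qcone_base)
  have face: "perp \<tau> = (if qpairing ?a x = 0 then (if qpairing ?b x = 0 then {0} else {y. qpairing ?a y = 0})
        else (if qpairing ?b x = 0 then {y. qpairing ?b y = 0} else UNIV))"
    if x: "x \<in> dual_cone ?\<sigma>" and \<tau>: "\<tau> = {n\<in>?\<sigma>. qpairing n x = 0}" for x \<tau>
  proof -
    have nn: "0 \<le> qpairing ?a x" "0 \<le> qpairing ?b x" using x unfolding sigma_dual by simp_all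
    have a\<tau>: "?a \<in> \<tau> \<longleftrightarrow> qpairing ?a x = 0" "?b \<in> \<tau> \<longleftrightarrow> qpairing ?b x = 0" using ab by (simp_all add: \<tau>)
    have comb: "\<exists>c d. m = qscale c ?a + qscale d ?b \<and> (qpairing ?a x \<noteq> 0 \<longrightarrow> c = 0) \<and> (qpairing ?b x \<noteq> 0 \<longrightarrow> d = 0)"
      if m: "m \<in> \<tau>" for m
    proof -
      have "m \<in> qcone {?a, ?b}" using m unfolding \<tau> sigma by simp
      then obtain c d where cd: "0 \<le> c" "0 \<le> d" "m = qscale c ?a + qscale d ?b" by (rule qcone_pairD)
      have "c * qpairing ?a x + d * qpairing ?b x = 0"
        using m unfolding \<tau> cd(3) by (simp add: qpairing_add_left qpairing_scale_left)
      moreover have "0 \<le> c * qpairing ?a x" "0 \<le> d * qpairing ?b x" using cd nn by simp_all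
      ultimately have "c * qpairing ?a x = 0" "d * qpairing ?b x = 0" by linarith+
      then show ?thesis using cd(3) by auto
    qed
    have "y \<in> perp \<tau> \<longleftrightarrow> (qpairing ?a x = 0 \<longrightarrow> qpairing ?a y = 0) \<and> (qpairing ?b x = 0 \<longrightarrow> qpairing ?b y = 0)" for y
    proof
      assume "y \<in> perp \<tau>"
      then show "(qpairing ?a x = 0 \<longrightarrow> qpairing ?a y = 0) \<and> (qpairing ?b x = 0 \<longrightarrow> qpairing ?b y = 0)"
        unfolding perp_def using a\<tau> by blast
    next
      assume r: "(qpairing ?a x = 0 \<longrightarrow> qpairing ?a y = 0) \<and> (qpairing ?b x = 0 \<longrightarrow> qpairing ?b y = 0)"
      have "qpairing m y = 0" if m: "m \<in> \<tau>" for m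
      proof -
        obtain c d where "m = qscale c ?a + qscale d ?b" "qpairing ?a x \<noteq> 0 \<longrightarrow> c = 0" "qpairing ?b x \<noteq> 0 \<longrightarrow> d = 0"
          using comb[OF m] by blast
        then show ?thesis using r by (auto simp: qpairing_add_left qpairing_scale_left)
      qed
      then show "y \<in> perp \<tau>" unfolding perp_def by blast
    qed
    moreover have "y = 0" if "qpairing ?a y = 0" "qpairing ?b y = 0" for y using qpairing_both_zero[OF that] .
    ultimately show ?thesis by (auto simp: set_eq_iff)
  qed
  let ?D = "dual_cone ?\<sigma>"
  have D: "?D = {x. 0 \<le> qpairing ?a x \<and> 0 \<le> qpairing ?b x}" by (rule sigma_dual)
  have D0: "?D \<inter> {0} = {0}" unfolding D by auto
  have D1: "?D \<inter> {y. qpairing ?a y = 0} = {y. qpairing ?a y = 0 \<and> 0 \<le> qpairing ?b y}" unfolding D by auto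
  have D2: "?D \<inter> {y. qpairing ?b y = 0} = {y. qpairing ?b y = 0 \<and> 0 \<le> qpairing ?a y}" unfolding D by auto
  have z: "0 \<in> S" using affine by (simp add: affine_monoid_def is_submonoid_def)
  define Z where "Z T = (u \<in> group_closure {u\<in>S. to_q u \<in> T} \<and> to_q u \<in> relint (?D \<inter> T))" for T
  have Z0: "Z {0} \<longleftrightarrow> u = 0"
  proof -
    have "{u\<in>S. to_q u \<in> {0}} = {0}" using z by auto
    then have "group_closure {u\<in>S. to_q u \<in> {0}} = {0}" using group_closure_insert_zero[of "{}"] by simp
    then show ?thesis unfolding Z_def D0 relint_origin by auto
  qed
  have Z1: "Z {y. qpairing ?a y = 0} \<longleftrightarrow> pairing v1 u = 0 \<and> 0 < pairing v2 u \<and> u \<in> G1"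
    unfolding Z_def D1 relint_edge[OF e1q] G1_eq by (auto simp: qpairing_to_q)
  have Z2: "Z {y. qpairing ?b y = 0} \<longleftrightarrow> pairing v2 u = 0 \<and> 0 < pairing v1 u \<and> u \<in> G2"
    unfolding Z_def D2 relint_edge[OF e2q] G2_eq by (auto simp: qpairing_to_q)
  have ZU: "Z UNIV \<longleftrightarrow> 0 < pairing v1 u \<and> 0 < pairing v2 u"
    unfolding Z_def using span by (simp add: D relint_open_cone[OF inner] qpairing_to_q)
  have mem: "u \<in> S \<longleftrightarrow> (\<exists>\<tau>. face_of_cone \<tau> ?\<sigma> \<and> Z (perp \<tau>))"
    using semi unfolding seminormal_def Z_def face_group_def by blast
  have "(\<exists>\<tau>. face_of_cone \<tau> ?\<sigma> \<and> Z (perp \<tau>)) \<longleftrightarrow>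
      Z UNIV \<or> Z {y. qpairing ?a y = 0} \<or> Z {y. qpairing ?b y = 0} \<or> Z {0}"
  proof
    assume "\<exists>\<tau>. face_of_cone \<tau> ?\<sigma> \<and> Z (perp \<tau>)"
    then obtain \<tau> x where x: "x \<in> ?D" "\<tau> = {n\<in>?\<sigma>. qpairing n x = 0}" "Z (perp \<tau>)"
      unfolding face_of_cone_def by blast
    show "Z UNIV \<or> Z {y. qpairing ?a y = 0} \<or> Z {y. qpairing ?b y = 0} \<or> Z {0}"
      using x(3) unfolding face[OF x(1,2)] by (simp split: if_splits)
  next
    have ex: "\<exists>\<tau>. face_of_cone \<tau> ?\<sigma> \<and> Z (perp \<tau>)" if "x \<in> ?D"
      "Z (if qpairing ?a x = 0 then (if qpairing ?b x = 0 then {0} else {y. qpairing ?a y = 0})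
        else (if qpairing ?b x = 0 then {y. qpairing ?b y = 0} else UNIV))" for x
      using that face[OF that(1) refl] unfolding face_of_cone_def by (intro exI[of _ "{n\<in>?\<sigma>. qpairing n x = 0}"]) auto
    assume "Z UNIV \<or> Z {y. qpairing ?a y = 0} \<or> Z {y. qpairing ?b y = 0} \<or> Z {0}"
    then show "\<exists>\<tau>. face_of_cone \<tau> ?\<sigma> \<and> Z (perp \<tau>)"
    proof (elim disjE)
      assume "Z UNIV" then show ?thesis using inner by (intro ex[of "to_q (e1 + e2)"]) (simp_all add: D)
    next
      assume "Z {y. qpairing ?a y = 0}" then show ?thesis using e1q by (intro ex[of "to_q e1"]) (simp_all add: D)
    next
      assume "Z {y. qpairing ?b y = 0}" then show ?thesis using e2q by (intro ex[of "to_q e2"]) (simp_all add: D)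
    next
      assume "Z {0}" then show ?thesis by (intro ex[of 0]) (simp_all add: D)
    qed
  qed
  then show ?thesis using mem Z0 Z1 Z2 ZU by blast
qed

end


section \<open>Subgroups of a rank one lattice\<close>

lemma int_subgroup_cyclic:
  fixes A :: "int set"
  assumes "0 \<in> A" and diff: "\<And>x y. x \<in> A \<Longrightarrow> y \<in> A \<Longrightarrow> x - y \<in> A" and nz: "k \<in> A" "k \<noteq> 0"
  obtains d where "0 < d" "A = {k. d dvd k}"
proof -
  have closed: "group_closure A = A"
  proof
    show "group_closure A \<subseteq> A"
    proof
      fix x assume "x \<in> group_closure A"
      then show "x \<in> A" by induction (use assms(1) diff in auto)
    qed
  qed (auto intro: group_closure.base)
  define d where "d = Gcd A"
  have dA: "d \<in> A" unfolding d_def using Gcd_group_closure_in_group_closure[of A] closed by simp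
  have all_dvd: "d dvd x" if "x \<in> A" for x using that by (simp add: d_def)
  have all_in: "x \<in> A" if "d dvd x" for x
  proof -
    obtain c where "x = d * c" using \<open>d dvd x\<close> by (auto elim: dvdE)
    then show ?thesis using group_closure_mult_left[of d A c] dA closed by simp
  qed
  have "d \<noteq> 0" using nz all_dvd[of k] by auto
  moreover have "0 \<le> d" by (simp add: d_def)
  ultimately have "0 < d" by linarith
  moreover have "A = {k. d dvd k}" using all_dvd all_in by blast
  ultimately show ?thesis using that by blast
qed

lemma zscale_right_inject: "e \<noteq> 0 \<Longrightarrow> zscale j e = zscale k e \<longleftrightarrow> j = k"
  by (cases e) (auto simp: zscale_def zero_prod_def)

lemma translate_eq_iff:
  fixes G :: "lattice set"
  assumes "0 \<in> G" and diff: "\<And>x y. x \<in> G \<Longrightarrow> y \<in> G \<Longrightarrow> x - y \<in> G"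
  shows "(+) u ` G = (+) v ` G \<longleftrightarrow> u - v \<in> G"
proof
  assume eq: "(+) u ` G = (+) v ` G"
  have "u + 0 \<in> (+) u ` G" using assms(1) by (rule imageI)
  then obtain x where x: "x \<in> G" "u = v + x" unfolding eq by auto
  then show "u - v \<in> G" by simp
next
  assume d: "u - v \<in> G"
  have neg: "- x \<in> G" if "x \<in> G" for x using diff[OF assms(1) that] by simp
  have add: "x + y \<in> G" if "x \<in> G" "y \<in> G" for x y using diff[OF that(1) neg[OF that(2)]] by simp
  show "(+) u ` G = (+) v ` G"
  proof (intro set_eqI iffI)
    fix y assume "y \<in> (+) u ` G"
    then obtain x where "x \<in> G" "y = u + x" by blast
    then show "y \<in> (+) v ` G" using add[OF d, of x] by (intro image_eqI[of _ _ "u - v + x"]) simp_all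
  next
    fix y assume "y \<in> (+) v ` G"
    then obtain x where "x \<in> G" "y = v + x" by blast
    then show "y \<in> (+) u ` G" using diff[OF _ d, of x] by (intro image_eqI[of _ _ "x - (u - v)"]) simp_all
  qed
qed

text \<open>A nonzero subgroup of \<open>\<int> e\<close> is generated by a multiple \<open>d e\<close>, and the points \<open>j e\<close> with
  \<open>0 \<le> j < d\<close> represent its cosets.\<close>

lemma ray_group:
  assumes e: "e \<noteq> 0" and X: "X \<subseteq> range (\<lambda>k. zscale k e)" and x: "x \<in> X" "x \<noteq> 0"
  obtains d where "0 < d" "group_closure X = {zscale k e | k. d dvd k}"
    "int (group_index (range (\<lambda>k. zscale k e)) (group_closure X)) = d"
proof -
  let ?G = "group_closure X"
  have G_sub: "?G \<subseteq> range (\<lambda>k. zscale k e)"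
  proof
    fix y assume "y \<in> ?G"
    then show "y \<in> range (\<lambda>k. zscale k e)"
    proof induction
      case (base s)
      then show ?case using X by (auto intro: range_eqI[of _ _ 0])
    next
      case (diff s t)
      then obtain j k where "s = zscale j e" "t = zscale k e" by blast
      then show ?case by (intro range_eqI[of _ _ "j - k"]) (simp add: zscale_diff_left)
    qed
  qed
  define A where "A = {k. zscale k e \<in> ?G}"
  have "\<exists>k. k \<in> A \<and> k \<noteq> 0"
  proof -
    obtain k where "x = zscale k e" using X x by blast
    then show ?thesis using x group_closure.base[of x X] by (intro exI[of _ k]) (auto simp: A_def)
  qed
  then obtain k0 where k0: "k0 \<in> A" "k0 \<noteq> 0" by blast
  obtain d where d: "0 < d" "A = {k. d dvd k}"
  proof (rule int_subgroup_cyclic[OF _ _ k0])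
    show "0 \<in> A" by (simp add: A_def)
    show "x - y \<in> A" if "x \<in> A" "y \<in> A" for x y
      using that group_closure.diff[of "zscale x e" X "zscale y e"] by (simp add: A_def zscale_diff_left)
  qed
  have G: "?G = {zscale k e | k. d dvd k}"
  proof (intro set_eqI iffI)
    fix y assume "y \<in> ?G"
    moreover then obtain k where "y = zscale k e" using G_sub by blast
    ultimately have "k \<in> A" "y = zscale k e" by (simp_all add: A_def)
    then show "y \<in> {zscale k e | k. d dvd k}" using d by blast
  next
    fix y assume "y \<in> {zscale k e | k. d dvd k}"
    then obtain k where "k \<in> A" "y = zscale k e" using d by blast
    then show "y \<in> ?G" by (simp add: A_def)
  qed
  have coset: "(+) (zscale j e) ` ?G = (+) (zscale k e) ` ?G \<longleftrightarrow> d dvd (j - k)" for j k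
  proof -
    have "(+) (zscale j e) ` ?G = (+) (zscale k e) ` ?G \<longleftrightarrow> zscale j e - zscale k e \<in> ?G"
      by (rule translate_eq_iff) (auto intro: group_closure.diff)
    also have "\<dots> \<longleftrightarrow> j - k \<in> A" by (simp add: A_def zscale_diff_left)
    finally show ?thesis using d by blast
  qed
  have "{(+) u ` ?G | u. u \<in> range (\<lambda>k. zscale k e)} = (\<lambda>j. (+) (zscale j e) ` ?G) ` {0..<d}"
  proof (intro set_eqI iffI)
    fix C assume "C \<in> {(+) u ` ?G | u. u \<in> range (\<lambda>k. zscale k e)}"
    then obtain k where "C = (+) (zscale k e) ` ?G" by blast
    moreover have "d dvd (k - k mod d)" by (simp add: minus_mod_eq_mult_div)
    ultimately have "C = (+) (zscale (k mod d) e) ` ?G" using coset by simp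
    moreover have "k mod d \<in> {0..<d}" using d(1) by simp
    ultimately show "C \<in> (\<lambda>j. (+) (zscale j e) ` ?G) ` {0..<d}" by blast
  qed blast
  moreover have "inj_on (\<lambda>j. (+) (zscale j e) ` ?G) {0..<d}"
  proof (rule inj_onI)
    fix j k assume jk: "j \<in> {0..<d}" "k \<in> {0..<d}" "(+) (zscale j e) ` ?G = (+) (zscale k e) ` ?G"
    then have "d dvd \<bar>j - k\<bar>" using coset by simp
    moreover have "\<bar>j - k\<bar> < d" using jk by auto
    ultimately show "j = k" using zdvd_not_zless[of "\<bar>j - k\<bar>" d] by fastforce
  qed
  ultimately have "group_index (range (\<lambda>k. zscale k e)) ?G = nat d"
    unfolding group_index_def by (simp add: card_image)
  then show ?thesis using that d(1) G by simp
qed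

context plane_cone
begin

lemma swap_plane: "plane_cone S v2 v1"
  by unfold_locales (use affine span dim2 semi prim sigma in \<open>simp_all add: insert_commute\<close>)

lemma e_nonzero: "e1 \<noteq> 0" "e2 \<noteq> 0"
  using pairing_e n_pos by (metis pairing_zero less_irrefl)+

lemma S_submonoid: "0 \<in> S" "x \<in> S \<Longrightarrow> y \<in> S \<Longrightarrow> x + y \<in> S"
  using affine by (auto simp: affine_monoid_def is_submonoid_def)

text \<open>If no nonzero element of \<open>S\<close> lay on the edge orthogonal to \<open>v\<^sub>1\<close>, the cone \<open>\<sigma>\<close> would contain
  \<open>N v\<^sub>1 - v\<^sub>2\<close> for large \<open>N\<close>.\<close>

lemma ray_element: "\<exists>u\<in>S. pairing v1 u = 0 \<and> u \<noteq> 0"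
proof (rule ccontr)
  assume none: "\<not> (\<exists>u\<in>S. pairing v1 u = 0 \<and> u \<noteq> 0)"
  obtain F where F: "finite F" "is_submonoid hull F = S" using affine by (auto simp: affine_monoid_def)
  define N where "N = (\<Sum>u\<in>F. \<bar>pairing v2 u\<bar>)"
  define m where "m = zscale N v1 - v2"
  have pm: "pairing m u = N * pairing v1 u - pairing v2 u" for u
    by (simp add: m_def pairing_def zscale_def algebra_simps)
  have "0 \<le> pairing m u" if u: "u \<in> F" for u
  proof (cases "u = 0")
    case False
    have uS: "u \<in> S" using u F(2) hull_subset[of F is_submonoid] by blast
    then have "1 \<le> pairing v1 u" using S_subset none False by (force simp: saturation_eq)
    moreover have "\<bar>pairing v2 u\<bar> \<le> N" unfolding N_def by (rule member_le_sum) (use u F in auto)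
    moreover have "0 \<le> N" unfolding N_def by (rule sum_nonneg) simp
    ultimately have "N * 1 \<le> N * pairing v1 u" by (intro mult_left_mono) simp_all
    then show ?thesis using \<open>\<bar>pairing v2 u\<bar> \<le> N\<close> by (simp add: pm)
  qed simp
  then have "F \<subseteq> {u. 0 \<le> pairing m u}" by blast
  moreover have "is_submonoid {u. 0 \<le> pairing m u}" by (simp add: is_submonoid_def pairing_add)
  ultimately have "S \<subseteq> {u. 0 \<le> pairing m u}" unfolding F(2)[symmetric] by (rule hull_minimal)
  then have "to_q m \<in> sigma_cone S"
    unfolding sigma_cone_def dual_qcone by (auto simp: qpairing_to_q)
  moreover have "to_q e1 \<in> dual_cone (sigma_cone S)"
    unfolding sigma_dual using n_pos by (simp add: qpairing_to_q pairing_e)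
  ultimately have "0 \<le> qpairing (to_q e1) (to_q m)" unfolding dual_cone_def by blast
  then have "0 \<le> pairing e1 m" unfolding qpairing_to_q of_int_0_le_iff .
  then have "0 \<le> pairing m e1" by (simp add: pairing_def mult.commute)
  then show False using pm[of e1] n_pos by (simp add: pairing_e)
qed

lemma kernel_range: "{u. pairing v1 u = 0} = range (\<lambda>k. zscale k e1)"
proof (intro set_eqI iffI)
  fix u assume "u \<in> range (\<lambda>k. zscale k e1)"
  then obtain k where "u = zscale k e1" by blast
  then have "pairing v1 u = k * pairing v1 e1" by (simp add: pairing_def zscale_def algebra_simps)
  then show "u \<in> {u. pairing v1 u = 0}" by (simp add: pairing_e)
qed (use kernel_1 in blast)

lemma face_group_ray:
  assumes l: "l = int (ray_index S v1)"
  shows "0 < l" "G1 = {zscale k e1 | k. l dvd k}"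
proof -
  obtain u where u: "u \<in> {u\<in>S. pairing v1 u = 0}" "u \<noteq> 0" using ray_element by blast
  have "{u\<in>S. pairing v1 u = 0} \<subseteq> range (\<lambda>k. zscale k e1)" using kernel_range by blast
  then obtain d where d: "0 < d" "G1 = {zscale k e1 | k. d dvd k}"
    "int (group_index (range (\<lambda>k. zscale k e1)) G1) = d"
    by (rule ray_group[OF e_nonzero(1) _ u, folded G1_eq])
  have "l = d"
    unfolding l ray_index_def G1_def[symmetric] ray_perp kernel_range d(3) ..
  then show "0 < l" "G1 = {zscale k e1 | k. l dvd k}" using d by simp_all
qed

end


section \<open>The minimal generators of the saturation\<close>

definition irreducible_in :: "lattice set \<Rightarrow> lattice \<Rightarrow> bool" where
  "irreducible_in C x \<longleftrightarrow> x \<in> C \<and> x \<noteq> 0 \<and> (\<forall>y\<in>C. \<forall>z\<in>C. x = y + z \<longrightarrow> y = 0 \<or> z = 0)"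

lemma is_submonoid_hull: "is_submonoid (is_submonoid hull H)"
  unfolding hull_def is_submonoid_def by auto

lemma dvd_recursion:
  fixes f :: "nat \<Rightarrow> int"
  assumes "d dvd f 0" "d dvd f 1" and rec: "\<And>j. 1 \<le> j \<Longrightarrow> j \<le> s \<Longrightarrow> f (j - 1) + f (j + 1) = c j * f j"
    and "j \<le> s + 1"
  shows "d dvd f j"
  using \<open>j \<le> s + 1\<close>
proof (induction j rule: less_induct)
  case (less j)
  show ?case
  proof (cases "j \<le> 1")
    case True
    then show ?thesis using assms(1,2) by (cases j) auto
  next
    case False
    have "f (j - 2) + f j = c (j - 1) * f (j - 1)"
      using rec[of "j - 1"] False less.prems by (simp add: diff_diff_left numeral_2_eq_2)
    moreover have "d dvd f (j - 2)" "d dvd f (j - 1)" using less False by simp_all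
    ultimately show ?thesis by (metis dvd_add_right_iff dvd_mult)
  qed
qed

context plane_cone
begin

lemma pairing_zscale: "pairing v (zscale k x) = k * pairing v x"
  by (simp add: pairing_def zscale_def algebra_simps)

lemma pairing_diff: "pairing v (x - y) = pairing v x - pairing v y"
  by (simp add: pairing_def algebra_simps)

lemma swap_Delta: "plane_cone.\<Delta> v2 v1 = - \<Delta>"
  unfolding plane_cone.\<Delta>_def[OF swap_plane] \<Delta>_def by (simp add: algebra_simps)

lemma swap_e: "plane_cone.e1 v2 v1 = e2" "plane_cone.e2 v2 v1 = e1" "plane_cone.n v2 v1 = n"
  unfolding plane_cone.e1_def[OF swap_plane] plane_cone.e2_def[OF swap_plane] plane_cone.n_def[OF swap_plane]
    swap_Delta e1_def e2_def n_def by (simp_all add: zscale_def sgn_if)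

lemma saturation_submonoid: "is_submonoid (saturation S)"
  by (simp add: saturation_eq is_submonoid_def pairing_add)

lemma height_positive: assumes "z \<in> saturation S" "z \<noteq> 0" shows "0 < pairing v1 z + pairing v2 z"
proof (rule ccontr)
  assume "\<not> ?thesis"
  then have "pairing v1 z = 0" "pairing v2 z = 0" using assms(1) by (auto simp: saturation_eq)
  then obtain k where "z = zscale k e1" using kernel_1 by blast
  then show False using \<open>pairing v2 z = 0\<close> assms(2) n_pos by (simp add: pairing_zscale pairing_e)
qed

text \<open>A generator that decomposes would be redundant, because its summands are sums of generators
  of smaller height. An irreducible element cannot be generated by other elements.\<close>

lemma minimal_generators:
  assumes min: "minimal_generating_set H (saturation S)"
  shows "H = {x. irreducible_in (saturation S) x}"
proof
  let ?C = "saturation S"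
  have hull: "is_submonoid hull H = ?C" using min by (simp add: minimal_generating_set_def)
  have sub: "H \<subseteq> ?C" using hull hull_subset[of H is_submonoid] by simp
  have min': "is_submonoid hull (H - {x}) \<noteq> ?C" if "x \<in> H" for x
    using min that unfolding minimal_generating_set_def by blast
  have le: "\<not> x \<in> is_submonoid hull (H - {x})" if "x \<in> H" for x
  proof
    assume x: "x \<in> is_submonoid hull (H - {x})"
    have "H \<subseteq> is_submonoid hull (H - {x})" using x hull_subset[of "H - {x}" is_submonoid] by blast
    then have "is_submonoid hull H \<subseteq> is_submonoid hull (H - {x})" by (rule hull_minimal) (rule is_submonoid_hull)
    moreover have "is_submonoid hull (H - {x}) \<subseteq> is_submonoid hull H" by (rule hull_mono) blast
    ultimately show False using min'[OF that] hull by simp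
  qed
  show "H \<subseteq> {x. irreducible_in ?C x}"
  proof
    fix x assume x: "x \<in> H"
    let ?h = "\<lambda>c. pairing v1 c + pairing v2 c"
    let ?H = "is_submonoid hull (H - {x})"
    have H0: "0 \<in> ?H" and Hadd: "\<And>a b. a \<in> ?H \<Longrightarrow> b \<in> ?H \<Longrightarrow> a + b \<in> ?H"
      using is_submonoid_hull[of "H - {x}"] by (simp_all add: is_submonoid_def)
    \<comment> \<open>Elements of smaller height than \<open>x\<close> are sums of generators other than \<open>x\<close>.\<close>
    have "is_submonoid hull H \<subseteq> {c\<in>?C. ?h c < ?h x \<longrightarrow> c \<in> ?H}"
    proof (rule hull_minimal)
      show "H \<subseteq> {c\<in>?C. ?h c < ?h x \<longrightarrow> c \<in> ?H}"
      proof
        fix c assume "c \<in> H"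
        then show "c \<in> {c\<in>?C. ?h c < ?h x \<longrightarrow> c \<in> ?H}"
          using sub hull_subset[of "H - {x}" is_submonoid] by (cases "c = x") auto
      qed
      show "is_submonoid {c\<in>?C. ?h c < ?h x \<longrightarrow> c \<in> ?H}"
        using saturation_submonoid H0 Hadd unfolding is_submonoid_def
        by (auto simp: saturation_eq pairing_add)
    qed
    then have small: "c \<in> ?H" if "c \<in> ?C" "?h c < ?h x" for c using hull that by blast
    have "x \<noteq> 0" using le[OF x] H0 by metis
    moreover have "y = 0 \<or> z = 0" if yz: "y \<in> ?C" "z \<in> ?C" "x = y + z" for y z
    proof (rule ccontr)
      assume "\<not> ?thesis"
      then have "0 < ?h y" "0 < ?h z" using height_positive yz by simp_all
      then have "y \<in> ?H" "z \<in> ?H" using small yz by (simp_all add: pairing_add)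
      then show False using Hadd le[OF x] yz(3) by blast
    qed
    ultimately show "x \<in> {x. irreducible_in ?C x}" using x sub by (auto simp: irreducible_in_def)
  qed
  show "{x. irreducible_in ?C x} \<subseteq> H"
  proof
    fix x assume "x \<in> {x. irreducible_in ?C x}"
    then have x: "x \<in> ?C" "x \<noteq> 0" "\<And>y z. y \<in> ?C \<Longrightarrow> z \<in> ?C \<Longrightarrow> x = y + z \<Longrightarrow> y = 0 \<or> z = 0"
      unfolding irreducible_in_def by blast+
    show "x \<in> H"
    proof (rule ccontr)
      assume "x \<notin> H"
      have "is_submonoid (?C - {x})" unfolding is_submonoid_def
      proof (intro conjI ballI)
        show "0 \<in> ?C - {x}" using saturation_submonoid x(2) by (simp add: is_submonoid_def)
        fix y z assume yz: "y \<in> ?C - {x}" "z \<in> ?C - {x}"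
        then have "y + z \<in> ?C" using saturation_submonoid by (simp add: is_submonoid_def)
        moreover have "y + z \<noteq> x" using x(3)[of y z] yz by auto
        ultimately show "y + z \<in> ?C - {x}" by simp
      qed
      then have "is_submonoid hull H \<subseteq> ?C - {x}" using sub \<open>x \<notin> H\<close> by (intro hull_minimal) auto
      then show False using hull x(1) by blast
    qed
  qed
qed

lemma irreducible_edge:
  "irreducible_in (saturation S) x \<and> pairing v1 x = 0 \<longleftrightarrow> x = e1"
proof
  assume x: "irreducible_in (saturation S) x \<and> pairing v1 x = 0"
  then obtain k where k: "x = zscale k e1" using kernel_1 by blast
  have "x \<in> saturation S" "x \<noteq> 0" using x by (simp_all add: irreducible_in_def)
  then have "0 \<le> k" "k \<noteq> 0" using k n_pos
    by (auto simp: saturation_eq pairing_zscale pairing_e zero_le_mult_iff)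
  show "x = e1"
  proof (cases "k = 1")
    case False
    have "x = zscale 1 e1 + zscale (k - 1) e1" unfolding zscale_add_left[symmetric] k by simp
    moreover have "zscale 1 e1 \<in> saturation S" "zscale (k - 1) e1 \<in> saturation S"
      using n_pos \<open>0 \<le> k\<close> \<open>k \<noteq> 0\<close> by (simp_all add: saturation_eq pairing_zscale pairing_e)
    ultimately have "zscale 1 e1 = 0 \<or> zscale (k - 1) e1 = 0"
      using x unfolding irreducible_in_def by blast
    then show ?thesis using False zscale_right_inject[OF e_nonzero(1), of "k - 1" 0] e_nonzero by simp
  qed (simp add: k)
next
  assume x: "x = e1"
  have "y = 0 \<or> z = 0" if yz: "y \<in> saturation S" "z \<in> saturation S" "e1 = y + z" for y z
  proof -
    have "pairing v1 y + pairing v1 z = 0" using pairing_e(1) yz(3) by (simp add: pairing_add)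
    then have "pairing v1 y = 0" "pairing v1 z = 0" using yz by (auto simp: saturation_eq)
    then obtain j k where jk: "y = zscale j e1" "z = zscale k e1" using kernel_1 by blast
    have "zscale 1 e1 = zscale (j + k) e1" using yz(3) unfolding jk zscale_add_left zscale_one .
    then have "1 = j + k" unfolding zscale_right_inject[OF e_nonzero(1)] .
    moreover have "0 \<le> j" "0 \<le> k" using yz(1,2) n_pos
      by (auto simp: jk saturation_eq pairing_zscale pairing_e zero_le_mult_iff)
    ultimately have "j = 0 \<or> k = 0" by linarith
    then show ?thesis using jk by auto
  qed
  then show "irreducible_in (saturation S) x \<and> pairing v1 x = 0" using x n_pos e_nonzero
    by (auto simp: irreducible_in_def saturation_eq pairing_e)
qed

lemma irreducible_edge_2:
  "irreducible_in (saturation S) x \<and> pairing v2 x = 0 \<longleftrightarrow> x = e2"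
  using plane_cone.irreducible_edge[OF swap_plane] unfolding swap_e .

text \<open>A lattice point at height one above the edge exists by Bezout; it is moved into the cone along the edge.\<close>

lemma height_one_point: "\<exists>u\<in>saturation S. pairing v1 u = 1"
proof -
  obtain c d where cd: "c * fst v1 + d * snd v1 = 1"
    using bezout_int[of "fst v1" "snd v1"] prim(1) unfolding primitive_def by (auto simp: coprime_iff_gcd_eq_1)
  define u0 where "u0 = (c, d)"
  define u where "u = u0 + zscale \<bar>pairing v2 u0\<bar> e1"
  have "pairing v1 u0 = 1" using cd by (simp add: u0_def pairing_def algebra_simps)
  then have "pairing v1 u = 1" by (simp add: u_def pairing_add pairing_zscale pairing_e)
  moreover have "\<bar>pairing v2 u0\<bar> * 1 \<le> \<bar>pairing v2 u0\<bar> * n" using n_pos by (intro mult_left_mono) simp_all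
  then have "0 \<le> pairing v2 u" unfolding u_def pairing_add pairing_zscale pairing_e by linarith
  ultimately show ?thesis by (intro bexI[of _ u]) (simp_all add: saturation_eq)
qed

text \<open>The heights of generators cannot have a common factor, as height one occurs.\<close>

lemma dvd_height_one:
  assumes hull: "is_submonoid hull H = saturation S" and d: "0 < d" "\<And>x. x \<in> H \<Longrightarrow> d dvd pairing v1 x"
  shows "d = 1"
proof -
  have "is_submonoid hull H \<subseteq> {x. d dvd pairing v1 x}"
    by (rule hull_minimal) (use d in \<open>auto simp: is_submonoid_def pairing_add\<close>)
  then have "d dvd 1" using height_one_point hull by force
  then show ?thesis using d(1) by simp
qed

text \<open>If there are only two irreducible elements, they are \<open>e1\<close> and \<open>e2\<close>, and by divisibility of
  heights \<open>n = 1\<close>. Otherwise the chain is made of irreducible elements only. Positivity of the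
  heights gives \<open>a j \<ge> 1\<close>, and \<open>a j = 1\<close> would decompose \<open>w j\<close>. By the recursion the height of
  \<open>w 1\<close> divides all heights, so it is one.\<close>

lemma chain_data:
  assumes ord: "ordered_generators S v1 v2 s w a"
  shows "1 \<le> s" "w 0 = e1" "w (Suc s) = e2" "pairing v1 (w 1) = 1" "pairing v2 (w s) = 1"
    "1 \<le> pairing v2 (w 1)" "pairing v2 (w 1) \<le> n" "1 \<le> pairing v1 (w s)" "pairing v1 (w s) \<le> n"
    "(n = 1 \<and> s = 1 \<and> a 1 = 1) \<or> (2 \<le> n \<and> (\<forall>j\<in>{1..s}. 2 \<le> a j \<and> irreducible_in (saturation S) (w j)))"
proof -
  let ?C = "saturation S" and ?E = "{x. irreducible_in (saturation S) x}"
  obtain H where H: "minimal_generating_set H ?C" and bijH: "bij_betw w {0..s + 1} (extended_generators H)"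
    using ord unfolding ordered_generators_def by blast
  have HE: "H = ?E" using H by (rule minimal_generators)
  have hull: "is_submonoid hull ?E = ?C" using H unfolding HE by (simp add: minimal_generating_set_def)
  have bij: "bij_betw w {0..s + 1} (extended_generators ?E)" using bijH unfolding HE .
  have w0: "pairing v1 (w 0) = 0" and ws: "pairing v2 (w (s + 1)) = 0"
    using ord unfolding ordered_generators_def ray_perp by blast+
  have rec: "w (j - 1) + w (j + 1) = zscale (a j) (w j)" if "1 \<le> j" "j \<le> s" for j
    using ord that unfolding ordered_generators_def by simp
  have eE: "e1 \<in> ?E" "e2 \<in> ?E" using irreducible_edge irreducible_edge_2 by blast+
  have e_ne: "e1 \<noteq> e2"
  proof
    assume "e1 = e2"
    then show False using pairing_e n_pos by simp
  qed
  have inE: "w j \<in> extended_generators ?E" if "j \<le> s + 1" for j using bij that by (auto simp: bij_betw_def)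
  have inj: "w j = w k \<longleftrightarrow> j = k" if "j \<le> s + 1" "k \<le> s + 1" for j k
    using bij_betw_imp_inj_on[OF bij] that by (auto simp: inj_on_def)
  have all: "1 \<le> s \<and> w 0 = e1 \<and> w (Suc s) = e2 \<and> pairing v1 (w 1) = 1 \<and> pairing v2 (w s) = 1
    \<and> 1 \<le> pairing v2 (w 1) \<and> pairing v2 (w 1) \<le> n \<and> 1 \<le> pairing v1 (w s) \<and> pairing v1 (w s) \<le> n
    \<and> ((n = 1 \<and> s = 1 \<and> a 1 = 1) \<or> (2 \<le> n \<and> (\<forall>j\<in>{1..s}. 2 \<le> a j \<and> irreducible_in ?C (w j))))"
  proof (cases "card ?E = 2")
    case True
    then have fin: "finite ?E" using card_ge_0_finite[of ?E] by simp
    have E: "?E = {e1, e2}"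
      using card_subset_eq[OF fin, of "{e1, e2}"] eE True e_ne by simp
    have ext: "extended_generators ?E = {e1 + e2, e1, e2}"
      unfolding extended_generators_def if_P[OF True] unfolding E using e_ne by simp
    have dist: "card {e1 + e2, e1, e2} = 3" using e_ne e_nonzero by simp
    have "card {0..s + 1} = 3" using bij_betw_same_card[OF bij] unfolding ext dist .
    then have s: "s = 1" by simp
    have n: "n = 1"
    proof (rule dvd_height_one[OF hull n_pos])
      fix x assume "x \<in> ?E"
      then have "x = e1 \<or> x = e2" unfolding E by simp
      then show "n dvd pairing v1 x" by (auto simp: pairing_e)
    qed
    have "w 0 \<in> {e1 + e2, e1, e2}" using inE[of 0] unfolding ext by simp
    then consider "w 0 = e1 + e2" | "w 0 = e1" | "w 0 = e2" by blast
    then have w0e: "w 0 = e1" by cases (use w0 n_pos in \<open>simp_all add: pairing_add pairing_e\<close>)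
    have ws2: "pairing v2 (w 2) = 0" using ws s by (simp add: numeral_2_eq_2)
    have "w 2 \<in> {e1 + e2, e1, e2}" using inE[of 2] s unfolding ext by simp
    then consider "w 2 = e1 + e2" | "w 2 = e1" | "w 2 = e2" by blast
    then have wse: "w 2 = e2" by cases (use ws2 n_pos in \<open>simp_all add: pairing_add pairing_e\<close>)
    have w1: "w 1 = e1 + e2" using inE[of 1] inj[of 1 0] inj[of 1 2] s w0e wse unfolding ext by auto
    have idx: "1 - 1 = (0::nat)" "1 + 1 = (2::nat)" by simp_all
    have "e1 + e2 = zscale (a 1) (e1 + e2)" using rec[of 1] s unfolding idx w0e wse w1 by simp
    from arg_cong[OF this, of "pairing v1"] have "a 1 = 1"
      using n by (simp only: pairing_zscale pairing_add pairing_e) simp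
    then show ?thesis using s n w0e wse w1 by (simp add: pairing_add pairing_e numeral_2_eq_2)
  next
    case False
    have ext: "extended_generators ?E = ?E" unfolding extended_generators_def using False by simp
    note inE = inE[unfolded ext]
    have inC: "w j \<in> ?C" "w j \<noteq> 0" if "j \<le> s + 1" for j using inE[OF that] by (simp_all add: irreducible_in_def)
    have w0e: "w 0 = e1" using inE[of 0] w0 irreducible_edge[of "w 0"] by simp
    have wse: "w (s + 1) = e2" using inE[of "s + 1"] ws irreducible_edge_2[of "w (s + 1)"] by simp
    have s: "1 \<le> s"
    proof (rule ccontr)
      assume "\<not> 1 \<le> s"
      moreover have "card {0..s + 1} = card ?E" using bij_betw_same_card[OF bij] unfolding ext .
      ultimately show False using False by simp
    qed
    have pos1: "0 < pairing v1 (w j)" if "1 \<le> j" "j \<le> s + 1" for j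
    proof -
      have "pairing v1 (w j) \<noteq> 0" using irreducible_edge[of "w j"] inE[of j] that inj[of j 0] w0e by auto
      then show ?thesis using inC(1)[of j] that by (simp add: saturation_eq)
    qed
    have pos2: "0 < pairing v2 (w j)" if "j \<le> s" for j
    proof -
      have "pairing v2 (w j) \<noteq> 0" using irreducible_edge_2[of "w j"] inE[of j] that inj[of j "s + 1"] wse by auto
      then show ?thesis using inC(1)[of j] that by (simp add: saturation_eq)
    qed
    have irr: "y = 0 \<or> z = 0" if "j \<le> s + 1" "y \<in> ?C" "z \<in> ?C" "w j = y + z" for j y z
      using inE[OF that(1)] that(2-4) unfolding irreducible_in_def by blast
    have a: "2 \<le> a j" if j: "1 \<le> j" "j \<le> s" for j
    proof -
      have "a j * pairing v1 (w j) = pairing v1 (w (j - 1)) + pairing v1 (w (j + 1))"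
        using arg_cong[OF rec[OF j], of "pairing v1"] by (simp only: pairing_zscale pairing_add)
      moreover have "0 < pairing v1 (w (j + 1))" "0 < pairing v1 (w j)" using pos1 j by simp_all
      moreover have "0 \<le> pairing v1 (w (j - 1))" using inC(1)[of "j - 1"] j by (simp add: saturation_eq)
      ultimately have "0 < a j * pairing v1 (w j)" "0 < pairing v1 (w j)" by linarith+
      then have "0 < a j" by (simp add: zero_less_mult_iff)
      moreover have "a j \<noteq> 1"
      proof
        assume "a j = 1"
        then have "w j = w (j - 1) + w (j + 1)" using rec[OF j] by simp
        then have "w (j - 1) = 0 \<or> w (j + 1) = 0" using irr[of j] inC(1)[of "j - 1"] inC(1)[of "j + 1"] j by simp
        then show False using inC(2)[of "j - 1"] inC(2)[of "j + 1"] j by simp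
      qed
      ultimately show ?thesis by linarith
    qed
    have E_eq: "?E = w ` {0..s + 1}" using bij unfolding ext by (simp add: bij_betw_def)
    have one1: "pairing v1 (w 1) = 1"
    proof (rule dvd_height_one[OF hull])
      show "0 < pairing v1 (w 1)" using pos1[of 1] by simp
      fix x assume "x \<in> ?E"
      then obtain j where j: "j \<le> s + 1" "x = w j" unfolding E_eq by auto
      have "pairing v1 (w 1) dvd pairing v1 (w j)"
      proof (rule dvd_recursion[of _ "\<lambda>j. pairing v1 (w j)" s a])
        show "pairing v1 (w (j - 1)) + pairing v1 (w (j + 1)) = a j * pairing v1 (w j)"
          if "1 \<le> j" "j \<le> s" for j
          using arg_cong[OF rec[OF that], of "pairing v1"] by (simp only: pairing_zscale pairing_add)
      qed (use w0 j in simp_all)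
      then show "pairing v1 (w 1) dvd pairing v1 x" using j by simp
    qed
    have one2: "pairing v2 (w s) = 1"
    proof (rule plane_cone.dvd_height_one[OF swap_plane hull])
      show "0 < pairing v2 (w s)" using pos2[of s] by simp
      fix x assume "x \<in> ?E"
      then obtain j where j: "j \<le> s + 1" "x = w j" unfolding E_eq by auto
      have "pairing v2 (w s) dvd pairing v2 (w (s + 1 - (s + 1 - j)))"
      proof (rule dvd_recursion[of _ "\<lambda>j. pairing v2 (w (s + 1 - j))" s "\<lambda>j. a (s + 1 - j)"])
        show "pairing v2 (w (s + 1 - (j - 1))) + pairing v2 (w (s + 1 - (j + 1)))
            = a (s + 1 - j) * pairing v2 (w (s + 1 - j))" if j: "1 \<le> j" "j \<le> s" for j
        proof -
          have "s + 1 - (j - 1) = s + 1 - j + 1" "s + 1 - (j + 1) = s + 1 - j - 1" using j by simp_all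
          moreover have "1 \<le> s + 1 - j" "s + 1 - j \<le> s" using j by simp_all
          then have "pairing v2 (w (s + 1 - j - 1)) + pairing v2 (w (s + 1 - j + 1))
              = a (s + 1 - j) * pairing v2 (w (s + 1 - j))"
            using arg_cong[OF rec[of "s + 1 - j"], of "pairing v2"] by (simp only: pairing_zscale pairing_add)
          ultimately show ?thesis by (metis add.commute)
        qed
      qed (use ws s in simp_all)
      then show "pairing v2 (w s) dvd pairing v2 x" using j by simp
    qed
    have n: "2 \<le> n"
    proof (rule ccontr)
      assume "\<not> 2 \<le> n"
      then have "w 1 - e2 \<in> ?C" "w 1 - e2 \<noteq> 0"
        using one1 pos2[of 1] s n_pos pairing_e by (auto simp: saturation_eq pairing_diff)
      moreover have "e2 \<in> ?C" using eE by (simp add: irreducible_in_def)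
      ultimately show False using irr[of 1 e2 "w 1 - e2"] s e_nonzero by simp
    qed
    have le1: "pairing v2 (w 1) \<le> n"
    proof (rule ccontr)
      assume "\<not> ?thesis"
      then have "w 1 - e1 \<in> ?C" "w 1 - e1 \<noteq> 0"
        using one1 pairing_e by (auto simp: saturation_eq pairing_diff)
      moreover have "e1 \<in> ?C" using eE by (simp add: irreducible_in_def)
      ultimately show False using irr[of 1 e1 "w 1 - e1"] s e_nonzero by simp
    qed
    have le2: "pairing v1 (w s) \<le> n"
    proof (rule ccontr)
      assume "\<not> ?thesis"
      then have "w s - e2 \<in> ?C" "w s - e2 \<noteq> 0"
        using one2 pairing_e by (auto simp: saturation_eq pairing_diff)
      moreover have "e2 \<in> ?C" using eE by (simp add: irreducible_in_def)
      ultimately show False using irr[of s e2 "w s - e2"] s e_nonzero by simp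
    qed
    have "1 \<le> pairing v2 (w 1)" "1 \<le> pairing v1 (w s)" using pos2[of 1] pos1[of s] s by simp_all
    moreover have "\<forall>j\<in>{1..s}. 2 \<le> a j \<and> irreducible_in ?C (w j)" using a inE by simp
    ultimately show ?thesis using s w0e wse one1 one2 n le1 le2 by simp
  qed
  then show "1 \<le> s" "w 0 = e1" "w (Suc s) = e2" "pairing v1 (w 1) = 1" "pairing v2 (w s) = 1"
    "1 \<le> pairing v2 (w 1)" "pairing v2 (w 1) \<le> n" "1 \<le> pairing v1 (w s)" "pairing v1 (w s) \<le> n"
    "(n = 1 \<and> s = 1 \<and> a 1 = 1) \<or> (2 \<le> n \<and> (\<forall>j\<in>{1..s}. 2 \<le> a j \<and> irreducible_in ?C (w j)))"
    by blast+
qed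

lemma D_add: "D (x + y) z = D x z + D y z" "D z (x + y) = D z x + D z y"
  by (simp_all add: D_def algebra_simps)

lemma D_self [simp]: "D x x = 0" by (simp add: D_def)

lemma D_zero: "D 0 x = 0" "D x 0 = 0" by (simp_all add: D_def)

lemma D_zscale: "D (zscale k x) y = k * D x y" "D x (zscale k y) = k * D x y"
  by (simp_all add: D_def zscale_def algebra_simps)

lemma cone_chain_of_plane:
  assumes l: "l1 = int (ray_index S v1)" "l2 = int (ray_index S v2)"
    and ord: "ordered_generators S v1 v2 s w a"
  shows "cone_chain (pairing v1) (\<lambda>x. D x (w 1)) (pairing v2) (\<lambda>x. D (w s) x) e1 (w 1) e2 (w s) l1 l2 n S s w a"
proof -
  note data = chain_data[OF ord]
  note f1 = face_group_ray[OF l(1)]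
  note f2 = plane_cone.face_group_ray[OF swap_plane l(2), unfolded swap_e plane_cone.G1_def[OF swap_plane] G2_def[symmetric]]
  have c1: "x = zscale (pairing v1 x) (w 1) + zscale (D x (w 1)) e1" for x
    using D_cramer[of e1 "w 1" x] data by (simp add: D_e1)
  have c2: "x = zscale (pairing v2 x) (w s) + zscale (D (w s) x) e2" for x
    using D_cramer[of "w s" e2 x] data by (simp add: D_e2 add.commute)
  have g1: "x \<in> G1 \<longleftrightarrow> l1 dvd D x (w 1)" if "pairing v1 x = 0" for x
  proof -
    have x: "x = zscale (D x (w 1)) e1" using c1[of x] that by simp
    show ?thesis
    proof
      assume "x \<in> G1"
      then obtain k where "x = zscale k e1" "l1 dvd k" using f1(2) by blast
      then show "l1 dvd D x (w 1)" using data by (simp add: D_zscale D_e1)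
    next
      assume "l1 dvd D x (w 1)"
      then show "x \<in> G1" unfolding f1(2) using x by blast
    qed
  qed
  have g2: "x \<in> G2 \<longleftrightarrow> l2 dvd D (w s) x" if "pairing v2 x = 0" for x
  proof -
    have x: "x = zscale (D (w s) x) e2" using c2[of x] that by simp
    show ?thesis
    proof
      assume "x \<in> G2"
      then obtain k where "x = zscale k e2" "l2 dvd k" using f2(2) by blast
      then show "l2 dvd D (w s) x" using data by (simp add: D_zscale D_e2)
    next
      assume "l2 dvd D (w s) x"
      then show "x \<in> G2" unfolding f2(2) using x by blast
    qed
  qed
  have S_iff: "x \<in> S \<longleftrightarrow> (0 < pairing v1 x \<or> pairing v1 x = 0 \<and> l1 dvd D x (w 1)) \<and>
    (0 < pairing v2 x \<or> pairing v2 x = 0 \<and> l2 dvd D (w s) x)" for x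
  proof (cases "pairing v1 x = 0 \<and> pairing v2 x = 0")
    case True
    then have "x = 0" using height_positive[of x] by (force simp: saturation_eq)
    then show ?thesis using S_submonoid by (simp add: D_zero)
  next
    case False
    then have "x \<noteq> 0" by auto
    then show ?thesis using False g1[of x] g2[of x] unfolding S_cases[of x] by force
  qed
  have kind: "(n = 1 \<and> s = 1 \<and> a 1 = 1) \<or> (2 \<le> n \<and> (\<forall>j\<in>{1..s}. 2 \<le> a j))"
    using data(10) by blast
  have rec: "w (j - 1) + w (j + 1) = zscale (a j) (w j)" if "1 \<le> j" "j \<le> s" for j
    using ord that unfolding ordered_generators_def by simp
  have basis: "D e1 (w 1) = 1" "D (w s) e2 = 1" "1 \<le> n" using data n_pos by (simp_all add: D_e1 D_e2)
  show ?thesis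
    by unfold_locales (rule refl c1 c2 S_iff kind rec basis data(1-9) f1(1) f2(1) pairing_e pairing_add D_add D_self;
      assumption?)+
qed

end


section \<open>The numbering of lattice points on a line\<close>

text \<open>Two numberings differ by an increasing bijection of \<open>\<int>\<close> that preserves positivity.\<close>

lemma increasing_bijection_int:
  fixes \<sigma> :: "int \<Rightarrow> int"
  assumes bij: "bij \<sigma>" and mono: "strict_mono \<sigma>" and pos: "\<And>m. 0 < m \<longleftrightarrow> 0 < \<sigma> m"
  shows "\<sigma> m = m"
proof -
  have step: "\<sigma> (m + 1) = \<sigma> m + 1" for m
  proof -
    obtain k where k: "\<sigma> k = \<sigma> m + 1" using bij by (metis bij_pointE)
    then have "m < k" using strict_mono_less[OF mono, of m k] by simp
    then have "\<sigma> (m + 1) \<le> \<sigma> k" using strict_mono_less_eq[OF mono, of "m + 1" k] by simp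
    moreover have "\<sigma> m < \<sigma> (m + 1)" using strict_mono_less[OF mono] by simp
    ultimately show ?thesis using k by linarith
  qed
  obtain k where k: "\<sigma> k = 1" using bij by (metis bij_pointE)
  then have "1 \<le> k" using pos[of k] by simp
  then have "\<sigma> 1 \<le> \<sigma> k" using strict_mono_less_eq[OF mono, of 1 k] by simp
  then have one: "\<sigma> 1 = 1" using k pos[of 1] by simp
  show ?thesis
  proof (induction m rule: int_induct[of _ 1])
    case base then show ?case by (rule one)
  next
    case (step1 i) then show ?case using step[of i] by simp
  next
    case (step2 i) then show ?case using step[of "i - 1"] by simp
  qed
qed

lemma numbering_unique:
  assumes f: "numbering v v' j f" and g: "numbering v v' j g"
  shows "g = f"
proof
  fix m
  define \<sigma> where "\<sigma> = (\<lambda>m. inv f (g m))"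
  have bf: "bij_betw f UNIV {u. pairing v u = j}" and bg: "bij_betw g UNIV {u. pairing v u = j}"
    and mf: "strict_mono (\<lambda>m. pairing v' (f m))" and mg: "strict_mono (\<lambda>m. pairing v' (g m))"
    and pf: "\<And>m. 0 < m \<longleftrightarrow> 0 < pairing v' (f m)" and pg: "\<And>m. 0 < m \<longleftrightarrow> 0 < pairing v' (g m)"
    using f g unfolding numbering_def by blast+
  have fs: "f (\<sigma> m) = g m" for m
    unfolding \<sigma>_def using bf bg by (intro f_inv_into_f) (auto simp: bij_betw_def)
  have "bij \<sigma>"
  proof -
    have "bij_betw (inv f \<circ> g) UNIV UNIV" using bg bij_betw_inv_into[OF bf] by (rule bij_betw_trans)
    then show ?thesis by (simp add: \<sigma>_def comp_def)
  qed
  moreover have "strict_mono \<sigma>"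
  proof (rule strict_monoI)
    fix a b :: int assume "a < b"
    have "pairing v' (f (\<sigma> a)) < pairing v' (f (\<sigma> b))" unfolding fs using strict_monoD[OF mg \<open>a < b\<close>] .
    then show "\<sigma> a < \<sigma> b" using strict_mono_less[OF mf] by simp
  qed
  moreover have "0 < m \<longleftrightarrow> 0 < \<sigma> m" for m using pf[of "\<sigma> m"] pg[of m] fs[of m] by simp
  ultimately have "\<sigma> m = m" by (rule increasing_bijection_int)
  then show "g m = f m" using fs[of m] by simp
qed

text \<open>The bounds say that \<open>c\<close> is the first point on its line that pairs positively with the other
  ray generator, because \<open>c - e1\<close> does not.\<close>

lemma (in plane_cone) line_point_eq:
  assumes c: "pairing v1 c = j" "1 \<le> pairing v2 c" "pairing v2 c \<le> n"
  shows "line_point v1 v2 j m = c + zscale (m - 1) e1"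
proof -
  let ?f = "\<lambda>m. c + zscale (m - 1) e1"
  have q: "pairing v2 (?f m) = pairing v2 c + (m - 1) * n" for m
    by (simp add: pairing_add pairing_zscale pairing_e)
  have num: "numbering v1 v2 j ?f" unfolding numbering_def
  proof (intro conjI allI)
    show "bij_betw ?f UNIV {u. pairing v1 u = j}" unfolding bij_betw_def
    proof
      show "inj ?f" by (rule injI) (simp add: zscale_right_inject[OF e_nonzero(1)])
      show "range ?f = {u. pairing v1 u = j}"
      proof (intro set_eqI iffI)
        fix u assume "u \<in> {u. pairing v1 u = j}"
        then have "pairing v1 (u - c) = 0" using c by (simp add: pairing_diff)
        then obtain k where "u - c = zscale k e1" using kernel_1 by blast
        then have "u = ?f (k + 1)" by (simp add: algebra_simps)
        then show "u \<in> range ?f" by blast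
      qed (auto simp: pairing_add pairing_zscale pairing_e c)
    qed
    show "strict_mono (\<lambda>m. pairing v2 (?f m))" unfolding q by (rule strict_monoI) (simp add: n_pos)
    fix m
    show "0 < m \<longleftrightarrow> 0 < pairing v2 (?f m)"
    proof (cases "0 < m")
      case True
      then have "0 \<le> (m - 1) * n" using n_pos by simp
      then have "0 < pairing v2 c + (m - 1) * n" using c by linarith
      then show ?thesis using True unfolding q by simp
    next
      case False
      then have "(m - 1) * n \<le> (-1) * n" using n_pos by (intro mult_right_mono) simp_all
      then show ?thesis using False c unfolding q by simp
    qed
  qed
  have "line_point v1 v2 j = ?f" unfolding line_point_def using num numbering_unique[OF num] by (rule the_equality)
  then show ?thesis by simp
qed

context ray_side
begin

lemma pt_eq_iff: "R = pt a j \<longleftrightarrow> p R = a \<and> i R = j"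
proof
  assume R: "R = pt a j"
  show "p R = a \<and> i R = j" unfolding R pt_def by (simp add: p_add i_add)
next
  assume "p R = a \<and> i R = j"
  then show "R = pt a j" unfolding pt_def using coords[of R] by simp
qed

lemma double_pt: "zscale 2 (pt 1 j) = pt 2 (2 * j)"
  by (simp add: pt_def zscale_add_right zscale_assoc)

lemma d_ray_eq:
  assumes L0: "\<And>m. line_point v v' 0 m = pt 0 m" and L1: "\<And>m. line_point v v' 1 m = pt 1 (m - 1)"
  shows "d_ray v v' l (- R) = ray_term l (p R) (i R)"
proof -
  have c1: "(\<exists>m. 1 \<le> m \<and> m < l \<and> p R = 0 \<and> i R = m) \<longleftrightarrow> p R = 0 \<and> 1 \<le> i R \<and> i R < l" by blast
  have c2: "(\<exists>m\<le>0. p R = 1 \<and> i R = m - 1) \<longleftrightarrow> p R = 1 \<and> i R < 0" by presburger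
  have c4: "(\<exists>m. 2 \<le> m \<and> m \<le> l \<and> p R = 1 \<and> i R = m - 1) \<longleftrightarrow> p R = 1 \<and> 1 \<le> i R \<and> i R \<le> l - 1" by presburger
  have c5: "(\<exists>m\<le>1. (p R = 2 \<and> i R = 2 * (m - 1)) \<and> l = 2) \<longleftrightarrow> p R = 2 \<and> l = 2 \<and> even (i R) \<and> i R \<le> 0" by presburger
  have the: "l - (THE m. p R = 1 \<and> i R = m - 1) + 1 = l - i R" if "p R = 1"
  proof -
    have "(THE m. p R = 1 \<and> i R = m - 1) = i R + 1" by (rule the_equality) (use that in auto)
    then show ?thesis by simp
  qed
  have e3: "(p R = 1 \<and> i R = 1 - 1) = (p R = 1 \<and> i R = 0)" by simp
  show ?thesis
    unfolding d_ray_def ray_term_def L0 L1 neg_equal_iff_equal double_pt pt_eq_iff c1 c2 c4 c5 e3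
    by (intro if_cong refl) (use the in simp)
qed

end


section \<open>The normalisation is the affine plane exactly for a smooth cone\<close>

text \<open>The cross product, unless it vanishes; then the two vectors are parallel.\<close>

lemma orthogonal_vector_3:
  fixes u1 u2 u3 v1 v2 v3 :: "'k::field"
  obtains x y z where "(x, y, z) \<noteq> (0, 0, 0)" "x * u1 + y * u2 + z * u3 = 0" "x * v1 + y * v2 + z * v3 = 0"
proof (cases "u2 * v3 - u3 * v2 = 0 \<and> u3 * v1 - u1 * v3 = 0 \<and> u1 * v2 - u2 * v1 = 0")
  case False
  show ?thesis
    by (rule that[of "u2 * v3 - u3 * v2" "u3 * v1 - u1 * v3" "u1 * v2 - u2 * v1"])
      (use False in \<open>auto simp: algebra_simps\<close>)
next
  case par: True
  show ?thesis
  proof (cases "u1 = 0 \<and> u2 = 0")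
    case False
    show ?thesis by (rule that[of "- u2" u1 0]) (use False par in \<open>auto simp: algebra_simps\<close>)
  next
    case u: True
    show ?thesis
    proof (cases "u3 = 0")
      case False
      show ?thesis by (rule that[of 1 0 0]) (use False u par in auto)
    next
      case True
      show ?thesis
      proof (cases "v1 = 0 \<and> v2 = 0")
        case False
        show ?thesis by (rule that[of "- v2" v1 0]) (use False True u in \<open>auto simp: algebra_simps\<close>)
      next
        case v: True
        show ?thesis by (rule that[of 1 0 0]) (use v True u in auto)
      qed
    qed
  qed
qed

lemma lookup_mult_lattice:
  fixes f h :: "lattice \<Rightarrow>\<^sub>0 'k::field"
  shows "Poly_Mapping.lookup (f * h) y =
    (\<Sum>x\<in>Poly_Mapping.keys f. Poly_Mapping.lookup f x * Poly_Mapping.lookup h (y - x))"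
proof -
  have "f * h = (\<Sum>x\<in>Poly_Mapping.keys f. Poly_Mapping.single x (Poly_Mapping.lookup f x) * h)"
    by (subst poly_mapping_sum_singles[of f]) (simp only: sum_distrib_right)
  then show ?thesis by (simp only: lookup_sum single_zero_mult_lookup)
qed

context plane_cone
begin

lemma lookup_outside: "f \<in> monoid_algebra C \<Longrightarrow> x \<notin> C \<Longrightarrow> Poly_Mapping.lookup f x = 0"
  by (auto simp: monoid_algebra_def in_keys_iff)

text \<open>The Leibniz rule at the origin: an irreducible exponent is a sum of two elements of the
  monoid in trivial ways only.\<close>

lemma lookup_mult_irreducible:
  fixes f h :: "lattice \<Rightarrow>\<^sub>0 'k::field"
  assumes f: "f \<in> monoid_algebra (saturation S)" and h: "h \<in> monoid_algebra (saturation S)"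
    and c: "irreducible_in (saturation S) c"
  shows "Poly_Mapping.lookup (f * h) c = Poly_Mapping.lookup f 0 * Poly_Mapping.lookup h c
    + Poly_Mapping.lookup f c * Poly_Mapping.lookup h 0"
proof -
  have zero: "Poly_Mapping.lookup f x * Poly_Mapping.lookup h (c - x) = 0" if x: "x \<noteq> 0" "x \<noteq> c" for x
  proof (rule ccontr)
    assume "\<not> ?thesis"
    then have "x \<in> saturation S" "c - x \<in> saturation S" using lookup_outside[OF f, of x] lookup_outside[OF h, of "c - x"] by force+
    moreover have "c = x + (c - x)" by simp
    ultimately have "x = 0 \<or> c - x = 0" using c unfolding irreducible_in_def by blast
    then show False using x by simp
  qed
  have "Poly_Mapping.lookup (f * h) c = (\<Sum>x\<in>{0, c}. Poly_Mapping.lookup f x * Poly_Mapping.lookup h (c - x))"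
    unfolding lookup_mult_lattice
    by (rule sum.mono_neutral_cong) (use zero in \<open>auto simp: in_keys_iff\<close>)
  then show ?thesis using c by (simp add: irreducible_in_def)
qed

text \<open>
  Each irreducible element gives a derivation at the origin, the coefficient of its character, and
  these derivations are independent.  The affine plane has only two independent derivations at a point.
\<close>

lemma affine_plane_irreducibles:
  assumes aff: "is_affine_plane (monoid_algebra (saturation S) :: (lattice \<Rightarrow>\<^sub>0 'k::field) set)"
    and c: "irreducible_in (saturation S) c1" "irreducible_in (saturation S) c2" "irreducible_in (saturation S) c3"
  shows "c1 = c2 \<or> c1 = c3 \<or> c2 = c3"
proof (rule ccontr)
  assume dist: "\<not> ?thesis"
  let ?A = "monoid_algebra (saturation S) :: (lattice \<Rightarrow>\<^sub>0 'k) set"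
  obtain F :: "((bool \<Rightarrow>\<^sub>0 nat) \<Rightarrow>\<^sub>0 'k) \<Rightarrow> (lattice \<Rightarrow>\<^sub>0 'k)" where bij: "bij_betw F UNIV ?A"
    and add: "\<And>x y. F (x + y) = F x + F y" and mult: "\<And>x y. F (x * y) = F x * F y"
    and const: "\<And>c. F (Poly_Mapping.single 0 c) = Poly_Mapping.single 0 c"
    using aff unfolding is_affine_plane_def by blast
  have FA: "F x \<in> ?A" for x using bij by (auto simp: bij_betw_def)
  let ?v = "\<lambda>b c. Poly_Mapping.lookup (F (Poly_Mapping.single (Poly_Mapping.single b 1) 1)) c"
  obtain \<alpha> \<beta> \<gamma> where nz: "(\<alpha>, \<beta>, \<gamma>) \<noteq> (0, 0, 0)"
    and T: "\<alpha> * ?v True c1 + \<beta> * ?v True c2 + \<gamma> * ?v True c3 = 0"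
    and Fa: "\<alpha> * ?v False c1 + \<beta> * ?v False c2 + \<gamma> * ?v False c3 = 0"
    by (rule orthogonal_vector_3)
  define \<epsilon> where "\<epsilon> x = Poly_Mapping.lookup (F x) 0" for x
  define L where "L x = \<alpha> * Poly_Mapping.lookup (F x) c1 + \<beta> * Poly_Mapping.lookup (F x) c2
    + \<gamma> * Poly_Mapping.lookup (F x) c3" for x
  have L_add: "L (x + y) = L x + L y" for x y by (simp add: L_def add lookup_add algebra_simps)
  have L_mult: "L (x * y) = \<epsilon> x * L y + L x * \<epsilon> y" for x y
    unfolding L_def \<epsilon>_def mult lookup_mult_irreducible[OF FA FA c(1)] lookup_mult_irreducible[OF FA FA c(2)]
      lookup_mult_irreducible[OF FA FA c(3)] by (simp add: algebra_simps)
  have c0: "c1 \<noteq> 0" "c2 \<noteq> 0" "c3 \<noteq> 0" using c by (simp_all add: irreducible_in_def)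
  have L_const: "L (Poly_Mapping.single 0 d) = 0" for d
    using c0 by (simp add: L_def const lookup_single when_def)
  have L_var: "L (Poly_Mapping.single (Poly_Mapping.single b 1) 1) = 0" for b
    using T Fa by (cases b) (simp_all only: L_def)
  have L_single: "L (Poly_Mapping.single e d) = 0" for e d
  proof (induction e rule: exponent_induct)
    case 1 show ?case by (rule L_const)
  next
    case (2 e b)
    have "Poly_Mapping.single (e + Poly_Mapping.single b 1) d
        = Poly_Mapping.single e d * Poly_Mapping.single (Poly_Mapping.single b 1) 1"
      by (simp add: mult_single)
    then show ?case using 2 L_var[of b] by (simp only: L_mult) simp
  qed
  have L_sum: "L (\<Sum>x\<in>X. f x) = (\<Sum>x\<in>X. L (f x))" for X :: "(bool \<Rightarrow>\<^sub>0 nat) set" and f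
    using L_const[of 0] by (induction X rule: infinite_finite_induct) (simp_all add: L_add)
  have L0: "L x = 0" for x
    by (subst poly_mapping_sum_singles[of x]) (simp add: L_sum L_single)
  have val: "L x = (\<alpha> when c = c1) + (\<beta> when c = c2) + (\<gamma> when c = c3)"
    if "F x = Poly_Mapping.single c 1" for x c
    using that by (simp add: L_def lookup_single when_def)
  have ex: "\<exists>x. F x = Poly_Mapping.single c 1" if "irreducible_in (saturation S) c" for c
  proof -
    have "Poly_Mapping.single c 1 \<in> ?A" using that by (simp add: monoid_algebra_def irreducible_in_def)
    then show ?thesis using bij unfolding bij_betw_def by (metis imageE)
  qed
  have "\<alpha> = 0" using ex[OF c(1)] val[of _ c1] L0 dist by (auto simp: when_def)
  moreover have "\<beta> = 0" using ex[OF c(2)] val[of _ c2] L0 dist by (auto simp: when_def)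
  moreover have "\<gamma> = 0" using ex[OF c(3)] val[of _ c3] L0 dist by (auto simp: when_def)
  ultimately show False using nz by simp
qed

text \<open>For \<open>n = 1\<close> the edge vectors are a basis of \<open>M\<close>, and the presentation by the two
  corresponding characters is an isomorphism.\<close>

lemma smooth_affine_plane:
  assumes n: "n = 1"
  shows "is_affine_plane (monoid_algebra (saturation S) :: (lattice \<Rightarrow>\<^sub>0 'k::field) set)"
proof -
  define g where "g b = (if b then e1 else e2)" for b
  let ?F = "presentation g :: ((bool \<Rightarrow>\<^sub>0 nat) \<Rightarrow>\<^sub>0 'k) \<Rightarrow> _"
  have weight: "weight g e = zscale (int (Poly_Mapping.lookup e False)) e2 + zscale (int (Poly_Mapping.lookup e True)) e1" for e
    by (simp add: weight_def UNIV_bool g_def)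
  have w1: "pairing v1 (weight g e) = int (Poly_Mapping.lookup e False)"
    and w2: "pairing v2 (weight g e) = int (Poly_Mapping.lookup e True)" for e
    by (simp_all add: weight pairing_add pairing_zscale pairing_e n)
  have inj: "inj (weight g)"
  proof (rule injI)
    fix e e' assume eq: "weight g e = weight g e'"
    have "Poly_Mapping.lookup e b = Poly_Mapping.lookup e' b" for b
      using w1[of e] w1[of e'] w2[of e] w2[of e'] eq by (cases b) simp_all
    then show "e = e'" by (rule poly_mapping_eqI)
  qed
  have C: "weight g e \<in> saturation S" for e by (simp add: saturation_eq w1 w2)
  have range: "x \<in> range (weight g)" if x: "x \<in> saturation S" for x
  proof -
    define e where "e = Poly_Mapping.single False (nat (pairing v1 x)) + Poly_Mapping.single True (nat (pairing v2 x))"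
    have "weight g e = zscale (pairing v1 x) e2 + zscale (pairing v2 x) e1"
      using x by (simp add: weight e_def lookup_add lookup_single saturation_eq)
    also have "\<dots> = x" using D_cramer[of e1 e2 x] by (simp add: D_e1 D_e2 pairing_e n)
    finally show ?thesis by (metis rangeI)
  qed
  have look: "Poly_Mapping.lookup (?F f) (weight g e) = Poly_Mapping.lookup f e" for f e
  proof -
    have "{e'\<in>Poly_Mapping.keys f. weight g e' = weight g e} = (if e \<in> Poly_Mapping.keys f then {e} else {})"
      using inj by (auto simp: inj_eq)
    then show ?thesis unfolding presentation_weighted lookup_weighted_presentation by (simp add: in_keys_iff)
  qed
  have "bij_betw ?F UNIV (monoid_algebra (saturation S))" unfolding bij_betw_def
  proof
    show "inj ?F"
    proof (rule injI)
      fix f h assume "?F f = ?F h"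
      then show "f = h" using look[of f] look[of h] by (intro poly_mapping_eqI) metis
    qed
    show "range ?F = monoid_algebra (saturation S)"
    proof (intro set_eqI iffI)
      fix h assume "h \<in> range ?F"
      then obtain f where h: "h = ?F f" by blast
      show "h \<in> monoid_algebra (saturation S)" unfolding monoid_algebra_def
      proof (intro CollectI subsetI)
        fix x assume "x \<in> Poly_Mapping.keys h"
        then have "{e\<in>Poly_Mapping.keys f. weight g e = x} \<noteq> {}"
          unfolding h in_keys_iff presentation_weighted lookup_weighted_presentation by (metis sum.empty)
        then show "x \<in> saturation S" using C by blast
      qed
    next
      fix h :: "lattice \<Rightarrow>\<^sub>0 'k" assume h: "h \<in> monoid_algebra (saturation S)"
      have "?F (\<Sum>x\<in>Poly_Mapping.keys h. Poly_Mapping.single (inv (weight g) x) (Poly_Mapping.lookup h x))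
          = (\<Sum>x\<in>Poly_Mapping.keys h. Poly_Mapping.single (weight g (inv (weight g) x)) (Poly_Mapping.lookup h x))"
        by (simp only: presentation_sum presentation_single)
      also have "\<dots> = (\<Sum>x\<in>Poly_Mapping.keys h. Poly_Mapping.single x (Poly_Mapping.lookup h x))"
      proof (rule sum.cong[OF refl])
        fix x assume "x \<in> Poly_Mapping.keys h"
        then have "x \<in> range (weight g)" using h range unfolding monoid_algebra_def by blast
        then show "Poly_Mapping.single (weight g (inv (weight g) x)) (Poly_Mapping.lookup h x)
            = Poly_Mapping.single x (Poly_Mapping.lookup h x)" by (simp only: f_inv_into_f)
      qed
      also have "\<dots> = h" by (rule poly_mapping_sum_singles[symmetric])
      finally show "h \<in> range ?F" by (metis rangeI)
    qed
  qed
  then show ?thesis unfolding is_affine_plane_def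
    by (intro exI[of _ ?F]) (simp add: presentation_add presentation_mult presentation_single)
qed

lemma affine_plane_iff_smooth:
  assumes ord: "ordered_generators S v1 v2 s w a"
  shows "is_affine_plane (monoid_algebra (saturation S) :: (lattice \<Rightarrow>\<^sub>0 'k::field) set) \<longleftrightarrow> n = 1"
proof
  assume aff: "is_affine_plane (monoid_algebra (saturation S) :: (lattice \<Rightarrow>\<^sub>0 'k) set)"
  note data = chain_data[OF ord]
  show "n = 1"
  proof (rule ccontr)
    assume "n \<noteq> 1"
    then have "irreducible_in (saturation S) (w 1)" using data(1,10) by simp
    moreover have "irreducible_in (saturation S) e1" "irreducible_in (saturation S) e2"
      using irreducible_edge[of e1] irreducible_edge_2[of e2] by simp_all
    ultimately have "e1 = e2 \<or> e1 = w 1 \<or> e2 = w 1" using affine_plane_irreducibles[OF aff, of e1 e2 "w 1"] by blast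
    then show False
    proof (elim disjE)
      assume "e1 = e2" then show False using pairing_e n_pos by simp
    next
      assume "e1 = w 1" then show False using pairing_e data(4) by simp
    next
      assume "e2 = w 1" then show False using pairing_e data(6) by simp
    qed
  qed
qed (rule smooth_affine_plane)

end


section \<open>The dimension of \<open>T\<^sup>1\<close>\<close>

theorem theorem5p1:
  fixes S :: "lattice set"
    and v1 v2 :: lattice
    and l1 l2 :: int
    and s :: nat and w :: "nat \<Rightarrow> lattice" and a :: "nat \<Rightarrow> int"
    and g :: "'i::finite \<Rightarrow> lattice"
    and u :: lattice
  assumes "affine_monoid S"
    and "group_closure S = UNIV"
    and "vector_space.dim qscale (sigma_cone S) = 2"
    and "seminormal S"
    and "primitive v1" and "primitive v2"
    and "sigma_cone S = qcone {to_q v1, to_q v2}"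
    and "l1 = int (ray_index S v1)" and "l2 = int (ray_index S v2)"
    and "ordered_generators S v1 v2 s w a"
    and "is_submonoid hull (range g) = S"
  shows "\<exists>n. T1_has_dimension TYPE('k::field_char_0) S g u n \<and>
    int n =
     (if \<not> is_affine_plane (monoid_algebra (saturation S) :: (lattice \<Rightarrow>\<^sub>0 'k) set) then
        (if s = 1 \<and> u = - zscale (a 1) (w 1) \<and> (l1 = 1 \<and> l2 \<noteq> 1 \<or> l1 \<noteq> 1 \<and> l2 = 1)
         then T1_formula v1 v2 l1 l2 s w a u - 1
         else T1_formula v1 v2 l1 l2 s w a u)
      else
        (if l1 \<ge> 2 \<and> l2 \<ge> 2 \<and>
            (u = - line_point v1 v2 1 l1 \<or> u = - line_point v2 v1 1 l2)
         then 0
         else if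
            (l1 = 1 \<and> (\<exists>m. 1 \<le> m \<and> m \<le> l2 - 1 \<and> u = - line_point v2 v1 1 m)) \<or>
            (l2 = 1 \<and> (\<exists>m. 1 \<le> m \<and> m \<le> l1 - 1 \<and> u = - line_point v1 v2 1 m))
         then T1_formula v1 v2 l1 l2 s w a u - 1
         else if u = - zscale 2 (line_point v1 v2 1 1)
         then (if l1 \<le> 2 \<and> l2 \<le> 2 \<and> (l1, l2) \<noteq> (1, 1) then 1 else 0)
         else T1_formula v1 v2 l1 l2 s w a u))"
proof -
  interpret C: plane_cone S v1 v2 by unfold_locales fact+
  note data = C.chain_data[OF assms(10)]
  interpret X: cone_chain "pairing v1" "\<lambda>x. C.D x (w 1)" "pairing v2" "C.D (w s)" C.e1 "w 1" C.e2 "w s"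
    l1 l2 C.n S s w a
    by (rule C.cone_chain_of_plane) fact+
  define R where "R = - u"
  have u: "u = - R" by (simp add: R_def)
  note line_1 = C.line_point_eq
  note line_2 = plane_cone.line_point_eq[OF C.swap_plane, unfolded C.swap_e]
  have L10: "line_point v1 v2 0 m = X.side1.pt 0 m" for m
    using line_1[of C.e1 0 m] C.pairing_e C.n_pos
    unfolding X.side1.pt_def by (simp add: zscale_diff_left)
  have L11: "line_point v1 v2 1 m = X.side1.pt 1 (m - 1)" for m
    using line_1[of "w 1" 1 m] data unfolding X.side1.pt_def by simp
  have L20: "line_point v2 v1 0 m = X.side2.pt 0 m" for m
    using line_2[of C.e2 0 m] C.pairing_e C.n_pos
    unfolding X.side2.pt_def by (simp add: zscale_diff_left)
  have L21: "line_point v2 v1 1 m = X.side2.pt 1 (m - 1)" for m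
    using line_2[of "w s" 1 m] data unfolding X.side2.pt_def by simp
  have chain: "d_normal s w a u = X.chain_term R"
    unfolding d_normal_def X.chain_term_def u neg_equal_iff_equal ..
  have formula: "T1_formula v1 v2 l1 l2 s w a u = X.generic_value R"
    unfolding T1_formula_def X.generic_value_def chain unfolding u
      X.side1.d_ray_eq[OF L10 L11] X.side2.d_ray_eq[OF L20 L21] ..
  have double: "zscale 2 (X.side1.pt 1 (1 - 1)) = zscale 2 (w 1)"
    unfolding X.side1.pt_def by simp
  obtain d where d: "additive_dim TYPE('k) S (X.K R) d" "int d = X.expected_value R"
    using X.value_formula[of R, where ?'k = 'k] unfolding X.has_value_def by blast
  have "X.K R = {x\<in>S. x + u \<notin> S}" unfolding X.K_eq u by simp
  with assms(11,2) have T1: "T1_has_dimension TYPE('k) S g u d"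
    using d(1)[unfolded additive_dim_def] by (rule T1_has_dimension_additive)
  show ?thesis
  proof (rule exI[of _ d], rule conjI[OF T1])
  qed (unfold d(2) X.expected_value_def C.affine_plane_iff_smooth[OF assms(10)] formula L11 L21 double,
      unfold u neg_equal_iff_equal, rule refl)
qed

end
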